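(* Let $k\in\mathbb N$, $0<p\le\infty$, $\alpha\ge 0$ and $\beta\ge 0$. There is a constant $c$ depending only on $k,p,\alpha,\beta$ such that, for every $f\in L_p^{\alpha,\beta}$, $$E_n(f)_{\alpha,\beta,p}\le c\,\omega_{k,0}^{\varphi}(f,1/n)_{\alpha,\beta,p}\quad\text{for all integers } n\ge k.$$
   Context: Jacobi weight: $w_{\alpha,\beta}(x)=(1-x)^\alpha(1+x)^\beta$. $\varphi(x)=\sqrt{1-x^2}$. $\|\cdot\|_p$ is the usual $L_p$ (quasi)norm on $[-1,1]$ (essential supremum if $p=\infty$). $L_p^{\alpha,\beta}=\{f:\|w_{\alpha,\beta}f\|_p<\infty\}$ (functions on $[-1,1]$, identified if equal a.e.). $\mathbb P_n$ is the set of algebraic polynomials of degree not more than $n-1$, and $E_n(f)_{\alpha,\beta,p}=\inf_{p_n\in\mathbb P_n}\|w_{\alpha,\beta}(f-p_n)\|_p$. Symmetric difference: $\Delta_h^k(f,x)=\sum_{i=0}^k\binom ki(-1)^{k-i}f(x-\frac{kh}2+ih)$ if $[x-\frac{kh}2,x+\frac{kh}2]\subseteq[-1,1]$, and $\Delta_h^k(f,x)=0$ otherwise. $\mathcal W_\delta^{\xi,\zeta}(x)=(1-x-\delta\varphi(x)/2)^\xi(1+x-\delta\varphi(x)/2)^\zeta$. Modulus: for $t>0$, $$\omega_{k,0}^{\varphi}(f,t)_{\alpha,\beta,p}=\sup_{0\le h\le t}\big\|\mathcal W_{kh}^{\alpha,\beta}(\cdot)\,\Delta_{h\varphi(\cdot)}^k(f,\cdot)\big\|_p,$$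 where the expression under the norm is understood to be $0$ at points $x$ where the difference $\Delta^k_{h\varphi(x)}(f,x)$ is set to $0$ because $[x-\frac{kh\varphi(x)}{2},x+\frac{kh\varphi(x)}{2}]\not\subseteq[-1,1]$. *)

theory Defs
  imports "HOL-Analysis.Analysis" "HOL-Probability.Essential_Supremum"
    "HOL-Computational_Algebra.Polynomial"
begin

abbreviation I_measure :: "real measure" where
  "I_measure \<equiv> lebesgue_on {-1..1}"

text \<open>The usual quasi-norm on \<open>[-1,1]\<close> with values in \<open>[0,\<infinity>]\<close>, for \<open>0 < p \<le> \<infinity>\<close>.
  Since \<open>powr\<close> is not available on \<^typ>\<open>ennreal\<close>, the \<open>p\<close>-th root of an infinite integral
  is treated separately.\<close>

definition Lp_norm :: "ennreal \<Rightarrow> (real \<Rightarrow> real) \<Rightarrow> ennreal" where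
  "Lp_norm p g =
    (if p = \<infinity> then esssup I_measure (\<lambda>x. ennreal \<bar>g x\<bar>)
     else (let J = (\<integral>\<^sup>+x. ennreal (\<bar>g x\<bar> powr enn2real p) \<partial>I_measure)
           in if J = \<infinity> then \<infinity> else ennreal (enn2real J powr (1 / enn2real p))))"

definition phi :: "real \<Rightarrow> real" where
  "phi x = sqrt (1 - x\<^sup>2)"

text \<open>\<open>0 powr 0 = 0\<close> in HOL. For \<open>jacobi_weight\<close> this convention matters at \<open>x = 1\<close> and \<open>x = -1\<close>
  only, and for \<open>shifted_weight\<close> (with \<open>\<delta>\<close> fixed) at finitely many points only; the norms above
  do not see such sets.\<close>

definition jacobi_weight :: "real \<Rightarrow> real \<Rightarrow> real \<Rightarrow> real" where
  "jacobi_weight \<alpha> \<beta> x = (1 - x) powr \<alpha> * (1 + x) powr \<beta>"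

definition shifted_weight :: "real \<Rightarrow> real \<Rightarrow> real \<Rightarrow> real \<Rightarrow> real" where
  "shifted_weight \<xi> \<zeta> \<delta> x =
    (1 - x - \<delta> * phi x / 2) powr \<xi> * (1 + x - \<delta> * phi x / 2) powr \<zeta>"

text \<open>Functions on \<open>[-1,1]\<close> are represented by functions on \<^typ>\<open>real\<close> whose values outside
  \<open>[-1,1]\<close> are irrelevant; classes modulo equality a.e. are represented by their members.\<close>

definition Lp_weighted :: "real \<Rightarrow> real \<Rightarrow> ennreal \<Rightarrow> (real \<Rightarrow> real) set" where
  "Lp_weighted \<alpha> \<beta> p =
    {f \<in> borel_measurable I_measure. Lp_norm p (\<lambda>x. jacobi_weight \<alpha> \<beta> x * f x) < \<infinity>}"

definition poly_space :: "nat \<Rightarrow> real poly set" where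
  "poly_space n = {q. q = 0 \<or> degree q < n}"

definition best_approx :: "nat \<Rightarrow> (real \<Rightarrow> real) \<Rightarrow> real \<Rightarrow> real \<Rightarrow> ennreal \<Rightarrow> ennreal" where
  "best_approx n f \<alpha> \<beta> p =
    (INF q\<in>poly_space n. Lp_norm p (\<lambda>x. jacobi_weight \<alpha> \<beta> x * (f x - poly q x)))"

definition sym_diff_k :: "nat \<Rightarrow> real \<Rightarrow> (real \<Rightarrow> real) \<Rightarrow> real \<Rightarrow> real" where
  "sym_diff_k k h f x =
    (if {x - real k * h / 2 .. x + real k * h / 2} \<subseteq> {-1..1}
     then (\<Sum>i=0..k. real (k choose i) * (-1) ^ (k - i) * f (x - real k * h / 2 + real i * h))
     else 0)"

text \<open>Where the difference is set to \<open>0\<close>, the whole product is \<open>0\<close> because \<open>powr\<close> is total.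
  Elsewhere both bases in the weight are nonnegative.\<close>

definition modulus :: "nat \<Rightarrow> (real \<Rightarrow> real) \<Rightarrow> real \<Rightarrow> real \<Rightarrow> real \<Rightarrow> ennreal \<Rightarrow> ennreal" where
  "modulus k f t \<alpha> \<beta> p =
    (SUP h\<in>{0..t}. Lp_norm p
       (\<lambda>x. shifted_weight \<alpha> \<beta> (real k * h) x * sym_diff_k k (h * phi x) f x))"

end

theory Submission
  imports Defs
begin

text \<open>
  The interval is cut at the Chebyshev nodes \<open>cos (j pi / (64 n))\<close>. On each cell a polynomial of degree
  less than \<open>k\<close> is found that is close to \<open>f\<close> in terms of the modulus, and the local polynomials are
  glued with polynomial approximations of step functions (integrals of a Jackson kernel) whose errors
  decay so fast that neither the growth of the polynomials nor that of the weight matters.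

  For \<open>p < 1\<close> averaging \<open>f\<close> makes no sense. The local step instead rests on self-correction,
  as in property testing: if the \<open>k\<close>-th differences of \<open>f\<close> are small for most start points and
  steps, then for every \<open>x\<close> most steps \<open>s\<close> predict nearly the same value for \<open>f x\<close> from \<open>f (x + s)\<close>,
  ..., \<open>f (x + k s)\<close>. The predicted value is a bounded function with small differences everywhere,
  to which Whitney's inequality in the uniform norm applies; that inequality needs no measurability.

  At an endpoint, with \<open>z\<close> the distance to it, the difference with first point \<open>z\<close> carries the
  weight \<open>z powr \<alpha>\<close> and, because \<open>\<alpha> \<ge> 0\<close>, its other points carry larger weights; so an
  approximation away from the endpoint extends up to it.
\<close>

section \<open>Finite differences and Lagrange interpolation\<close>

text \<open>The supremum over \<open>h\<close> in the modulus cannot be localised, but an average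
  can: integrating \<open>P\<close>-th powers over \<open>0 <= h <= 1/n\<close> gives an integral
  over pairs (first point, step), which is additive over regions, so every cell receives its own
  share. The substitution from (\<open>h\<close>, centre) to (first point, step) brings in the
  factor \<open>1 / phi\<close>. On a cell of length \<open>b\<close> it is at least a constant
  times \<open>1 / (n b)\<close>, rescaling the plane gives \<open>b^(-2)\<close> and rescaling the
  line gives \<open>b\<close>. So every cell loses exactly one factor \<open>n\<close>, and the
  length \<open>1/n\<close> of the range of \<open>h\<close> pays for it.

  The mesh has 64 \<open>n\<close> cells so that every difference inside a local interval has a step
  admissible for some \<open>h <= 1/n\<close>. Local intervals consist of two cells: consecutive
  ones share a cell, on which both local polynomials approximate the same \<open>f\<close>, and this
  controls their distance. Self-correction looks to one side only and needs room there, so the local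
  estimates use differences on 5/4 of the interval.

  Only the half next to the endpoint 1 is treated directly, with differences running away from 1.
  The reflection of the interval, which exchanges the exponents, gives the other half.\<close>

definition fdiff :: "nat \<Rightarrow> real \<Rightarrow> (real \<Rightarrow> real) \<Rightarrow> real \<Rightarrow> real" where
  "fdiff k s f y = (\<Sum>i\<le>k. (-1) ^ i * real (k choose i) * f (y + real i * s))"

lemma fdiff_Suc: "fdiff (Suc k) s f y = fdiff k s f y - fdiff k s f (y + s)"
proof -
  define G where "G i = f (y + real i * s)" for i
  have shift: "f (y + s + real i * s) = G (Suc i)" for i
    by (simp add: G_def algebra_simps)
  have "fdiff (Suc k) s f y = G 0 + (\<Sum>i\<le>k. (-1) ^ Suc i * real (Suc k choose Suc i) * G (Suc i))"
    unfolding fdiff_def by (subst sum.atMost_Suc_shift) (simp add: G_def)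
  also have "(\<Sum>i\<le>k. (-1) ^ Suc i * real (Suc k choose Suc i) * G (Suc i))
      = (\<Sum>i\<le>k. (-1) ^ Suc i * real (k choose Suc i) * G (Suc i) - (-1) ^ i * real (k choose i) * G (Suc i))"
    by (rule sum.cong) (simp_all add: left_diff_distrib right_diff_distrib distrib_left distrib_right)
  also have "\<dots> = (\<Sum>i\<le>k. (-1) ^ Suc i * real (k choose Suc i) * G (Suc i))
        - (\<Sum>i\<le>k. (-1) ^ i * real (k choose i) * G (Suc i))"
    by (rule sum_subtractf)
  also have "G 0 + \<dots> = (\<Sum>i\<le>Suc k. (-1) ^ i * real (k choose i) * G i)
        - (\<Sum>i\<le>k. (-1) ^ i * real (k choose i) * G (Suc i))"
    unfolding sum.atMost_Suc_shift by simp
  also have "\<dots> = fdiff k s f y - fdiff k s f (y + s)"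
    unfolding fdiff_def shift by (simp add: G_def)
  finally show ?thesis .
qed

lemma fdiff_diff: "fdiff k s (\<lambda>x. f x - g x) y = fdiff k s f y - fdiff k s g y"
  unfolding fdiff_def sum_subtractf [symmetric] by (simp add: right_diff_distrib)

text \<open>Reading the points from the other end reverses the step, and the sign
  \<open>(-1)^k\<close> disappears in the absolute value. Later this permits cell coordinates that
  run towards the left.\<close>

lemma fdiff_reflect: "\<bar>fdiff k s f y\<bar> = \<bar>fdiff k (- s) f (y + real k * s)\<bar>"
proof -
  have "fdiff k s f y = (\<Sum>i\<le>k. (-1) ^ (k - i) * real (k choose (k - i)) * f (y + real (k - i) * s))"
    unfolding fdiff_def by (rule sum.reindex_bij_witness [of _ "\<lambda>i. k - i" "\<lambda>i. k - i"]) auto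
  also have "\<dots> = (\<Sum>i\<le>k. (-1) ^ k * ((-1) ^ i * real (k choose i) * f (y + real k * s + real i * - s)))"
  proof (intro sum.cong refl)
    fix i assume "i \<in> {..k}"
    then have i: "i \<le> k" by simp
    obtain d where d: "k = i + d" using i le_Suc_ex by blast
    have 1: "(-1::real) ^ (k - i) = (-1) ^ k * (-1) ^ i"
      by (simp add: d power_add mult_ac power_mult_distrib [symmetric])
    have 2: "k choose (k - i) = k choose i"
      using binomial_symmetric [OF i] by simp
    have 3: "y + real (k - i) * s = y + real k * s + real i * - s"
      by (simp add: d algebra_simps)
    show "(-1) ^ (k - i) * real (k choose (k - i)) * f (y + real (k - i) * s)
      = (-1) ^ k * ((-1) ^ i * real (k choose i) * f (y + real k * s + real i * - s))"
      unfolding 1 2 3 by (simp only: mult.assoc)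
  qed
  also have "\<dots> = (-1) ^ k * fdiff k (- s) f (y + real k * s)"
    unfolding fdiff_def by (rule sum_distrib_left [symmetric])
  finally show ?thesis by (simp add: abs_mult power_abs)
qed

lemma sum_choose_le: "(\<Sum>i\<in>{1..k}. real (k choose i)) \<le> 2 ^ k"
proof -
  have "(\<Sum>i\<in>{1..k}. real (k choose i)) \<le> (\<Sum>i\<le>k. real (k choose i))"
    by (rule sum_mono2) auto
  also have "\<dots> = real (\<Sum>i\<le>k. k choose i)" by simp
  finally show ?thesis by (simp add: choose_row_sum)
qed

text \<open>The substitution of \<open>x + s\<close> keeps the leading coefficient, so the top terms
  cancel. Iterated, this is why differences of order \<open>k\<close> annihilate polynomials of
  degree below \<open>k\<close>.\<close>

lemma degree_shift_diff:
  fixes p :: "real poly"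
  assumes "degree p \<noteq> 0"
  shows "degree (p - pcompose p [:s, 1:]) < degree p"
proof -
  let ?r = "pcompose p [:s, 1:]"
  have d: "degree ?r = degree p" by (simp add: degree_pcompose)
  have l: "coeff ?r (degree p) = coeff p (degree p)"
    using lead_coeff_comp [of "[:s, 1:]" p] d by simp
  have "degree (p - ?r) \<le> degree p" using d by (metis degree_diff_le order_refl)
  moreover have "degree (p - ?r) \<noteq> degree p"
  proof
    assume e: "degree (p - ?r) = degree p"
    then have "coeff (p - ?r) (degree (p - ?r)) = 0" using l by simp
    then have "p - ?r = 0" by (simp only: leading_coeff_0_iff)
    then show False using e assms by simp
  qed
  ultimately show ?thesis by linarith
qed

lemma fdiff_poly: "degree p < k \<Longrightarrow> fdiff k s (poly p) y = 0"
proof (induction k arbitrary: p y)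
  case 0
  then show ?case by simp
next
  case (Suc k)
  have "fdiff k s (poly p) y - fdiff k s (poly p) (y + s)
      = fdiff k s (poly (p - pcompose p [:s, 1:])) y"
    unfolding fdiff_def sum_subtractf [symmetric] by (simp add: poly_pcompose right_diff_distrib add_ac)
  also have "\<dots> = 0"
  proof (cases "degree p = 0")
    case True
    then obtain c where "p = [:c:]" by (meson degree_eq_zeroE)
    then show ?thesis by (simp add: fdiff_def pcompose_const)
  next
    case False
    then show ?thesis using degree_shift_diff [OF False, of s] Suc by (intro Suc.IH) simp
  qed
  finally show ?case by (simp add: fdiff_Suc)
qed

section \<open>Lagrange interpolation and the growth of interpolation errors\<close>

definition lagrange :: "nat \<Rightarrow> (nat \<Rightarrow> real) \<Rightarrow> nat \<Rightarrow> real \<Rightarrow> real" where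
  "lagrange k t j x = (\<Prod>i\<in>{..<k} - {j}. (x - t i) / (t j - t i))"

lemma interpolation:
  fixes t :: "nat \<Rightarrow> real"
  assumes "1 \<le> k" and inj: "inj_on t {..<k}"
  shows "\<exists>p. degree p < k \<and> (\<forall>j<k. poly p (t j) = v j) \<and>
    (\<forall>x. poly p x = (\<Sum>j<k. v j * lagrange k t j x))"
proof -
  define L where "L j = (\<Prod>i\<in>{..<k} - {j}. smult (1 / (t j - t i)) [:- t i, 1:])" for j
  have L: "poly (L j) x = lagrange k t j x" for j x
    unfolding L_def lagrange_def poly_prod by (simp add: diff_divide_distrib)
  have dL: "degree (L j) < k" if "j < k" for j
  proof -
    have "degree (L j) \<le> (\<Sum>i\<in>{..<k} - {j}. degree (smult (1 / (t j - t i)) [:- t i, 1:]))"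
      unfolding L_def by (rule degree_prod_sum_le [unfolded o_def]) simp
    also have "\<dots> \<le> (\<Sum>i\<in>{..<k} - {j}. 1)"
      by (intro sum_mono order_trans [OF degree_smult_le]) simp
    also have "\<dots> < k" using that by simp
    finally show ?thesis .
  qed
  let ?p = "\<Sum>j<k. smult (v j) (L j)"
  have dp: "degree ?p < k"
  proof -
    have "degree ?p \<le> k - 1"
    proof (rule degree_sum_le)
      fix j assume "j \<in> {..<k}"
      then have "degree (L j) < k" using dL by simp
      then show "degree (smult (v j) (L j)) \<le> k - 1"
        using degree_smult_le [of "v j" "L j"] by linarith
    qed simp
    then show ?thesis using assms(1) by linarith
  qed
  have px: "poly ?p x = (\<Sum>j<k. v j * lagrange k t j x)" for x
    by (simp add: poly_sum L)
  have lag: "lagrange k t j (t i) = (if i = j then 1 else 0)" if "i < k" "j < k" for i j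
  proof (cases "i = j")
    case True
    have "t j \<noteq> t l" if "l \<in> {..<k} - {j}" for l
      using that \<open>j < k\<close> inj by (auto simp: inj_on_def)
    then show ?thesis using True unfolding lagrange_def by (simp add: prod.neutral)
  next
    case False
    then show ?thesis using that unfolding lagrange_def by (auto intro!: prod_zero)
  qed
  have "poly ?p (t i) = v i" if "i < k" for i
  proof -
    have "(\<Sum>j<k. v j * lagrange k t j (t i)) = (\<Sum>j<k. if i = j then v j else 0)"
      by (rule sum.cong) (use lag that in auto)
    then show ?thesis using that by (simp add: px)
  qed
  with dp px show ?thesis by blast
qed

lemma lagrange_formula:
  fixes t :: "nat \<Rightarrow> real"
  assumes "degree p < k" and inj: "inj_on t {..<k}"
  shows "poly p x = (\<Sum>j<k. poly p (t j) * lagrange k t j x)"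
proof -
  have "1 \<le> k" using assms(1) by simp
  then obtain r where r: "degree r < k" "\<forall>j<k. poly r (t j) = poly p (t j)"
    and rx: "\<And>x. poly r x = (\<Sum>j<k. poly p (t j) * lagrange k t j x)"
    using interpolation [OF _ inj, of "\<lambda>j. poly p (t j)"] by blast
  have "p - r = 0"
  proof (rule ccontr)
    assume nz: "p - r \<noteq> 0"
    have "k = card (t ` {..<k})" using inj by (simp add: card_image)
    also have "\<dots> \<le> card {x. poly (p - r) x = 0}"
      using r(2) by (intro card_mono poly_roots_finite nz) auto
    also have "\<dots> \<le> degree (p - r)" by (rule card_poly_roots_bound [OF nz])
    also have "\<dots> < k" using assms(1) r(1) by (simp add: degree_diff_less)
    finally show False by simp
  qed
  then have "p = r" by simp
  then show ?thesis using rx [of x] by metis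
qed

text \<open>A difference expresses its last value through the \<open>k\<close> preceding ones with
  coefficients of total size below \<open>2^k\<close>, so the bound grows by at most the factor
  \<open>2^k + 1\<close> from one index to the next. Applied to a function minus its interpolant at
  the first \<open>k\<close> points, it bounds the interpolation error along a progression by
  differences alone.\<close>

lemma newton_bound:
  fixes v :: "nat \<Rightarrow> real"
  assumes k: "1 \<le> k" and v0: "\<And>j. j < k \<Longrightarrow> v j = 0" and e: "0 \<le> \<epsilon>"
    and d: "\<And>m. m + k \<le> L \<Longrightarrow> \<bar>\<Sum>i\<le>k. (-1) ^ i * real (k choose i) * v (m + i)\<bar> \<le> \<epsilon>"
  shows "i \<le> L \<Longrightarrow> \<bar>v i\<bar> \<le> (2 ^ k + 1) ^ i * \<epsilon>"
proof (induction i rule: less_induct)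
  case (less i)
  show ?case
  proof (cases "i < k")
    case True
    then show ?thesis using v0 e by simp
  next
    case False
    define m where "m = i - k"
    have i: "i = m + k" using False by (simp add: m_def)
    obtain i' where i': "i = Suc i'" using i k not0_implies_Suc [of i] by fastforce
    let ?A = "(2 ^ k + 1 :: real)"
    have s: "(\<Sum>l\<le>k. (-1) ^ l * real (k choose l) * v (m + l))
        = (\<Sum>l<k. (-1) ^ l * real (k choose l) * v (m + l)) + (-1) ^ k * v i"
      by (simp add: lessThan_Suc_atMost [symmetric] i)
    have "\<bar>\<Sum>l<k. (-1) ^ l * real (k choose l) * v (m + l)\<bar>
        \<le> (\<Sum>l<k. real (k choose l) * (?A ^ i' * \<epsilon>))"
    proof (rule order_trans [OF sum_abs], rule sum_mono)
      fix l assume l: "l \<in> {..<k}"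
      have "\<bar>v (m + l)\<bar> \<le> ?A ^ (m + l) * \<epsilon>" using l less.prems i by (intro less.IH) auto
      also have "\<dots> \<le> ?A ^ i' * \<epsilon>"
        using l i i' e by (intro mult_right_mono power_increasing) auto
      finally show "\<bar>(-1) ^ l * real (k choose l) * v (m + l)\<bar> \<le> real (k choose l) * (?A ^ i' * \<epsilon>)"
        by (simp add: abs_mult power_abs mult_left_mono)
    qed
    also have "\<dots> = (\<Sum>l<k. real (k choose l)) * (?A ^ i' * \<epsilon>)" by (rule sum_distrib_right [symmetric])
    also have "\<dots> \<le> 2 ^ k * (?A ^ i' * \<epsilon>)"
    proof (rule mult_right_mono)
      have "(\<Sum>l<k. real (k choose l)) \<le> (\<Sum>l\<le>k. real (k choose l))" by (rule sum_mono2) auto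
      also have "\<dots> = real (\<Sum>i\<le>k. k choose i)" by simp
      finally show "(\<Sum>l<k. real (k choose l)) \<le> 2 ^ k" by (simp add: choose_row_sum)
    qed (use e in simp)
    finally have 1: "\<bar>\<Sum>l<k. (-1) ^ l * real (k choose l) * v (m + l)\<bar> \<le> 2 ^ k * (?A ^ i' * \<epsilon>)" .
    have 2: "\<bar>\<Sum>l\<le>k. (-1) ^ l * real (k choose l) * v (m + l)\<bar> \<le> \<epsilon>"
      using d [of m] less.prems i by simp
    have "\<bar>v i\<bar> = \<bar>(-1) ^ k * v i\<bar>" by (simp add: abs_mult power_abs)
    also have "\<dots> \<le> \<epsilon> + 2 ^ k * (?A ^ i' * \<epsilon>)" using 1 2 s by linarith
    also have "\<dots> \<le> ?A ^ i' * \<epsilon> + 2 ^ k * (?A ^ i' * \<epsilon>)"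
      using e by (simp add: mult_le_cancel_right1 one_le_power)
    also have "\<dots> = ?A ^ i * \<epsilon>" by (simp add: i' algebra_simps)
    finally show ?thesis .
  qed
qed

section \<open>Whitney's inequality for bounded functions\<close>

text \<open>At 0 all fundamental polynomials with \<open>j >= 1\<close> for the nodes 0, ..., k - 1
  vanish, so by continuity their sum is small at \<open>1/B\<close> once \<open>B\<close> is large.
  Passing from the node 0 to the point \<open>1/B\<close> thus takes over at most half of the values
  at the other nodes.\<close>

lemma lagrange_contraction:
  assumes k: "1 \<le> k"
  shows "\<exists>B::nat. 1 \<le> B \<and> (\<Sum>j\<in>{1..<k}. \<bar>lagrange k real j (1 / real B)\<bar>) \<le> 1 / 2
    \<and> \<bar>lagrange k real 0 (1 / real B)\<bar> \<le> 1"
proof -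
  define F where "F x = (\<Sum>j\<in>{1..<k}. \<bar>lagrange k real j x\<bar>)" for x
  have F0: "F 0 = 0"
    unfolding F_def lagrange_def by (intro sum.neutral ballI) (auto intro!: prod_zero)
  have F: "isCont F 0"
    unfolding F_def lagrange_def divide_inverse by (intro continuous_intros)
  have "(\<lambda>n. F (1 / real (Suc n))) \<longlonglongrightarrow> F 0"
    by (rule isCont_tendsto_compose [OF F LIMSEQ_Suc [OF lim_1_over_n]])
  then have "(\<lambda>n. F (1 / real (Suc n))) \<longlonglongrightarrow> 0" using F0 by simp
  then have "\<forall>\<^sub>F n in sequentially. F (1 / real (Suc n)) < 1 / 2"
    by (rule order_tendstoD) simp
  then obtain n where n: "F (1 / real (Suc n)) < 1 / 2" by (meson eventually_sequentially order_refl)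
  have "\<bar>lagrange k real 0 (1 / real (Suc n))\<bar> \<le> 1"
    unfolding lagrange_def abs_prod
  proof (rule prod_le_1)
    fix i assume "i \<in> {..<k} - {0}"
    then have i: "1 \<le> real i" by auto
    moreover have "1 / real (Suc n) \<le> 1" "0 \<le> 1 / real (Suc n)" by auto
    ultimately have "\<bar>1 / real (Suc n) - real i\<bar> \<le> real i" by linarith
    then show "0 \<le> \<bar>(1 / real (Suc n) - real i) / (real 0 - real i)\<bar> \<and>
        \<bar>(1 / real (Suc n) - real i) / (real 0 - real i)\<bar> \<le> 1"
      using i by (simp add: abs_divide divide_le_eq)
  qed
  then show ?thesis using n unfolding F_def by (intro exI [of _ "Suc n"]) (auto intro: less_imp_le)
qed

text \<open>Along the progression the sequence is a polynomial up to the accumulated difference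
  error. This polynomial is interpolated at the indices 0, B, ..., (k - 1) B; in units of
  \<open>B\<close> the index 1 is the point \<open>1/B\<close>, where
  \<open>lagrange_contraction\<close> applies.\<close>

lemma contraction_step:
  fixes v :: "nat \<Rightarrow> real"
  assumes k: "1 \<le> k" and B: "1 \<le> B" and hB: "(\<Sum>j\<in>{1..<k}. \<bar>lagrange k real j (1 / real B)\<bar>) \<le> 1 / 2"
    and h0: "\<bar>lagrange k real 0 (1 / real B)\<bar> \<le> 1" and e: "0 \<le> \<epsilon>"
    and d: "\<And>m. m + k \<le> k * B \<Longrightarrow> \<bar>\<Sum>i\<le>k. (-1) ^ i * real (k choose i) * v (m + i)\<bar> \<le> \<epsilon>"
    and v0: "\<bar>v 0\<bar> \<le> \<delta>" and vM: "\<And>i. i \<le> k * B \<Longrightarrow> \<bar>v i\<bar> \<le> M"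
  shows "\<bar>v 1\<bar> \<le> M / 2 + \<delta> + 2 * ((2 ^ k + 1) ^ (k * B) * \<epsilon>)"
proof -
  define K where "K = (2 ^ k + 1 :: real) ^ (k * B) * \<epsilon>"
  have K0: "0 \<le> K" using e by (simp add: K_def)
  obtain p where p: "degree p < k" "\<forall>j<k. poly p (real j) = v j"
    using interpolation [OF k, of real v] by (auto simp: inj_on_def)
  have pv: "\<bar>v i - poly p (real i)\<bar> \<le> K" if i: "i \<le> k * B" for i
  proof -
    have "\<bar>v i - poly p (real i)\<bar> \<le> (2 ^ k + 1) ^ i * \<epsilon>"
    proof (rule newton_bound [OF k _ e _ i])
      fix m assume m: "m + k \<le> k * B"
      have "(\<Sum>i\<le>k. (-1) ^ i * real (k choose i) * (v (m + i) - poly p (real (m + i))))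
        = (\<Sum>i\<le>k. (-1) ^ i * real (k choose i) * v (m + i)) - fdiff k 1 (poly p) (real m)"
        unfolding fdiff_def sum_subtractf [symmetric] by (simp add: right_diff_distrib)
      then show "\<bar>\<Sum>i\<le>k. (-1) ^ i * real (k choose i) * (v (m + i) - poly p (real (m + i)))\<bar> \<le> \<epsilon>"
        using d [OF m] fdiff_poly [OF p(1)] by simp
    qed (use p in simp)
    also have "\<dots> \<le> K" unfolding K_def using i e by (intro mult_right_mono power_increasing) auto
    finally show ?thesis .
  qed
  define r where "r = pcompose p [:0, real B:]"
  have r: "degree r < k" using p(1) degree_pcompose_le [of p "[:0, real B:]"]
    by (simp add: r_def degree_pcompose)
  have rj: "poly r (real j) = poly p (real (j * B))" for j
    by (simp add: r_def poly_pcompose mult.commute)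
  have "poly p 1 = poly r (1 / real B)"
    using B by (simp add: r_def poly_pcompose)
  also have "\<dots> = (\<Sum>j<k. poly r (real j) * lagrange k real j (1 / real B))"
    by (rule lagrange_formula [OF r]) (auto simp: inj_on_def)
  also have "\<dots> = poly r 0 * lagrange k real 0 (1 / real B)
      + (\<Sum>j\<in>{1..<k}. poly r (real j) * lagrange k real j (1 / real B))"
    using k by (simp add: lessThan_atLeast0 sum.atLeast_Suc_lessThan)
  finally have p1: "\<bar>poly p 1\<bar> \<le> \<bar>poly r 0 * lagrange k real 0 (1 / real B)\<bar>
      + \<bar>\<Sum>j\<in>{1..<k}. poly r (real j) * lagrange k real j (1 / real B)\<bar>" by linarith
  have "poly r 0 = v 0" using p(2) k by (auto simp: r_def poly_pcompose)
  then have "\<bar>poly r 0 * lagrange k real 0 (1 / real B)\<bar> \<le> \<delta> * 1"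
    unfolding abs_mult using v0 h0 by (intro mult_mono) auto
  moreover have "\<bar>\<Sum>j\<in>{1..<k}. poly r (real j) * lagrange k real j (1 / real B)\<bar> \<le> (M + K) * (1 / 2)"
  proof -
    have "\<bar>\<Sum>j\<in>{1..<k}. poly r (real j) * lagrange k real j (1 / real B)\<bar>
        \<le> (\<Sum>j\<in>{1..<k}. (M + K) * \<bar>lagrange k real j (1 / real B)\<bar>)"
    proof (rule order_trans [OF sum_abs], rule sum_mono)
      fix j assume "j \<in> {1..<k}"
      then have "j * B \<le> k * B" by simp
      then have "\<bar>poly r (real j)\<bar> \<le> M + K" using vM pv rj by (smt (verit, best))
      then show "\<bar>poly r (real j) * lagrange k real j (1 / real B)\<bar> \<le> (M + K) * \<bar>lagrange k real j (1 / real B)\<bar>"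
        by (simp add: abs_mult mult_right_mono)
    qed
    also have "\<dots> = (M + K) * (\<Sum>j\<in>{1..<k}. \<bar>lagrange k real j (1 / real B)\<bar>)"
      by (rule sum_distrib_left [symmetric])
    also have "\<dots> \<le> (M + K) * (1 / 2)"
      using hB vM [of 0] K0 by (intro mult_left_mono) auto
    finally show ?thesis .
  qed
  moreover have "1 \<le> k * B" using k B by (metis mult_le_mono mult_1)
  then have "\<bar>v 1 - poly p 1\<bar> \<le> K" using pv [of 1] by simp
  ultimately show ?thesis using p1 K0 unfolding K_def by (simp add: field_simps)
qed

text \<open>\<open>g\<close> minus its interpolant is small on a lattice. Every \<open>x\<close> is
  one short step \<open>d\<close> away from a lattice point, and the progression through the two,
  continued in the same direction, stays in the unit interval, so \<open>contraction_step\<close>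
  bounds the error at \<open>x\<close> by half its supremum \<open>M\<close> plus a multiple of
  \<open>\<epsilon>\<close>. Boundedness of \<open>g\<close> makes \<open>M\<close> finite, and the
  half is absorbed.\<close>

lemma whitney_unit:
  assumes k: "1 \<le> k"
  shows "\<exists>C>0. \<forall>g \<epsilon>. 0 \<le> \<epsilon> \<longrightarrow> (\<exists>L. \<forall>x\<in>{0..1}. \<bar>g x\<bar> \<le> L) \<longrightarrow>
    (\<forall>x t. 0 \<le> x \<longrightarrow> 0 \<le> t \<longrightarrow> x + real k * t \<le> 1 \<longrightarrow> \<bar>fdiff k t g x\<bar> \<le> \<epsilon>) \<longrightarrow>
    (\<exists>q. degree q < k \<and> (\<forall>x\<in>{0..1}. \<bar>g x - poly q x\<bar> \<le> C * \<epsilon>))"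
proof -
  obtain B where B: "1 \<le> B" "(\<Sum>j\<in>{1..<k}. \<bar>lagrange k real j (1 / real B)\<bar>) \<le> 1 / 2"
    "\<bar>lagrange k real 0 (1 / real B)\<bar> \<le> 1"
    using lagrange_contraction [OF k] by blast
  define L where "L = k * B"
  \<comment> \<open>A walk of \<open>L\<close> steps of length at most \<open>1/N\<close> then
    covers at most 1/2: points of the left half walk to the right, points of the right half walk to
    the left, and neither leaves the unit interval.\<close>
  define N where "N = 2 * L"
  have L1: "1 \<le> L" unfolding L_def using k B by (metis mult_le_mono mult_1)
  have N0: "real N > 0" using L1 by (simp add: N_def)
  have LN: "real L / real N = 1 / 2" using L1 by (simp add: N_def)
  define K where "K = 2 * ((2 ^ k + 1 :: real) ^ N + 2 * (2 ^ k + 1) ^ L)"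
  show ?thesis
  proof (intro exI [of _ K] conjI allI impI)
    show "0 < K" unfolding K_def by (intro mult_pos_pos add_pos_pos zero_less_power) auto
    fix g :: "real \<Rightarrow> real" and \<epsilon> :: real
    assume e: "0 \<le> \<epsilon>" and bd: "\<exists>L. \<forall>x\<in>{0..1}. \<bar>g x\<bar> \<le> L"
      and d: "\<forall>x t. 0 \<le> x \<longrightarrow> 0 \<le> t \<longrightarrow> x + real k * t \<le> 1 \<longrightarrow> \<bar>fdiff k t g x\<bar> \<le> \<epsilon>"
    obtain q where q: "degree q < k" "\<forall>j<k. poly q (real j / real N) = g (real j / real N)"
      using interpolation [OF k, of "\<lambda>j. real j / real N" "\<lambda>j. g (real j / real N)"] N0
      by (auto simp: inj_on_def)
    define r where "r x = g x - poly q x" for x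
    have fr: "fdiff k t r x = fdiff k t g x" for t x
      unfolding r_def fdiff_diff using fdiff_poly [OF q(1)] by simp
    have dr: "\<bar>fdiff k t r x\<bar> \<le> \<epsilon>" if "0 \<le> x" "x \<le> 1" "0 \<le> x + real k * t" "x + real k * t \<le> 1" for t x
    proof (cases "0 \<le> t")
      case True
      then show ?thesis using d that fr by simp
    next
      case False
      have "\<bar>fdiff k (- t) g (x + real k * t)\<bar> \<le> \<epsilon>" using d that False by simp
      then show ?thesis unfolding fr fdiff_reflect [of k t g x] .
    qed
    have lat: "\<bar>r (real i / real N)\<bar> \<le> (2 ^ k + 1) ^ N * \<epsilon>" if i: "i \<le> N" for i
    proof -
      have "\<bar>r (real i / real N)\<bar> \<le> (2 ^ k + 1) ^ i * \<epsilon>"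
      proof (rule newton_bound [where v = "\<lambda>i. r (real i / real N)", OF k _ e _ i])
        fix m assume m: "m + k \<le> N"
        have "(\<Sum>i\<le>k. (-1) ^ i * real (k choose i) * r (real (m + i) / real N)) = fdiff k (1 / real N) r (real m / real N)"
          unfolding fdiff_def by (simp add: add_divide_distrib)
        moreover have "real m / real N + real k * (1 / real N) \<le> 1"
        proof -
          have "real m / real N + real k * (1 / real N) = real (m + k) / real N" by (simp add: add_divide_distrib)
          also have "\<dots> \<le> 1" using m N0 by (simp del: of_nat_add)
          finally show ?thesis .
        qed
        moreover have "real m / real N \<le> 1" using m N0 by simp
        ultimately show "\<bar>\<Sum>i\<le>k. (-1) ^ i * real (k choose i) * r (real (m + i) / real N)\<bar> \<le> \<epsilon>"
          using dr [of "real m / real N" "1 / real N"] N0 by simp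
      qed (use q in \<open>simp add: r_def\<close>)
      also have "\<dots> \<le> (2 ^ k + 1) ^ N * \<epsilon>" using i e by (intro mult_right_mono power_increasing) auto
      finally show ?thesis .
    qed
    obtain L1 where L1: "\<forall>x\<in>{0..1}. \<bar>g x\<bar> \<le> L1" using bd by blast
    have "bounded (poly q ` {0..1})"
      by (intro compact_imp_bounded compact_continuous_image continuous_intros) simp
    then obtain L2 where L2: "\<forall>x\<in>{0..1}. \<bar>poly q x\<bar> \<le> L2"
      by (auto simp: bounded_iff)
    have bdd: "bdd_above ((\<lambda>x. \<bar>r x\<bar>) ` {0..1})"
    proof (rule bdd_aboveI2)
      fix x :: real assume x: "x \<in> {0..1}"
      then have "\<bar>g x\<bar> \<le> L1" "\<bar>poly q x\<bar> \<le> L2" using L1 L2 by auto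
      then show "\<bar>r x\<bar> \<le> L1 + L2" unfolding r_def by linarith
    qed
    define M where "M = (SUP x\<in>{0..1}. \<bar>r x\<bar>)"
    have rM: "\<bar>r x\<bar> \<le> M" if "x \<in> {0..1}" for x
      unfolding M_def using that bdd by (rule cSUP_upper)
    have step: "\<bar>r x\<bar> \<le> M / 2 + (2 ^ k + 1) ^ N * \<epsilon> + 2 * ((2 ^ k + 1) ^ L * \<epsilon>)" if x: "x \<in> {0..1}" for x
    proof -
      have "\<exists>i0 d. i0 \<le> N \<and> x = real i0 / real N + d \<and> (\<forall>l\<le>L. real i0 / real N + real l * d \<in> {0..1})"
      proof (cases "x \<le> 1 / 2")
        case True
        define i0 where "i0 = nat \<lfloor>x * real N\<rfloor>"
        define d where "d = x - real i0 / real N"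
        have i0: "real i0 \<le> x * real N" "x * real N < real i0 + 1"
          unfolding i0_def using x N0 by (simp_all add: floor_le_iff) (linarith?)
        have 1: "real i0 / real N \<le> x" using i0 N0 by (simp add: divide_le_eq)
        have d0: "0 \<le> d" using 1 by (simp add: d_def)
        have "d = (x * real N - real i0) / real N" using N0 by (simp add: d_def field_simps)
        then have d1: "d \<le> 1 / real N" using i0 N0 by (simp add: divide_right_mono)
        have "real i0 \<le> 1 * real N" using i0(1) x mult_right_mono [of x 1 "real N"] by auto
        then have 2: "i0 \<le> N" by simp
        have "real i0 / real N + real l * d \<in> {0..1}" if l: "l \<le> L" for l
        proof -
          have "real l * d \<le> real L * (1 / real N)" using l d0 d1 by (intro mult_mono) auto
          then have "real l * d \<le> 1 / 2" using LN by simp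
          then show ?thesis using 1 True d0 by simp
        qed
        then show ?thesis using 2 by (intro exI [of _ i0] exI [of _ d]) (auto simp: d_def)
      next
        case False
        define i0 where "i0 = nat \<lceil>x * real N\<rceil>"
        define d where "d = x - real i0 / real N"
        have i0: "x * real N \<le> real i0" "real i0 < x * real N + 1"
          unfolding i0_def using x N0 by (simp_all add: of_nat_nat) (linarith)
        have 1: "x \<le> real i0 / real N" using i0 N0 by (simp add: le_divide_eq)
        have d0: "d \<le> 0" using 1 by (simp add: d_def)
        have "- d = (real i0 - x * real N) / real N" using N0 by (simp add: d_def field_simps)
        then have d1: "- d \<le> 1 / real N" using i0 N0 by (simp add: divide_right_mono)
        have "real i0 < real N + 1" using i0(2) x mult_right_mono [of x 1 "real N"] by auto
        then have 2: "i0 \<le> N" by linarith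
        have "real i0 / real N + real l * d \<in> {0..1}" if l: "l \<le> L" for l
        proof -
          have "real l * - d \<le> real L * (1 / real N)" using l d0 d1 by (intro mult_mono) auto
          then have "- (real l * d) \<le> 1 / 2" using LN by simp
          moreover have "real l * d \<le> 0" using d0 by (simp add: mult_nonneg_nonpos)
          moreover have "real i0 / real N \<le> 1" using 2 N0 by simp
          ultimately show ?thesis using 1 False by simp
        qed
        then show ?thesis using 2 by (intro exI [of _ i0] exI [of _ d]) (auto simp: d_def)
      qed
      then obtain i0 d where i0: "i0 \<le> N" "x = real i0 / real N + d"
        and pts: "\<And>l. l \<le> L \<Longrightarrow> real i0 / real N + real l * d \<in> {0..1}" by blast
      let ?v = "\<lambda>l. r (real i0 / real N + real l * d)"
      have "\<bar>?v 1\<bar> \<le> M / 2 + (2 ^ k + 1) ^ N * \<epsilon> + 2 * ((2 ^ k + 1) ^ (k * B) * \<epsilon>)"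
      proof (rule contraction_step [OF k B e])
        fix m assume m: "m + k \<le> k * B"
        have "(\<Sum>i\<le>k. (-1) ^ i * real (k choose i) * ?v (m + i)) = fdiff k d r (real i0 / real N + real m * d)"
          unfolding fdiff_def by (simp add: algebra_simps)
        moreover have "real i0 / real N + real m * d + real k * d = real i0 / real N + real (m + k) * d"
          by (simp add: algebra_simps)
        ultimately show "\<bar>\<Sum>i\<le>k. (-1) ^ i * real (k choose i) * ?v (m + i)\<bar> \<le> \<epsilon>"
          using dr [of "real i0 / real N + real m * d" d] pts [of m] pts [of "m + k"] m by (simp add: L_def)
      next
        show "\<bar>?v 0\<bar> \<le> (2 ^ k + 1) ^ N * \<epsilon>" using lat [OF i0(1)] by simp
      next
        fix i assume "i \<le> k * B"
        then show "\<bar>?v i\<bar> \<le> M" using pts by (intro rM) (simp add: L_def)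
      qed
      then show ?thesis using i0(2) by (simp add: L_def)
    qed
    have "M \<le> M / 2 + (2 ^ k + 1) ^ N * \<epsilon> + 2 * ((2 ^ k + 1) ^ L * \<epsilon>)"
      unfolding M_def by (rule cSUP_least) (use step M_def in auto)
    then have "M \<le> K * \<epsilon>" unfolding K_def by (simp add: algebra_simps)
    then show "\<exists>q. degree q < k \<and> (\<forall>x\<in>{0..1}. \<bar>g x - poly q x\<bar> \<le> K * \<epsilon>)"
      using q(1) rM unfolding r_def by (intro exI [of _ q]) force
  qed
qed

lemma whitney_interval:
  fixes a b :: real
  assumes k: "1 \<le> k" and ab: "a < b"
  shows "\<exists>C>0. \<forall>g \<epsilon>. 0 \<le> \<epsilon> \<longrightarrow> (\<exists>L. \<forall>x\<in>{a..b}. \<bar>g x\<bar> \<le> L) \<longrightarrow>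
    (\<forall>x t. a \<le> x \<longrightarrow> 0 \<le> t \<longrightarrow> x + real k * t \<le> b \<longrightarrow> \<bar>fdiff k t g x\<bar> \<le> \<epsilon>) \<longrightarrow>
    (\<exists>q. degree q < k \<and> (\<forall>x\<in>{a..b}. \<bar>g x - poly q x\<bar> \<le> C * \<epsilon>))"
proof -
  obtain C where C: "C > 0" and W: "\<And>g \<epsilon>. 0 \<le> \<epsilon> \<Longrightarrow> (\<exists>L. \<forall>x\<in>{0..1}. \<bar>g x\<bar> \<le> L) \<Longrightarrow>
    (\<forall>x t. 0 \<le> x \<longrightarrow> 0 \<le> t \<longrightarrow> x + real k * t \<le> 1 \<longrightarrow> \<bar>fdiff k t g x\<bar> \<le> \<epsilon>) \<Longrightarrow>
    (\<exists>q. degree q < k \<and> (\<forall>x\<in>{0..1}. \<bar>g x - poly q x\<bar> \<le> C * \<epsilon>))"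
    using whitney_unit [OF k] by blast
  let ?l = "b - a"
  show ?thesis
  proof (intro exI [of _ C] conjI allI impI C)
    fix g :: "real \<Rightarrow> real" and \<epsilon> :: real
    assume e: "0 \<le> \<epsilon>" and bd: "\<exists>L. \<forall>x\<in>{a..b}. \<bar>g x\<bar> \<le> L"
      and d: "\<forall>x t. a \<le> x \<longrightarrow> 0 \<le> t \<longrightarrow> x + real k * t \<le> b \<longrightarrow> \<bar>fdiff k t g x\<bar> \<le> \<epsilon>"
    let ?g = "\<lambda>x. g (a + ?l * x)"
    have sc: "?l * x \<le> ?l" if "x \<le> 1" for x
      using mult_left_mono [OF that, of ?l] ab by simp
    have "\<exists>L. \<forall>x\<in>{0..1}. \<bar>?g x\<bar> \<le> L"
    proof -
      obtain L where L: "\<forall>x\<in>{a..b}. \<bar>g x\<bar> \<le> L" using bd by blast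
      have "a + ?l * x \<in> {a..b}" if "x \<in> {0..1}" for x
      proof -
        have "?l * x \<le> ?l" "0 \<le> ?l * x" using sc [of x] that ab by auto
        then show ?thesis unfolding atLeastAtMost_iff by linarith
      qed
      then show ?thesis using L by blast
    qed
    moreover have "\<bar>fdiff k t ?g x\<bar> \<le> \<epsilon>" if "0 \<le> x" "0 \<le> t" "x + real k * t \<le> 1" for x t
    proof -
      have "fdiff k t ?g x = fdiff k (?l * t) g (a + ?l * x)"
        unfolding fdiff_def by (simp add: algebra_simps)
      moreover have "a + ?l * x + real k * (?l * t) \<le> b"
        using sc [OF that(3)] by (simp add: algebra_simps)
      ultimately show ?thesis using d that ab by simp
    qed
    ultimately obtain q where q: "degree q < k" "\<forall>x\<in>{0..1}. \<bar>?g x - poly q x\<bar> \<le> C * \<epsilon>"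
      using W [OF e, of ?g] by blast
    let ?q = "pcompose q [:- a / ?l, 1 / ?l:]"
    have "\<bar>g x - poly ?q x\<bar> \<le> C * \<epsilon>" if x: "x \<in> {a..b}" for x
    proof -
      have "(x - a) / ?l \<in> {0..1}" using x ab by (simp add: divide_le_eq)
      then have "\<bar>?g ((x - a) / ?l) - poly q ((x - a) / ?l)\<bar> \<le> C * \<epsilon>" using q(2) by blast
      moreover have "a + ?l * ((x - a) / ?l) = x" using ab by simp
      moreover have "poly ?q x = poly q ((x - a) / ?l)"
        by (simp add: poly_pcompose diff_divide_distrib)
      ultimately show ?thesis by simp
    qed
    moreover have "degree ?q < k" using q(1) ab by (simp add: degree_pcompose)
    ultimately show "\<exists>q. degree q < k \<and> (\<forall>x\<in>{a..b}. \<bar>g x - poly q x\<bar> \<le> C * \<epsilon>)" by blast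
  qed
qed

section \<open>Self-correction: from small differences in measure to a polynomial\<close>

abbreviation plane :: "(real \<times> real) measure" where
  "plane \<equiv> lborel \<Otimes>\<^sub>M lborel"

lemma measurable_poly [measurable]: "poly q \<in> borel_measurable borel" for q :: "real poly"
  by (intro borel_measurable_continuous_onI continuous_intros)

lemma sets_Collect_plane:
  "Measurable.pred plane P \<Longrightarrow> {z. P z} \<in> sets plane"
  for P :: "real \<times> real \<Rightarrow> bool"
  by (simp add: pred_def space_pair_measure)

text \<open>This transports smallness of a bad set to the grid points \<open>x + i s\<close> with
  \<open>i >= 1\<close>, uniformly in \<open>x\<close>. The point \<open>x\<close> itself, with
  \<open>i = 0\<close>, is out of reach; all identities below are arranged to avoid differences that
  start there.\<close>

lemma emeasure_affine_le:
  fixes t c :: real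
  assumes [measurable]: "N \<in> sets borel" and c: "1 \<le> c"
  shows "emeasure lborel {u. t + c * u \<in> N} \<le> emeasure lborel N"
proof -
  have "emeasure lborel N = ennreal \<bar>c\<bar> * (\<integral>\<^sup>+x. indicator N (t + c * x) \<partial>lborel)"
    using nn_integral_real_affine [of "indicator N" c t] c by simp
  also have "(\<integral>\<^sup>+x. indicator N (t + c * x) \<partial>lborel) = (\<integral>\<^sup>+x. indicator {u. t + c * u \<in> N} x \<partial>lborel)"
    by (intro nn_integral_cong) (simp add: indicator_def)
  also have "\<dots> = emeasure lborel {u. t + c * u \<in> N}"
    by (rule nn_integral_indicator) measurable
  finally have "emeasure lborel N = ennreal c * emeasure lborel {u. t + c * u \<in> N}" using c by simp
  moreover have "1 * emeasure lborel {u. t + c * u \<in> N} \<le> ennreal c * emeasure lborel {u. t + c * u \<in> N}"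
    using c by (intro mult_right_mono) auto
  ultimately show ?thesis by simp
qed

lemma emeasure_affine2_le:
  assumes [measurable]: "T \<in> sets plane" and "1 \<le> a" "1 \<le> b"
  shows "emeasure plane {z. (x + a * fst z, t + b * snd z) \<in> T}
    \<le> emeasure plane (T :: (real \<times> real) set)"
proof -
  have S: "{z. (x + a * fst z, t + b * snd z) \<in> T} \<in> sets plane"
    by (rule sets_Collect_plane) measurable
  have m [measurable]: "Pair y -` T \<in> sets borel" for y
    using sets_Pair1 [OF assms(1)] by simp
  have g [measurable]: "(\<lambda>y. emeasure lborel (Pair y -` T)) \<in> borel_measurable borel"
    using lborel.measurable_emeasure_Pair [OF assms(1)] by simp
  have "emeasure plane {z. (x + a * fst z, t + b * snd z) \<in> T}
      = (\<integral>\<^sup>+u. emeasure lborel {v. t + b * v \<in> Pair (x + a * u) -` T} \<partial>lborel)"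
    by (subst lborel.emeasure_pair_measure_alt [OF S]) (auto intro!: nn_integral_cong arg_cong [where f = "emeasure lborel"])
  also have "\<dots> \<le> (\<integral>\<^sup>+u. emeasure lborel (Pair (x + a * u) -` T) \<partial>lborel)"
    by (intro nn_integral_mono emeasure_affine_le m assms)
  also have "\<dots> = 1 * \<dots>" by simp
  also have "\<dots> \<le> ennreal \<bar>a\<bar> * (\<integral>\<^sup>+u. emeasure lborel (Pair (x + a * u) -` T) \<partial>lborel)"
    using assms by (intro mult_right_mono) auto
  also have "\<dots> = (\<integral>\<^sup>+y. emeasure lborel (Pair y -` T) \<partial>lborel)"
    using assms by (intro nn_integral_real_affine [symmetric] g) auto
  also have "\<dots> = emeasure plane T"
    by (rule lborel.emeasure_pair_measure_alt [symmetric]) fact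
  finally show ?thesis .
qed

text \<open>With this normalisation \<open>f x\<close> has the coefficient 1, so
  \<open>f x - fdiff k s f x\<close> is the value at \<open>x\<close> predicted from the points
  \<open>x + i s\<close>, \<open>i >= 1\<close>.\<close>

lemma fdiff_split: "fdiff k s f x = f x + (\<Sum>i\<in>{1..k}. (-1) ^ i * real (k choose i) * f (x + real i * s))"
  unfolding fdiff_def atMost_atLeast0 by (subst sum.atLeast_Suc_atMost) auto

lemma weighted_sum_bound:
  assumes "\<And>i. i \<in> {1..k} \<Longrightarrow> \<bar>z i\<bar> \<le> \<epsilon>" and "0 \<le> \<epsilon>"
  shows "\<bar>\<Sum>i\<in>{1..k}. (-1) ^ i * real (k choose i) * z i\<bar> \<le> 2 ^ k * \<epsilon>"
proof -
  have "\<bar>\<Sum>i\<in>{1..k}. (-1) ^ i * real (k choose i) * z i\<bar> \<le> (\<Sum>i\<in>{1..k}. real (k choose i) * \<epsilon>)"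
    by (rule order_trans [OF sum_abs], rule sum_mono) (simp add: abs_mult power_abs mult_left_mono assms)
  also have "\<dots> = (\<Sum>i\<in>{1..k}. real (k choose i)) * \<epsilon>" by (rule sum_distrib_right [symmetric])
  also have "\<dots> \<le> 2 ^ k * \<epsilon>" using sum_choose_le assms(2) by (rule mult_right_mono)
  finally show ?thesis .
qed

text \<open>Both predictions of \<open>f x\<close> are compared with the same double sum over the
  grid points \<open>x + i s + j s'\<close> with \<open>i, j >= 1\<close>: differences in direction
  \<open>s'\<close> reduce it to the prediction by \<open>s\<close>, differences in direction
  \<open>s\<close> to the prediction by \<open>s'\<close>.\<close>

lemma grid_consistency:
  assumes "\<And>i. i \<in> {1..k} \<Longrightarrow> \<bar>fdiff k s' f (x + real i * s)\<bar> \<le> \<epsilon>"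
    and "\<And>i. i \<in> {1..k} \<Longrightarrow> \<bar>fdiff k s f (x + real i * s')\<bar> \<le> \<epsilon>" and e: "0 \<le> \<epsilon>"
  shows "\<bar>fdiff k s f x - fdiff k s' f x\<bar> \<le> 2 ^ (k + 1) * \<epsilon>"
proof -
  define c where "c i = (-1) ^ i * real (k choose i)" for i
  let ?G = "\<lambda>i j. f (x + real i * s + real j * s')"
  have 1: "(\<Sum>i\<in>{1..k}. c i * fdiff k s' f (x + real i * s))
      = (fdiff k s f x - f x) + (\<Sum>i\<in>{1..k}. \<Sum>j\<in>{1..k}. c i * c j * ?G i j)"
    unfolding fdiff_split [of k s] fdiff_split [of k s'] c_def
    by (simp add: distrib_left sum.distrib sum_distrib_left mult.assoc)
  have 2: "(\<Sum>j\<in>{1..k}. c j * fdiff k s f (x + real j * s'))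
      = (fdiff k s' f x - f x) + (\<Sum>j\<in>{1..k}. \<Sum>i\<in>{1..k}. c j * c i * ?G i j)"
    unfolding fdiff_split [of k s] fdiff_split [of k s'] c_def
    by (simp add: distrib_left sum.distrib sum_distrib_left mult.assoc add.assoc add.commute add.left_commute)
  have 3: "(\<Sum>j\<in>{1..k}. \<Sum>i\<in>{1..k}. c j * c i * ?G i j) = (\<Sum>i\<in>{1..k}. \<Sum>j\<in>{1..k}. c i * c j * ?G i j)"
    by (subst sum.swap) (simp add: mult.commute)
  have "\<bar>\<Sum>i\<in>{1..k}. c i * fdiff k s' f (x + real i * s)\<bar> \<le> 2 ^ k * \<epsilon>"
    unfolding c_def by (rule weighted_sum_bound) (use assms in auto)
  moreover have "\<bar>\<Sum>j\<in>{1..k}. c j * fdiff k s f (x + real j * s')\<bar> \<le> 2 ^ k * \<epsilon>"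
    unfolding c_def by (rule weighted_sum_bound) (use assms in auto)
  ultimately show ?thesis using 1 2 3 by (simp add: abs_le_iff algebra_simps)
qed

text \<open>\<open>G i\<close> stands for the corrected value at \<open>x + i t\<close>, which is
  predicted with the step \<open>u + i v\<close>. The point used with index \<open>j\<close> is
  \<open>x + i t + j (u + i v) = (x + j u) + i (t + j v)\<close>, so for fixed \<open>j\<close>
  these points form a progression in \<open>i\<close>. Exchanging the sums turns the difference of
  the predictions into differences of \<open>f\<close> with \<open>j >= 1\<close>.\<close>

lemma corrected_difference:
  assumes g: "\<And>i. i \<le> k \<Longrightarrow> \<bar>G i + (fdiff k (u + real i * v) f (x + real i * t) - f (x + real i * t))\<bar> \<le> \<delta>"
    and d: "\<And>j. j \<in> {1..k} \<Longrightarrow> \<bar>fdiff k (t + real j * v) f (x + real j * u)\<bar> \<le> \<epsilon>" and e: "0 \<le> \<epsilon>" "0 \<le> \<delta>"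
  shows "\<bar>\<Sum>i\<le>k. (-1) ^ i * real (k choose i) * G i\<bar> \<le> 2 ^ k * \<delta> + 2 ^ k * \<epsilon>"
proof -
  define c where "c i = (-1) ^ i * real (k choose i)" for i
  let ?H = "\<lambda>i j. f (x + real i * t + real j * (u + real i * v))"
  let ?F = "\<lambda>i. fdiff k (u + real i * v) f (x + real i * t) - f (x + real i * t)"
  have F: "?F i = (\<Sum>j\<in>{1..k}. c j * ?H i j)" for i
    unfolding fdiff_split c_def by simp
  have D: "fdiff k (t + real j * v) f (x + real j * u) = (\<Sum>i\<le>k. c i * ?H i j)" for j
    unfolding fdiff_def c_def by (simp add: algebra_simps)
  have "(\<Sum>i\<le>k. c i * ?F i) = (\<Sum>j\<in>{1..k}. c j * fdiff k (t + real j * v) f (x + real j * u))"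
    unfolding F D sum_distrib_left by (subst sum.swap) (simp add: mult_ac)
  moreover have "\<bar>\<Sum>j\<in>{1..k}. c j * fdiff k (t + real j * v) f (x + real j * u)\<bar> \<le> 2 ^ k * \<epsilon>"
    unfolding c_def by (rule weighted_sum_bound) (use assms in auto)
  moreover have "\<bar>\<Sum>i\<le>k. c i * (G i + ?F i)\<bar> \<le> 2 ^ k * \<delta>"
  proof -
    have "\<bar>\<Sum>i\<le>k. c i * (G i + ?F i)\<bar> \<le> (\<Sum>i\<le>k. real (k choose i) * \<delta>)"
      by (rule order_trans [OF sum_abs], rule sum_mono)
        (use g in \<open>simp add: c_def abs_mult power_abs mult_left_mono\<close>)
    also have "\<dots> = real (\<Sum>i\<le>k. k choose i) * \<delta>" by (simp add: sum_distrib_right)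
    finally show ?thesis by (simp add: choose_row_sum)
  qed
  moreover have "(\<Sum>i\<le>k. c i * (G i + ?F i)) = (\<Sum>i\<le>k. c i * G i) + (\<Sum>i\<le>k. c i * ?F i)"
    by (simp add: distrib_left sum.distrib)
  ultimately show ?thesis unfolding c_def [symmetric] by linarith
qed

lemma measurable_fdiff [measurable]:
  assumes [measurable]: "f \<in> borel_measurable borel" "u \<in> borel_measurable M" "v \<in> borel_measurable M"
  shows "(\<lambda>z. fdiff k (u z) f (v z)) \<in> borel_measurable M"
  unfolding fdiff_def by measurable

text \<open>Pairs \<open>(u, v)\<close> for which some difference at \<open>x + i u\<close> with
  step \<open>v\<close> is large have measure at most \<open>k \<tau>\<close>. Some
  \<open>s0\<close> therefore has small slices, and by \<open>grid_consistency\<close> its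
  prediction agrees with that of most other steps. It plays the part of a majority vote.\<close>

lemma good_step_exists:
  fixes \<sigma> \<tau> :: real
  assumes k: "1 \<le> k" and f [measurable]: "f \<in> borel_measurable borel" and e: "0 \<le> \<epsilon>" and s: "0 < \<sigma>" "0 < \<tau>"
    and T: "T = {z. A \<le> fst z \<and> 0 \<le> snd z \<and> fst z + real k * snd z \<le> B \<and> \<epsilon> < \<bar>fdiff k (snd z) f (fst z)\<bar>}"
    and mT: "emeasure plane T \<le> ennreal \<tau>"
    and x: "A \<le> x" "x + 2 * real k * \<sigma> \<le> B"
  shows "\<exists>s0\<in>{0..\<sigma>}. emeasure lborel {s\<in>{0..\<sigma>}. 2 ^ (k + 1) * \<epsilon> < \<bar>fdiff k s f x - fdiff k s0 f x\<bar>} \<le> ennreal (4 * real k * \<tau> / \<sigma>)"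
proof -
  have Tm [measurable]: "T \<in> sets plane" unfolding T by (rule sets_Collect_plane) measurable
  define B1 where "B1 = (\<Union>i\<in>{1..k}. {z. (x + real i * fst z, 0 + 1 * snd z) \<in> T})"
  have B1m [measurable]: "B1 \<in> sets plane" unfolding B1_def by (intro sets.finite_UN sets_Collect_plane) (simp, measurable)
  have "emeasure plane B1
      \<le> (\<Sum>i\<in>{1..k}. emeasure plane {z. (x + real i * fst z, 0 + 1 * snd z) \<in> T})"
    unfolding B1_def by (rule emeasure_subadditive_finite) (simp, intro image_subsetI sets_Collect_plane, measurable)
  also have "\<dots> \<le> (\<Sum>i\<in>{1..k}. ennreal \<tau>)"
    by (intro sum_mono order_trans [OF emeasure_affine2_le [OF Tm] mT]) auto
  also have "\<dots> = ennreal (real k * \<tau>)" using s by (simp add: ennreal_mult ennreal_of_nat_eq_real_of_nat)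
  finally have mB: "emeasure plane B1 \<le> ennreal (real k * \<tau>)" .
  \<comment> \<open>Both slices through \<open>s0\<close> matter: the comparison of \<open>s\<close>
    with \<open>s0\<close> uses differences with step \<open>s0\<close> at \<open>x + i s\<close>
    and with step \<open>s\<close> at \<open>x + i s0\<close>.\<close>
  define h where "h y = emeasure lborel (Pair y -` B1) + emeasure lborel ((\<lambda>x. (x, y)) -` B1)" for y
  have m1 [measurable]: "(\<lambda>y. emeasure lborel (Pair y -` B1)) \<in> borel_measurable borel"
    using lborel.measurable_emeasure_Pair [OF B1m] by simp
  have m2 [measurable]: "(\<lambda>y. emeasure lborel ((\<lambda>x. (x, y)) -` B1)) \<in> borel_measurable borel"
    using lborel_pair.measurable_emeasure_Pair2 [OF B1m] by simp
  \<comment> \<open>The mean of \<open>h\<close> is at most \<open>2 k \<tau> / \<sigma>\<close>;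
    doubling this gives a contradiction with non-strict inequalities.\<close>
  have "\<exists>s0\<in>{0..\<sigma>}. h s0 \<le> ennreal (4 * real k * \<tau> / \<sigma>)"
  proof (rule ccontr)
    assume "\<not> ?thesis"
    then have c: "ennreal (4 * real k * \<tau> / \<sigma>) \<le> h s0" if "s0 \<in> {0..\<sigma>}" for s0
      using that by (meson le_cases)
    have "ennreal (4 * real k * \<tau>) = (\<integral>\<^sup>+y. ennreal (4 * real k * \<tau> / \<sigma>) * indicator {0..\<sigma>} y \<partial>lborel)"
      using s by (simp add: nn_integral_cmult_indicator ennreal_mult [symmetric])
    also have "\<dots> \<le> (\<integral>\<^sup>+y. h y \<partial>lborel)"
      by (rule nn_integral_mono) (use c in \<open>auto simp: indicator_def\<close>)
    also have "\<dots> = emeasure plane B1 + emeasure plane B1"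
      unfolding h_def by (subst nn_integral_add)
        (simp_all add: lborel.emeasure_pair_measure_alt [OF B1m, symmetric] lborel_pair.emeasure_pair_measure_alt2 [OF B1m, symmetric])
    also have "\<dots> \<le> ennreal (real k * \<tau>) + ennreal (real k * \<tau>)" by (intro add_mono mB)
    also have "\<dots> = ennreal (2 * real k * \<tau>)" using s by (simp add: ennreal_plus [symmetric])
    finally have "4 * real k * \<tau> \<le> 2 * real k * \<tau>" using s by (simp add: ennreal_le_iff)
    then show False using k s by simp
  qed
  then obtain s0 where s0: "s0 \<in> {0..\<sigma>}" "h s0 \<le> ennreal (4 * real k * \<tau> / \<sigma>)" by blast
  have in_range: "x + real i * a + real k * b \<le> B \<and> A \<le> x + real i * a"
    if "i \<in> {1..k}" "a \<in> {0..\<sigma>}" "b \<in> {0..\<sigma>}" for i a b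
  proof -
    have "real i * a \<le> real k * \<sigma>" "real k * b \<le> real k * \<sigma>" "0 \<le> real i * a"
      using that by (auto intro!: mult_mono)
    then show ?thesis using x by simp
  qed
  have sub: "{s\<in>{0..\<sigma>}. 2 ^ (k + 1) * \<epsilon> < \<bar>fdiff k s f x - fdiff k s0 f x\<bar>} \<subseteq> Pair s0 -` B1 \<union> (\<lambda>x. (x, s0)) -` B1"
  proof (rule subsetI, rule ccontr)
    fix s assume s: "s \<in> {s\<in>{0..\<sigma>}. 2 ^ (k + 1) * \<epsilon> < \<bar>fdiff k s f x - fdiff k s0 f x\<bar>}"
      and n: "s \<notin> Pair s0 -` B1 \<union> (\<lambda>x. (x, s0)) -` B1"
    have sI: "s \<in> {0..\<sigma>}" using s by simp
    have "\<bar>fdiff k s f x - fdiff k s0 f x\<bar> \<le> 2 ^ (k + 1) * \<epsilon>"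
    proof (rule grid_consistency [OF _ _ e])
      fix i assume i: "i \<in> {1..k}"
      have "(x + real i * s, s0) \<notin> T" using n i by (auto simp: B1_def)
      then show "\<bar>fdiff k s0 f (x + real i * s)\<bar> \<le> \<epsilon>"
        using in_range [OF i sI s0(1)] s0(1) unfolding T by auto
      have "(x + real i * s0, s) \<notin> T" using n i by (auto simp: B1_def)
      then show "\<bar>fdiff k s f (x + real i * s0)\<bar> \<le> \<epsilon>"
        using in_range [OF i s0(1) sI] sI unfolding T by auto
    qed
    then show False using s by simp
  qed
  have slices: "Pair s0 -` B1 \<in> sets lborel" "(\<lambda>x. (x, s0)) -` B1 \<in> sets lborel"
    by (rule sets_Pair1 [OF B1m], rule sets_Pair2 [OF B1m])
  have "emeasure lborel {s\<in>{0..\<sigma>}. 2 ^ (k + 1) * \<epsilon> < \<bar>fdiff k s f x - fdiff k s0 f x\<bar>} \<le> emeasure lborel (Pair s0 -` B1 \<union> (\<lambda>x. (x, s0)) -` B1)"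
    by (rule emeasure_mono [OF sub sets.Un [OF slices]])
  also have "\<dots> \<le> h s0" unfolding h_def by (rule emeasure_subadditive [OF slices])
  also note s0(2)
  finally show ?thesis using s0(1) by blast
qed

text \<open>A union bound in the square of side \<open>s1\<close>. Each \<open>N i\<close> costs at
  most \<open>s1 \<kappa>\<close>, since for fixed \<open>v\<close> its slice is a translate, and
  each of the \<open>k\<close> transported copies of \<open>T\<close> costs at most
  \<open>\<tau>\<close>.\<close>

lemma good_pair_exists:
  fixes N :: "nat \<Rightarrow> real set" and T :: "(real \<times> real) set"
  assumes [measurable]: "\<And>i. i \<le> k \<Longrightarrow> N i \<in> sets borel" and T [measurable]: "T \<in> sets plane"
    and mN: "\<And>i. i \<le> k \<Longrightarrow> emeasure lborel (N i) \<le> ennreal \<kappa>" and mT: "emeasure plane T \<le> ennreal \<tau>"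
    and s1: "0 < s1" and pos: "0 \<le> \<kappa>" "0 \<le> \<tau>" and small: "real (k + 1) * (s1 * \<kappa>) + real k * \<tau> < s1 * s1"
  shows "\<exists>u\<in>{0..s1}. \<exists>v\<in>{0..s1}. (\<forall>i\<le>k. u + real i * v \<notin> N i) \<and> (\<forall>j\<in>{1..k}. (x + real j * u, t + real j * v) \<notin> T)"
proof (rule ccontr)
  assume neg: "\<not> ?thesis"
  define U where "U i = {z. snd z \<in> {0..s1} \<and> fst z + real i * snd z \<in> N i}" for i
  define V where "V j = {z. (x + real j * fst z, t + real j * snd z) \<in> T}" for j :: nat
  have Um [measurable]: "U i \<in> sets plane" if "i \<le> k" for i
  proof -
    have [measurable]: "N i \<in> sets borel" using that assms(1) by blast
    show ?thesis unfolding U_def by (rule sets_Collect_plane) measurable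
  qed
  have Vm [measurable]: "V j \<in> sets plane" for j unfolding V_def by (rule sets_Collect_plane) measurable
  have sub: "{0..s1} \<times> {0..s1} \<subseteq> (\<Union>i\<in>{..k}. U i) \<union> (\<Union>j\<in>{1..k}. V j)"
  proof
    fix z assume "z \<in> {0..s1} \<times> {0..s1}"
    then obtain u v where z: "z = (u, v)" "u \<in> {0..s1}" "v \<in> {0..s1}" by auto
    then have "(\<exists>i\<le>k. u + real i * v \<in> N i) \<or> (\<exists>j\<in>{1..k}. (x + real j * u, t + real j * v) \<in> T)"
      using neg by blast
    then show "z \<in> (\<Union>i\<in>{..k}. U i) \<union> (\<Union>j\<in>{1..k}. V j)"
      using z unfolding U_def V_def by auto
  qed
  have mU: "emeasure plane (U i) \<le> ennreal (s1 * \<kappa>)" if i: "i \<le> k" for i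
  proof -
    have [measurable]: "N i \<in> sets borel" using that assms(1) by blast
    have "emeasure plane (U i) = (\<integral>\<^sup>+v. emeasure lborel ((\<lambda>u. (u, v)) -` U i) \<partial>lborel)"
      by (rule lborel_pair.emeasure_pair_measure_alt2 [OF Um [OF i]])
    also have "\<dots> \<le> (\<integral>\<^sup>+v. ennreal \<kappa> * indicator {0..s1} v \<partial>lborel)"
    proof (rule nn_integral_mono)
      fix v :: real
      show "emeasure lborel ((\<lambda>u. (u, v)) -` U i) \<le> ennreal \<kappa> * indicator {0..s1} v"
      proof (cases "v \<in> {0..s1}")
        case True
        have "(\<lambda>u. (u, v)) -` U i = {u. real i * v + 1 * u \<in> N i}"
          using True by (auto simp: U_def add.commute)
        then show ?thesis using emeasure_affine_le [of "N i" 1 "real i * v"] mN [OF i] True by simp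
      qed (auto simp: U_def)
    qed
    also have "\<dots> = ennreal (s1 * \<kappa>)"
      using s1 pos by (simp add: nn_integral_cmult_indicator ennreal_mult [symmetric] mult.commute)
    finally show ?thesis .
  qed
  have mV: "emeasure plane (V j) \<le> ennreal \<tau>" if "j \<in> {1..k}" for j
    unfolding V_def using that by (intro order_trans [OF emeasure_affine2_le [OF T] mT]) auto
  have Us: "(\<Union>i\<in>{..k}. U i) \<in> sets plane" by (intro sets.finite_UN Um) auto
  have Vs: "(\<Union>j\<in>{1..k}. V j) \<in> sets plane" by (intro sets.finite_UN Vm) auto
  have "ennreal (s1 * s1) = emeasure plane ({0..s1} \<times> {0..s1})"
    using s1 by (subst lborel.emeasure_pair_measure_Times) (auto simp: ennreal_mult)
  also have "\<dots> \<le> emeasure plane ((\<Union>i\<in>{..k}. U i) \<union> (\<Union>j\<in>{1..k}. V j))"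
    by (rule emeasure_mono [OF sub sets.Un [OF Us Vs]])
  also have "\<dots> \<le> emeasure plane (\<Union>i\<in>{..k}. U i) + emeasure plane (\<Union>j\<in>{1..k}. V j)"
    by (rule emeasure_subadditive [OF Us Vs])
  also have "\<dots> \<le> (\<Sum>i\<in>{..k}. emeasure plane (U i)) + (\<Sum>j\<in>{1..k}. emeasure plane (V j))"
    by (intro add_mono emeasure_subadditive_finite image_subsetI Um Vm) auto
  also have "\<dots> \<le> (\<Sum>i\<in>{..k}. ennreal (s1 * \<kappa>)) + (\<Sum>j\<in>{1..k}. ennreal \<tau>)"
    by (intro add_mono sum_mono mU mV) auto
  also have "\<dots> = ennreal (real (k + 1) * (s1 * \<kappa>) + real k * \<tau>)"
    using s1 pos by (simp add: ennreal_mult [symmetric] ennreal_of_nat_eq_real_of_nat ennreal_plus [symmetric] del: ennreal_plus)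
  finally have "s1 * s1 \<le> real (k + 1) * (s1 * \<kappa>) + real k * \<tau>"
    using s1 pos by (subst (asm) ennreal_le_iff) auto
  then show False using small by simp
qed

text \<open>This is purely qualitative. It will give the corrected function some bound, as Whitney's
  inequality asks, and \<open>L\<close> enters no constant.\<close>

lemma bounded_off_small_set:
  fixes f :: "real \<Rightarrow> real"
  assumes [measurable]: "f \<in> borel_measurable borel" and "0 < (\<tau>::real)"
  shows "\<exists>L\<ge>0. emeasure lborel {y\<in>{a..b}. L < \<bar>f y\<bar>} \<le> ennreal \<tau>"
proof -
  let ?A = "\<lambda>n. {y\<in>{a..b}. real n < \<bar>f y\<bar>}"
  have "(\<lambda>n. emeasure lborel (?A n)) \<longlonglongrightarrow> emeasure lborel (\<Inter>n. ?A n)"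
  proof (rule Lim_emeasure_decseq)
    show "range ?A \<subseteq> sets lborel" by auto
    show "decseq ?A" by (auto simp: decseq_def intro: order_le_less_trans [OF of_nat_mono])
    fix n
    have "emeasure lborel (?A n) \<le> emeasure lborel {a..b}" by (rule emeasure_mono) auto
    also have "\<dots> < \<infinity>" using emeasure_lborel_Icc_eq [of a b] by simp
    finally show "emeasure lborel (?A n) \<noteq> \<infinity>" by simp
  qed
  moreover have "(\<Inter>n. ?A n) = {}"
  proof -
    have "\<exists>n. \<not> real n < \<bar>f y\<bar>" for y using reals_Archimedean2 [of "\<bar>f y\<bar>"] by (meson less_le_not_le not_less)
    then show ?thesis by blast
  qed
  ultimately have "(\<lambda>n. emeasure lborel (?A n)) \<longlonglongrightarrow> 0" by simp
  then have "\<forall>\<^sub>F n in sequentially. emeasure lborel (?A n) < ennreal \<tau>"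
    using assms(2) by (intro order_tendstoD) auto
  then obtain n where "emeasure lborel (?A n) < ennreal \<tau>" by (meson eventually_sequentially order_refl)
  then show ?thesis by (intro exI [of _ "real n"]) (auto intro: less_imp_le)
qed

text \<open>No bound on \<open>f x\<close> alone can hold at every \<open>x\<close>, because
  \<open>f\<close> may be changed at a single point. Such a change reappears in the differences that
  start at \<open>x\<close>. Hence the error is allowed to contain \<open>fdiff k s f x\<close>, for
  at least half of the steps \<open>s\<close>; integration over \<open>s\<close> disposes of it
  later. Predictions use points to the right of \<open>x\<close>, so the hypothesis reaches
  \<open>\<eta>\<close> beyond \<open>B\<close>.\<close>

lemma local_whitney_in_measure:
  fixes A B \<eta> :: real
  assumes k: "1 \<le> k" and AB: "A < B" and eta: "0 < \<eta>"
  shows "\<exists>\<tau>>0. \<exists>C>0. \<exists>\<sigma>>0. 2 * real k * \<sigma> \<le> \<eta> \<and> (\<forall>f\<in>borel_measurable borel. \<forall>\<epsilon>\<ge>0.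
    emeasure plane {z. A \<le> fst z \<and> 0 \<le> snd z \<and> fst z + real k * snd z \<le> B + \<eta> \<and>
        \<epsilon> < \<bar>fdiff k (snd z) f (fst z)\<bar>} \<le> ennreal \<tau> \<longrightarrow>
    (\<exists>q. degree q < k \<and> (\<forall>x\<in>{A..B}.
       emeasure lborel {s\<in>{0..\<sigma>}. \<bar>fdiff k s f x\<bar> + C * \<epsilon> < \<bar>f x - poly q x\<bar>} \<le> ennreal (\<sigma> / 2))))"
proof -
  obtain W where W: "W > 0" and Wh: "\<And>g \<epsilon>. 0 \<le> \<epsilon> \<Longrightarrow> (\<exists>L. \<forall>x\<in>{A..B}. \<bar>g x\<bar> \<le> L) \<Longrightarrow>
    (\<forall>x t. A \<le> x \<longrightarrow> 0 \<le> t \<longrightarrow> x + real k * t \<le> B \<longrightarrow> \<bar>fdiff k t g x\<bar> \<le> \<epsilon>) \<Longrightarrow>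
    (\<exists>q. degree q < k \<and> (\<forall>x\<in>{A..B}. \<bar>g x - poly q x\<bar> \<le> W * \<epsilon>))"
    using whitney_interval [OF k AB] by blast
  \<comment> \<open>The choice of \<open>\<sigma>\<close> keeps all grid points within
    \<open>B + \<eta>\<close>, and \<open>(k + 1) s1 = \<sigma>\<close> keeps the steps
    \<open>u + i v\<close> within \<open>[0, \<sigma>]\<close>. The factor 10 makes the forbidden
    part of the square of side \<open>s1\<close> at most half of it, and
    \<open>\<kappa> <= \<sigma> / 2\<close>.\<close>
  define \<sigma> where "\<sigma> = \<eta> / (2 * real k)"
  define s1 where "s1 = \<sigma> / (real k + 1)"
  define \<tau> where "\<tau> = s1 * s1 / (10 * real k)"
  define \<kappa> where "\<kappa> = 4 * real k * \<tau> / \<sigma>"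
  define D where "D = (2 ^ k * 2 ^ (k + 1) + 2 ^ k :: real)"
  define C where "C = 2 ^ (k + 1) + W * D"
  have kr: "1 \<le> real k" using k by simp
  have sg: "0 < \<sigma>" using eta kr by (simp add: \<sigma>_def)
  have s1: "0 < s1" using sg by (simp add: s1_def)
  have t0: "0 < \<tau>" using s1 kr by (simp add: \<tau>_def)
  have kap: "0 < \<kappa>" using t0 sg kr by (simp add: \<kappa>_def)
  have s1s: "(real k + 1) * s1 = \<sigma>" by (simp add: s1_def)
  have ks: "2 * real k * \<sigma> = \<eta>" using kr by (simp add: \<sigma>_def)
  have ks1: "real k * \<sigma> \<le> \<eta>" using ks eta by (simp add: mult.assoc)
  have k10: "10 * real k * \<tau> = s1 * s1" using kr by (simp add: \<tau>_def)
  have small1: "real (k + 1) * (s1 * \<kappa>) + real k * \<tau> < s1 * s1"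
  proof -
    have "real (k + 1) * (s1 * \<kappa>) = ((real k + 1) * s1) * \<kappa>" by (simp add: algebra_simps)
    also have "\<dots> = 4 * real k * \<tau>" unfolding s1s \<kappa>_def using sg by simp
    finally have "real (k + 1) * (s1 * \<kappa>) + real k * \<tau> = 5 * (real k * \<tau>)" by simp
    also have "\<dots> < 10 * (real k * \<tau>)" using t0 kr by simp
    finally show ?thesis using k10 by linarith
  qed
  have kap2: "\<kappa> \<le> \<sigma> / 2"
  proof -
    have "s1 \<le> \<sigma>" using s1s s1 kr mult_right_mono [of 1 "real k + 1" s1] by simp
    then have "s1 * s1 \<le> \<sigma> * \<sigma>" using s1 by (intro mult_mono) auto
    moreover have "0 \<le> \<sigma> * \<sigma>" by simp
    ultimately have "8 * real k * \<tau> \<le> \<sigma> * \<sigma>" using k10 by linarith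
    then show ?thesis unfolding \<kappa>_def using sg by (simp add: field_simps)
  qed
  have D0: "0 < D" unfolding D_def by (intro add_pos_pos mult_pos_pos) auto
  have C0: "0 < C" using W D0 unfolding C_def by (intro add_pos_pos mult_pos_pos) auto
  show ?thesis
  proof (rule exI [of _ \<tau>], rule conjI [OF t0], rule exI [of _ C], rule conjI [OF C0],
      rule exI [of _ \<sigma>], rule conjI [OF sg], intro conjI ballI allI impI)
    show "2 * real k * \<sigma> \<le> \<eta>" using ks by simp
    fix f :: "real \<Rightarrow> real" and \<epsilon> :: real
    assume f [measurable]: "f \<in> borel_measurable borel" and e: "0 \<le> \<epsilon>"
    define T where "T = {z. A \<le> fst z \<and> 0 \<le> snd z \<and> fst z + real k * snd z \<le> B + \<eta> \<and> \<epsilon> < \<bar>fdiff k (snd z) f (fst z)\<bar>}"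
    assume "emeasure plane {z. A \<le> fst z \<and> 0 \<le> snd z \<and> fst z + real k * snd z \<le> B + \<eta> \<and>
        \<epsilon> < \<bar>fdiff k (snd z) f (fst z)\<bar>} \<le> ennreal \<tau>"
    then have mT: "emeasure plane T \<le> ennreal \<tau>" by (simp add: T_def)
    have Tm [measurable]: "T \<in> sets plane" unfolding T_def by (rule sets_Collect_plane) measurable
    define Q where "Q x s0 \<longleftrightarrow> s0 \<in> {0..\<sigma>} \<and>
      emeasure lborel {s\<in>{0..\<sigma>}. 2 ^ (k + 1) * \<epsilon> < \<bar>fdiff k s f x - fdiff k s0 f x\<bar>} \<le> ennreal \<kappa>" for x s0
    have "\<forall>x\<in>{A..B}. \<exists>s0. Q x s0"
      using good_step_exists [OF k f e sg t0 T_def mT] ks unfolding \<kappa>_def Q_def by force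
    from bchoice [OF this] obtain S where S: "\<And>x. x \<in> {A..B} \<Longrightarrow> Q x (S x)" by blast
    have mS: "emeasure lborel {s\<in>{0..\<sigma>}. 2 ^ (k + 1) * \<epsilon> < \<bar>fdiff k s f x - fdiff k (S x) f x\<bar>} \<le> ennreal \<kappa>"
      if "x \<in> {A..B}" for x
      using S [OF that] unfolding Q_def by blast
    \<comment> \<open>The corrected function: at each \<open>x\<close> the value predicted by the
      chosen good step. \<open>S\<close> is an arbitrary choice, so \<open>g\<close> may fail to be
      measurable.\<close>
    define g where "g x = f x - fdiff k (S x) f x" for x
    define N where "N x = {s\<in>{0..\<sigma>}. 2 ^ (k + 1) * \<epsilon> < \<bar>g x + (fdiff k s f x - f x)\<bar>}" for x
    have Nm [measurable]: "N x \<in> sets borel" for x unfolding N_def by measurable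
    have mN: "emeasure lborel (N x) \<le> ennreal \<kappa>" if "x \<in> {A..B}" for x
      using mS [OF that] unfolding N_def g_def by (simp add: algebra_simps)
    have "\<exists>L. \<forall>x\<in>{A..B}. \<bar>g x\<bar> \<le> L"
    proof -
      define \<tau>' where "\<tau>' = \<sigma> / (4 * real k)"
      have t': "0 < \<tau>'" using sg kr by (simp add: \<tau>'_def)
      obtain L where L: "0 \<le> L" "emeasure lborel {y\<in>{A..B + \<eta>}. L < \<bar>f y\<bar>} \<le> ennreal \<tau>'"
        using bounded_off_small_set [OF f t'] by blast
      let ?Y = "{y\<in>{A..B + \<eta>}. L < \<bar>f y\<bar>}"
      have Ym [measurable]: "?Y \<in> sets borel" by measurable
      have "\<bar>g x\<bar> \<le> 2 ^ k * L + 2 ^ (k + 1) * \<epsilon>" if x: "x \<in> {A..B}" for x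
      proof -
        let ?Z = "\<lambda>i. {s. x + real i * s \<in> ?Y}"
        have Zm: "?Z i \<in> sets borel" for i by measurable
        \<comment> \<open>Steps with an untypical prediction fill at most
          \<open>\<sigma> / 2\<close>, and steps that meet a large value of \<open>f\<close> at one
          of the \<open>k\<close> points at most \<open>\<sigma> / 4\<close>. Any remaining step
          bounds \<open>g x\<close>.\<close>
        have "\<not> {0..\<sigma>} \<subseteq> N x \<union> (\<Union>i\<in>{1..k}. ?Z i)"
        proof
          assume sub: "{0..\<sigma>} \<subseteq> N x \<union> (\<Union>i\<in>{1..k}. ?Z i)"
          have "ennreal \<sigma> = emeasure lborel {0..\<sigma>}" using sg by simp
          also have "\<dots> \<le> emeasure lborel (N x \<union> (\<Union>i\<in>{1..k}. ?Z i))"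
            using Zm by (intro emeasure_mono [OF sub]) auto
          also have "\<dots> \<le> emeasure lborel (N x) + emeasure lborel (\<Union>i\<in>{1..k}. ?Z i)"
            using Zm by (intro emeasure_subadditive) auto
          also have "\<dots> \<le> emeasure lborel (N x) + (\<Sum>i\<in>{1..k}. emeasure lborel (?Z i))"
            using Zm by (intro add_left_mono emeasure_subadditive_finite) auto
          also have "\<dots> \<le> ennreal \<kappa> + (\<Sum>i\<in>{1..k}. ennreal \<tau>')"
            by (intro add_mono sum_mono mN x order_trans [OF emeasure_affine_le [OF Ym] L(2)]) auto
          also have "\<dots> = ennreal (\<kappa> + real k * \<tau>')"
            using kap t' by (simp add: ennreal_mult [symmetric] ennreal_of_nat_eq_real_of_nat ennreal_plus [symmetric] del: ennreal_plus)
          finally have "\<sigma> \<le> \<kappa> + real k * \<tau>'" using kap t' by (subst (asm) ennreal_le_iff) auto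
          moreover have "real k * \<tau>' = \<sigma> / 4" using kr by (simp add: \<tau>'_def)
          ultimately show False using kap2 sg by linarith
        qed
        then obtain s where s: "s \<in> {0..\<sigma>}" "s \<notin> N x" "\<And>i. i \<in> {1..k} \<Longrightarrow> x + real i * s \<notin> ?Y" by blast
        have "\<bar>\<Sum>i\<in>{1..k}. (-1) ^ i * real (k choose i) * f (x + real i * s)\<bar> \<le> 2 ^ k * L"
        proof (rule weighted_sum_bound [OF _ L(1)])
          fix i assume i: "i \<in> {1..k}"
          have "real i * s \<le> real k * \<sigma>" "0 \<le> real i * s" using i s(1) by (auto intro!: mult_mono)
          moreover note ks1
          ultimately have "x + real i * s \<in> {A..B + \<eta>}" using x by auto
          then show "\<bar>f (x + real i * s)\<bar> \<le> L" using s(3) [OF i] by auto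
        qed
        then have "\<bar>fdiff k s f x - f x\<bar> \<le> 2 ^ k * L" unfolding fdiff_split by simp
        moreover have "\<bar>g x + (fdiff k s f x - f x)\<bar> \<le> 2 ^ (k + 1) * \<epsilon>" using s(1,2) unfolding N_def by auto
        ultimately show ?thesis by linarith
      qed
      then show ?thesis by blast
    qed
    moreover have "\<bar>fdiff k t g x\<bar> \<le> D * \<epsilon>" if x: "A \<le> x" and t: "0 \<le> t" and xt: "x + real k * t \<le> B" for x t
    proof -
      have xi: "x + real i * t \<in> {A..B}" if "i \<le> k" for i
      proof -
        have "real i * t \<le> real k * t" "0 \<le> real i * t" using that t by (auto intro!: mult_right_mono)
        then show ?thesis using x xt by auto
      qed
      \<comment> \<open>One pair \<open>(u, v)\<close> serves all \<open>k + 1\<close> points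
        \<open>x + i t\<close> at once: each \<open>u + i v\<close> predicts \<open>g\<close> there,
        and all differences of \<open>f\<close> on the resulting grid with \<open>j >= 1\<close> are
        small.\<close>
      obtain u v where uv: "u \<in> {0..s1}" "v \<in> {0..s1}" and 1: "\<And>i. i \<le> k \<Longrightarrow> u + real i * v \<notin> N (x + real i * t)"
        and 2: "\<And>j. j \<in> {1..k} \<Longrightarrow> (x + real j * u, t + real j * v) \<notin> T"
        using good_pair_exists [of k "\<lambda>i. N (x + real i * t)" T \<kappa> \<tau> s1 x t, OF Nm Tm mN [OF xi] mT s1 less_imp_le [OF kap] less_imp_le [OF t0] small1]
        by blast
      have jb: "real j * u \<le> real k * s1" "real j * v \<le> real k * s1" "0 \<le> real j * u" "0 \<le> real j * v"
        if "j \<le> k" for j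
        using that uv by (auto intro!: mult_mono)
      have "\<bar>\<Sum>i\<le>k. (-1) ^ i * real (k choose i) * g (x + real i * t)\<bar> \<le> 2 ^ k * (2 ^ (k + 1) * \<epsilon>) + 2 ^ k * \<epsilon>"
      proof (rule corrected_difference [where u = u and v = v and f = f])
        fix i assume i: "i \<le> k"
        have "u + real i * v \<le> s1 + real k * s1" using uv jb [OF i] by simp
        also have "\<dots> = \<sigma>" using s1s by (simp add: algebra_simps)
        finally have "u + real i * v \<in> {0..\<sigma>}" using uv jb [OF i] by simp
        then show "\<bar>g (x + real i * t) + (fdiff k (u + real i * v) f (x + real i * t) - f (x + real i * t))\<bar> \<le> 2 ^ (k + 1) * \<epsilon>"
          using 1 [OF i] unfolding N_def by auto
      next
        fix j assume j: "j \<in> {1..k}"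
        then have jk: "j \<le> k" by simp
        have "x + real j * u + real k * (t + real j * v) = (x + real k * t) + real j * u + real k * (real j * v)"
          by (simp add: algebra_simps)
        also have "\<dots> \<le> B + real k * s1 + real k * (real k * s1)"
          using jb [OF jk] xt by (intro add_mono mult_left_mono) auto
        also have "\<dots> = B + real k * ((real k + 1) * s1)" by (simp add: algebra_simps)
        also have "\<dots> = B + real k * \<sigma>" unfolding s1s ..
        also have "\<dots> \<le> B + \<eta>" using ks1 by simp
        finally show "\<bar>fdiff k (t + real j * v) f (x + real j * u)\<bar> \<le> \<epsilon>"
          using 2 [OF j] jb [OF jk] x t unfolding T_def by auto
      qed (use e in auto)
      then show ?thesis unfolding fdiff_def D_def by (simp add: algebra_simps)
    qed
    ultimately obtain q where q: "degree q < k" "\<forall>x\<in>{A..B}. \<bar>g x - poly q x\<bar> \<le> W * (D * \<epsilon>)"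
      using Wh [of "D * \<epsilon>" g] e D0 by auto
    have "emeasure lborel {s\<in>{0..\<sigma>}. \<bar>fdiff k s f x\<bar> + C * \<epsilon> < \<bar>f x - poly q x\<bar>} \<le> ennreal (\<sigma> / 2)" if x: "x \<in> {A..B}" for x
    proof -
      have "{s\<in>{0..\<sigma>}. \<bar>fdiff k s f x\<bar> + C * \<epsilon> < \<bar>f x - poly q x\<bar>} \<subseteq> N x"
      proof
        fix s assume s: "s \<in> {s\<in>{0..\<sigma>}. \<bar>fdiff k s f x\<bar> + C * \<epsilon> < \<bar>f x - poly q x\<bar>}"
        have "\<bar>g x - poly q x\<bar> \<le> W * (D * \<epsilon>)" using q x by blast
        moreover have "C * \<epsilon> = 2 ^ (k + 1) * \<epsilon> + W * (D * \<epsilon>)" by (simp add: C_def algebra_simps)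
        moreover have "\<bar>fdiff k s f x\<bar> + C * \<epsilon> < \<bar>f x - poly q x\<bar>" using s by simp
        ultimately have "2 ^ (k + 1) * \<epsilon> < \<bar>g x + (fdiff k s f x - f x)\<bar>" by linarith
        then show "s \<in> N x" using s by (simp add: N_def)
      qed
      then have "emeasure lborel {s\<in>{0..\<sigma>}. \<bar>fdiff k s f x\<bar> + C * \<epsilon> < \<bar>f x - poly q x\<bar>} \<le> emeasure lborel (N x)"
        by (rule emeasure_mono) simp
      also have "\<dots> \<le> ennreal \<kappa>" by (rule mN [OF x])
      also have "\<dots> \<le> ennreal (\<sigma> / 2)" using kap2 by (rule ennreal_leI)
      finally show ?thesis .
    qed
    then show "\<exists>q. degree q < k \<and> (\<forall>x\<in>{A..B}.
       emeasure lborel {s\<in>{0..\<sigma>}. \<bar>fdiff k s f x\<bar> + C * \<epsilon> < \<bar>f x - poly q x\<bar>} \<le> ennreal (\<sigma> / 2))"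
      using q(1) by blast
  qed
qed

section \<open>Local weighted approximation\<close>

text \<open>The sum is at most the number of terms times the largest one. This crude constant treats
  \<open>P < 1\<close> and \<open>P >= 1\<close> alike.\<close>

lemma powr_sum_le:
  fixes x :: "'a \<Rightarrow> real"
  assumes "finite A" and x: "\<And>i. i \<in> A \<Longrightarrow> 0 \<le> x i" and P: "0 < P"
  shows "(\<Sum>i\<in>A. x i) powr P \<le> real (card A) powr P * (\<Sum>i\<in>A. x i powr P)"
proof (cases "A = {}")
  case False
  define M where "M = Max (x ` A)"
  have M: "x i \<le> M" if "i \<in> A" for i using that assms(1) by (simp add: M_def)
  obtain j where j: "j \<in> A" "M = x j"
    using Max_in [of "x ` A"] assms(1) False unfolding M_def by blast
  have "(\<Sum>i\<in>A. x i) \<le> real (card A) * M" using sum_bounded_above [of A x M] M by simp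
  then have "(\<Sum>i\<in>A. x i) powr P \<le> (real (card A) * M) powr P"
    using x P by (intro powr_mono2 sum_nonneg) auto
  also have "\<dots> = real (card A) powr P * x j powr P" using x j by (simp add: powr_mult)
  also have "\<dots> \<le> real (card A) powr P * (\<Sum>i\<in>A. x i powr P)"
    using j assms(1) by (intro mult_left_mono member_le_sum) auto
  finally show ?thesis .
qed (use P in simp)

lemma powr_add_le:
  fixes x y P :: real
  assumes "0 \<le> x" "0 \<le> y" "0 < P"
  shows "(x + y) powr P \<le> 2 powr P * (x powr P + y powr P)"
  using powr_sum_le [of "{True, False}" "\<lambda>b. if b then x else y" P] assms by simp

text \<open>The strict inequality in the level set keeps the bound true for \<open>e = 0\<close>:
  the level is then 0, and the set where \<open>u\<close> is positive is null.\<close>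

lemma nn_integral_Markov_strict:
  assumes [measurable]: "u \<in> borel_measurable M" and u: "\<And>x. 0 \<le> u x"
    and le: "(\<integral>\<^sup>+x. ennreal (u x) \<partial>M) \<le> ennreal e" and e: "0 \<le> e" and t: "0 < \<tau>"
  shows "emeasure M {x\<in>space M. e / \<tau> < u x} \<le> ennreal \<tau>"
proof (cases "e = 0")
  case True
  then have "(\<integral>\<^sup>+x. ennreal (u x) \<partial>M) = 0" using le by simp
  then have "AE x in M. ennreal (u x) = 0" by (subst (asm) nn_integral_0_iff_AE) auto
  then have "AE x in M. \<not> 0 < u x" by (rule AE_mp) (auto simp: ennreal_eq_0_iff)
  then have "emeasure M {x\<in>space M. 0 < u x} = 0"
    by (subst (asm) AE_iff_measurable [OF _ refl]) auto
  then show ?thesis using True by simp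
next
  case False
  then have e: "0 < e" using e by simp
  let ?T = "{x\<in>space M. e / \<tau> < u x}"
  have "ennreal (e / \<tau>) * emeasure M ?T = (\<integral>\<^sup>+x. ennreal (e / \<tau>) * indicator ?T x \<partial>M)"
    by (subst nn_integral_cmult_indicator) auto
  also have "\<dots> \<le> (\<integral>\<^sup>+x. ennreal (u x) \<partial>M)"
    by (rule nn_integral_mono) (auto simp: indicator_def intro!: ennreal_leI)
  also note le
  also have "ennreal e = ennreal (e / \<tau>) * ennreal \<tau>"
    using e t by (simp add: ennreal_mult [symmetric])
  finally show ?thesis using e t by (subst (asm) ennreal_mult_le_mult_iff) auto
qed

lemma nn_integral_affine_le:
  fixes u :: "real \<Rightarrow> ennreal"
  assumes [measurable]: "u \<in> borel_measurable borel" and c: "1 \<le> c"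
  shows "(\<integral>\<^sup>+s. u (t + c * s) \<partial>lborel) \<le> (\<integral>\<^sup>+x. u x \<partial>lborel)"
proof -
  have "(\<integral>\<^sup>+s. u (t + c * s) \<partial>lborel) = 1 * (\<integral>\<^sup>+s. u (t + c * s) \<partial>lborel)" by simp
  also have "\<dots> \<le> ennreal \<bar>c\<bar> * (\<integral>\<^sup>+s. u (t + c * s) \<partial>lborel)"
    using c by (intro mult_right_mono) auto
  also have "\<dots> = (\<integral>\<^sup>+x. u x \<partial>lborel)"
    using c by (intro nn_integral_real_affine [symmetric]) auto
  finally show ?thesis .
qed

text \<open>The difference annihilates \<open>q\<close>, so the error at \<open>t\<close> is
  recovered from one difference of \<open>f\<close> and the errors at the inner points
  \<open>t + i s\<close>. There are \<open>k + 1\<close> terms with binomial coefficients at most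
  \<open>2^k\<close>.\<close>

lemma extension_bound:
  fixes P t s :: real
  assumes q: "degree q < k" and P: "0 < P"
  shows "\<bar>f t - poly q t\<bar> powr P \<le> (real k + 1) powr P * 2 powr (real k * P) *
    (\<bar>fdiff k s f t\<bar> powr P + (\<Sum>i\<in>{1..k}. \<bar>f (t + real i * s) - poly q (t + real i * s)\<bar> powr P))"
proof -
  let ?g = "\<lambda>x. f x - poly q x"
  have fd: "fdiff k s ?g t = fdiff k s f t" unfolding fdiff_diff using fdiff_poly [OF q] by simp
  define x where "x i = (if i = 0 then \<bar>fdiff k s f t\<bar> else real (k choose i) * \<bar>?g (t + real i * s)\<bar>)" for i
  have x0: "0 \<le> x i" for i by (simp add: x_def)
  have "\<bar>?g t\<bar> \<le> \<bar>fdiff k s f t\<bar> + \<bar>\<Sum>i\<in>{1..k}. (-1) ^ i * real (k choose i) * ?g (t + real i * s)\<bar>"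
    using fdiff_split [of k s ?g t] fd by linarith
  also have "\<bar>\<Sum>i\<in>{1..k}. (-1) ^ i * real (k choose i) * ?g (t + real i * s)\<bar> \<le> (\<Sum>i\<in>{1..k}. x i)"
    by (rule order_trans [OF sum_abs], rule sum_mono) (simp add: x_def abs_mult power_abs)
  also have "\<bar>fdiff k s f t\<bar> + (\<Sum>i\<in>{1..k}. x i) = (\<Sum>i\<in>{0..k}. x i)"
    by (subst sum.atLeast_Suc_atMost) (auto simp: x_def)
  finally have "\<bar>?g t\<bar> powr P \<le> (\<Sum>i\<in>{0..k}. x i) powr P" using P by (intro powr_mono2) auto
  also have "\<dots> \<le> (real k + 1) powr P * (\<Sum>i\<in>{0..k}. x i powr P)"
    using powr_sum_le [of "{0..k}" x P] x0 P by (simp add: add.commute)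
  also have "(\<Sum>i\<in>{0..k}. x i powr P) \<le> 2 powr (real k * P) *
    (\<bar>fdiff k s f t\<bar> powr P + (\<Sum>i\<in>{1..k}. \<bar>?g (t + real i * s)\<bar> powr P))"
  proof -
    have "x i powr P \<le> 2 powr (real k * P) * \<bar>?g (t + real i * s)\<bar> powr P" if i: "i \<in> {1..k}" for i
    proof -
      have "real (k choose i) \<le> real (2 ^ k)" by (simp only: of_nat_le_iff binomial_le_pow2)
      then have "real (k choose i) powr P \<le> (2 ^ k) powr P" using P by (intro powr_mono2) auto
      also have "\<dots> = 2 powr (real k * P)" by (simp add: powr_realpow [symmetric] powr_powr)
      finally show ?thesis using i by (auto simp: x_def powr_mult intro: mult_right_mono)
    qed
    then have "(\<Sum>i\<in>{1..k}. x i powr P) \<le> 2 powr (real k * P) * (\<Sum>i\<in>{1..k}. \<bar>?g (t + real i * s)\<bar> powr P)"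
      unfolding sum_distrib_left by (rule sum_mono)
    moreover have "x 0 powr P \<le> 2 powr (real k * P) * \<bar>fdiff k s f t\<bar> powr P"
      using P mult_right_mono [of 1 "2 powr (real k * P)" "\<bar>fdiff k s f t\<bar> powr P"] by (simp add: x_def ge_one_powr_ge_zero)
    ultimately show ?thesis
      by (subst sum.atLeast_Suc_atMost) (auto simp: distrib_left)
  qed
  finally show ?thesis by (simp add: mult.assoc mult_left_mono)
qed

text \<open>The model of a cell. \<open>fst z\<close> is the rescaled distance from the end of the
  cell that lies nearer to 1, and differences run away from that end. For \<open>0 <= a\<close> the
  weight sits at the point where it is smallest.\<close>

definition cell_energy :: "nat \<Rightarrow> real \<Rightarrow> real \<Rightarrow> real \<Rightarrow> (real \<Rightarrow> real) \<Rightarrow> ennreal" where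
  "cell_energy k a P b f = (\<integral>\<^sup>+z. ennreal (fst z powr a * \<bar>fdiff k (snd z) f (fst z)\<bar> powr P) *
     indicator {z. 0 \<le> fst z \<and> 0 \<le> snd z \<and> fst z + real k * snd z \<le> b} z \<partial>plane)"

lemma sets_region [measurable]:
  "{z. 0 \<le> fst z \<and> 0 \<le> snd z \<and> fst z + real k * snd z \<le> b} \<in> sets plane"
  by (rule sets_Collect_plane) measurable

lemma cell_energy_iterated:
  assumes [measurable]: "f \<in> borel_measurable borel"
  shows "cell_energy k a P b f = (\<integral>\<^sup>+t. \<integral>\<^sup>+s. ennreal (t powr a * \<bar>fdiff k s f t\<bar> powr P) *
     indicator {z. 0 \<le> fst z \<and> 0 \<le> snd z \<and> fst z + real k * snd z \<le> b} (t, s) \<partial>lborel \<partial>lborel)"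
  unfolding cell_energy_def by (subst lborel.nn_integral_fst [symmetric]) auto

text \<open>Away from 0 the weight is at least \<open>\<mu> powr a\<close>, so the energy bounds the
  measure of the set of large differences, and the local result in measure applies. Its pointwise
  bound is then averaged over the good steps, which turns the remaining difference into a slice of
  the energy.\<close>

lemma local_whitney_Lp_core:
  fixes \<mu> \<eta> a P :: real
  assumes k: "1 \<le> k" and P: "0 < P" and a: "0 \<le> a" and eta: "0 < \<eta>" and mu: "0 < \<mu>" "\<mu> < 1"
  shows "\<exists>C>0. \<forall>f\<in>borel_measurable borel. \<forall>e\<ge>0. cell_energy k a P (1 + \<eta>) f \<le> ennreal e \<longrightarrow>
    (\<exists>q. degree q < k \<and>
      (\<integral>\<^sup>+t. ennreal (\<bar>f t - poly q t\<bar> powr P) * indicator {\<mu>..1} t \<partial>lborel) \<le> ennreal (C * e))"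
proof -
  obtain \<tau> C0 \<sigma> where t0: "0 < \<tau>" and C0: "0 < C0" and sg: "0 < \<sigma>" and sge: "2 * real k * \<sigma> \<le> \<eta>"
    and PL: "\<And>f \<epsilon>. f \<in> borel_measurable borel \<Longrightarrow> 0 \<le> \<epsilon> \<Longrightarrow>
    emeasure plane {z. \<mu> \<le> fst z \<and> 0 \<le> snd z \<and> fst z + real k * snd z \<le> 1 + \<eta> \<and>
        \<epsilon> < \<bar>fdiff k (snd z) f (fst z)\<bar>} \<le> ennreal \<tau> \<Longrightarrow>
    (\<exists>q. degree q < k \<and> (\<forall>x\<in>{\<mu>..1}.
       emeasure lborel {s\<in>{0..\<sigma>}. \<bar>fdiff k s f x\<bar> + C0 * \<epsilon> < \<bar>f x - poly q x\<bar>} \<le> ennreal (\<sigma> / 2)))"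
    using local_whitney_in_measure [OF k mu(2) eta] by blast
  have mua: "0 < \<mu> powr a" using mu by simp
  define B where "B = 2 powr P / \<mu> powr a * (1 + \<sigma> * (C0 powr P / \<tau>))"
  define C where "C = 2 / \<sigma> * B"
  have B0: "0 < B" unfolding B_def using mua t0 C0 sg by (intro mult_pos_pos add_pos_nonneg divide_pos_pos) auto
  show ?thesis
  proof (intro exI [of _ C] conjI ballI allI impI)
    show "0 < C" unfolding C_def using B0 sg by simp
    fix f :: "real \<Rightarrow> real" and e :: real
    assume f [measurable]: "f \<in> borel_measurable borel" and e: "0 \<le> e" and E: "cell_energy k a P (1 + \<eta>) f \<le> ennreal e"
    define R where "R = {z. 0 \<le> fst z \<and> 0 \<le> snd z \<and> fst z + real k * snd z \<le> 1 + \<eta>}"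
    have Rm [measurable]: "R \<in> sets plane" unfolding R_def by (rule sets_region)
    define u where "u z = fst z powr a * \<bar>fdiff k (snd z) f (fst z)\<bar> powr P * indicator R z" for z
    have um [measurable]: "u \<in> borel_measurable plane" unfolding u_def by measurable
    have uE: "(\<integral>\<^sup>+z. ennreal (u z) \<partial>plane) = cell_energy k a P (1 + \<eta>) f"
      unfolding cell_energy_def u_def R_def [symmetric]
      by (intro nn_integral_cong) (auto simp: indicator_def)
    \<comment> \<open>With this value a difference above \<open>\<epsilon>\<close> forces the energy
      density above \<open>e / \<tau>\<close>, the level at which Markov's inequality gives measure
      at most \<open>\<tau>\<close>.\<close>
    define \<epsilon> where "\<epsilon> = (e / \<tau> / \<mu> powr a) powr (1 / P)"
    have e0: "0 \<le> \<epsilon>" by (simp add: \<epsilon>_def)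
    have eP: "\<epsilon> powr P = e / \<tau> / \<mu> powr a"
      unfolding \<epsilon>_def powr_powr using P e t0 mua by simp
    have "emeasure plane {z. \<mu> \<le> fst z \<and> 0 \<le> snd z \<and> fst z + real k * snd z \<le> 1 + \<eta> \<and>
        \<epsilon> < \<bar>fdiff k (snd z) f (fst z)\<bar>} \<le> emeasure plane {z\<in>space plane. e / \<tau> < u z}"
    proof (rule emeasure_mono)
      show "{z. \<mu> \<le> fst z \<and> 0 \<le> snd z \<and> fst z + real k * snd z \<le> 1 + \<eta> \<and> \<epsilon> < \<bar>fdiff k (snd z) f (fst z)\<bar>}
        \<subseteq> {z\<in>space plane. e / \<tau> < u z}"
      proof (rule subsetI)
        fix z assume z: "z \<in> {z. \<mu> \<le> fst z \<and> 0 \<le> snd z \<and> fst z + real k * snd z \<le> 1 + \<eta> \<and> \<epsilon> < \<bar>fdiff k (snd z) f (fst z)\<bar>}"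
        then have zR: "z \<in> R" using mu by (auto simp: R_def)
        have 1: "\<epsilon> powr P < \<bar>fdiff k (snd z) f (fst z)\<bar> powr P" using z e0 P by (intro powr_less_mono2) auto
        have 2: "\<mu> powr a \<le> fst z powr a" using z mu a by (intro powr_mono2) auto
        have "e / \<tau> = \<mu> powr a * \<epsilon> powr P" using mua eP by simp
        also have "\<dots> < \<mu> powr a * \<bar>fdiff k (snd z) f (fst z)\<bar> powr P" using 1 mua by simp
        also have "\<dots> \<le> u z" using 2 zR by (simp add: u_def mult_right_mono)
        finally show "z \<in> {z\<in>space plane. e / \<tau> < u z}" by (simp add: space_pair_measure)
      qed
    qed measurable
    also have "\<dots> \<le> ennreal \<tau>"
      by (rule nn_integral_Markov_strict [OF um]) (use uE E e t0 in \<open>auto simp: u_def\<close>)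
    finally obtain q where q: "degree q < k" and qm: "\<And>x. x \<in> {\<mu>..1} \<Longrightarrow>
       emeasure lborel {s\<in>{0..\<sigma>}. \<bar>fdiff k s f x\<bar> + C0 * \<epsilon> < \<bar>f x - poly q x\<bar>} \<le> ennreal (\<sigma> / 2)"
      using PL [OF f e0] by blast
    define w where "w t = \<bar>f t - poly q t\<bar> powr P" for t
    have [measurable]: "w \<in> borel_measurable borel" unfolding w_def by measurable
    have pt: "ennreal (w t) * indicator {\<mu>..1} t \<le> ennreal (2 / \<sigma>) * (\<integral>\<^sup>+s. ennreal (2 powr P / \<mu> powr a) * ennreal (u (t, s)) \<partial>lborel
        + ennreal (\<sigma> * (2 powr P * (C0 powr P * \<epsilon> powr P))) * indicator {\<mu>..1} t)" for t
    proof (cases "t \<in> {\<mu>..1}")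
      case t: True
      \<comment> \<open>The good steps have measure at least \<open>\<sigma> / 2\<close>;
        integrating the bound on \<open>w t\<close> over them costs the factor
        \<open>2 / \<sigma>\<close>.\<close>
      let ?G = "{s\<in>{0..\<sigma>}. \<bar>f t - poly q t\<bar> \<le> \<bar>fdiff k s f t\<bar> + C0 * \<epsilon>}"
      let ?Bd = "{s\<in>{0..\<sigma>}. \<bar>fdiff k s f t\<bar> + C0 * \<epsilon> < \<bar>f t - poly q t\<bar>}"
      have Gm [measurable]: "?G \<in> sets borel" "?Bd \<in> sets borel" by measurable
      have "ennreal \<sigma> = emeasure lborel {0..\<sigma>}" using sg by simp
      also have "\<dots> \<le> emeasure lborel (?G \<union> ?Bd)" by (rule emeasure_mono) auto
      also have "\<dots> \<le> emeasure lborel ?G + emeasure lborel ?Bd" by (rule emeasure_subadditive) auto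
      also have "\<dots> \<le> emeasure lborel ?G + ennreal (\<sigma> / 2)" using qm [OF t] by (intro add_left_mono)
      finally have "ennreal (\<sigma> / 2) + ennreal (\<sigma> / 2) \<le> ennreal (\<sigma> / 2) + emeasure lborel ?G"
        using sg by (simp add: ennreal_plus [symmetric] add.commute del: ennreal_plus)
      then have G: "ennreal (\<sigma> / 2) \<le> emeasure lborel ?G"
        unfolding ennreal_add_left_cancel_le by simp
      have "ennreal (\<sigma> / 2) * ennreal (w t) \<le> emeasure lborel ?G * ennreal (w t)" using G by (rule mult_right_mono) simp
      also have "\<dots> = (\<integral>\<^sup>+s. ennreal (w t) * indicator ?G s \<partial>lborel)"
        by (subst nn_integral_cmult_indicator) (auto simp: mult.commute)
      also have "\<dots> \<le> (\<integral>\<^sup>+s. ennreal (2 powr P / \<mu> powr a) * ennreal (u (t, s)) + ennreal (2 powr P * (C0 powr P * \<epsilon> powr P)) * indicator {0..\<sigma>} s \<partial>lborel)"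
      proof (rule nn_integral_mono)
        fix s
        show "ennreal (w t) * indicator ?G s \<le> ennreal (2 powr P / \<mu> powr a) * ennreal (u (t, s)) + ennreal (2 powr P * (C0 powr P * \<epsilon> powr P)) * indicator {0..\<sigma>} s"
        proof (cases "s \<in> ?G")
          case s: True
          have "real k * s \<le> real k * \<sigma>" using s by (intro mult_left_mono) auto
          moreover have "real k * \<sigma> \<le> \<eta>" using sge eta by (simp add: mult.assoc)
          ultimately have "t + real k * s \<le> 1 + \<eta>" using t by auto
          then have tR: "(t, s) \<in> R" using s t mu by (simp add: R_def)
          have "w t \<le> (\<bar>fdiff k s f t\<bar> + C0 * \<epsilon>) powr P" unfolding w_def using s P by (intro powr_mono2) auto
          also have "\<dots> \<le> 2 powr P * (\<bar>fdiff k s f t\<bar> powr P + (C0 * \<epsilon>) powr P)"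
            using C0 e0 P by (intro powr_add_le) auto
          also have "\<dots> = 2 powr P * \<bar>fdiff k s f t\<bar> powr P + 2 powr P * (C0 powr P * \<epsilon> powr P)"
            using C0 e0 by (simp add: powr_mult distrib_left)
          also have "2 powr P * \<bar>fdiff k s f t\<bar> powr P \<le> 2 powr P / \<mu> powr a * u (t, s)"
          proof -
            have "\<mu> powr a \<le> t powr a" using t mu a by (intro powr_mono2) auto
            then have "\<mu> powr a * \<bar>fdiff k s f t\<bar> powr P \<le> u (t, s)" using tR by (simp add: u_def mult_right_mono)
            then have "2 powr P / \<mu> powr a * (\<mu> powr a * \<bar>fdiff k s f t\<bar> powr P) \<le> 2 powr P / \<mu> powr a * u (t, s)"
              using mua by (intro mult_left_mono) auto
            then show ?thesis using mua by simp
          qed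
          finally have "ennreal (w t) \<le> ennreal (2 powr P / \<mu> powr a * u (t, s) + 2 powr P * (C0 powr P * \<epsilon> powr P))"
            by (intro ennreal_leI) simp
          also have "\<dots> = ennreal (2 powr P / \<mu> powr a) * ennreal (u (t, s)) + ennreal (2 powr P * (C0 powr P * \<epsilon> powr P))"
            by (simp add: ennreal_mult [symmetric] u_def)
          finally show ?thesis using s by simp
        qed simp
      qed
      also have "\<dots> = (\<integral>\<^sup>+s. ennreal (2 powr P / \<mu> powr a) * ennreal (u (t, s)) \<partial>lborel) + ennreal (\<sigma> * (2 powr P * (C0 powr P * \<epsilon> powr P)))"
      proof (subst nn_integral_add)
        have "(\<integral>\<^sup>+s. ennreal (2 powr P * (C0 powr P * \<epsilon> powr P)) * indicator {0..\<sigma>} s \<partial>lborel)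
            = ennreal (2 powr P * (C0 powr P * \<epsilon> powr P)) * ennreal \<sigma>"
          using sg by (subst nn_integral_cmult_indicator) auto
        also have "\<dots> = ennreal (\<sigma> * (2 powr P * (C0 powr P * \<epsilon> powr P)))"
          using sg by (simp add: ennreal_mult [symmetric] mult.commute)
        finally show "(\<integral>\<^sup>+s. ennreal (2 powr P / \<mu> powr a) * ennreal (u (t, s)) \<partial>lborel) +
            (\<integral>\<^sup>+s. ennreal (2 powr P * (C0 powr P * \<epsilon> powr P)) * indicator {0..\<sigma>} s \<partial>lborel) =
            (\<integral>\<^sup>+s. ennreal (2 powr P / \<mu> powr a) * ennreal (u (t, s)) \<partial>lborel) +
            ennreal (\<sigma> * (2 powr P * (C0 powr P * \<epsilon> powr P)))" by simp
      qed auto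
      finally have *: "ennreal (\<sigma> / 2) * ennreal (w t) \<le> (\<integral>\<^sup>+s. ennreal (2 powr P / \<mu> powr a) * ennreal (u (t, s)) \<partial>lborel) + ennreal (\<sigma> * (2 powr P * (C0 powr P * \<epsilon> powr P)))" .
      have "ennreal (w t) = ennreal (2 / \<sigma>) * (ennreal (\<sigma> / 2) * ennreal (w t))"
        using sg by (simp add: ennreal_mult [symmetric] w_def)
      also have "\<dots> \<le> ennreal (2 / \<sigma>) * ((\<integral>\<^sup>+s. ennreal (2 powr P / \<mu> powr a) * ennreal (u (t, s)) \<partial>lborel) + ennreal (\<sigma> * (2 powr P * (C0 powr P * \<epsilon> powr P))))"
        by (rule mult_left_mono [OF *]) simp
      finally show ?thesis using t by simp
    qed simp
    have "(\<integral>\<^sup>+t. ennreal (w t) * indicator {\<mu>..1} t \<partial>lborel)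
      \<le> (\<integral>\<^sup>+t. ennreal (2 / \<sigma>) * (\<integral>\<^sup>+s. ennreal (2 powr P / \<mu> powr a) * ennreal (u (t, s)) \<partial>lborel
        + ennreal (\<sigma> * (2 powr P * (C0 powr P * \<epsilon> powr P))) * indicator {\<mu>..1} t) \<partial>lborel)"
      by (rule nn_integral_mono) (rule pt)
    also have "\<dots> = ennreal (2 / \<sigma>) * (ennreal (2 powr P / \<mu> powr a) * (\<integral>\<^sup>+t. \<integral>\<^sup>+s. ennreal (u (t, s)) \<partial>lborel \<partial>lborel)
        + ennreal (\<sigma> * (2 powr P * (C0 powr P * \<epsilon> powr P))) * ennreal (1 - \<mu>))"
      using mu by (simp add: nn_integral_cmult nn_integral_add nn_integral_cmult_indicator)
    also have "(\<integral>\<^sup>+t. \<integral>\<^sup>+s. ennreal (u (t, s)) \<partial>lborel \<partial>lborel) = cell_energy k a P (1 + \<eta>) f"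
      unfolding uE [symmetric] by (subst lborel.nn_integral_fst) auto
    also have "ennreal (2 / \<sigma>) * (ennreal (2 powr P / \<mu> powr a) * cell_energy k a P (1 + \<eta>) f
        + ennreal (\<sigma> * (2 powr P * (C0 powr P * \<epsilon> powr P))) * ennreal (1 - \<mu>))
        \<le> ennreal (2 / \<sigma>) * (ennreal (2 powr P / \<mu> powr a) * ennreal e
        + ennreal (\<sigma> * (2 powr P * (C0 powr P * \<epsilon> powr P))) * 1)"
      using mu by (intro mult_left_mono add_mono E) (auto simp: ennreal_le_1)
    also have "\<dots> = ennreal (C * e)"
    proof -
      have "2 / \<sigma> * (2 powr P / \<mu> powr a * e + \<sigma> * (2 powr P * (C0 powr P * \<epsilon> powr P))) = C * e"
        unfolding C_def B_def eP using sg t0 mua by (simp add: field_simps)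
      then show ?thesis using sg e mua
        by (simp add: ennreal_mult [symmetric] ennreal_plus [symmetric] del: ennreal_plus)
    qed
    finally show "\<exists>q. degree q < k \<and>
      (\<integral>\<^sup>+t. ennreal (\<bar>f t - poly q t\<bar> powr P) * indicator {\<mu>..1} t \<partial>lborel) \<le> ennreal (C * e)"
      using q unfolding w_def by blast
  qed
qed

text \<open>The approximation on \<open>[\<mu>, 1]\<close> is continued to \<open>[0, \<mu>)\<close>
  by averaging \<open>extension_bound\<close> over steps that carry every further point into
  \<open>[\<mu>, 1]\<close>. The weight at the first point is at most 1, and the difference term
  already carries it.\<close>

lemma local_whitney_Lp:
  fixes \<eta> a P :: real
  assumes k: "1 \<le> k" and P: "0 < P" and a: "0 \<le> a" and eta: "0 < \<eta>"
  shows "\<exists>C>0. \<forall>f\<in>borel_measurable borel. \<forall>e\<ge>0. cell_energy k a P (1 + \<eta>) f \<le> ennreal e \<longrightarrow>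
    (\<exists>q. degree q < k \<and>
      (\<integral>\<^sup>+t. ennreal (t powr a * \<bar>f t - poly q t\<bar> powr P) * indicator {0..1} t \<partial>lborel) \<le> ennreal (C * e))"
proof -
  \<comment> \<open>For \<open>t < \<mu>\<close> and \<open>\<mu> <= s <= 2 \<mu>\<close> the points
    \<open>t + i s\<close> with \<open>1 <= i <= k\<close> lie between \<open>\<mu>\<close> and
    \<open>(2 k + 1) \<mu> = 1\<close>.\<close>
  define \<mu> where "\<mu> = 1 / (2 * real k + 1)"
  have mu: "0 < \<mu>" "\<mu> < 1" and muk: "(2 * real k + 1) * \<mu> = 1" using k by (simp_all add: \<mu>_def)
  obtain C1 where C1: "0 < C1" and core: "\<And>f e. f \<in> borel_measurable borel \<Longrightarrow> 0 \<le> e \<Longrightarrow>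
    cell_energy k a P (1 + \<eta>) f \<le> ennreal e \<Longrightarrow> (\<exists>q. degree q < k \<and>
      (\<integral>\<^sup>+t. ennreal (\<bar>f t - poly q t\<bar> powr P) * indicator {\<mu>..1} t \<partial>lborel) \<le> ennreal (C1 * e))"
    using local_whitney_Lp_core [OF k P a eta mu] by blast
  define K where "K = (real k + 1) powr P * 2 powr (real k * P)"
  have K0: "0 < K" by (simp add: K_def add_pos_nonneg)
  define C where "C = K / \<mu> * (1 + real k * C1) + C1"
  have C: "0 < C" unfolding C_def using K0 mu C1 by (intro add_pos_pos mult_pos_pos add_pos_nonneg divide_pos_pos) auto
  show ?thesis
  proof (intro exI [of _ C] conjI ballI allI impI C)
    fix f :: "real \<Rightarrow> real" and e :: real
    assume f [measurable]: "f \<in> borel_measurable borel" and e: "0 \<le> e" and E: "cell_energy k a P (1 + \<eta>) f \<le> ennreal e"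
    obtain q where q: "degree q < k"
      and qb: "(\<integral>\<^sup>+t. ennreal (\<bar>f t - poly q t\<bar> powr P) * indicator {\<mu>..1} t \<partial>lborel) \<le> ennreal (C1 * e)"
      using core [OF f e E] by blast
    define R where "R = {z. 0 \<le> fst z \<and> 0 \<le> snd z \<and> fst z + real k * snd z \<le> 1 + \<eta>}"
    have Rm [measurable]: "R \<in> sets plane" unfolding R_def by (rule sets_region)
    define u where "u t s = ennreal (t powr a * \<bar>fdiff k s f t\<bar> powr P) * indicator R (t, s)" for t s
    have [measurable]: "(\<lambda>z. u (fst z) (snd z)) \<in> borel_measurable plane" unfolding u_def by measurable
    have [measurable]: "u t \<in> borel_measurable borel" for t unfolding u_def by measurable
    have [measurable]: "(\<lambda>t. \<integral>\<^sup>+s. u t s \<partial>lborel) \<in> borel_measurable borel"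
      unfolding u_def by measurable
    define w where "w t = \<bar>f t - poly q t\<bar> powr P" for t
    have [measurable]: "w \<in> borel_measurable borel" unfolding w_def by measurable
    define w1 where "w1 t = ennreal (w t) * indicator {\<mu>..1} t" for t
    have w1m [measurable]: "w1 \<in> borel_measurable borel" unfolding w1_def by measurable
    have pt: "ennreal (t powr a * w t) * indicator {0..<\<mu>} t \<le>
       ennreal (K / \<mu>) * ((\<integral>\<^sup>+s. u t s \<partial>lborel) + ennreal (real k * (C1 * e)) * indicator {0..<\<mu>} t)" for t
    proof (cases "t \<in> {0..<\<mu>}")
      case t: True
      have "ennreal \<mu> * ennreal (t powr a * w t) = (\<integral>\<^sup>+s. ennreal (t powr a * w t) * indicator {\<mu>..2 * \<mu>} s \<partial>lborel)"
        using mu by (subst nn_integral_cmult_indicator) (auto simp: mult.commute)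
      also have "\<dots> \<le> (\<integral>\<^sup>+s. ennreal K * (u t s + (\<Sum>i\<in>{1..k}. w1 (t + real i * s))) \<partial>lborel)"
      proof (rule nn_integral_mono)
        fix s
        show "ennreal (t powr a * w t) * indicator {\<mu>..2 * \<mu>} s \<le> ennreal K * (u t s + (\<Sum>i\<in>{1..k}. w1 (t + real i * s)))"
        proof (cases "s \<in> {\<mu>..2 * \<mu>}")
          case s: True
          have rng: "t + real i * s \<in> {\<mu>..1}" if "i \<in> {1..k}" for i
          proof -
            have 1: "s \<le> real i * s" using that s mu mult_right_mono [of 1 "real i" s] by simp
            have 2: "real i * s \<le> real k * (2 * \<mu>)" using that s mu by (intro mult_mono) auto
            have 3: "real k * (2 * \<mu>) + \<mu> = 1" using muk by (simp add: algebra_simps)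
            show ?thesis unfolding atLeastAtMost_iff
            proof
              have "\<mu> \<le> s" "0 \<le> t" using s t by auto
              then show "\<mu> \<le> t + real i * s" using 1 by linarith
              have "t < \<mu>" using t by auto
              then show "t + real i * s \<le> 1" using 2 3 by linarith
            qed
          qed
          have "(t, s) \<in> R" using rng [of k] k s t mu eta by (auto simp: R_def)
          then have uR: "u t s = ennreal (t powr a * \<bar>fdiff k s f t\<bar> powr P)" by (simp add: u_def)
          have t1: "t powr a \<le> 1" using t mu a powr_mono2 [of a t 1] by simp
          have "t powr a * w t \<le> t powr a * (K * (\<bar>fdiff k s f t\<bar> powr P + (\<Sum>i\<in>{1..k}. w (t + real i * s))))"
            using extension_bound [OF q P, of f t s] unfolding w_def K_def by (rule mult_left_mono) simp
          also have "\<dots> = K * (t powr a * \<bar>fdiff k s f t\<bar> powr P + t powr a * (\<Sum>i\<in>{1..k}. w (t + real i * s)))"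
            by (simp add: algebra_simps)
          also have "\<dots> \<le> K * (t powr a * \<bar>fdiff k s f t\<bar> powr P + 1 * (\<Sum>i\<in>{1..k}. w (t + real i * s)))"
            using K0 t1 by (intro mult_left_mono add_left_mono mult_right_mono sum_nonneg) (auto simp: w_def)
          finally have "ennreal (t powr a * w t) \<le> ennreal (K * (t powr a * \<bar>fdiff k s f t\<bar> powr P + (\<Sum>i\<in>{1..k}. w (t + real i * s))))"
            by (intro ennreal_leI) simp
          also have "\<dots> = ennreal K * (u t s + (\<Sum>i\<in>{1..k}. ennreal (w (t + real i * s))))"
            unfolding uR using K0 by (subst sum_ennreal) (auto simp: w_def ennreal_mult sum_nonneg)
          also have "(\<Sum>i\<in>{1..k}. ennreal (w (t + real i * s))) = (\<Sum>i\<in>{1..k}. w1 (t + real i * s))"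
            using rng by (intro sum.cong) (auto simp: w1_def)
          finally show ?thesis using s by simp
        qed simp
      qed
      also have "\<dots> = ennreal K * ((\<integral>\<^sup>+s. u t s \<partial>lborel) + (\<Sum>i\<in>{1..k}. \<integral>\<^sup>+s. w1 (t + real i * s) \<partial>lborel))"
        by (simp add: nn_integral_cmult nn_integral_add nn_integral_sum)
      also have "\<dots> \<le> ennreal K * ((\<integral>\<^sup>+s. u t s \<partial>lborel) + (\<Sum>i\<in>{1..k}. ennreal (C1 * e)))"
      proof (intro mult_left_mono add_left_mono sum_mono)
        fix i assume "i \<in> {1..k}"
        then have "(\<integral>\<^sup>+s. w1 (t + real i * s) \<partial>lborel) \<le> (\<integral>\<^sup>+x. w1 x \<partial>lborel)"
          by (intro nn_integral_affine_le w1m) auto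
        also have "\<dots> \<le> ennreal (C1 * e)" using qb by (simp add: w1_def w_def)
        finally show "(\<integral>\<^sup>+s. w1 (t + real i * s) \<partial>lborel) \<le> ennreal (C1 * e)" .
      qed simp
      also have "(\<Sum>i\<in>{1..k}. ennreal (C1 * e)) = ennreal (real k * (C1 * e))"
        using C1 e by (simp add: ennreal_mult ennreal_of_nat_eq_real_of_nat)
      finally have *: "ennreal \<mu> * ennreal (t powr a * w t) \<le> ennreal K * ((\<integral>\<^sup>+s. u t s \<partial>lborel) + ennreal (real k * (C1 * e)))" .
      have "ennreal (t powr a * w t) = ennreal (1 / \<mu>) * (ennreal \<mu> * ennreal (t powr a * w t))"
        using mu by (simp add: ennreal_mult [symmetric] w_def)
      also have "\<dots> \<le> ennreal (1 / \<mu>) * (ennreal K * ((\<integral>\<^sup>+s. u t s \<partial>lborel) + ennreal (real k * (C1 * e))))"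
        by (rule mult_left_mono [OF *]) simp
      also have "\<dots> = ennreal (K / \<mu>) * ((\<integral>\<^sup>+s. u t s \<partial>lborel) + ennreal (real k * (C1 * e)))"
        using mu K0 by (simp add: mult.assoc [symmetric] ennreal_mult [symmetric])
      finally show ?thesis using t by simp
    qed simp
    have Eu: "(\<integral>\<^sup>+t. \<integral>\<^sup>+s. u t s \<partial>lborel \<partial>lborel) = cell_energy k a P (1 + \<eta>) f"
      unfolding cell_energy_iterated [OF f] u_def R_def ..
    have "(\<integral>\<^sup>+t. ennreal (t powr a * w t) * indicator {0..1} t \<partial>lborel)
      \<le> (\<integral>\<^sup>+t. ennreal (K / \<mu>) * ((\<integral>\<^sup>+s. u t s \<partial>lborel) + ennreal (real k * (C1 * e)) * indicator {0..<\<mu>} t) + w1 t \<partial>lborel)"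
    proof (rule nn_integral_mono)
      fix t :: real
      have "ennreal (t powr a * w t) * indicator {\<mu>..1} t \<le> w1 t"
      proof (cases "t \<in> {\<mu>..1}")
        case True
        then have "t powr a \<le> 1" using mu a powr_mono2 [of a t 1] by simp
        then have "t powr a * w t \<le> 1 * w t" by (intro mult_right_mono) (auto simp: w_def)
        then show ?thesis using True by (simp add: w1_def ennreal_leI)
      qed simp
      moreover have "ennreal (t powr a * w t) * indicator {0..1} t =
        ennreal (t powr a * w t) * indicator {0..<\<mu>} t + ennreal (t powr a * w t) * indicator {\<mu>..1} t"
        using mu by (auto simp: indicator_def)
      ultimately show "ennreal (t powr a * w t) * indicator {0..1} t \<le>
        ennreal (K / \<mu>) * ((\<integral>\<^sup>+s. u t s \<partial>lborel) + ennreal (real k * (C1 * e)) * indicator {0..<\<mu>} t) + w1 t"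
        using pt [of t] by (simp add: add_mono)
    qed
    also have "\<dots> = ennreal (K / \<mu>) * (cell_energy k a P (1 + \<eta>) f + ennreal (real k * (C1 * e)) * ennreal \<mu>) + (\<integral>\<^sup>+t. w1 t \<partial>lborel)"
      using mu by (simp add: nn_integral_cmult nn_integral_add nn_integral_cmult_indicator Eu)
    also have "\<dots> \<le> ennreal (K / \<mu>) * (ennreal e + ennreal (real k * (C1 * e)) * 1) + ennreal (C1 * e)"
      using mu qb E by (intro add_mono mult_left_mono) (auto simp: ennreal_le_1 w1_def w_def)
    also have "\<dots> = ennreal (C * e)"
    proof -
      have "K / \<mu> * (e + real k * (C1 * e)) + C1 * e = C * e"
        unfolding C_def by (simp add: algebra_simps add_divide_distrib)
      then show ?thesis using K0 mu C1 e
        by (simp add: ennreal_mult [symmetric] ennreal_plus [symmetric] del: ennreal_plus)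
    qed
    finally show "\<exists>q. degree q < k \<and>
      (\<integral>\<^sup>+t. ennreal (t powr a * \<bar>f t - poly q t\<bar> powr P) * indicator {0..1} t \<partial>lborel) \<le> ennreal (C * e)"
      using q unfolding w_def by blast
  qed
qed

text \<open>The counterpart for \<open>p = \<infinity>\<close>. The set of large differences is now
  null, so the result in measure applies directly, and averaging over steps is replaced by picking
  one step outside a null set.\<close>

lemma local_whitney_sup:
  fixes \<eta> a :: real
  assumes k: "1 \<le> k" and a: "0 \<le> a" and eta: "0 < \<eta>"
  shows "\<exists>C>0. \<forall>f\<in>borel_measurable borel. \<forall>\<epsilon>\<ge>0.
    (AE z in plane. 0 \<le> fst z \<and> 0 \<le> snd z \<and> fst z + real k * snd z \<le> 1 + \<eta> \<longrightarrow>
       fst z powr a * \<bar>fdiff k (snd z) f (fst z)\<bar> \<le> \<epsilon>) \<longrightarrow>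
    (\<exists>q. degree q < k \<and> (AE t in lborel. t \<in> {0..1} \<longrightarrow> t powr a * \<bar>f t - poly q t\<bar> \<le> C * \<epsilon>))"
proof -
  define \<mu> where "\<mu> = 1 / (2 * real k + 1)"
  have mu: "0 < \<mu>" "\<mu> < 1" and muk: "(2 * real k + 1) * \<mu> = 1" using k by (simp_all add: \<mu>_def)
  obtain \<tau> C0 \<sigma> where t0: "0 < \<tau>" and C0: "0 < C0" and sg: "0 < \<sigma>" and sge: "2 * real k * \<sigma> \<le> \<eta>"
    and PL: "\<And>f \<epsilon>. f \<in> borel_measurable borel \<Longrightarrow> 0 \<le> \<epsilon> \<Longrightarrow>
    emeasure plane {z. \<mu> \<le> fst z \<and> 0 \<le> snd z \<and> fst z + real k * snd z \<le> 1 + \<eta> \<and>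
        \<epsilon> < \<bar>fdiff k (snd z) f (fst z)\<bar>} \<le> ennreal \<tau> \<Longrightarrow>
    (\<exists>q. degree q < k \<and> (\<forall>x\<in>{\<mu>..1}.
       emeasure lborel {s\<in>{0..\<sigma>}. \<bar>fdiff k s f x\<bar> + C0 * \<epsilon> < \<bar>f x - poly q x\<bar>} \<le> ennreal (\<sigma> / 2)))"
    using local_whitney_in_measure [OF k mu(2) eta] by blast
  have mua: "0 < \<mu> powr a" using mu by simp
  define M where "M = (1 + C0) / \<mu> powr a"
  have M0: "0 < M" unfolding M_def using C0 mua by simp
  show ?thesis
  proof (intro exI [of _ "1 + 2 ^ k * M"] conjI ballI allI impI)
    show "0 < 1 + 2 ^ k * M" using M0 by (simp add: add_pos_pos)
    fix f :: "real \<Rightarrow> real" and \<epsilon> :: real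
    assume f [measurable]: "f \<in> borel_measurable borel" and e: "0 \<le> \<epsilon>"
    define G where "G z \<longleftrightarrow> (0 \<le> fst z \<and> 0 \<le> snd z \<and> fst z + real k * snd z \<le> 1 + \<eta> \<longrightarrow>
       fst z powr a * \<bar>fdiff k (snd z) f (fst z)\<bar> \<le> \<epsilon>)" for z
    assume "AE z in plane. 0 \<le> fst z \<and> 0 \<le> snd z \<and> fst z + real k * snd z \<le> 1 + \<eta> \<longrightarrow>
       fst z powr a * \<bar>fdiff k (snd z) f (fst z)\<bar> \<le> \<epsilon>"
    then have AG: "AE z in plane. G z" unfolding G_def .
    have Gm [measurable]: "Measurable.pred plane G" unfolding G_def by measurable
    define \<epsilon>' where "\<epsilon>' = \<epsilon> / \<mu> powr a"
    have e': "0 \<le> \<epsilon>'" using e mua by (simp add: \<epsilon>'_def)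
    have big: "\<bar>fdiff k s f t\<bar> \<le> \<epsilon>'" if "G (t, s)" "\<mu> \<le> t" "0 \<le> s" "t + real k * s \<le> 1 + \<eta>" for t s
    proof -
      have "\<mu> powr a \<le> t powr a" using that mu a by (intro powr_mono2) auto
      then have "\<mu> powr a * \<bar>fdiff k s f t\<bar> \<le> t powr a * \<bar>fdiff k s f t\<bar>" by (rule mult_right_mono) simp
      also have "\<dots> \<le> \<epsilon>" using that mu by (auto simp: G_def)
      finally show ?thesis unfolding \<epsilon>'_def using mua by (simp add: field_simps)
    qed
    let ?T = "{z. \<mu> \<le> fst z \<and> 0 \<le> snd z \<and> fst z + real k * snd z \<le> 1 + \<eta> \<and> \<epsilon>' < \<bar>fdiff k (snd z) f (fst z)\<bar>}"
    have Tm: "?T \<in> sets plane" by (rule sets_Collect_plane) measurable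
    have "AE z in plane. z \<notin> ?T"
      using AG by (rule AE_mp) (intro AE_I2, use big in force)
    then have "emeasure plane ?T = 0"
      using AE_iff_null_sets [OF Tm] by (simp only: null_setsD1)
    then obtain q where q: "degree q < k" and qm: "\<And>x. x \<in> {\<mu>..1} \<Longrightarrow>
       emeasure lborel {s\<in>{0..\<sigma>}. \<bar>fdiff k s f x\<bar> + C0 * \<epsilon>' < \<bar>f x - poly q x\<bar>} \<le> ennreal (\<sigma> / 2)"
      using PL [OF f e'] by force
    have AG2: "AE t in lborel. AE s in lborel. G (t, s)" by (rule lborel_pair.AE_pair [OF AG])
    have near: "AE t in lborel. t \<in> {\<mu>..1} \<longrightarrow> \<bar>f t - poly q t\<bar> \<le> M * \<epsilon>"
      using AG2
    proof (rule AE_mp, intro AE_I2 impI)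
      fix t assume t: "AE s in lborel. G (t, s)" "t \<in> {\<mu>..1}"
      \<comment> \<open>If the bound failed at \<open>t\<close>, almost every step in
        \<open>[0, \<sigma>]\<close> would be bad, but the bad steps have measure at most
        \<open>\<sigma> / 2\<close>.\<close>
      let ?Bd = "{s\<in>{0..\<sigma>}. \<bar>fdiff k s f t\<bar> + C0 * \<epsilon>' < \<bar>f t - poly q t\<bar>}"
      show "\<bar>f t - poly q t\<bar> \<le> M * \<epsilon>"
      proof (rule ccontr)
        assume n: "\<not> \<bar>f t - poly q t\<bar> \<le> M * \<epsilon>"
        have "emeasure lborel {0..\<sigma>} \<le> emeasure lborel ?Bd"
        proof (rule emeasure_mono_AE)
          show "AE s in lborel. s \<in> {0..\<sigma>} \<longrightarrow> s \<in> ?Bd"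
            using t(1)
          proof (rule AE_mp, intro AE_I2 impI)
            fix s assume s: "G (t, s)" "s \<in> {0..\<sigma>}"
            have "real k * s \<le> real k * \<sigma>" using s by (intro mult_left_mono) auto
            moreover have "real k * \<sigma> \<le> \<eta>" using sge eta by (simp add: mult.assoc)
            ultimately have "\<bar>fdiff k s f t\<bar> \<le> \<epsilon>'" using s t by (intro big) auto
            moreover have "M * \<epsilon> = \<epsilon>' + C0 * \<epsilon>'" by (simp add: M_def \<epsilon>'_def add_divide_distrib distrib_right)
            ultimately show "s \<in> ?Bd" using n s by auto
          qed
        qed measurable
        also have "\<dots> \<le> ennreal (\<sigma> / 2)" by (rule qm [OF t(2)])
        finally show False using sg by simp
      qed
    qed
    have "AE t in lborel. t \<in> {0..<\<mu>} \<longrightarrow> t powr a * \<bar>f t - poly q t\<bar> \<le> (1 + 2 ^ k * M) * \<epsilon>"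
      using AG2
    proof (rule AE_mp, intro AE_I2 impI)
      fix t assume t: "AE s in lborel. G (t, s)" "t \<in> {0..<\<mu>}"
      have "AE s in lborel. \<forall>i\<in>{1..k}. t + real i * s \<in> {\<mu>..1} \<longrightarrow> \<bar>f (t + real i * s) - poly q (t + real i * s)\<bar> \<le> M * \<epsilon>"
      proof (intro AE_finite_allI ballI)
        fix i assume "i \<in> {1..k}"
        then show "AE s in lborel. t + real i * s \<in> {\<mu>..1} \<longrightarrow> \<bar>f (t + real i * s) - poly q (t + real i * s)\<bar> \<le> M * \<epsilon>"
          by (intro AE_borel_affine [OF _ _ near]) (auto, measurable)
      qed simp
      then have "AE s in lborel. G (t, s) \<and> (\<forall>i\<in>{1..k}. t + real i * s \<in> {\<mu>..1} \<longrightarrow> \<bar>f (t + real i * s) - poly q (t + real i * s)\<bar> \<le> M * \<epsilon>)"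
        using t(1) by (rule AE_conjI [rotated])
      \<comment> \<open>An interval of positive length contains a step at which all the almost sure
        properties hold together.\<close>
      moreover have "\<not> (AE s in lborel. s \<notin> {\<mu>..2 * \<mu>})"
        using mu by (subst AE_iff_null_sets [symmetric]) (auto simp: null_sets_def)
      ultimately obtain s where s: "s \<in> {\<mu>..2 * \<mu>}" "G (t, s)"
        and si: "\<And>i. i \<in> {1..k} \<Longrightarrow> t + real i * s \<in> {\<mu>..1} \<Longrightarrow> \<bar>f (t + real i * s) - poly q (t + real i * s)\<bar> \<le> M * \<epsilon>"
        by (smt (verit, del_insts) AE_mp AE_I2)
      have rng: "t + real i * s \<in> {\<mu>..1}" if "i \<in> {1..k}" for i
      proof -
        have 1: "s \<le> real i * s" using that s mu mult_right_mono [of 1 "real i" s] by simp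
        have 2: "real i * s \<le> real k * (2 * \<mu>)" using that s mu by (intro mult_mono) auto
        have 3: "real k * (2 * \<mu>) + \<mu> = 1" using muk by (simp add: algebra_simps)
        show ?thesis unfolding atLeastAtMost_iff
        proof
          have "\<mu> \<le> s" "0 \<le> t" using s t by auto
              then show "\<mu> \<le> t + real i * s" using 1 by linarith
          have "t < \<mu>" using t by auto
              then show "t + real i * s \<le> 1" using 2 3 by linarith
        qed
      qed
      let ?g = "\<lambda>x. f x - poly q x"
      have t1: "t powr a \<le> 1" using t mu a powr_mono2 [of a t 1] by simp
      have fd: "fdiff k s ?g t = fdiff k s f t" unfolding fdiff_diff using fdiff_poly [OF q] by simp
      have "\<bar>\<Sum>i\<in>{1..k}. (-1) ^ i * real (k choose i) * ?g (t + real i * s)\<bar> \<le> 2 ^ k * (M * \<epsilon>)"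
        by (rule weighted_sum_bound) (use si rng M0 e in auto)
      then have "\<bar>?g t\<bar> \<le> \<bar>fdiff k s f t\<bar> + 2 ^ k * (M * \<epsilon>)"
        using fdiff_split [of k s ?g t] fd by linarith
      then have "t powr a * \<bar>?g t\<bar> \<le> t powr a * (\<bar>fdiff k s f t\<bar> + 2 ^ k * (M * \<epsilon>))" by (rule mult_left_mono) simp
      also have "\<dots> = t powr a * \<bar>fdiff k s f t\<bar> + t powr a * (2 ^ k * (M * \<epsilon>))" by (rule distrib_left)
      also have "t powr a * \<bar>fdiff k s f t\<bar> \<le> \<epsilon>"
        using s rng [of k] k t mu eta unfolding G_def by auto
      also have "t powr a * (2 ^ k * (M * \<epsilon>)) \<le> 1 * (2 ^ k * (M * \<epsilon>))"
        using t1 M0 e by (intro mult_right_mono) auto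
      finally show "t powr a * \<bar>f t - poly q t\<bar> \<le> (1 + 2 ^ k * M) * \<epsilon>" by (simp add: algebra_simps)
    qed
    with near have "AE t in lborel. t \<in> {0..1} \<longrightarrow> t powr a * \<bar>f t - poly q t\<bar> \<le> (1 + 2 ^ k * M) * \<epsilon>"
    proof eventually_elim
      case (elim t)
      show ?case
      proof (cases "t \<in> {0..1} \<and> \<not> t < \<mu>")
        case True
        then have "t powr a * \<bar>f t - poly q t\<bar> \<le> 1 * (M * \<epsilon>)"
          using elim a powr_mono2 [of a t 1] mu by (intro mult_mono) auto
        also have "\<dots> \<le> (1 + 2 ^ k * M) * \<epsilon>"
        proof -
          have "1 * M \<le> 2 ^ k * M" using M0 by (intro mult_right_mono) auto
          then show ?thesis using e by (simp add: mult_right_mono)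
        qed
        finally show ?thesis by simp
      qed (use elim in auto)
    qed
    then show "\<exists>q. degree q < k \<and> (AE t in lborel. t \<in> {0..1} \<longrightarrow> t powr a * \<bar>f t - poly q t\<bar> \<le> (1 + 2 ^ k * M) * \<epsilon>)"
      using q by blast
  qed
qed

section \<open>The modulus as an average over start points and step sizes\<close>

lemma phi_pos: "- 1 < x \<Longrightarrow> x < 1 \<Longrightarrow> 0 < phi x"
  by (simp add: phi_def abs_square_less_1)

lemma measurable_phi [measurable]: "phi \<in> borel_measurable borel"
  unfolding phi_def by measurable

text \<open>This is \<open>shifted_weight\<close> in the coordinates \<open>y = x - k s / 2\<close>
  (the leftmost point) and \<open>s = h * phi x\<close> (the actual step): its bases are the
  distances of the outermost points of the difference from 1 and from -1.\<close>

definition step_weight :: "real \<Rightarrow> real \<Rightarrow> nat \<Rightarrow> real \<Rightarrow> real \<Rightarrow> real" where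
  "step_weight \<alpha> \<beta> k y s = (1 - y - real k * s) powr \<alpha> * (1 + y) powr \<beta>"

text \<open>The pairs (leftmost point, step) that come from \<open>0 <= h <= r\<close> and a centre
  strictly inside the interval. At the endpoints \<open>phi\<close> vanishes and the substitution
  would degenerate.\<close>

definition steps :: "nat \<Rightarrow> real \<Rightarrow> (real \<times> real) set" where
  "steps k r = {z. - 1 \<le> fst z \<and> 0 \<le> snd z \<and> fst z + real k * snd z \<le> 1 \<and>
     - 1 < fst z + real k * snd z / 2 \<and> fst z + real k * snd z / 2 < 1 \<and>
     snd z \<le> r * phi (fst z + real k * snd z / 2)}"

lemma sets_steps [measurable]: "steps k r \<in> sets plane"
  unfolding steps_def by (rule sets_Collect_plane) measurable

lemma measurable_step_weight [measurable]:
  assumes [measurable]: "u \<in> borel_measurable M" "v \<in> borel_measurable M"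
  shows "(\<lambda>z. step_weight \<alpha> \<beta> k (u z) (v z)) \<in> borel_measurable M"
  unfolding step_weight_def by measurable

lemma step_weight_nonneg [simp]: "0 \<le> step_weight \<alpha> \<beta> k y s"
  by (simp add: step_weight_def)

lemma sym_diff_k_eq_fdiff:
  assumes "- 1 \<le> x - real k * h / 2" "x + real k * h / 2 \<le> 1" "0 \<le> h"
  shows "\<bar>sym_diff_k k h f x\<bar> = \<bar>fdiff k h f (x - real k * h / 2)\<bar>"
proof -
  have "sym_diff_k k h f x = (\<Sum>i\<le>k. (-1) ^ k * ((-1) ^ i * real (k choose i) * f (x - real k * h / 2 + real i * h)))"
    unfolding sym_diff_k_def atMost_atLeast0 using assms
  proof (simp, intro sum.cong refl)
    fix i assume i: "i \<in> {0..k}"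
    then obtain d where d: "k = i + d" using le_Suc_ex by auto
    have "(-1::real) ^ (k - i) = (-1) ^ k * (-1) ^ i"
      by (simp add: d power_add mult_ac power_mult_distrib [symmetric])
    then show "real (k choose i) * (-1) ^ (k - i) * f (x - real k * h / 2 + real i * h)
      = (-1) ^ k * ((-1) ^ i * real (k choose i) * f (x - real k * h / 2 + real i * h))" by simp
  qed
  also have "\<dots> = (-1) ^ k * fdiff k h f (x - real k * h / 2)"
    unfolding fdiff_def by (rule sum_distrib_left [symmetric])
  finally show ?thesis by (simp add: abs_mult power_abs)
qed

text \<open>Two one-dimensional substitutions: for fixed step the leftmost point is translated to
  the centre \<open>x\<close>, and for fixed \<open>x\<close> the step is written as
  \<open>h * phi x\<close>. The factor \<open>phi x\<close> of the second one cancels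
  \<open>1 / phi\<close>.\<close>

lemma steps_integral_eq:
  fixes H :: "real \<times> real \<Rightarrow> ennreal"
  assumes [measurable]: "H \<in> borel_measurable plane"
  shows "(\<integral>\<^sup>+z. H z * indicator (steps k r) z * ennreal (1 / phi (fst z + real k * snd z / 2)) \<partial>plane)
    = (\<integral>\<^sup>+h. \<integral>\<^sup>+x. H (x - real k * (h * phi x) / 2, h * phi x) *
        indicator {z. - 1 < snd z \<and> snd z < 1 \<and> 0 \<le> fst z \<and> fst z \<le> r \<and> - 1 \<le> snd z - real k * (fst z * phi (snd z)) / 2 \<and>
          snd z + real k * (fst z * phi (snd z)) / 2 \<le> 1} (h, x) \<partial>lborel \<partial>lborel)"
proof -
  define \<Theta> where "\<Theta> y s = H (y, s) * indicator (steps k r) (y, s) * ennreal (1 / phi (y + real k * s / 2))" for y s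
  have Tm [measurable]: "(\<lambda>z. \<Theta> (fst z) (snd z)) \<in> borel_measurable plane"
    unfolding \<Theta>_def by measurable
  have Tm' [measurable]: "(\<lambda>z. \<Theta> (u z) (v z)) \<in> borel_measurable M"
    if "u \<in> borel_measurable M" "v \<in> borel_measurable M" for u v M
    using measurable_compose [of "\<lambda>z. (u z, v z)" M "plane", OF _ Tm] that by simp
  define A where "A = {z. - 1 < snd z \<and> snd z < 1 \<and> 0 \<le> fst z \<and> fst z \<le> r \<and> - 1 \<le> snd z - real k * (fst z * phi (snd z)) / 2 \<and>
          snd z + real k * (fst z * phi (snd z)) / 2 \<le> 1}"
  have Am [measurable]: "A \<in> sets plane" unfolding A_def by (rule sets_Collect_plane) measurable
  have "(\<integral>\<^sup>+z. H z * indicator (steps k r) z * ennreal (1 / phi (fst z + real k * snd z / 2)) \<partial>plane)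
      = (\<integral>\<^sup>+z. \<Theta> (fst z) (snd z) \<partial>plane)"
    by (simp add: \<Theta>_def)
  also have "\<dots> = (\<integral>\<^sup>+s. \<integral>\<^sup>+y. \<Theta> y s \<partial>lborel \<partial>lborel)"
    by (subst lborel_pair.nn_integral_snd [symmetric]) auto
  also have "\<dots> = (\<integral>\<^sup>+s. \<integral>\<^sup>+x. \<Theta> (x - real k * s / 2) s \<partial>lborel \<partial>lborel)"
  proof (rule nn_integral_cong)
    fix s
    show "(\<integral>\<^sup>+y. \<Theta> y s \<partial>lborel) = (\<integral>\<^sup>+x. \<Theta> (x - real k * s / 2) s \<partial>lborel)"
      using nn_integral_real_affine [of "\<lambda>y. \<Theta> y s" 1 "- (real k * s / 2)"] by simp
  qed
  also have "\<dots> = (\<integral>\<^sup>+x. \<integral>\<^sup>+s. \<Theta> (x - real k * s / 2) s \<partial>lborel \<partial>lborel)"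
    by (rule lborel_pair.Fubini') measurable
  also have "\<dots> = (\<integral>\<^sup>+x. \<integral>\<^sup>+h. H (x - real k * (h * phi x) / 2, h * phi x) * indicator A (h, x) \<partial>lborel \<partial>lborel)"
  proof (rule nn_integral_cong)
    fix x
    show "(\<integral>\<^sup>+s. \<Theta> (x - real k * s / 2) s \<partial>lborel) = (\<integral>\<^sup>+h. H (x - real k * (h * phi x) / 2, h * phi x) * indicator A (h, x) \<partial>lborel)"
    proof (cases "- 1 < x \<and> x < 1")
      case True
      then have p: "0 < phi x" using phi_pos by simp
      have "(\<integral>\<^sup>+s. \<Theta> (x - real k * s / 2) s \<partial>lborel) = ennreal \<bar>phi x\<bar> * (\<integral>\<^sup>+h. \<Theta> (x - real k * (0 + phi x * h) / 2) (0 + phi x * h) \<partial>lborel)"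
        using p by (intro nn_integral_real_affine [where f = "\<lambda>s. \<Theta> (x - real k * s / 2) s"]) auto
      also have "\<dots> = (\<integral>\<^sup>+h. ennreal \<bar>phi x\<bar> * \<Theta> (x - real k * (0 + phi x * h) / 2) (0 + phi x * h) \<partial>lborel)"
        by (rule nn_integral_cmult [symmetric]) measurable
      also have "\<dots> = (\<integral>\<^sup>+h. H (x - real k * (h * phi x) / 2, h * phi x) * indicator A (h, x) \<partial>lborel)"
      proof (rule nn_integral_cong)
        fix h
        have e: "(x - real k * (phi x * h) / 2, phi x * h) \<in> steps k r \<longleftrightarrow> (h, x) \<in> A"
          using p True by (auto simp: steps_def A_def field_simps zero_le_mult_iff)
        have "ennreal (phi x) * ennreal (1 / phi x) = 1"
          using p by (simp add: ennreal_mult [symmetric])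
        then have "ennreal (phi x) * (a * ennreal (1 / phi x)) = a" for a
          by (metis mult.left_commute mult.right_neutral)
        then show "ennreal \<bar>phi x\<bar> * \<Theta> (x - real k * (0 + phi x * h) / 2) (0 + phi x * h)
          = H (x - real k * (h * phi x) / 2, h * phi x) * indicator A (h, x)"
          using e p unfolding \<Theta>_def by (simp add: indicator_def mult.commute [of h])
      qed
      finally show ?thesis .
    next
      case False
      then have "\<Theta> (x - real k * s / 2) s = 0" for s by (auto simp: \<Theta>_def steps_def)
      moreover have "indicator A (h, x) = (0::ennreal)" for h using False by (auto simp: A_def indicator_def)
      ultimately show ?thesis by simp
    qed
  qed
  also have "\<dots> = (\<integral>\<^sup>+h. \<integral>\<^sup>+x. H (x - real k * (h * phi x) / 2, h * phi x) * indicator A (h, x) \<partial>lborel \<partial>lborel)"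
    by (rule lborel_pair.Fubini') measurable
  finally show ?thesis unfolding A_def .
qed

text \<open>For fixed \<open>x\<close> each point of the difference is affine in \<open>h\<close>,
  so it avoids a null set for almost every \<open>h\<close>. The slope vanishes only for the middle
  point, which is \<open>x\<close> itself. Exchanging the order of the two quantifiers needs a
  measurable null set, hence \<open>N\<close>.\<close>

lemma AE_eq_at_steps:
  fixes f g :: "real \<Rightarrow> real"
  assumes eq: "AE x in lborel. x \<in> {-1..1} \<longrightarrow> f x = g x"
  shows "AE h in lborel. AE x in lborel. - 1 < x \<and> x < 1 \<longrightarrow>
    (\<forall>i\<le>k. x - real k * (h * phi x) / 2 + real i * (h * phi x) \<in> {-1..1} \<longrightarrow>
       f (x - real k * (h * phi x) / 2 + real i * (h * phi x)) = g (x - real k * (h * phi x) / 2 + real i * (h * phi x)))"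
proof -
  obtain N where N: "N \<in> null_sets lborel" and sub: "{x. \<not> (x \<in> {-1..1} \<longrightarrow> f x = g x)} \<subseteq> N"
    using eq by (auto simp: eventually_ae_filter)
  have Nm [measurable]: "N \<in> sets borel" using N by auto
  have AN: "AE x in lborel. x \<notin> N" using N by (rule AE_not_in)
  let ?y = "\<lambda>i h x. x - real k * (h * phi x) / 2 + real i * (h * phi x)"
  have "AE x in lborel. AE h in lborel. - 1 < x \<and> x < 1 \<longrightarrow> (\<forall>i\<le>k. ?y i h x \<notin> N)"
    using AN
  proof (rule eventually_mono)
    fix x assume x: "x \<notin> N"
    show "AE h in lborel. - 1 < x \<and> x < 1 \<longrightarrow> (\<forall>i\<le>k. ?y i h x \<notin> N)"
    proof (cases "- 1 < x \<and> x < 1")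
      case True
      then have p: "0 < phi x" using phi_pos by simp
      have "AE h in lborel. \<forall>i\<in>{..k}. ?y i h x \<notin> N"
      proof (intro AE_finite_allI ballI)
        fix i
        define c where "c = (real i - real k / 2) * phi x"
        have y: "?y i h x = x + c * h" for h by (simp add: c_def algebra_simps)
        show "AE h in lborel. ?y i h x \<notin> N"
        proof (cases "c = 0")
          case True
          then show ?thesis unfolding y using x by simp
        next
          case False
          show ?thesis unfolding y by (rule AE_borel_affine [OF False _ AN]) measurable
        qed
      qed simp
      then show ?thesis by (rule AE_mp) simp
    qed auto
  qed
  then have "AE h in lborel. AE x in lborel. - 1 < x \<and> x < 1 \<longrightarrow> (\<forall>i\<le>k. ?y i h x \<notin> N)"
    by (subst lborel_pair.AE_commute) measurable
  then show ?thesis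
  proof (rule eventually_mono)
    fix h assume "AE x in lborel. - 1 < x \<and> x < 1 \<longrightarrow> (\<forall>i\<le>k. ?y i h x \<notin> N)"
    then show "AE x in lborel. - 1 < x \<and> x < 1 \<longrightarrow> (\<forall>i\<le>k. ?y i h x \<in> {-1..1} \<longrightarrow> f (?y i h x) = g (?y i h x))"
    proof (rule AE_mp, intro AE_I2 impI allI)
      fix x i assume "- 1 < x \<and> x < 1 \<longrightarrow> (\<forall>i\<le>k. ?y i h x \<notin> N)" "- 1 < x \<and> x < 1" "i \<le> k" "?y i h x \<in> {-1..1}"
      then show "f (?y i h x) = g (?y i h x)" using sub by blast
    qed
  qed
qed

lemma fdiff_cong_points:
  "(\<And>i. i \<le> k \<Longrightarrow> f (y + real i * s) = g (y + real i * s)) \<Longrightarrow> fdiff k s f y = fdiff k s g y"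
  unfolding fdiff_def by (intro sum.cong) auto

text \<open>Expressions such as \<open>f (y + i * s)\<close> must be measurable in the plane.
  Composition guarantees this for Borel functions but not for Lebesgue measurable ones.\<close>

lemma borel_representative:
  fixes f :: "real \<Rightarrow> real"
  assumes "f \<in> borel_measurable (lebesgue_on {-1..1})"
  shows "\<exists>g\<in>borel_measurable borel. AE x in lborel. x \<in> {-1..1} \<longrightarrow> f x = g x"
proof -
  have "(\<lambda>x. if x \<in> {-1..1} then f x else 0) \<in> borel_measurable lebesgue"
    using assms by (subst borel_measurable_if) auto
  then have "\<exists>g\<in>borel_measurable lborel. AE x in lborel. (if x \<in> {-1..1} then f x else 0) = g x"
    by (rule completion_ex_borel_measurable_real)
  then obtain g where g: "g \<in> borel_measurable lborel" "AE x in lborel. (if x \<in> {-1..1} then f x else 0) = g x" by blast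
  have "AE x in lborel. x \<in> {-1..1} \<longrightarrow> f x = g x" using g(2) by (rule AE_mp) auto
  then show ?thesis using g(1) by auto
qed

text \<open>In the coordinates \<open>h\<close> and \<open>x\<close> this is the integral over
  \<open>0 <= h <= r\<close> of the \<open>P\<close>-th powers of the norms in the modulus; the
  factor \<open>1 / phi\<close> comes from the substitution.\<close>

definition step_energy :: "nat \<Rightarrow> real \<Rightarrow> real \<Rightarrow> real \<Rightarrow> real \<Rightarrow> (real \<Rightarrow> real) \<Rightarrow> ennreal" where
  "step_energy k r P \<alpha> \<beta> f = (\<integral>\<^sup>+z. ennreal ((step_weight \<alpha> \<beta> k (fst z) (snd z) * \<bar>fdiff k (snd z) f (fst z)\<bar>) powr P) *
     indicator (steps k r) z * ennreal (1 / phi (fst z + real k * snd z / 2)) \<partial>plane)"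

text \<open>The functions \<open>f\<close> and \<open>g\<close> agree only almost everywhere, so their differences along the curves
  \<open>x \<mapsto> x + c h \<phi> x\<close> need not agree almost everywhere for every \<open>h\<close>; by Fubini they do for almost
  every \<open>h\<close>, which is enough after averaging over \<open>h\<close>.\<close>

lemma steps_integral_le:
  fixes H :: "real \<Rightarrow> ennreal"
  assumes f [measurable]: "g \<in> borel_measurable borel" and eq: "AE x in lborel. x \<in> {-1..1} \<longrightarrow> f x = g x"
    and H [measurable]: "H \<in> borel_measurable borel" and r: "0 \<le> r"
    and b: "\<And>h. 0 \<le> h \<Longrightarrow> h \<le> r \<Longrightarrow>
      (\<integral>\<^sup>+x. H \<bar>shifted_weight \<alpha> \<beta> (real k * h) x * sym_diff_k k (h * phi x) f x\<bar> \<partial>I_measure) \<le> ennreal b"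
  shows "(\<integral>\<^sup>+z. H (step_weight \<alpha> \<beta> k (fst z) (snd z) * \<bar>fdiff k (snd z) g (fst z)\<bar>) *
     indicator (steps k r) z * ennreal (1 / phi (fst z + real k * snd z / 2)) \<partial>plane) \<le> ennreal b * ennreal r"
proof -
  define G where "G z = H (step_weight \<alpha> \<beta> k (fst z) (snd z) * \<bar>fdiff k (snd z) g (fst z)\<bar>)" for z
  have Gm [measurable]: "G \<in> borel_measurable plane" unfolding G_def by measurable
  define A where "A = {z. - 1 < snd z \<and> snd z < 1 \<and> 0 \<le> fst z \<and> fst z \<le> r \<and> - 1 \<le> snd z - real k * (fst z * phi (snd z)) / 2 \<and>
          snd z + real k * (fst z * phi (snd z)) / 2 \<le> 1}"
  have "(\<integral>\<^sup>+z. G z * indicator (steps k r) z * ennreal (1 / phi (fst z + real k * snd z / 2)) \<partial>plane)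
      = (\<integral>\<^sup>+h. \<integral>\<^sup>+x. G (x - real k * (h * phi x) / 2, h * phi x) * indicator A (h, x) \<partial>lborel \<partial>lborel)"
    unfolding A_def by (rule steps_integral_eq) measurable
  also have "\<dots> \<le> (\<integral>\<^sup>+h. ennreal b * indicator {0..r} h \<partial>lborel)"
    using AE_eq_at_steps [OF eq, of k]
  proof (intro nn_integral_mono_AE, elim AE_mp, intro AE_I2 impI)
    fix h
    assume ae: "AE x in lborel. - 1 < x \<and> x < 1 \<longrightarrow>
      (\<forall>i\<le>k. x - real k * (h * phi x) / 2 + real i * (h * phi x) \<in> {-1..1} \<longrightarrow>
       f (x - real k * (h * phi x) / 2 + real i * (h * phi x)) = g (x - real k * (h * phi x) / 2 + real i * (h * phi x)))"
    show "(\<integral>\<^sup>+x. G (x - real k * (h * phi x) / 2, h * phi x) * indicator A (h, x) \<partial>lborel) \<le> ennreal b * indicator {0..r} h"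
    proof (cases "h \<in> {0..r}")
      case h: True
      have "(\<integral>\<^sup>+x. G (x - real k * (h * phi x) / 2, h * phi x) * indicator A (h, x) \<partial>lborel)
        \<le> (\<integral>\<^sup>+x. H \<bar>shifted_weight \<alpha> \<beta> (real k * h) x * sym_diff_k k (h * phi x) f x\<bar> * indicator {-1..1} x \<partial>lborel)"
        using ae
      proof (intro nn_integral_mono_AE, elim AE_mp, intro AE_I2 impI)
        fix x
        assume pts: "- 1 < x \<and> x < 1 \<longrightarrow>
          (\<forall>i\<le>k. x - real k * (h * phi x) / 2 + real i * (h * phi x) \<in> {-1..1} \<longrightarrow>
           f (x - real k * (h * phi x) / 2 + real i * (h * phi x)) = g (x - real k * (h * phi x) / 2 + real i * (h * phi x)))"
        show "G (x - real k * (h * phi x) / 2, h * phi x) * indicator A (h, x)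
          \<le> H \<bar>shifted_weight \<alpha> \<beta> (real k * h) x * sym_diff_k k (h * phi x) f x\<bar> * indicator {-1..1} x"
        proof (cases "(h, x) \<in> A")
          case True
          then have x: "- 1 < x" "x < 1" and e: "- 1 \<le> x - real k * (h * phi x) / 2" "x + real k * (h * phi x) / 2 \<le> 1"
            by (auto simp: A_def)
          have s0: "0 \<le> h * phi x" using phi_pos [OF x] h by simp
          have "fdiff k (h * phi x) g (x - real k * (h * phi x) / 2) = fdiff k (h * phi x) f (x - real k * (h * phi x) / 2)"
          proof (rule fdiff_cong_points)
            fix i assume i: "i \<le> k"
            have "real i * (h * phi x) \<le> real k * (h * phi x)" "0 \<le> real i * (h * phi x)"
              using i s0 by (auto intro!: mult_right_mono)
            then have "x - real k * (h * phi x) / 2 + real i * (h * phi x) \<in> {-1..1}" using e by auto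
            then show "g (x - real k * (h * phi x) / 2 + real i * (h * phi x)) = f (x - real k * (h * phi x) / 2 + real i * (h * phi x))"
              using pts x i by simp
          qed
          moreover have "\<bar>sym_diff_k k (h * phi x) f x\<bar> = \<bar>fdiff k (h * phi x) f (x - real k * (h * phi x) / 2)\<bar>"
            by (rule sym_diff_k_eq_fdiff [OF e s0])
          moreover have "step_weight \<alpha> \<beta> k (x - real k * (h * phi x) / 2) (h * phi x) = shifted_weight \<alpha> \<beta> (real k * h) x"
            unfolding step_weight_def shifted_weight_def
            by (intro arg_cong2 [where f = "(*)"] arg_cong2 [where f = "(powr)"]) (auto simp: field_simps)
          moreover have "0 \<le> shifted_weight \<alpha> \<beta> (real k * h) x" by (simp add: shifted_weight_def)
          ultimately show ?thesis using x True by (simp add: G_def abs_mult)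
        qed simp
      qed
      also have "\<dots> = (\<integral>\<^sup>+x. H \<bar>shifted_weight \<alpha> \<beta> (real k * h) x * sym_diff_k k (h * phi x) f x\<bar> * indicator {-1..1} x \<partial>lebesgue)"
        by (rule nn_integral_completion [symmetric])
      also have "\<dots> = (\<integral>\<^sup>+x. H \<bar>shifted_weight \<alpha> \<beta> (real k * h) x * sym_diff_k k (h * phi x) f x\<bar> \<partial>I_measure)"
        by (rule nn_integral_restrict_space [symmetric]) simp
      also have "\<dots> \<le> ennreal b" using h by (intro b) auto
      finally show ?thesis using h by simp
    qed (auto simp: A_def)
  qed
  also have "\<dots> = ennreal b * ennreal r" using r by (subst nn_integral_cmult_indicator) auto
  finally show ?thesis unfolding G_def .
qed

lemma step_energy_le_modulus:
  assumes g: "g \<in> borel_measurable borel" and eq: "AE x in lborel. x \<in> {-1..1} \<longrightarrow> f x = g x"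
    and p: "p \<noteq> \<infinity>" "0 < enn2real p" and r: "0 \<le> r"
    and m: "modulus k f r \<alpha> \<beta> p \<le> ennreal \<omega>" and w: "0 \<le> \<omega>"
  shows "step_energy k r (enn2real p) \<alpha> \<beta> g \<le> ennreal (\<omega> powr enn2real p * r)"
proof -
  let ?P = "enn2real p"
  have "step_energy k r ?P \<alpha> \<beta> g \<le> ennreal (\<omega> powr ?P) * ennreal r"
    unfolding step_energy_def
  proof (rule steps_integral_le [where H = "\<lambda>y. ennreal (y powr ?P)", OF g eq _ r])
    fix h assume h: "0 \<le> h" "h \<le> r"
    let ?F = "\<lambda>x. shifted_weight \<alpha> \<beta> (real k * h) x * sym_diff_k k (h * phi x) f x"
    let ?J = "\<integral>\<^sup>+x. ennreal (\<bar>?F x\<bar> powr ?P) \<partial>I_measure"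
    have "Lp_norm p ?F \<le> modulus k f r \<alpha> \<beta> p"
      unfolding modulus_def using h by (intro SUP_upper) auto
    then have L: "Lp_norm p ?F \<le> ennreal \<omega>" using m by (rule order_trans)
    show "?J \<le> ennreal (\<omega> powr ?P)"
    proof (cases "?J = \<infinity>")
      case True
      then have "Lp_norm p ?F = \<infinity>" using p by (simp add: Lp_norm_def)
      then show ?thesis using L by (simp add: top_unique)
    next
      case False
      then have "Lp_norm p ?F = ennreal (enn2real ?J powr (1 / ?P))" using p by (simp add: Lp_norm_def Let_def)
      then have "enn2real ?J powr (1 / ?P) \<le> \<omega>" using L w by (simp add: ennreal_le_iff)
      then have "(enn2real ?J powr (1 / ?P)) powr ?P \<le> \<omega> powr ?P" using p by (intro powr_mono2) auto
      then have "enn2real ?J \<le> \<omega> powr ?P" using p by (simp add: powr_powr)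
      then have "ennreal (enn2real ?J) \<le> ennreal (\<omega> powr ?P)" by (rule ennreal_leI)
      moreover have "ennreal (enn2real ?J) = ?J" using False by (simp add: less_top)
      ultimately show ?thesis by metis
    qed
  qed measurable
  then show ?thesis using r by (simp add: ennreal_mult)
qed

abbreviation steps_bounded :: "nat \<Rightarrow> real \<Rightarrow> real \<Rightarrow> real \<Rightarrow> (real \<Rightarrow> real) \<Rightarrow> real \<Rightarrow> bool" where
  "steps_bounded k r \<alpha> \<beta> f \<omega> \<equiv> AE z in plane. z \<in> steps k r \<longrightarrow>
    step_weight \<alpha> \<beta> k (fst z) (snd z) * \<bar>fdiff k (snd z) f (fst z)\<bar> \<le> \<omega>"

text \<open>The bound is expressed as the vanishing of an integral, with \<open>H\<close> the
  indicator of the values above \<open>\<omega>\<close>; this lets the averaging lemma serve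
  \<open>p = \<infinity>\<close> too. Since \<open>1 / phi\<close> is positive on
  \<open>steps\<close>, it can be removed from the null integral.\<close>

lemma steps_AE_le_modulus:
  assumes g [measurable]: "g \<in> borel_measurable borel" and eq: "AE x in lborel. x \<in> {-1..1} \<longrightarrow> f x = g x"
    and r: "0 \<le> r" and m: "modulus k f r \<alpha> \<beta> \<infinity> \<le> ennreal \<omega>" and w: "0 \<le> \<omega>"
  shows "steps_bounded k r \<alpha> \<beta> g \<omega>"
proof -
  let ?H = "\<lambda>y::real. indicator {\<omega><..} y :: ennreal"
  let ?G = "\<lambda>z. ?H (step_weight \<alpha> \<beta> k (fst z) (snd z) * \<bar>fdiff k (snd z) g (fst z)\<bar>) *
     indicator (steps k r) z * ennreal (1 / phi (fst z + real k * snd z / 2))"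
  have "(\<integral>\<^sup>+z. ?G z \<partial>plane) \<le> ennreal 0 * ennreal r"
  proof (rule steps_integral_le [OF g eq _ r])
    fix h assume h: "0 \<le> h" "h \<le> r"
    let ?F = "\<lambda>x. shifted_weight \<alpha> \<beta> (real k * h) x * sym_diff_k k (h * phi x) f x"
    have "Lp_norm \<infinity> ?F \<le> modulus k f r \<alpha> \<beta> \<infinity>"
      unfolding modulus_def using h by (intro SUP_upper) auto
    then have es: "esssup I_measure (\<lambda>x. ennreal \<bar>?F x\<bar>) \<le> ennreal \<omega>"
      using order_trans [OF _ m] unfolding Lp_norm_def by simp
    have "AE x in I_measure. ennreal \<bar>?F x\<bar> \<le> ennreal \<omega>"
      using esssup_AE by (rule eventually_mono) (rule order_trans [OF _ es])
    then have "AE x in I_measure. ?H \<bar>?F x\<bar> = 0"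
    proof (rule eventually_mono)
      fix x assume "ennreal \<bar>?F x\<bar> \<le> ennreal \<omega>"
      then have "\<bar>?F x\<bar> \<le> \<omega>" using w by (simp only: ennreal_le_iff)
      then show "?H \<bar>?F x\<bar> = 0" by (simp add: indicator_def)
    qed
    then have "(\<integral>\<^sup>+x. ?H \<bar>?F x\<bar> \<partial>I_measure) = (\<integral>\<^sup>+x. 0 \<partial>I_measure)" by (rule nn_integral_cong_AE)
    then show "(\<integral>\<^sup>+x. ?H \<bar>?F x\<bar> \<partial>I_measure) \<le> ennreal 0" by simp
  qed measurable
  then have "(\<integral>\<^sup>+z. ?G z \<partial>plane) = 0" by simp
  then have "AE z in plane. ?G z = 0"
    by (subst (asm) nn_integral_0_iff_AE) auto
  then show ?thesis
  proof (rule AE_mp, intro AE_I2 impI)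
    fix z assume z: "?G z = 0" "z \<in> steps k r"
    then have "0 < phi (fst z + real k * snd z / 2)" by (intro phi_pos) (auto simp: steps_def)
    then have "ennreal (1 / phi (fst z + real k * snd z / 2)) \<noteq> 0" by (simp add: ennreal_eq_0_iff)
    then show "step_weight \<alpha> \<beta> k (fst z) (snd z) * \<bar>fdiff k (snd z) g (fst z)\<bar> \<le> \<omega>"
      using z by (auto simp: indicator_def split: if_splits)
  qed
qed

section \<open>Chebyshev nodes\<close>

lemma sin_ge_half:
  fixes x :: real
  assumes "0 \<le> x" "x \<le> pi / 2"
  shows "x / 2 \<le> sin x"
proof -
  have "convex_on {0..pi / 2} (\<lambda>x. - sin x)"
  proof (rule f''_ge0_imp_convex [where f' = "\<lambda>x. - cos x" and f'' = "\<lambda>x. sin x"])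
    show "((\<lambda>x. - sin x) has_real_derivative - cos x) (at x)" for x
      by (auto intro!: derivative_eq_intros)
    show "((\<lambda>x. - cos x) has_real_derivative sin x) (at x)" for x
      by (auto intro!: derivative_eq_intros)
    show "0 \<le> sin x" if "x \<in> {0..pi / 2}" for x using that by (intro sin_ge_zero) auto
  qed simp
  then have "- sin ((1 - x / (pi / 2)) *\<^sub>R 0 + (x / (pi / 2)) *\<^sub>R (pi / 2)) \<le> (1 - x / (pi / 2)) * (- sin 0) + (x / (pi / 2)) * (- sin (pi / 2))"
    using assms by (intro convex_onD) (auto simp: field_simps)
  then have "x / (pi / 2) \<le> sin x" by simp
  moreover have "pi * x \<le> 4 * x" using assms pi_less_4 by (intro mult_right_mono) auto
  then have "x / 2 \<le> x / (pi / 2)" by (simp add: field_simps)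
  ultimately show ?thesis by linarith
qed

text \<open>Numbered from right to left: cell \<open>j\<close> lies between
  \<open>node m (j + 1)\<close> and \<open>node m j\<close>, and cell 0 touches the endpoint
  1.\<close>

definition node :: "nat \<Rightarrow> nat \<Rightarrow> real" where
  "node m j = cos (real j * (pi / real m))"

lemma node_0 [simp]: "node m 0 = 1"
  by (simp add: node_def)

lemma node_range: "- 1 \<le> node m j" "node m j \<le> 1"
  by (simp_all add: node_def)

lemma node_less: "i < j \<Longrightarrow> j \<le> m \<Longrightarrow> node m j < node m i"
  unfolding node_def by (intro cos_monotone_0_pi) (auto simp: field_simps)

lemma node_le: "i \<le> j \<Longrightarrow> j \<le> m \<Longrightarrow> node m j \<le> node m i"
  using node_less [of i j m] by (cases "i = j") auto

lemma one_minus_node: "1 - node m j = 2 * (sin (real j * (pi / real m) / 2))\<^sup>2"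
  unfolding node_def using cos_double_sin [of "real j * (pi / real m) / 2"] by simp

lemma phi_sq: "- 1 \<le> c \<Longrightarrow> c \<le> 1 \<Longrightarrow> (phi c)\<^sup>2 = (1 - c) * (1 + c)"
proof -
  assume c: "- 1 \<le> c" "c \<le> 1"
  have e: "1 - c\<^sup>2 = (1 - c) * (1 + c)" by (simp add: power2_eq_square algebra_simps)
  have "0 \<le> (1 - c) * (1 + c)" using c by simp
  then show ?thesis unfolding phi_def e by simp
qed

text \<open>This translates the model cell to two consecutive cells of total length
  \<open>b\<close>. \<open>t\<close> is measured leftwards from \<open>node j\<close>, so in the
  image of \<open>(t, s)\<close> the point nearest to 1 is \<open>node j - b t\<close>, and the
  point nearest to -1 is the leftmost point of the difference. The weight is modelled by
  \<open>V * t powr a\<close>: in the end cell it is a genuine power (\<open>a = \<alpha>\<close>),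
  elsewhere it is comparable with a constant (\<open>a = 0\<close>). In \<open>K\<close>, the factor
  \<open>64 powr \<alpha>\<close> bounds the variation of the factor with \<open>\<alpha>\<close>,
  \<open>2 powr \<beta>\<close> that of the other factor, and 128 the quotient of \<open>phi\<close>
  by \<open>n b\<close>.\<close>

lemma right_cell:
  fixes n j k :: nat and \<alpha> \<beta> :: real
  assumes n: "1 \<le> n" and j: "j < 32 * n" and k: "1 \<le> k" and ab: "0 \<le> \<alpha>" "0 \<le> \<beta>"
    and b: "b = node (64 * n) j - node (64 * n) (j + 2)" and K: "K = 64 powr \<alpha> * 2 powr \<beta> * 128"
  shows "0 < b \<and> (\<exists>V>0. \<exists>a\<in>{0, \<alpha>}.
    (\<forall>t. 0 < t \<longrightarrow> t \<le> 1 \<longrightarrow> jacobi_weight \<alpha> \<beta> (node (64 * n) j - b * t) \<le> K * V * t powr a) \<and>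
    (\<forall>t s. 0 < t \<longrightarrow> 0 \<le> s \<longrightarrow> t + real k * s \<le> 5 / 4 \<longrightarrow>
      (node (64 * n) j - b * (t + real k * s), b * s) \<in> steps k (1 / real n) \<and>
      V * t powr a \<le> K * step_weight \<alpha> \<beta> k (node (64 * n) j - b * (t + real k * s)) (b * s) \<and>
      phi (node (64 * n) j - b * (t + real k * s) + real k * (b * s) / 2) \<le> K * real n * b \<and>
      node (64 * n) (j + 3) \<le> node (64 * n) j - b * (t + real k * s)))"
proof -
  define \<delta> where "\<delta> = pi / real (64 * n)"
  define x where "x = node (64 * n)"
  \<comment> \<open>The angle halfway between those of the nodes \<open>j\<close> and
    \<open>j + 2\<close>; it makes \<open>b\<close> the product
    \<open>2 * sin A * sin \<delta>\<close>, and \<open>b\<close> is comparable with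
    \<open>A * \<delta>\<close>.\<close>
  define A where "A = (real j + 1) * \<delta>"
  have nr: "1 \<le> real n" using n by simp
  have d0: "0 < \<delta>" using n by (simp add: \<delta>_def)
  have nd: "real n * \<delta> = pi / 64" using nr by (simp add: \<delta>_def)
  have "1 * \<delta> \<le> real n * \<delta>" using nr d0 by (intro mult_right_mono) auto
  then have d64: "\<delta> \<le> pi / 64" using nd by linarith
  have d64': "\<delta> \<le> 0.05" using d64 pi_approx(2) by simp
  have A: "0 < A" "A \<le> pi / 2"
  proof -
    have "real j + 1 \<le> 32 * real n" using j by linarith
    then have "A \<le> 32 * real n * \<delta>" unfolding A_def using d0 by (intro mult_right_mono) auto
    then show "A \<le> pi / 2" using nd by simp
  qed (use d0 in \<open>simp add: A_def add_nonneg_pos\<close>)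
  have jm: "j + 3 \<le> 64 * n" using j n by linarith
  have sd: "\<delta> / 2 \<le> sin \<delta>" "sin \<delta> \<le> \<delta>" "0 < sin \<delta>"
    using sin_ge_half [of \<delta>] sin_x_le_x [of \<delta>] sin_gt_zero [of \<delta>] d0 d64 pi_gt_zero by auto
  have sA: "A / 2 \<le> sin A" "sin A \<le> A" "0 < sin A"
    using sin_ge_half [of A] sin_x_le_x [of A] sin_gt_zero [of A] A by auto
  have bs: "b = 2 * sin A * sin \<delta>"
  proof -
    have 1: "(real j * \<delta> + real (j + 2) * \<delta>) / 2 = A" "(real (j + 2) * \<delta> - real j * \<delta>) / 2 = \<delta>"
      by (simp_all add: A_def algebra_simps)
    show ?thesis unfolding b node_def cos_diff_cos \<delta>_def [symmetric] 1 ..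
  qed
  have b0: "0 < b" unfolding bs using sA sd by simp
  have bl: "A * \<delta> / 2 \<le> b" unfolding bs using mult_mono [OF sA(1) sd(1)] sA d0 by simp
  have bu: "b \<le> 2 * A * \<delta>" unfolding bs using mult_mono [OF sA(2) sd(2)] A sd by simp
  \<comment> \<open>The next cell has length at least \<open>b / 4\<close>. This is the room beyond
    the double cell that allows \<open>t + k s\<close> up to 5/4.\<close>
  have G1: "b / 4 \<le> x (j + 2) - x (j + 3)"
  proof -
    have e: "x (j + 2) - x (j + 3) = 2 * sin (A + 3 / 2 * \<delta>) * sin (\<delta> / 2)"
    proof -
      have 1: "(real (j + 2) * \<delta> + real (j + 3) * \<delta>) / 2 = A + 3 / 2 * \<delta>"
        "(real (j + 3) * \<delta> - real (j + 2) * \<delta>) / 2 = \<delta> / 2"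
        by (simp_all add: A_def algebra_simps)
      show ?thesis unfolding x_def node_def cos_diff_cos \<delta>_def [symmetric] 1 ..
    qed
    have "sin A * cos (3 / 2 * \<delta>) \<le> sin (A + 3 / 2 * \<delta>)"
      unfolding sin_add using A d0 d64' pi_gt3 by (auto intro!: mult_nonneg_nonneg cos_ge_zero sin_ge_zero)
    moreover have "1 / 2 \<le> cos (3 / 2 * \<delta>)"
      using cos_monotone_0_pi_le [of "3 / 2 * \<delta>" "pi / 3"] d0 d64 by (simp add: cos_60)
    then have "sin A * (1 / 2) \<le> sin A * cos (3 / 2 * \<delta>)" using sA by (intro mult_left_mono) auto
    ultimately have 1: "sin A / 2 \<le> sin (A + 3 / 2 * \<delta>)" by linarith
    have "sin \<delta> = 2 * sin (\<delta> / 2) * cos (\<delta> / 2)" using sin_double [of "\<delta> / 2"] by simp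
    also have "\<dots> \<le> 2 * sin (\<delta> / 2) * 1"
      using d0 d64 by (intro mult_left_mono) (auto intro!: sin_ge_zero)
    finally have 2: "sin \<delta> / 2 \<le> sin (\<delta> / 2)" by simp
    have "sin A / 2 * (sin \<delta> / 2) \<le> sin (A + 3 / 2 * \<delta>) * sin (\<delta> / 2)"
      using 1 2 sA sd by (intro mult_mono) auto
    then show ?thesis unfolding e bs by simp
  qed
  \<comment> \<open>As \<open>j < 32 n\<close>, the angle of node \<open>j + 3\<close> is at most
    two thirds of \<open>pi\<close>. Staying to the right of \<open>-1/2\<close> keeps
    \<open>(1 + y) powr \<beta>\<close> between constants.\<close>
  have G2: "- 1 / 2 \<le> x (j + 3)"
  proof -
    have "real (j + 3) * \<delta> = A + 2 * \<delta>" by (simp add: A_def algebra_simps)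
    also have "\<dots> \<le> 2 * pi / 3" using A d64 pi_gt_zero by simp
    finally have "cos (2 * pi / 3) \<le> cos (real (j + 3) * \<delta>)"
      using d0 by (intro cos_monotone_0_pi_le) auto
    then show ?thesis by (simp add: x_def node_def \<delta>_def cos_120)
  qed
  have lo: "x (j + 3) \<le> x j - b * (t + real k * s)" if "t + real k * s \<le> 5 / 4" for t s
  proof -
    have "b * (t + real k * s) \<le> b * (5 / 4)" using b0 that by (intro mult_left_mono) auto
    moreover have "x j - b = x (j + 2)" by (simp add: b x_def)
    ultimately show ?thesis using G1 by linarith
  qed
  have oneminus: "1 - x (j + 3) \<le> 9 / 2 * A\<^sup>2"
  proof -
    have "\<bar>sin (real (j + 3) * \<delta> / 2)\<bar> \<le> \<bar>real (j + 3) * \<delta> / 2\<bar>" by (rule abs_sin_x_le_abs_x)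
    also have "\<dots> \<le> \<bar>3 * A / 2\<bar>"
    proof -
      have "real (j + 3) * \<delta> \<le> (3 * (real j + 1)) * \<delta>" using d0 by (intro mult_right_mono) auto
      then show ?thesis using d0 A by (simp add: A_def)
    qed
    finally have "(sin (real (j + 3) * \<delta> / 2))\<^sup>2 \<le> (3 * A / 2)\<^sup>2" by (simp only: abs_le_square_iff)
    then show ?thesis unfolding x_def one_minus_node \<delta>_def by (simp add: power2_eq_square)
  qed
  have phiU: "phi c \<le> 128 * real n * b" if c: "x (j + 3) \<le> c" "c \<le> 1" for c
  proof -
    have "- 1 \<le> c" using G2 c by simp
    then have "(phi c)\<^sup>2 = (1 - c) * (1 + c)" using phi_sq c by simp
    also have "\<dots> \<le> (1 - x (j + 3)) * 2" using c \<open>- 1 \<le> c\<close> by (intro mult_mono) auto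
    also have "\<dots> \<le> (3 * A)\<^sup>2" using oneminus by (simp add: power2_eq_square)
    finally have "phi c \<le> 3 * A" by (rule power2_le_imp_le) (use A in simp)
    also have "\<dots> \<le> 128 * real n * (A * \<delta> / 2)"
    proof -
      have "128 * real n * (A * \<delta> / 2) = 64 * A * (real n * \<delta>)" by simp
      also have "\<dots> = A * pi" unfolding nd by simp
      finally show ?thesis using A pi_gt3 by simp
    qed
    also have "\<dots> \<le> 128 * real n * b" using bl by (intro mult_left_mono) auto
    finally show ?thesis .
  qed
  have xj1: "x j \<le> 1" by (simp add: x_def node_range)
  have in_steps: "(x j - b * (t + real k * s), b * s) \<in> steps k (1 / real n)"
    if t: "0 < t" and s: "0 \<le> s" and ts: "t + real k * s \<le> 5 / 4" for t s
  proof -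
    let ?y = "x j - b * (t + real k * s)"
    define c where "c = ?y + real k * (b * s) / 2"
    have ks0: "0 \<le> real k * s" using s by simp
    have kbs: "0 \<le> real k * (b * s)" using b0 s by simp
    have c1: "c = x j - b * t - real k * (b * s) / 2" by (simp add: c_def algebra_simps)
    have bt: "0 < b * t" using b0 t by simp
    have y: "x (j + 3) \<le> ?y" by (rule lo [OF ts])
    have c2: "x (j + 3) \<le> c" "c < x j" "c < 1" using y kbs bt c1 xj1 unfolding c_def by auto
    have k1: "b * s \<le> real k * (b * s)" using k b0 s mult_right_mono [of 1 "real k" "b * s"] by simp
    have k2: "real k * (b * s) \<le> 5 / 4 * b"
    proof -
      have "real k * s \<le> 5 / 4" using ts t by simp
      then have "b * (real k * s) \<le> b * (5 / 4)" using b0 by (intro mult_left_mono) auto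
      then show ?thesis by (simp add: algebra_simps)
    qed
    have cc: "- 1 \<le> c" using c2 G2 by simp
    have psq: "(phi c)\<^sup>2 = (1 - c) * (1 + c)" using phi_sq cc c2 by simp
    have "b * s \<le> 1 / real n * phi c"
    \<comment> \<open>In the end cell \<open>phi\<close> tends to 0, so the step is measured against
      its own distance from 1: the centre \<open>c\<close> is at least \<open>k b s / 2\<close>
      away, hence the square of \<open>phi c\<close> is at least \<open>k b s / 4\<close>, and this
      dominates the square of \<open>n b s\<close> because \<open>n^2 b\<close> is at most
      1/128.\<close>
    proof (cases "j = 0")
      case True
      have 1: "real k * (b * s) / 2 \<le> 1 - c" using c1 bt True by (simp add: x_def)
      have "real k * (b * s) / 2 * (1 / 2) \<le> (1 - c) * (1 + c)"
        using 1 c2 G2 kbs by (intro mult_mono) auto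
      moreover have "(real n * (b * s))\<^sup>2 \<le> real k * (b * s) / 2 * (1 / 2)"
      proof -
        have "b \<le> 2 * \<delta>\<^sup>2" using bu True by (simp add: A_def power2_eq_square)
        then have "(real n)\<^sup>2 * b \<le> (real n)\<^sup>2 * (2 * \<delta>\<^sup>2)" by (intro mult_left_mono) auto
        also have "\<dots> = 2 * (real n * \<delta>)\<^sup>2" by (simp add: power_mult_distrib)
        also have "\<dots> \<le> 2 * (1 / 16)\<^sup>2" unfolding nd using pi_less_4
          by (intro mult_left_mono power_mono) auto
        finally have nb: "(real n)\<^sup>2 * b \<le> 1 / 128" by (simp add: power2_eq_square)
        have "(real n)\<^sup>2 * (b * s) \<le> (real n)\<^sup>2 * (5 / 4 * b)" using k1 k2 by (intro mult_left_mono) auto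
        also have "\<dots> = 5 / 4 * ((real n)\<^sup>2 * b)" by simp
        also have "\<dots> \<le> 1 / 4" using nb by linarith
        also have "\<dots> \<le> real k / 4" using k by simp
        finally have "(real n)\<^sup>2 * (b * s) * (b * s) \<le> real k / 4 * (b * s)"
          using b0 s by (intro mult_right_mono) auto
        then show ?thesis by (simp add: power2_eq_square algebra_simps)
      qed
      ultimately have "(real n * (b * s))\<^sup>2 \<le> (phi c)\<^sup>2" using psq by linarith
      then have "real n * (b * s) \<le> phi c"
        by (rule power2_le_imp_le) (use c2 cc in \<open>auto simp: phi_def abs_square_le_1\<close>)
      then show ?thesis using nr by (simp add: field_simps)
    next
      case False
      have jd: "real j * \<delta> / 2 / 2 \<le> sin (real j * \<delta> / 2)"
      proof (rule sin_ge_half)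
        have "real j * \<delta> \<le> A" using d0 by (simp add: A_def)
        then show "real j * \<delta> / 2 \<le> pi / 2" using A by simp
      qed (use d0 in simp)
      have "A \<le> 2 * (real j * \<delta>)"
      proof -
        have "(real j + 1) * \<delta> \<le> (2 * real j) * \<delta>" using False d0 by (intro mult_right_mono) auto
        then show ?thesis by (simp add: A_def)
      qed
      then have "A / 8 \<le> sin (real j * \<delta> / 2)" using jd by linarith
      then have "(A / 8)\<^sup>2 \<le> (sin (real j * \<delta> / 2))\<^sup>2" using A by (intro power_mono) auto
      also have "\<dots> = (1 - x j) * (1 / 2)" unfolding x_def one_minus_node \<delta>_def by simp
      also have "\<dots> \<le> (1 - c) * (1 + c)" using c2 G2 xj1 by (intro mult_mono) auto
      finally have "(A / 8)\<^sup>2 \<le> (phi c)\<^sup>2" using psq by simp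
      then have p: "A / 8 \<le> phi c" by (rule power2_le_imp_le) (use c2 cc in \<open>auto simp: phi_def abs_square_le_1\<close>)
      \<comment> \<open>This comparison decides the mesh: it comes down to
        \<open>5/2 * pi/64 <= 1/8\<close>.\<close>
      have "real n * (b * s) \<le> real n * (5 / 4 * (2 * A * \<delta>))"
        using k1 k2 bu by (intro mult_left_mono) auto
      also have "\<dots> = 5 / 2 * A * (real n * \<delta>)" by simp
      also have "\<dots> \<le> A / 8" unfolding nd using A pi_approx(2) by (simp add: field_simps)
      also note p
      finally show ?thesis using nr by (simp add: field_simps)
    qed
    then show ?thesis
      unfolding steps_def using y G2 c2 cc kbs b0 s bt xj1 ks0 unfolding c_def
      by (auto simp: algebra_simps)
  qed
  have K1: "1 \<le> 64 powr \<alpha>" "1 \<le> 2 powr \<beta>" using ab by (simp_all add: ge_one_powr_ge_zero)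
  have K128: "128 \<le> K" unfolding K using mult_mono [OF K1] by simp
  have Kab: "64 powr \<alpha> * 2 powr \<beta> \<le> K" unfolding K by simp
  have K0: "0 < K" using K128 by simp
  have phiK: "phi (x j - b * (t + real k * s) + real k * (b * s) / 2) \<le> K * real n * b"
    if t: "0 < t" and s: "0 \<le> s" and ts: "t + real k * s \<le> 5 / 4" for t s
  proof -
    have "phi (x j - b * (t + real k * s) + real k * (b * s) / 2) \<le> 128 * real n * b"
    proof (rule phiU)
      have "0 \<le> real k * (b * s)" using b0 s by simp
      then show "x (j + 3) \<le> x j - b * (t + real k * s) + real k * (b * s) / 2"
        using lo [OF ts] by linarith
      have "x j - b * (t + real k * s) + real k * (b * s) / 2 = x j - b * t - real k * (b * s) / 2"
        by (simp add: algebra_simps)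
      also have "\<dots> \<le> 1" using xj1 b0 s t by (simp add: add_increasing2 diff_le_eq)
      finally show "x j - b * (t + real k * s) + real k * (b * s) / 2 \<le> 1" .
    qed
    also have "\<dots> \<le> K * real n * b" using K128 b0 by (intro mult_right_mono) auto
    finally show ?thesis .
  qed
  have b2: "(1 + y) powr \<beta> \<le> 2 powr \<beta>" "1 \<le> 2 powr \<beta> * (1 + y) powr \<beta>" if "x (j + 3) \<le> y" "y \<le> 1" for y
  proof -
    have y: "1 / 2 \<le> 1 + y" "1 + y \<le> 2" using that G2 by auto
    show "(1 + y) powr \<beta> \<le> 2 powr \<beta>" using y ab by (intro powr_mono2) auto
    have "2 powr \<beta> * (1 / 2) powr \<beta> \<le> 2 powr \<beta> * (1 + y) powr \<beta>"
      using y ab by (intro mult_left_mono powr_mono2) auto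
    moreover have "2 powr \<beta> * (1 / 2) powr \<beta> = (1::real)" by (simp add: powr_mult [symmetric])
    ultimately show "1 \<le> 2 powr \<beta> * (1 + y) powr \<beta>" by simp
  qed
  have "\<exists>V>0. \<exists>a\<in>{0, \<alpha>}.
    (\<forall>t. 0 < t \<longrightarrow> t \<le> 1 \<longrightarrow> (1 - (x j - b * t)) powr \<alpha> \<le> 64 powr \<alpha> * (V * t powr a)) \<and>
    (\<forall>t s. 0 < t \<longrightarrow> 0 \<le> s \<longrightarrow> t + real k * s \<le> 5 / 4 \<longrightarrow> V * t powr a \<le> (1 - (x j - b * t)) powr \<alpha>)"
  proof (cases "j = 0")
    case True
    have bp: "0 < b powr \<alpha>" using b0 by simp
    show ?thesis
    proof (rule exI [of _ "b powr \<alpha>"], rule conjI [OF bp], rule bexI [of _ \<alpha>], intro conjI allI impI)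
      fix t :: real
      assume t: "0 < t"
      have e: "(1 - (x j - b * t)) powr \<alpha> = b powr \<alpha> * t powr \<alpha>"
        using True b0 t by (simp add: x_def powr_mult)
      then show "b powr \<alpha> * t powr \<alpha> \<le> (1 - (x j - b * t)) powr \<alpha>" by simp
      show "(1 - (x j - b * t)) powr \<alpha> \<le> 64 powr \<alpha> * (b powr \<alpha> * t powr \<alpha>)"
        unfolding e using mult_right_mono [OF K1(1), of "b powr \<alpha> * t powr \<alpha>"] by simp
    qed simp
  next
    case False
    define Z where "Z = 1 - x j"
    have Z0: "0 < Z" using node_less [of 0 j "64 * n"] False jm by (simp add: Z_def x_def)
    \<comment> \<open>This 64 is the square of 8 and has nothing to do with the mesh: the sines of
      half the angles at nodes \<open>j + 3\<close> and \<open>j\<close> differ by at most the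
      factor 8.\<close>
    have Z64: "1 - x (j + 3) \<le> 64 * Z"
    proof -
      have "\<bar>sin (real (j + 3) * \<delta> / 2)\<bar> \<le> \<bar>real (j + 3) * \<delta> / 2\<bar>" by (rule abs_sin_x_le_abs_x)
      also have "\<dots> \<le> 8 * (real j * \<delta> / 2 / 2)"
      proof -
        have "real (j + 3) * \<delta> \<le> (4 * real j) * \<delta>" using False d0 by (intro mult_right_mono) auto
        then show ?thesis using d0 by simp
      qed
      also have "real j * \<delta> / 2 / 2 \<le> sin (real j * \<delta> / 2)"
      proof (rule sin_ge_half)
        have "real j * \<delta> \<le> A" using d0 by (simp add: A_def)
        then show "real j * \<delta> / 2 \<le> pi / 2" using A by simp
      qed (use d0 in simp)
      finally have "\<bar>sin (real (j + 3) * \<delta> / 2)\<bar> \<le> \<bar>8 * sin (real j * \<delta> / 2)\<bar>" by simp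
      then have "(sin (real (j + 3) * \<delta> / 2))\<^sup>2 \<le> (8 * sin (real j * \<delta> / 2))\<^sup>2" by (simp only: abs_le_square_iff)
      then show ?thesis unfolding x_def Z_def one_minus_node \<delta>_def by (simp add: power2_eq_square)
    qed
    have Zp: "0 < Z powr \<alpha>" using Z0 by simp
    show ?thesis
    proof (rule exI [of _ "Z powr \<alpha>"], rule conjI [OF Zp], rule bexI [of _ 0], intro conjI allI impI)
      fix t :: real
      assume t: "0 < t"
      have bt: "0 < b * t" using b0 t by simp
      show "Z powr \<alpha> * t powr 0 \<le> (1 - (x j - b * t)) powr \<alpha>"
        using t bt Z0 ab by (simp add: Z_def) (intro powr_mono2, auto)
      assume t1: "t \<le> 1"
      have "x (j + 3) \<le> x j - b * t" using lo [of t 0] t1 by simp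
      then have "1 - (x j - b * t) \<le> 64 * Z" using Z64 by linarith
      then have "(1 - (x j - b * t)) powr \<alpha> \<le> (64 * Z) powr \<alpha>"
        using ab bt xj1 by (intro powr_mono2) auto
      then show "(1 - (x j - b * t)) powr \<alpha> \<le> 64 powr \<alpha> * (Z powr \<alpha> * t powr 0)"
        using Z0 t by (simp add: powr_mult)
    qed simp
  qed
  then obtain V a where V: "0 < V" "a \<in> {0, \<alpha>}"
    and up: "\<And>t. 0 < t \<Longrightarrow> t \<le> 1 \<Longrightarrow> (1 - (x j - b * t)) powr \<alpha> \<le> 64 powr \<alpha> * (V * t powr a)"
    and dn: "\<And>t s. 0 < t \<Longrightarrow> 0 \<le> s \<Longrightarrow> t + real k * s \<le> 5 / 4 \<Longrightarrow> V * t powr a \<le> (1 - (x j - b * t)) powr \<alpha>"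
    by blast
  have wu: "jacobi_weight \<alpha> \<beta> (x j - b * t) \<le> K * V * t powr a" if t: "0 < t" "t \<le> 1" for t
  proof -
    have y: "x (j + 3) \<le> x j - b * t" using lo [of t 0] t by simp
    have y1: "x j - b * t \<le> 1" using xj1 b0 t by (smt (verit) mult_pos_pos)
    have "jacobi_weight \<alpha> \<beta> (x j - b * t) \<le> 64 powr \<alpha> * (V * t powr a) * 2 powr \<beta>"
      unfolding jacobi_weight_def using up [OF t] b2(1) [OF y y1] V by (intro mult_mono) auto
    also have "\<dots> = (64 powr \<alpha> * 2 powr \<beta>) * (V * t powr a)" by simp
    also have "\<dots> \<le> K * (V * t powr a)" using Kab V by (intro mult_right_mono) auto
    finally show ?thesis by (simp add: mult.assoc)
  qed
  have wl: "V * t powr a \<le> K * step_weight \<alpha> \<beta> k (x j - b * (t + real k * s)) (b * s)"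
    if t: "0 < t" and s: "0 \<le> s" and ts: "t + real k * s \<le> 5 / 4" for t s
  proof -
    let ?y = "x j - b * (t + real k * s)"
    have y: "x (j + 3) \<le> ?y" by (rule lo [OF ts])
    have y1: "?y \<le> 1" using xj1 b0 t s by (smt (verit) mult_nonneg_nonneg of_nat_0_le_iff)
    have e: "1 - ?y - real k * (b * s) = 1 - (x j - b * t)" by (simp add: algebra_simps)
    have "V * t powr a * 1 \<le> (1 - (x j - b * t)) powr \<alpha> * (2 powr \<beta> * (1 + ?y) powr \<beta>)"
      using dn [OF t s ts] b2(2) [OF y y1] by (intro mult_mono) auto
    also have "\<dots> = 2 powr \<beta> * step_weight \<alpha> \<beta> k ?y (b * s)" unfolding step_weight_def e by simp
    also have "\<dots> \<le> K * step_weight \<alpha> \<beta> k ?y (b * s)"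
    proof (rule mult_right_mono)
      have "1 * 2 powr \<beta> \<le> 64 powr \<alpha> * 2 powr \<beta>" using K1 by (intro mult_right_mono) auto
      then show "2 powr \<beta> \<le> K" using Kab by linarith
    qed simp
    finally show ?thesis by simp
  qed
  show ?thesis
    unfolding x_def [symmetric]
  proof (rule conjI [OF b0], rule exI [of _ V], rule conjI [OF V(1)], rule bexI [OF _ V(2)], intro conjI allI impI)
  qed ((fact wu in_steps wl phiK)+, rule lo)
qed

section \<open>Approximation on the cells\<close>

lemma nn_integral_plane_affine:
  fixes h :: "real \<times> real \<Rightarrow> ennreal"
  assumes [measurable]: "h \<in> borel_measurable plane" and b: "0 < b"
  shows "(\<integral>\<^sup>+z. h z \<partial>plane) =
    ennreal (b * b) * (\<integral>\<^sup>+z. h (x0 - b * (fst z + c * snd z), b * snd z) \<partial>plane)"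
proof -
  have [measurable]: "(\<lambda>s. \<integral>\<^sup>+y. h (y, s) \<partial>lborel) \<in> borel_measurable borel" by measurable
  have "(\<integral>\<^sup>+z. h z \<partial>plane) = (\<integral>\<^sup>+s. \<integral>\<^sup>+y. h (y, s) \<partial>lborel \<partial>lborel)"
    by (subst lborel_pair.nn_integral_snd [symmetric]) auto
  also have "\<dots> = ennreal \<bar>b\<bar> * (\<integral>\<^sup>+s. \<integral>\<^sup>+y. h (y, 0 + b * s) \<partial>lborel \<partial>lborel)"
    using b by (intro nn_integral_real_affine [where f = "\<lambda>s. \<integral>\<^sup>+y. h (y, s) \<partial>lborel"]) auto
  also have "(\<integral>\<^sup>+s. \<integral>\<^sup>+y. h (y, 0 + b * s) \<partial>lborel \<partial>lborel) =
     (\<integral>\<^sup>+s. ennreal b * (\<integral>\<^sup>+t. h (x0 - b * (t + c * s), b * s) \<partial>lborel) \<partial>lborel)"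
  proof (rule nn_integral_cong)
    fix s
    have "(\<integral>\<^sup>+y. h (y, 0 + b * s) \<partial>lborel) = ennreal \<bar>- b\<bar> * (\<integral>\<^sup>+t. h (x0 - b * (c * s) + - b * t, 0 + b * s) \<partial>lborel)"
      using b by (intro nn_integral_real_affine [where f = "\<lambda>y. h (y, 0 + b * s)"]) auto
    moreover have "(\<integral>\<^sup>+t. h (x0 - b * (c * s) + - b * t, 0 + b * s) \<partial>lborel) = (\<integral>\<^sup>+t. h (x0 - b * (t + c * s), b * s) \<partial>lborel)"
      by (intro nn_integral_cong) (simp add: algebra_simps)
    ultimately show "(\<integral>\<^sup>+y. h (y, 0 + b * s) \<partial>lborel) = ennreal b * (\<integral>\<^sup>+t. h (x0 - b * (t + c * s), b * s) \<partial>lborel)"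
      using b by simp
  qed
  also have "\<dots> = ennreal b * (\<integral>\<^sup>+s. \<integral>\<^sup>+t. h (x0 - b * (t + c * s), b * s) \<partial>lborel \<partial>lborel)"
    by (rule nn_integral_cmult) measurable
  also have "(\<integral>\<^sup>+s. \<integral>\<^sup>+t. h (x0 - b * (t + c * s), b * s) \<partial>lborel \<partial>lborel) =
     (\<integral>\<^sup>+z. h (x0 - b * (fst z + c * snd z), b * snd z) \<partial>plane)"
    by (subst lborel_pair.nn_integral_snd [symmetric]) auto
  finally show ?thesis using b by (simp add: ennreal_mult mult.assoc)
qed

text \<open>The cell coordinate runs to the left, so the first point of a difference in
  \<open>t\<close> is the rightmost point of the original one. The leftmost one,
  \<open>x0 - b (t + k s)\<close>, appears on the right-hand side.\<close>

lemma fdiff_affine_backwards: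
  "\<bar>fdiff k s (\<lambda>t. f (x0 - b * t)) t\<bar> = \<bar>fdiff k (b * s) f (x0 - b * (t + real k * s))\<bar>"
proof -
  have "fdiff k s (\<lambda>t. f (x0 - b * t)) t = fdiff k (- (b * s)) f (x0 - b * (t + real k * s) + real k * (b * s))"
    unfolding fdiff_def by (simp add: algebra_simps)
  then show ?thesis using fdiff_reflect [of k "b * s" f] by simp
qed

abbreviation weighted_error :: "real \<Rightarrow> real \<Rightarrow> real \<Rightarrow> (real \<Rightarrow> real) \<Rightarrow> real poly \<Rightarrow> real set \<Rightarrow> ennreal" where
  "weighted_error \<alpha> \<beta> P f q S \<equiv>
    \<integral>\<^sup>+x. ennreal ((jacobi_weight \<alpha> \<beta> x * \<bar>f x - poly q x\<bar>) powr P) * indicator S x \<partial>lborel"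

definition energy_density :: "nat \<Rightarrow> real \<Rightarrow> real \<Rightarrow> real \<Rightarrow> real \<Rightarrow> (real \<Rightarrow> real) \<Rightarrow> real \<times> real \<Rightarrow> ennreal" where
  "energy_density k r P \<alpha> \<beta> f z = ennreal ((step_weight \<alpha> \<beta> k (fst z) (snd z) * \<bar>fdiff k (snd z) f (fst z)\<bar>) powr P) *
     indicator (steps k r) z * ennreal (1 / phi (fst z + real k * snd z / 2))"

lemma step_energy_eq: "step_energy k r P \<alpha> \<beta> f = (\<integral>\<^sup>+z. energy_density k r P \<alpha> \<beta> f z \<partial>plane)"
  by (simp add: step_energy_def energy_density_def)

lemma measurable_energy_density [measurable]:
  assumes [measurable]: "f \<in> borel_measurable borel"
  shows "energy_density k r P \<alpha> \<beta> f \<in> borel_measurable plane"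
  unfolding energy_density_def [abs_def] by measurable

lemma measurable_jacobi_weight [measurable]: "jacobi_weight \<alpha> \<beta> \<in> borel_measurable borel"
  unfolding jacobi_weight_def [abs_def] by measurable

lemma jacobi_weight_nonneg [simp]: "0 \<le> jacobi_weight \<alpha> \<beta> x"
  by (simp add: jacobi_weight_def)

text \<open>All dependence on the cell cancels: the plane contributes \<open>b^(-2)\<close>, the
  line \<open>b\<close>, the bound on \<open>phi\<close> the factor \<open>n b\<close>, and the
  powers of \<open>V\<close> from the two sides of the weight comparison are reciprocal. One factor
  \<open>n\<close> remains.\<close>

lemma right_cell_whitney_Lp:
  fixes k :: nat and \<alpha> \<beta> P :: real
  assumes k: "1 \<le> k" and ab: "0 \<le> \<alpha>" "0 \<le> \<beta>" and P: "0 < P"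
  shows "\<exists>C>0. \<forall>n\<ge>1. \<forall>j<32 * n. \<forall>f\<in>borel_measurable borel. \<forall>e\<ge>0.
    (\<integral>\<^sup>+z. energy_density k (1 / real n) P \<alpha> \<beta> f z * indicator {node (64 * n) (j + 3)..node (64 * n) j} (fst z) \<partial>plane) \<le> ennreal e \<longrightarrow>
    (\<exists>q. degree q < k \<and> weighted_error \<alpha> \<beta> P f q {node (64 * n) (j + 2)..node (64 * n) j} \<le> ennreal (C * real n * e))"
proof -
  have ex: "\<exists>C>0. \<forall>f\<in>borel_measurable borel. \<forall>e\<ge>0. cell_energy k (a * P) P (1 + 1 / 4) f \<le> ennreal e \<longrightarrow>
    (\<exists>q. degree q < k \<and>
      (\<integral>\<^sup>+t. ennreal (t powr (a * P) * \<bar>f t - poly q t\<bar> powr P) * indicator {0..1} t \<partial>lborel) \<le> ennreal (C * e))"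
    if "a \<in> {0, \<alpha>}" for a
    using that ab P by (intro local_whitney_Lp k) auto
  define Cw where "Cw a = (SOME C. C > 0 \<and> (\<forall>f\<in>borel_measurable borel. \<forall>e\<ge>0. cell_energy k (a * P) P (1 + 1 / 4) f \<le> ennreal e \<longrightarrow>
    (\<exists>q. degree q < k \<and>
      (\<integral>\<^sup>+t. ennreal (t powr (a * P) * \<bar>f t - poly q t\<bar> powr P) * indicator {0..1} t \<partial>lborel) \<le> ennreal (C * e))))" for a
  have Cw: "Cw a > 0" "\<And>f e. f \<in> borel_measurable borel \<Longrightarrow> 0 \<le> e \<Longrightarrow> cell_energy k (a * P) P (1 + 1 / 4) f \<le> ennreal e \<Longrightarrow>
    (\<exists>q. degree q < k \<and>
      (\<integral>\<^sup>+t. ennreal (t powr (a * P) * \<bar>f t - poly q t\<bar> powr P) * indicator {0..1} t \<partial>lborel) \<le> ennreal (Cw a * e))"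
    if "a \<in> {0, \<alpha>}" for a
    using someI_ex [OF ex [OF that]] unfolding Cw_def [symmetric] by blast+
  define K where "K = 64 powr \<alpha> * 2 powr \<beta> * (128 :: real)"
  have K0: "0 < K" by (simp add: K_def)
  \<comment> \<open>The exponent \<open>a\<close> depends on the cell but takes only two values;
    adding both constants gives one for all cells.\<close>
  define C where "C = (Cw 0 + Cw \<alpha>) * (K powr P * K powr P * K)"
  have C0: "0 < C" unfolding C_def using Cw(1) K0 by (intro mult_pos_pos add_pos_pos) auto
  show ?thesis
  proof (rule exI [of _ C], rule conjI [OF C0], intro allI impI ballI)
    fix n j :: nat and f :: "real \<Rightarrow> real" and e :: real
    assume n: "1 \<le> n" and j: "j < 32 * n" and f [measurable]: "f \<in> borel_measurable borel" and e: "0 \<le> e"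
    let ?x = "node (64 * n)"
    assume E: "(\<integral>\<^sup>+z. energy_density k (1 / real n) P \<alpha> \<beta> f z * indicator {?x (j + 3)..?x j} (fst z) \<partial>plane) \<le> ennreal e"
    define b where "b = ?x j - ?x (j + 2)"
    obtain V a where b0: "0 < b" and V: "0 < V" and a: "a \<in> {0, \<alpha>}"
      and wu: "\<And>t. 0 < t \<Longrightarrow> t \<le> 1 \<Longrightarrow> jacobi_weight \<alpha> \<beta> (?x j - b * t) \<le> K * V * t powr a"
      and cell: "\<And>t s. 0 < t \<Longrightarrow> 0 \<le> s \<Longrightarrow> t + real k * s \<le> 5 / 4 \<Longrightarrow>
      (?x j - b * (t + real k * s), b * s) \<in> steps k (1 / real n) \<and>
      V * t powr a \<le> K * step_weight \<alpha> \<beta> k (?x j - b * (t + real k * s)) (b * s) \<and>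
      phi (?x j - b * (t + real k * s) + real k * (b * s) / 2) \<le> K * real n * b \<and>
      ?x (j + 3) \<le> ?x j - b * (t + real k * s)"
      using right_cell [OF n j k ab b_def K_def] by blast
    have a0: "0 \<le> a" using a ab by auto
    define g where "g t = f (?x j - b * t)" for t
    have gm [measurable]: "g \<in> borel_measurable borel" unfolding g_def by measurable
    define \<Theta> where "\<Theta> z = energy_density k (1 / real n) P \<alpha> \<beta> f z * indicator {?x (j + 3)..?x j} (fst z)" for z :: "real \<times> real"
    have Tm [measurable]: "\<Theta> \<in> borel_measurable plane" unfolding \<Theta>_def by measurable
    let ?T = "\<lambda>z. (?x j - b * (fst z + real k * snd z), b * snd z)"
    define L where "L = (K / V) powr P * (K * real n * b)"
    have L0: "0 \<le> L" unfolding L_def using K0 b0 by simp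
    have nr: "0 < real n" using n by simp
    have "cell_energy k (a * P) P (1 + 1 / 4) g \<le> (\<integral>\<^sup>+z. ennreal L * \<Theta> (?T z) \<partial>plane)"
      unfolding cell_energy_def
    proof (rule nn_integral_mono)
      fix z :: "real \<times> real"
      obtain t s where z: "z = (t, s)" by (cases z)
      let ?R = "{z. 0 \<le> fst z \<and> 0 \<le> snd z \<and> fst z + real k * snd z \<le> 1 + 1 / 4}"
      show "ennreal (fst z powr (a * P) * \<bar>fdiff k (snd z) g (fst z)\<bar> powr P) * indicator ?R z \<le> ennreal L * \<Theta> (?T z)"
      proof (cases "z \<in> ?R \<and> 0 < t")
        case True
        then have ts: "0 < t" "0 \<le> s" "t + real k * s \<le> 5 / 4" using z by auto
        let ?y = "?x j - b * (t + real k * s)"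
        let ?c = "?y + real k * (b * s) / 2"
        let ?D = "\<bar>fdiff k (b * s) f ?y\<bar>"
        have st: "(?y, b * s) \<in> steps k (1 / real n)" and v: "V * t powr a \<le> K * step_weight \<alpha> \<beta> k ?y (b * s)"
          and ph: "phi ?c \<le> K * real n * b" and lo: "?x (j + 3) \<le> ?y" using cell [OF ts] by auto
        have hi: "?y \<le> ?x j" using b0 ts by simp
        have phc: "0 < phi ?c" using st by (intro phi_pos) (auto simp: steps_def)
        have "t powr (a * P) * ?D powr P = (t powr a * ?D) powr P" using ts by (simp add: powr_mult powr_powr)
        also have "\<dots> \<le> (K / V * (step_weight \<alpha> \<beta> k ?y (b * s) * ?D)) powr P"
        proof (rule powr_mono2)
          have "t powr a \<le> K / V * step_weight \<alpha> \<beta> k ?y (b * s)" using v V by (simp add: field_simps)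
          then have "t powr a * ?D \<le> K / V * step_weight \<alpha> \<beta> k ?y (b * s) * ?D" by (rule mult_right_mono) simp
          then show "t powr a * ?D \<le> K / V * (step_weight \<alpha> \<beta> k ?y (b * s) * ?D)" by (simp only: mult.assoc)
        qed (use P in auto)
        also have "\<dots> = (K / V) powr P * (step_weight \<alpha> \<beta> k ?y (b * s) * ?D) powr P"
          by (subst powr_mult) (use K0 V in auto)
        also have "\<dots> \<le> (K / V) powr P * ((step_weight \<alpha> \<beta> k ?y (b * s) * ?D) powr P * (K * real n * b * (1 / phi ?c)))"
        proof (rule mult_left_mono)
          have "1 \<le> K * real n * b * (1 / phi ?c)" using ph phc by (simp add: field_simps)
          then have "(step_weight \<alpha> \<beta> k ?y (b * s) * ?D) powr P * 1 \<le> (step_weight \<alpha> \<beta> k ?y (b * s) * ?D) powr P * (K * real n * b * (1 / phi ?c))"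
            by (rule mult_left_mono) simp
          then show "(step_weight \<alpha> \<beta> k ?y (b * s) * ?D) powr P \<le> (step_weight \<alpha> \<beta> k ?y (b * s) * ?D) powr P * (K * real n * b * (1 / phi ?c))" by simp
        qed simp
        also have "\<dots> = L * ((step_weight \<alpha> \<beta> k ?y (b * s) * ?D) powr P * (1 / phi ?c))"
          by (simp add: L_def)
        finally have "ennreal (t powr (a * P) * ?D powr P) \<le> ennreal (L * ((step_weight \<alpha> \<beta> k ?y (b * s) * ?D) powr P * (1 / phi ?c)))"
          by (rule ennreal_leI)
        also have "\<dots> = ennreal L * (ennreal ((step_weight \<alpha> \<beta> k ?y (b * s) * ?D) powr P) * ennreal (1 / phi ?c))"
          using L0 phc by (simp add: ennreal_mult del: times_divide_eq_right)
        also have "\<dots> = ennreal L * \<Theta> (?T z)"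
          using st lo hi by (simp add: \<Theta>_def energy_density_def z)
        finally have "ennreal (t powr (a * P) * ?D powr P) \<le> ennreal L * \<Theta> (?T z)" .
        moreover have "\<bar>fdiff k s g t\<bar> = ?D" unfolding g_def by (rule fdiff_affine_backwards)
        ultimately show ?thesis using True z by simp
      next
        case False
        then have "z \<notin> ?R \<or> t = 0" using z by auto
        then show ?thesis using z by auto
      qed
    qed
    also have "\<dots> = ennreal L * (\<integral>\<^sup>+z. \<Theta> (?T z) \<partial>plane)"
      by (rule nn_integral_cmult) measurable
    also have "(\<integral>\<^sup>+z. \<Theta> (?T z) \<partial>plane) = ennreal (1 / (b * b)) * (ennreal (b * b) * (\<integral>\<^sup>+z. \<Theta> (?T z) \<partial>plane))"
      using b0 by (simp add: mult.assoc [symmetric] ennreal_mult [symmetric])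
    also have "ennreal (b * b) * (\<integral>\<^sup>+z. \<Theta> (?T z) \<partial>plane) = (\<integral>\<^sup>+z. \<Theta> z \<partial>plane)"
      by (rule nn_integral_plane_affine [OF Tm b0, symmetric])
    also have "ennreal L * (ennreal (1 / (b * b)) * (\<integral>\<^sup>+z. \<Theta> z \<partial>plane)) \<le> ennreal L * (ennreal (1 / (b * b)) * ennreal e)"
      using E unfolding \<Theta>_def by (intro mult_left_mono) auto
    also have "\<dots> = ennreal (L * (1 / (b * b) * e))"
      using L0 b0 e by (simp add: ennreal_mult [symmetric])
    finally have ce: "cell_energy k (a * P) P (1 + 1 / 4) g \<le> ennreal (L * (1 / (b * b) * e))" .
    obtain q where q: "degree q < k" and qe: "(\<integral>\<^sup>+t. ennreal (t powr (a * P) * \<bar>g t - poly q t\<bar> powr P) * indicator {0..1} t \<partial>lborel)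
       \<le> ennreal (Cw a * (L * (1 / (b * b) * e)))"
      using Cw(2) [OF a gm _ ce] L0 b0 e by auto
    define r where "r = pcompose q [:?x j / b, - 1 / b:]"
    have rx: "poly r x = poly q ((?x j - x) / b)" for x
      by (simp add: r_def poly_pcompose diff_divide_distrib)
    have dr: "degree r < k" using q b0 by (simp add: r_def degree_pcompose)
    have "(\<integral>\<^sup>+x. ennreal ((jacobi_weight \<alpha> \<beta> x * \<bar>f x - poly r x\<bar>) powr P) * indicator {?x (j + 2)..?x j} x \<partial>lborel)
      = ennreal \<bar>- b\<bar> * (\<integral>\<^sup>+t. ennreal ((jacobi_weight \<alpha> \<beta> (?x j + - b * t) * \<bar>f (?x j + - b * t) - poly r (?x j + - b * t)\<bar>) powr P) *
          indicator {?x (j + 2)..?x j} (?x j + - b * t) \<partial>lborel)"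
      using b0 by (intro nn_integral_real_affine [where f = "\<lambda>x. ennreal ((jacobi_weight \<alpha> \<beta> x * \<bar>f x - poly r x\<bar>) powr P) * indicator {?x (j + 2)..?x j} x"]) auto
    also have "\<dots> \<le> ennreal \<bar>- b\<bar> * (\<integral>\<^sup>+t. ennreal ((K * V) powr P) * (ennreal (t powr (a * P) * \<bar>g t - poly q t\<bar> powr P) * indicator {0..1} t) \<partial>lborel)"
    proof (intro mult_left_mono nn_integral_mono_AE)
      \<comment> \<open>At \<open>t = 0\<close> the convention \<open>0 powr 0 = 0\<close> would
        make the bound on the weight false, so this single point is discarded.\<close>
      have "AE t in lborel. t \<noteq> (0::real)" by (rule AE_lborel_singleton)
      then show "AE t in lborel. ennreal ((jacobi_weight \<alpha> \<beta> (?x j + - b * t) * \<bar>f (?x j + - b * t) - poly r (?x j + - b * t)\<bar>) powr P) *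
          indicator {?x (j + 2)..?x j} (?x j + - b * t)
        \<le> ennreal ((K * V) powr P) * (ennreal (t powr (a * P) * \<bar>g t - poly q t\<bar> powr P) * indicator {0..1} t)"
      proof (rule eventually_mono)
        fix t :: real assume t0: "t \<noteq> 0"
        have iff: "?x j + - b * t \<in> {?x (j + 2)..?x j} \<longleftrightarrow> t \<in> {0..1}"
        proof -
          have "?x (j + 2) = ?x j - b" by (simp add: b_def)
          then have "?x j + - b * t \<in> {?x (j + 2)..?x j} \<longleftrightarrow> b * t \<le> b * 1 \<and> 0 \<le> b * t" by auto
          also have "\<dots> \<longleftrightarrow> t \<in> {0..1}" using b0 by (simp add: zero_le_mult_iff) auto
          finally show ?thesis .
        qed
        show "ennreal ((jacobi_weight \<alpha> \<beta> (?x j + - b * t) * \<bar>f (?x j + - b * t) - poly r (?x j + - b * t)\<bar>) powr P) *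
          indicator {?x (j + 2)..?x j} (?x j + - b * t)
        \<le> ennreal ((K * V) powr P) * (ennreal (t powr (a * P) * \<bar>g t - poly q t\<bar> powr P) * indicator {0..1} t)"
        proof (cases "t \<in> {0..1}")
          case True
          then have t: "0 < t" "t \<le> 1" using t0 by auto
          have gq: "\<bar>f (?x j + - b * t) - poly r (?x j + - b * t)\<bar> = \<bar>g t - poly q t\<bar>"
            unfolding rx g_def using b0 by simp
          have "(jacobi_weight \<alpha> \<beta> (?x j + - b * t) * \<bar>g t - poly q t\<bar>) powr P \<le> (K * V * t powr a * \<bar>g t - poly q t\<bar>) powr P"
            using wu [OF t] P by (intro powr_mono2 mult_right_mono) auto
          also have "\<dots> = (K * V) powr P * (t powr (a * P) * \<bar>g t - poly q t\<bar> powr P)"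
            using K0 V t by (simp add: powr_mult powr_powr)
          finally show ?thesis unfolding gq using True iff
            by (simp add: ennreal_mult [symmetric] ennreal_leI)
        qed (use iff in auto)
      qed
    qed simp
    also have "\<dots> = ennreal b * (ennreal ((K * V) powr P) * (\<integral>\<^sup>+t. (ennreal (t powr (a * P) * \<bar>g t - poly q t\<bar> powr P) * indicator {0..1} t) \<partial>lborel))"
      using b0 by (subst nn_integral_cmult) auto
    also have "\<dots> \<le> ennreal b * (ennreal ((K * V) powr P) * ennreal (Cw a * (L * (1 / (b * b) * e))))"
      by (intro mult_left_mono qe) auto
    also have "\<dots> = ennreal (b * ((K * V) powr P * (Cw a * (L * (1 / (b * b) * e)))))"
      using b0 L0 e Cw(1) [OF a] by (simp add: ennreal_mult [symmetric])
    also have "\<dots> \<le> ennreal (C * real n * e)"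
    proof (rule ennreal_leI)
      have "(K * V) powr P * (K / V) powr P = K powr P * K powr P" using K0 V by (simp add: powr_mult powr_divide)
      moreover have "b * ((K * V) powr P * (Cw a * (L * (1 / (b * b) * e)))) = Cw a * (((K * V) powr P * (K / V) powr P) * K) * real n * e"
        unfolding L_def using b0 by (simp add: field_simps)
      ultimately have "b * ((K * V) powr P * (Cw a * (L * (1 / (b * b) * e)))) = Cw a * (K powr P * K powr P * K) * real n * e" by simp
      also have "\<dots> \<le> C * real n * e"
      proof -
        have "Cw a \<le> Cw 0 + Cw \<alpha>" using a Cw(1) [of 0] Cw(1) [of \<alpha>] by auto
        then show ?thesis unfolding C_def using K0 e by (intro mult_right_mono) auto
      qed
      finally show "b * ((K * V) powr P * (Cw a * (L * (1 / (b * b) * e)))) \<le> C * real n * e" .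
    qed
    finally show "\<exists>q. degree q < k \<and> weighted_error \<alpha> \<beta> P f q {?x (j + 2)..?x j} \<le> ennreal (C * real n * e)"
      using dr by blast
  qed
qed

text \<open>An almost sure property is the vanishing of the integral of an indicator, so the
  substitution formula for integrals carries it over.\<close>

lemma AE_plane_affine:
  assumes Q: "Measurable.pred plane Q" and ae: "AE z in plane. Q z" and b: "0 < b"
  shows "AE z in plane. Q (x0 - b * (fst z + c * snd z), b * snd z)"
proof -
  note Q [measurable]
  define h where "h z = (if Q z then 0 else 1 :: ennreal)" for z
  have hm [measurable]: "h \<in> borel_measurable plane" unfolding h_def by measurable
  have "AE z in plane. h z = 0" using ae by (rule eventually_mono) (simp add: h_def)
  then have "(\<integral>\<^sup>+z. h z \<partial>plane) = 0" by (subst nn_integral_0_iff_AE) auto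
  moreover have "\<not> b * b \<le> 0" using mult_pos_pos [OF b b] by linarith
  ultimately have "(\<integral>\<^sup>+z. h (x0 - b * (fst z + c * snd z), b * snd z) \<partial>plane) = 0"
    unfolding nn_integral_plane_affine [OF hm b, of x0 c] by (simp add: ennreal_eq_0_iff)
  then have "AE z in plane. h (x0 - b * (fst z + c * snd z), b * snd z) = 0"
    by (subst (asm) nn_integral_0_iff_AE) auto
  then show ?thesis by (rule eventually_mono) (simp add: h_def split: if_splits)
qed

text \<open>The same transfer for \<open>p = \<infinity>\<close>. Without integration no power of
  \<open>b\<close> or \<open>n\<close> arises, and only the two weight comparisons contribute, which
  gives \<open>K * K\<close>.\<close>

lemma right_cell_whitney_sup:
  fixes k :: nat and \<alpha> \<beta> :: real
  assumes k: "1 \<le> k" and ab: "0 \<le> \<alpha>" "0 \<le> \<beta>"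
  shows "\<exists>C>0. \<forall>n\<ge>1. \<forall>j<32 * n. \<forall>f\<in>borel_measurable borel. \<forall>\<omega>\<ge>0.
    steps_bounded k (1 / real n) \<alpha> \<beta> f \<omega> \<longrightarrow>
    (\<exists>q. degree q < k \<and> (AE x in lborel. x \<in> {node (64 * n) (j + 2)..node (64 * n) j} \<longrightarrow>
        jacobi_weight \<alpha> \<beta> x * \<bar>f x - poly q x\<bar> \<le> C * \<omega>))"
proof -
  have ex: "\<exists>C>0. \<forall>f\<in>borel_measurable borel. \<forall>\<epsilon>\<ge>0.
    (AE z in plane. 0 \<le> fst z \<and> 0 \<le> snd z \<and> fst z + real k * snd z \<le> 1 + 1 / 4 \<longrightarrow>
       fst z powr a * \<bar>fdiff k (snd z) f (fst z)\<bar> \<le> \<epsilon>) \<longrightarrow>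
    (\<exists>q. degree q < k \<and> (AE t in lborel. t \<in> {0..1} \<longrightarrow> t powr a * \<bar>f t - poly q t\<bar> \<le> C * \<epsilon>))"
    if "a \<in> {0, \<alpha>}" for a
    using that ab by (intro local_whitney_sup k) auto
  define Cw where "Cw a = (SOME C. C > 0 \<and> (\<forall>f\<in>borel_measurable borel. \<forall>\<epsilon>\<ge>0.
    (AE z in plane. 0 \<le> fst z \<and> 0 \<le> snd z \<and> fst z + real k * snd z \<le> 1 + 1 / 4 \<longrightarrow>
       fst z powr a * \<bar>fdiff k (snd z) f (fst z)\<bar> \<le> \<epsilon>) \<longrightarrow>
    (\<exists>q. degree q < k \<and> (AE t in lborel. t \<in> {0..1} \<longrightarrow> t powr a * \<bar>f t - poly q t\<bar> \<le> C * \<epsilon>))))" for a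
  have Cw: "Cw a > 0" "\<And>f \<epsilon>. f \<in> borel_measurable borel \<Longrightarrow> 0 \<le> \<epsilon> \<Longrightarrow>
    (AE z in plane. 0 \<le> fst z \<and> 0 \<le> snd z \<and> fst z + real k * snd z \<le> 1 + 1 / 4 \<longrightarrow>
       fst z powr a * \<bar>fdiff k (snd z) f (fst z)\<bar> \<le> \<epsilon>) \<Longrightarrow>
    (\<exists>q. degree q < k \<and> (AE t in lborel. t \<in> {0..1} \<longrightarrow> t powr a * \<bar>f t - poly q t\<bar> \<le> Cw a * \<epsilon>))"
    if "a \<in> {0, \<alpha>}" for a
    using someI_ex [OF ex [OF that]] unfolding Cw_def [symmetric] by blast+
  define K where "K = 64 powr \<alpha> * 2 powr \<beta> * (128 :: real)"
  have K0: "0 < K" by (simp add: K_def)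
  define C where "C = (Cw 0 + Cw \<alpha>) * (K * K)"
  have C0: "0 < C" unfolding C_def using Cw(1) K0 by (intro mult_pos_pos add_pos_pos) auto
  show ?thesis
  proof (rule exI [of _ C], rule conjI [OF C0], intro allI impI ballI)
    fix n j :: nat and f :: "real \<Rightarrow> real" and \<omega> :: real
    assume n: "1 \<le> n" and j: "j < 32 * n" and f [measurable]: "f \<in> borel_measurable borel" and w: "0 \<le> \<omega>"
    let ?x = "node (64 * n)"
    assume E: "steps_bounded k (1 / real n) \<alpha> \<beta> f \<omega>"
    define b where "b = ?x j - ?x (j + 2)"
    obtain V a where b0: "0 < b" and V: "0 < V" and a: "a \<in> {0, \<alpha>}"
      and wu: "\<And>t. 0 < t \<Longrightarrow> t \<le> 1 \<Longrightarrow> jacobi_weight \<alpha> \<beta> (?x j - b * t) \<le> K * V * t powr a"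
      and cell: "\<And>t s. 0 < t \<Longrightarrow> 0 \<le> s \<Longrightarrow> t + real k * s \<le> 5 / 4 \<Longrightarrow>
      (?x j - b * (t + real k * s), b * s) \<in> steps k (1 / real n) \<and>
      V * t powr a \<le> K * step_weight \<alpha> \<beta> k (?x j - b * (t + real k * s)) (b * s) \<and>
      phi (?x j - b * (t + real k * s) + real k * (b * s) / 2) \<le> K * real n * b \<and>
      ?x (j + 3) \<le> ?x j - b * (t + real k * s)"
      using right_cell [OF n j k ab b_def K_def] by blast
    define g where "g t = f (?x j - b * t)" for t
    have gm [measurable]: "g \<in> borel_measurable borel" unfolding g_def by measurable
    have "AE z in plane. (?x j - b * (fst z + real k * snd z), b * snd z) \<in> steps k (1 / real n) \<longrightarrow>
       step_weight \<alpha> \<beta> k (?x j - b * (fst z + real k * snd z)) (b * snd z) * \<bar>fdiff k (b * snd z) f (?x j - b * (fst z + real k * snd z))\<bar> \<le> \<omega>"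
    proof -
      have "Measurable.pred plane
          (\<lambda>z. z \<in> steps k (1 / real n) \<longrightarrow> step_weight \<alpha> \<beta> k (fst z) (snd z) * \<bar>fdiff k (snd z) f (fst z)\<bar> \<le> \<omega>)"
        by measurable
      from AE_plane_affine [OF this E b0, of "?x j" "real k"] show ?thesis by simp
    qed
    then have "AE z in plane. 0 \<le> fst z \<and> 0 \<le> snd z \<and> fst z + real k * snd z \<le> 1 + 1 / 4 \<longrightarrow>
       fst z powr a * \<bar>fdiff k (snd z) g (fst z)\<bar> \<le> K / V * \<omega>"
    proof (rule eventually_mono, intro impI)
      fix z :: "real \<times> real"
      obtain t s where z: "z = (t, s)" by (cases z)
      let ?y = "?x j - b * (fst z + real k * snd z)"
      assume ae: "(?y, b * snd z) \<in> steps k (1 / real n) \<longrightarrow> step_weight \<alpha> \<beta> k ?y (b * snd z) * \<bar>fdiff k (b * snd z) f ?y\<bar> \<le> \<omega>"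
        and R: "0 \<le> fst z \<and> 0 \<le> snd z \<and> fst z + real k * snd z \<le> 1 + 1 / 4"
      show "fst z powr a * \<bar>fdiff k (snd z) g (fst z)\<bar> \<le> K / V * \<omega>"
      proof (cases "fst z = 0")
        case False
        then have ts: "0 < fst z" "0 \<le> snd z" "fst z + real k * snd z \<le> 5 / 4" using R by auto
        have fd: "\<bar>fdiff k (snd z) g (fst z)\<bar> = \<bar>fdiff k (b * snd z) f ?y\<bar>" unfolding g_def by (rule fdiff_affine_backwards)
        have le: "fst z powr a \<le> K / V * step_weight \<alpha> \<beta> k ?y (b * snd z)" using cell [OF ts] V by (simp add: field_simps)
        have "fst z powr a * \<bar>fdiff k (snd z) g (fst z)\<bar> \<le> K / V * step_weight \<alpha> \<beta> k ?y (b * snd z) * \<bar>fdiff k (b * snd z) f ?y\<bar>"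
          unfolding fd by (rule mult_right_mono [OF le]) simp
        also have "\<dots> = K / V * (step_weight \<alpha> \<beta> k ?y (b * snd z) * \<bar>fdiff k (b * snd z) f ?y\<bar>)" by simp
        also have "\<dots> \<le> K / V * \<omega>" using ae cell [OF ts] K0 V by (intro mult_left_mono) auto
        finally show ?thesis .
      qed (use K0 V w in simp)
    qed
    then obtain q where q: "degree q < k" and qe: "AE t in lborel. t \<in> {0..1} \<longrightarrow> t powr a * \<bar>g t - poly q t\<bar> \<le> Cw a * (K / V * \<omega>)"
      using Cw(2) [OF a gm, of "K / V * \<omega>"] K0 V w by auto
    define r where "r = pcompose q [:?x j / b, - 1 / b:]"
    have rx: "poly r x = poly q ((?x j - x) / b)" for x
      by (simp add: r_def poly_pcompose diff_divide_distrib)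
    have dr: "degree r < k" using q b0 by (simp add: r_def degree_pcompose)
    have "AE t in lborel. t \<noteq> (0::real)" by (rule AE_lborel_singleton)
    with qe have "AE t in lborel. t \<in> {0..1} \<longrightarrow> t \<noteq> 0 \<and> t powr a * \<bar>g t - poly q t\<bar> \<le> Cw a * (K / V * \<omega>)"
      by eventually_elim simp
    then have "AE x in lborel. ?x j / b + - (1 / b) * x \<in> {0..1} \<longrightarrow> ?x j / b + - (1 / b) * x \<noteq> 0 \<and>
       (?x j / b + - (1 / b) * x) powr a * \<bar>g (?x j / b + - (1 / b) * x) - poly q (?x j / b + - (1 / b) * x)\<bar> \<le> Cw a * (K / V * \<omega>)"
      using b0 by (intro AE_borel_affine [where P = "\<lambda>t. t \<in> {0..1} \<longrightarrow> t \<noteq> 0 \<and> t powr a * \<bar>g t - poly q t\<bar> \<le> Cw a * (K / V * \<omega>)"]) auto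
    then have "AE x in lborel. x \<in> {?x (j + 2)..?x j} \<longrightarrow> jacobi_weight \<alpha> \<beta> x * \<bar>f x - poly r x\<bar> \<le> C * \<omega>"
    proof (rule eventually_mono, intro impI)
      fix x
      define t where "t = (?x j - x) / b"
      have e: "?x j / b + - (1 / b) * x = t" by (simp add: t_def diff_divide_distrib)
      assume "?x j / b + - (1 / b) * x \<in> {0..1} \<longrightarrow> ?x j / b + - (1 / b) * x \<noteq> 0 \<and>
       (?x j / b + - (1 / b) * x) powr a * \<bar>g (?x j / b + - (1 / b) * x) - poly q (?x j / b + - (1 / b) * x)\<bar> \<le> Cw a * (K / V * \<omega>)"
        and x: "x \<in> {?x (j + 2)..?x j}"
      then have ae: "t \<in> {0..1} \<longrightarrow> t \<noteq> 0 \<and> t powr a * \<bar>g t - poly q t\<bar> \<le> Cw a * (K / V * \<omega>)" unfolding e by blast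
      have "t \<in> {0..1}" using x b0 by (simp add: t_def b_def divide_le_eq)
      then have t: "0 < t" "t \<le> 1" and tq: "t powr a * \<bar>g t - poly q t\<bar> \<le> Cw a * (K / V * \<omega>)" using ae by auto
      have xt: "x = ?x j - b * t" using b0 by (simp add: t_def)
      have "\<bar>f x - poly r x\<bar> = \<bar>g t - poly q t\<bar>" unfolding rx g_def t_def using b0 by simp
      then have "jacobi_weight \<alpha> \<beta> x * \<bar>f x - poly r x\<bar> \<le> K * V * t powr a * \<bar>g t - poly q t\<bar>"
        using wu [OF t] xt by (simp add: mult_right_mono)
      also have "\<dots> = K * V * (t powr a * \<bar>g t - poly q t\<bar>)" by simp
      also have "\<dots> \<le> K * V * (Cw a * (K / V * \<omega>))" using tq K0 V by (intro mult_left_mono) auto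
      also have "\<dots> = Cw a * (K * K) * \<omega>" using V by simp
      also have "\<dots> \<le> C * \<omega>"
      proof -
        have "Cw a \<le> Cw 0 + Cw \<alpha>" using a Cw(1) [of 0] Cw(1) [of \<alpha>] by auto
        then show ?thesis unfolding C_def using K0 w by (intro mult_right_mono) auto
      qed
      finally show "jacobi_weight \<alpha> \<beta> x * \<bar>f x - poly r x\<bar> \<le> C * \<omega>" .
    qed
    then show "\<exists>q. degree q < k \<and> (AE x in lborel. x \<in> {?x (j + 2)..?x j} \<longrightarrow>
        jacobi_weight \<alpha> \<beta> x * \<bar>f x - poly q x\<bar> \<le> C * \<omega>)"
      using dr by blast
  qed
qed

section \<open>Polynomial approximation of step functions\<close>

lemma chebyshev_exists: "\<exists>p::real poly. degree p \<le> l \<and> (\<forall>u. poly p (cos u) = cos (real l * u))"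
proof (induction l rule: less_induct)
  case (less l)
  consider "l = 0" | "l = 1" | m where "l = Suc (Suc m)" by (metis One_nat_def not0_implies_Suc)
  then show ?case
  proof cases
    case 1
    then show ?thesis by (intro exI [of _ 1]) simp
  next
    case 2
    then show ?thesis by (intro exI [of _ "[:0, 1:]"]) simp
  next
    case 3
    obtain p where p: "degree p \<le> m" "\<And>u. poly p (cos u) = cos (real m * u)" using less [of m] 3 by auto
    obtain q where q: "degree q \<le> Suc m" "\<And>u. poly q (cos u) = cos (real (Suc m) * u)" using less [of "Suc m"] 3 by auto
    have "degree ([:0, 2:] * q - p) \<le> l"
      using p(1) q(1) 3 degree_mult_le [of "[:0, 2:]" q] by (intro degree_diff_le) auto
    moreover have "poly ([:0, 2:] * q - p) (cos u) = cos (real l * u)" for u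
    proof -
      have 1: "real l * u = real (Suc m) * u + u" "real m * u = real (Suc m) * u - u"
        by (simp_all add: 3 algebra_simps)
      have "cos (real l * u) + cos (real m * u) = 2 * cos u * cos (real (Suc m) * u)"
        unfolding 1 cos_add cos_diff by simp
      then show ?thesis by (simp add: p(2) q(2) algebra_simps)
    qed
    ultimately show ?thesis by blast
  qed
qed

definition cos_sum :: "nat \<Rightarrow> (real \<Rightarrow> real) \<Rightarrow> bool" where
  "cos_sum L f \<longleftrightarrow> (\<exists>a. \<forall>u. f u = (\<Sum>l\<le>L. a l * cos (real l * u)))"

lemma cos_sum_add: "cos_sum L f \<Longrightarrow> cos_sum L g \<Longrightarrow> cos_sum L (\<lambda>u. f u + g u)"
proof -
  assume "cos_sum L f" "cos_sum L g"
  then obtain a b where "\<And>u. f u = (\<Sum>l\<le>L. a l * cos (real l * u))" "\<And>u. g u = (\<Sum>l\<le>L. b l * cos (real l * u))"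
    by (auto simp: cos_sum_def)
  then show ?thesis unfolding cos_sum_def
    by (intro exI [of _ "\<lambda>l. a l + b l"]) (simp add: distrib_right sum.distrib)
qed

lemma cos_sum_scale: "cos_sum L f \<Longrightarrow> cos_sum L (\<lambda>u. c * f u)"
proof -
  assume "cos_sum L f"
  then obtain a where "\<And>u. f u = (\<Sum>l\<le>L. a l * cos (real l * u))" by (auto simp: cos_sum_def)
  then show ?thesis unfolding cos_sum_def
    by (intro exI [of _ "\<lambda>l. c * a l"]) (simp add: sum_distrib_left mult.assoc)
qed

lemma cos_sum_single: "l \<le> L \<Longrightarrow> cos_sum L (\<lambda>u. cos (real l * u))"
proof -
  assume l: "l \<le> L"
  have "cos (real l * u) = (\<Sum>i\<le>L. (if i = l then 1 else 0) * cos (real i * u))" for u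
  proof -
    have "(\<Sum>i\<le>L. (if i = l then 1 else 0) * cos (real i * u)) = (\<Sum>i\<le>L. if i = l then cos (real i * u) else 0)"
      by (rule sum.cong) auto
    then show ?thesis using l by simp
  qed
  then show ?thesis unfolding cos_sum_def by (intro exI [of _ "\<lambda>i. if i = l then 1 else 0"]) simp
qed

lemma cos_sum_sum: "finite A \<Longrightarrow> (\<And>i. i \<in> A \<Longrightarrow> cos_sum L (f i)) \<Longrightarrow> cos_sum L (\<lambda>u. \<Sum>i\<in>A. f i u)"
proof (induction A rule: finite_induct)
  case empty
  then show ?case unfolding cos_sum_def by (intro exI [of _ "\<lambda>_. 0"]) simp
next
  case (insert x A)
  then show ?case by (simp add: cos_sum_add)
qed

lemma cos_sum_times_cos: "cos_sum L f \<Longrightarrow> cos_sum (Suc L) (\<lambda>u. cos u * f u)"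
proof -
  assume "cos_sum L f"
  then obtain a where a: "\<And>u. f u = (\<Sum>l\<le>L. a l * cos (real l * u))" by (auto simp: cos_sum_def)
  have "cos_sum (Suc L) (\<lambda>u. \<Sum>l\<le>L. a l * (cos u * cos (real l * u)))"
  proof (intro cos_sum_sum cos_sum_scale)
    fix l assume l: "l \<in> {..L}"
    show "cos_sum (Suc L) (\<lambda>u. cos u * cos (real l * u))"
    proof (cases l)
      case 0
      have "cos_sum (Suc L) (\<lambda>u. cos (real 1 * u))" by (rule cos_sum_single) simp
      then show ?thesis by (simp add: 0)
    next
      case (Suc m)
      have "cos u * cos (real l * u) = (1 / 2) * cos (real (Suc l) * u) + (1 / 2) * cos (real m * u)" for u
      proof -
        have 1: "real (Suc l) * u = real l * u + u" "real m * u = real l * u - u"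
          by (simp_all add: Suc algebra_simps)
        show ?thesis unfolding 1 cos_add cos_diff by (simp add: field_simps)
      qed
      moreover have "cos_sum (Suc L) (\<lambda>u. (1 / 2) * cos (real (Suc l) * u) + (1 / 2) * cos (real m * u))"
        using l Suc by (intro cos_sum_add cos_sum_scale cos_sum_single) auto
      ultimately show ?thesis by simp
    qed
  qed simp
  then show ?thesis by (simp add: a sum_distrib_left mult_ac)
qed

lemma poly_cos_sum: "degree p \<le> L \<Longrightarrow> cos_sum L (\<lambda>u. poly p (cos u))"
proof (induction p arbitrary: L rule: pCons_induct)
  case 0
  have "cos_sum L (\<lambda>u. 0 * cos (real 0 * u))" by (intro cos_sum_scale cos_sum_single) simp
  then show ?case by simp
next
  case (pCons c q)
  have c: "cos_sum L (\<lambda>u. c * cos (real 0 * u))" by (intro cos_sum_scale cos_sum_single) simp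
  show ?case
  proof (cases "q = 0")
    case True
    then show ?thesis using c by simp
  next
    case False
    then obtain L' where L': "L = Suc L'" "degree q \<le> L'" using pCons.prems by (cases L) auto
    have "cos_sum L (\<lambda>u. cos u * poly q (cos u))" unfolding L'(1) by (rule cos_sum_times_cos [OF pCons.IH [OF L'(2)]])
    from cos_sum_add [OF c this] show ?thesis by simp
  qed
qed

text \<open>The kernel is a power of \<open>(1 - cos M u) / (1 - cos u)\<close>, a polynomial in \<open>cos u\<close>; \<open>J\<close> is its
  antiderivative normalised by \<open>J \<pi> = 1 / 2\<close>, and \<open>1 / 2 - J u\<close> is the mass of the tail.\<close>

lemma jackson_kernel_primitive:
  fixes \<rho> M :: nat
  assumes rho: "1 \<le> \<rho>" and M: "1 \<le> M"
  shows "\<exists>J a. (\<forall>u. J u = a 0 * u + (\<Sum>l\<in>{1..2 * \<rho> * (M - 1)}. a l * sin (real l * u))) \<and> J pi = 1 / 2 \<and>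
    (\<forall>u\<in>{0..pi}. 0 \<le> 1 / 2 - J u \<and> (1 / 2 - J u) * (1 + real M * u) ^ (4 * \<rho> - 1) \<le> 2 ^ (4 * \<rho>) * 64 ^ (2 * \<rho>))"
proof -
  obtain T where T: "degree T \<le> M" "\<And>u. poly T (cos u) = cos (real M * u)" using chebyshev_exists [of M] by blast
  \<comment> \<open>Since the Chebyshev polynomial \<open>T\<close> equals 1 at 1, the factor
    \<open>1 - x\<close> splits off from \<open>1 - T\<close>; the quotient \<open>F\<close> at
    \<open>cos u\<close> is the Fejer kernel up to normalisation.\<close>
  have "poly (1 - T) 1 = 0" using T(2) [of 0] by simp
  then have "[:- 1, 1:] dvd 1 - T" by (simp only: poly_eq_0_iff_dvd)
  then obtain F0 where F0: "1 - T = [:- 1, 1:] * F0" by (rule dvdE)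
  define F where "F = - F0"
  have F: "(1 - cos u) * poly F (cos u) = 1 - cos (real M * u)" for u
  proof -
    have "poly (1 - T) (cos u) = poly ([:- 1, 1:] * F0) (cos u)" using F0 by simp
    then show ?thesis by (simp add: T(2) F_def algebra_simps)
  qed
  have dF: "degree F \<le> M - 1"
  proof (cases "F0 = 0")
    case False
    have "Suc (degree F0) = degree ([:- 1, 1:] * F0)" using False by (subst degree_mult_eq) auto
    also have "\<dots> = degree (1 - T)" by (simp only: F0)
    also have "\<dots> \<le> M" using T(1) by (intro degree_diff_le) auto
    finally show ?thesis by (simp add: F_def)
  qed (simp add: F_def)
  define L where "L = 2 * \<rho> * (M - 1)"
  have "degree (F ^ (2 * \<rho>)) \<le> degree F * (2 * \<rho>)" by (rule degree_power_le)
  also have "\<dots> \<le> L" using mult_right_mono [OF dF, of "2 * \<rho>"] by (simp add: L_def mult.commute)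
  finally have "cos_sum L (\<lambda>u. poly (F ^ (2 * \<rho>)) (cos u))" by (rule poly_cos_sum)
  then obtain a where a: "\<And>u. poly F (cos u) ^ (2 * \<rho>) = (\<Sum>l\<le>L. a l * cos (real l * u))"
    by (auto simp: cos_sum_def poly_power)
  define K where "K u = poly F (cos u) ^ (2 * \<rho>)" for u
  define J0 where "J0 u = a 0 * u + (\<Sum>l\<in>{1..L}. a l / real l * sin (real l * u))" for u
  have DJ: "(J0 has_real_derivative K u) (at u)" for u
  proof -
    have "(J0 has_real_derivative a 0 + (\<Sum>l\<in>{1..L}. a l / real l * (cos (real l * u) * real l))) (at u)"
      unfolding J0_def by (auto intro!: derivative_eq_intros sum.cong)
    also have "a 0 + (\<Sum>l\<in>{1..L}. a l / real l * (cos (real l * u) * real l)) = K u"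
      unfolding K_def a atMost_atLeast0 by (subst sum.atLeast_Suc_atMost) auto
    finally show ?thesis .
  qed
  have K0: "0 \<le> K u" for u unfolding K_def power_mult by simp
  have mono: "J0 u \<le> J0 v" if "u \<le> v" for u v
    using that by (rule DERIV_nonneg_imp_nondecreasing) (use DJ K0 in blast)
  have sinsq: "1 - cos v = 2 * (sin (v / 2))\<^sup>2" for v :: real using cos_double_sin [of "v / 2"] by simp
  have Feq: "(sin (u / 2))\<^sup>2 * poly F (cos u) = (sin (real M * u / 2))\<^sup>2" for u
    using F [of u] unfolding sinsq by simp
  have Mr: "1 \<le> real M" using M by simp
  have Kup: "K u \<le> 16 ^ (2 * \<rho>) * (1 / u) ^ (4 * \<rho>)" if u: "0 < u" "u \<le> pi" for u
  proof -
    have s: "u / 2 / 2 \<le> sin (u / 2)" using u by (intro sin_ge_half) auto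
    then have s2: "(u / 4)\<^sup>2 \<le> (sin (u / 2))\<^sup>2" using u by (intro power_mono) auto
    have "0 < (u / 4)\<^sup>2" using u by simp
    then have pos: "0 < (sin (u / 2))\<^sup>2" using s2 by linarith
    have e: "poly F (cos u) = (sin (real M * u / 2))\<^sup>2 / (sin (u / 2))\<^sup>2"
      using Feq [of u] pos by (simp add: field_simps)
    have F0: "0 \<le> poly F (cos u)" unfolding e by simp
    have "poly F (cos u) \<le> 1 / (u / 4)\<^sup>2"
      unfolding e using s2 u by (intro frac_le) (auto simp: abs_square_le_1)
    also have "\<dots> = 16 * (1 / u)\<^sup>2" using u by (simp add: power2_eq_square)
    finally have "K u \<le> (16 * (1 / u)\<^sup>2) ^ (2 * \<rho>)" unfolding K_def using F0 by (intro power_mono)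
    also have "\<dots> = 16 ^ (2 * \<rho>) * (1 / u) ^ (4 * \<rho>)"
      by (simp only: power_mult_distrib power_mult [symmetric]) (simp add: mult.assoc [symmetric])
    finally show ?thesis .
  qed
  have Klo: "((real M)\<^sup>2 / 4) ^ (2 * \<rho>) \<le> K u" if u: "0 < u" "u \<le> pi / real M" for u
  proof -
    have Mu: "real M * u \<le> pi" using u Mr by (simp add: field_simps)
    have "1 * u \<le> real M * u" using Mr u by (intro mult_right_mono) auto
    then have upi: "u \<le> pi" using Mu by simp
    have s: "real M * u / 2 / 2 \<le> sin (real M * u / 2)" using u Mu by (intro sin_ge_half) auto
    then have s2: "(real M * u / 4)\<^sup>2 \<le> (sin (real M * u / 2))\<^sup>2" using u by (intro power_mono) auto
    have sp: "0 < sin (u / 2)" using u upi by (intro sin_gt_zero) auto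
    have "sin (u / 2) \<le> u / 2" using u by (intro sin_x_le_x) auto
    then have s3: "(sin (u / 2))\<^sup>2 \<le> (u / 2)\<^sup>2" using sp by (intro power_mono) auto
    have e: "poly F (cos u) = (sin (real M * u / 2))\<^sup>2 / (sin (u / 2))\<^sup>2"
      using Feq [of u] sp by (simp add: field_simps)
    have "(real M)\<^sup>2 / 4 = (real M * u / 4)\<^sup>2 / (u / 2)\<^sup>2" using u by (simp add: power2_eq_square)
    also have "\<dots> \<le> poly F (cos u)" unfolding e using s2 s3 sp by (intro frac_le) auto
    finally show ?thesis unfolding K_def by (intro power_mono) auto
  qed
  define I where "I = J0 pi"
  have J00: "J0 0 = 0" by (simp add: J0_def)
  \<comment> \<open>The total mass is at least that over the interval from \<open>pi / (2 M)\<close>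
    to \<open>pi / M\<close>, where the kernel still has the size of its peak and whose length is at
    least \<open>1 / M\<close>.\<close>
  have Ilow: "((real M)\<^sup>2 / 4) ^ (2 * \<rho>) \<le> real M * I"
  proof -
    let ?u = "pi / (2 * real M)" and ?v = "pi / real M"
    have uv: "0 < ?u" "?u < ?v" "?v \<le> pi" using Mr pi_gt_zero by (simp_all add: field_simps)
    obtain z where z: "?u < z" "z < ?v" "J0 ?v - J0 ?u = (?v - ?u) * K z"
      using MVT2 [OF uv(2), of J0 K] DJ by blast
    have k: "((real M)\<^sup>2 / 4) ^ (2 * \<rho>) \<le> K z" using z uv by (intro Klo) auto
    have "?v - ?u = pi / (2 * real M)" using Mr by (simp add: field_simps)
    then have d: "1 / real M \<le> ?v - ?u" using pi_ge_two Mr by (simp add: field_simps)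
    have "1 / real M * K z \<le> J0 ?v - J0 ?u" unfolding z(3) using d K0 by (intro mult_right_mono) auto
    also have "\<dots> \<le> I" using mono [OF uv(3)] mono [of 0 ?u] uv J00 unfolding I_def by linarith
    finally have "K z \<le> real M * I" using Mr by (simp add: field_simps)
    then show ?thesis using k by linarith
  qed
  have M4: "0 < ((real M)\<^sup>2 / 4) ^ (2 * \<rho>)" using Mr by simp
  have I0: "0 < I" using Ilow M4 Mr by (smt (verit) zero_less_mult_pos)
  define N where "N = 4 * \<rho> - 1"
  have N: "4 * \<rho> = Suc N" "1 \<le> N" using rho by (auto simp: N_def)
  \<comment> \<open>Instead of integrating the bound on \<open>K\<close>, derivatives are compared:
    the tail minus its majorant is nondecreasing and at most 0 at \<open>pi\<close>. Integration
    costs one power of \<open>u\<close>, hence the exponent \<open>4 \<rho> - 1\<close>.\<close>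
  have tail: "I - J0 u \<le> 16 ^ (2 * \<rho>) * (1 / u) ^ N" if u: "0 < u" "u \<le> pi" for u
  proof -
    let ?c = "16 ^ (2 * \<rho>) :: real"
    let ?h = "\<lambda>v. (I - J0 v) - ?c * (1 / v) ^ N"
    have "?h u \<le> ?h pi"
    proof (rule DERIV_nonneg_imp_nondecreasing [OF u(2)])
      fix v assume v: "u \<le> v" "v \<le> pi"
      have v0: "0 < v" using v u by simp
      have "(?h has_real_derivative (0 - K v) - ?c * (real N * (1 / v) ^ (N - 1) * (- 1 / v\<^sup>2))) (at v)"
        using v0 by (auto intro!: derivative_eq_intros DJ simp: power2_eq_square)
      moreover have "0 \<le> (0 - K v) - ?c * (real N * (1 / v) ^ (N - 1) * (- 1 / v\<^sup>2))"
      proof -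
        have "(1 / v) ^ (N - 1) * (1 / v\<^sup>2) = (1 / v) ^ (4 * \<rho>)"
        proof -
          have "4 * \<rho> = (N - 1) + 2" using N by simp
          then show ?thesis by (simp only: power_add) (simp add: power_one_over)
        qed
        then have "?c * (real N * (1 / v) ^ (N - 1) * (- 1 / v\<^sup>2)) = - (real N * (?c * (1 / v) ^ (4 * \<rho>)))"
          by (simp add: algebra_simps)
        moreover have "1 * (?c * (1 / v) ^ (4 * \<rho>)) \<le> real N * (?c * (1 / v) ^ (4 * \<rho>))"
          using N v0 by (intro mult_right_mono) auto
        ultimately show ?thesis using Kup [OF v0 v(2)] by linarith
      qed
      ultimately show "\<exists>y. (?h has_real_derivative y) (at v) \<and> 0 \<le> y" by blast
    qed
    also have "\<dots> \<le> 0" by (simp add: I_def)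
    finally show ?thesis by simp
  qed
  define J where "J u = J0 u / (2 * I)" for u
  define a' where "a' l = (if l = 0 then a 0 / (2 * I) else a l / real l / (2 * I))" for l
  have "J u = a' 0 * u + (\<Sum>l\<in>{1..L}. a' l * sin (real l * u))" for u
  proof -
    have "(\<Sum>l\<in>{1..L}. a' l * sin (real l * u)) = (\<Sum>l\<in>{1..L}. a l / real l * sin (real l * u) / (2 * I))"
      by (rule sum.cong) (auto simp: a'_def)
    then show ?thesis unfolding J_def J0_def by (simp add: a'_def add_divide_distrib sum_divide_distrib)
  qed
  moreover have "J pi = 1 / 2" using I0 by (simp add: J_def I_def)
  moreover have "0 \<le> 1 / 2 - J u \<and> (1 / 2 - J u) * (1 + real M * u) ^ (4 * \<rho> - 1) \<le> 2 ^ (4 * \<rho>) * 64 ^ (2 * \<rho>)"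
    if u: "u \<in> {0..pi}" for u
  proof
    have e: "1 / 2 - J u = (I - J0 u) / (2 * I)" using I0 by (simp add: J_def field_simps)
    have nn: "0 \<le> I - J0 u" using mono [of u pi] u by (simp add: I_def)
    show 0: "0 \<le> 1 / 2 - J u" unfolding e using nn I0 by simp
    have le1: "1 / 2 - J u \<le> 1"
    proof -
      have "0 \<le> J0 u" using mono [of 0 u] u J00 by simp
      then have "0 \<le> J u" using I0 by (simp add: J_def)
      then show ?thesis by simp
    qed
    have A0: "1 \<le> (64::real) ^ (2 * \<rho>)" by (rule one_le_power) simp
    show "(1 / 2 - J u) * (1 + real M * u) ^ (4 * \<rho> - 1) \<le> 2 ^ (4 * \<rho>) * 64 ^ (2 * \<rho>)"
    proof (cases "real M * u \<le> 1")
      case True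
      have "(1 / 2 - J u) * (1 + real M * u) ^ N \<le> 1 * 2 ^ N"
        using True 0 le1 u by (intro mult_mono power_mono) auto
      also have "\<dots> \<le> 2 ^ (4 * \<rho>) * 64 ^ (2 * \<rho>)" using N A0 mult_mono [of "2 ^ N" "2 ^ (4 * \<rho>)" 1 "64 ^ (2 * \<rho>) :: real"]
        by (simp add: power_increasing)
      finally show ?thesis by (simp add: N_def)
    next
      case False
      then have u0: "0 < u" using u Mr by (cases "u = 0") auto
      have "1 + real M * u \<le> 2 * (real M * u)" using False by linarith
      then have "(1 + real M * u) ^ N \<le> (2 * (real M * u)) ^ N" using u by (intro power_mono) auto
      then have "(1 / 2 - J u) * (1 + real M * u) ^ N \<le> (16 ^ (2 * \<rho>) * (1 / u) ^ N / (2 * I)) * (2 * (real M * u)) ^ N"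
        unfolding e using tail [OF u0] u I0 nn by (intro mult_mono divide_right_mono) auto
      also have "\<dots> = 16 ^ (2 * \<rho>) * 2 ^ N * (real M ^ N / (2 * I))"
        using u0 by (simp add: power_mult_distrib power_one_over field_simps)
      also have "\<dots> \<le> 16 ^ (2 * \<rho>) * 2 ^ N * 4 ^ (2 * \<rho>)"
      proof (rule mult_left_mono)
        have "real M * real M ^ N = ((real M)\<^sup>2) ^ (2 * \<rho>)"
          using N(1) by (simp add: power_mult [symmetric] power_Suc [symmetric] del: power_Suc)
        then have "real M * real M ^ N \<le> real M * (4 ^ (2 * \<rho>) * I)"
          using Ilow by (simp add: power_divide field_simps)
        then have "real M ^ N \<le> 4 ^ (2 * \<rho>) * I" using Mr by simp
        also have "\<dots> \<le> 4 ^ (2 * \<rho>) * (2 * I)" using I0 by (intro mult_left_mono) auto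
        finally show "real M ^ N / (2 * I) \<le> 4 ^ (2 * \<rho>)" using I0 by (simp add: field_simps)
      qed simp
      also have "\<dots> = 2 ^ N * 64 ^ (2 * \<rho>)"
      proof -
        have "(16::real) ^ (2 * \<rho>) * 4 ^ (2 * \<rho>) = 64 ^ (2 * \<rho>)" by (simp add: power_mult_distrib [symmetric])
        then show ?thesis by (simp add: mult_ac)
      qed
      also have "\<dots> \<le> 2 ^ (4 * \<rho>) * 64 ^ (2 * \<rho>)" using N by (intro mult_right_mono power_increasing) auto
      finally show ?thesis by (simp add: N_def)
    qed
  qed
  ultimately show ?thesis unfolding L_def by blast
qed

text \<open>\<open>J (\<theta> + \<theta>0) - J (\<theta> - \<theta>0)\<close> is the convolution of
  the kernel with the indicator of the angles of modulus below \<open>\<theta>0\<close>. It is even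
  in \<open>\<theta>\<close>: the linear terms of \<open>J\<close> leave a constant, the sines leave
  cosines, so it is a polynomial in \<open>cos \<theta>\<close>. The error consists of two tails of
  the kernel.\<close>

lemma step_polynomial:
  fixes \<rho> M :: nat and \<theta>0 :: real
  assumes rho: "1 \<le> \<rho>" and M: "1 \<le> M" and t0: "\<theta>0 \<in> {0..pi}"
  shows "\<exists>T::real poly. degree T \<le> 2 * \<rho> * (M - 1) \<and> (\<forall>\<theta>\<in>{0..pi}.
    \<bar>(if \<theta> < \<theta>0 then 1 else 0) - poly T (cos \<theta>)\<bar> * (1 + real M * \<bar>\<theta> - \<theta>0\<bar>) ^ (4 * \<rho> - 1) \<le> 2 * (2 ^ (4 * \<rho>) * 64 ^ (2 * \<rho>)))"
proof -
  define L where "L = 2 * \<rho> * (M - 1)"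
  define N where "N = 4 * \<rho> - 1"
  define C where "C = (2 ^ (4 * \<rho>) * 64 ^ (2 * \<rho>) :: real)"
  obtain J a where J: "\<And>u. J u = a 0 * u + (\<Sum>l\<in>{1..L}. a l * sin (real l * u))" and Jpi: "J pi = 1 / 2"
    and tail: "\<And>u. u \<in> {0..pi} \<Longrightarrow> 0 \<le> 1 / 2 - J u \<and> (1 / 2 - J u) * (1 + real M * u) ^ N \<le> C"
    using jackson_kernel_primitive [OF rho M] unfolding L_def N_def C_def by blast
  have "sin (real l * pi) = 0" for l by (rule sin_npi)
  then have a0: "a 0 * pi = 1 / 2" using Jpi unfolding J by simp
  have odd: "J (- u) = - J u" for u unfolding J by (simp add: sum_negf)
  have refl: "J (2 * pi - u) = 1 - J u" for u
  proof -
    have "sin (real l * (2 * pi - u)) = - sin (real l * u)" for l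
    proof -
      have "real l * (2 * pi - u) = 2 * pi * real l - real l * u" by (simp add: algebra_simps)
      moreover have "sin (2 * pi * real l) = 0" "cos (2 * pi * real l) = 1"
        using sin_2npi [of l] cos_2npi [of l] by (simp_all add: mult_ac)
      ultimately show ?thesis by (simp add: sin_diff)
    qed
    then have "J (2 * pi - u) = a 0 * (2 * pi - u) - (\<Sum>l\<in>{1..L}. a l * sin (real l * u))"
      unfolding J by (simp add: sum_negf)
    also have "\<dots> = 2 * (a 0 * pi) - J u" unfolding J by (simp add: algebra_simps)
    finally show ?thesis unfolding a0 by simp
  qed
  have "\<exists>p::real poly. degree p \<le> l \<and> (\<forall>u. poly p (cos u) = cos (real l * u))" for l by (rule chebyshev_exists)
  then obtain Ch :: "nat \<Rightarrow> real poly" where Ch: "\<And>l. degree (Ch l) \<le> l" "\<And>l u. poly (Ch l) (cos u) = cos (real l * u)" by metis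
  define T where "T = [:2 * a 0 * \<theta>0:] + (\<Sum>l\<in>{1..L}. smult (2 * a l * sin (real l * \<theta>0)) (Ch l))"
  have dT: "degree T \<le> L"
    unfolding T_def using Ch(1)
    by (intro degree_add_le degree_sum_le order_trans [OF degree_smult_le]) (auto intro: order_trans)
  have Tv: "poly T (cos \<theta>) = J (\<theta> + \<theta>0) - J (\<theta> - \<theta>0)" for \<theta>
  proof -
    have "J (\<theta> + \<theta>0) - J (\<theta> - \<theta>0) = 2 * a 0 * \<theta>0 + (\<Sum>l\<in>{1..L}. a l * (sin (real l * (\<theta> + \<theta>0)) - sin (real l * (\<theta> - \<theta>0))))"
      unfolding J by (simp add: algebra_simps sum_subtractf)
    also have "(\<Sum>l\<in>{1..L}. a l * (sin (real l * (\<theta> + \<theta>0)) - sin (real l * (\<theta> - \<theta>0))))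
       = (\<Sum>l\<in>{1..L}. 2 * a l * sin (real l * \<theta>0) * cos (real l * \<theta>))"
    proof (rule sum.cong)
      fix l
      have "sin (real l * (\<theta> + \<theta>0)) - sin (real l * (\<theta> - \<theta>0)) = 2 * cos (real l * \<theta>) * sin (real l * \<theta>0)"
        unfolding distrib_left right_diff_distrib sin_add sin_diff by simp
      then show "a l * (sin (real l * (\<theta> + \<theta>0)) - sin (real l * (\<theta> - \<theta>0))) = 2 * a l * sin (real l * \<theta>0) * cos (real l * \<theta>)" by simp
    qed simp
    also have "2 * a 0 * \<theta>0 + \<dots> = poly T (cos \<theta>)" by (simp add: T_def poly_sum Ch(2))
    finally show ?thesis by simp
  qed
  have "\<bar>(if \<theta> < \<theta>0 then 1 else 0) - poly T (cos \<theta>)\<bar> * (1 + real M * \<bar>\<theta> - \<theta>0\<bar>) ^ N \<le> 2 * C" if th: "\<theta> \<in> {0..pi}" for \<theta>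
  proof -
    define d where "d = \<bar>\<theta> - \<theta>0\<bar>"
    define A where "A = 1 / 2 - J d"
    define B where "B = 1 / 2 - J (\<theta> + \<theta>0)"
    have d: "d \<in> {0..pi}" using th t0 by (auto simp: d_def)
    have A: "0 \<le> A" "A * (1 + real M * d) ^ N \<le> C" using tail [OF d] by (auto simp: A_def)
    have B: "\<bar>B\<bar> * (1 + real M * d) ^ N \<le> C"
    proof -
      obtain v where v: "v \<in> {0..pi}" "d \<le> v" "\<bar>B\<bar> = 1 / 2 - J v"
      \<comment> \<open>The tail at \<open>\<theta> + \<theta>0\<close> may lie beyond
        \<open>pi\<close>, where the symmetry of \<open>J\<close> about \<open>pi\<close> replaces
        the argument by \<open>2 pi - (\<theta> + \<theta>0)\<close>. Either argument is at least
        the distance of \<open>\<theta>\<close> from \<open>\<theta>0\<close>.\<close>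
      proof (cases "\<theta> + \<theta>0 \<le> pi")
        case True
        then have "\<theta> + \<theta>0 \<in> {0..pi}" using th t0 by auto
        then show ?thesis using that [of "\<theta> + \<theta>0"] tail th t0 by (auto simp: B_def d_def)
      next
        case False
        define w where "w = 2 * pi - (\<theta> + \<theta>0)"
        have w: "w \<in> {0..pi}" using False th t0 by (auto simp: w_def)
        have "B = J w - 1 / 2" using refl [of w] by (simp add: B_def w_def)
        then have "\<bar>B\<bar> = 1 / 2 - J w" using tail [OF w] by simp
        moreover have "d \<le> w" using th t0 by (auto simp: d_def w_def)
        ultimately show ?thesis using that w by blast
      qed
      have "(1 + real M * d) ^ N \<le> (1 + real M * v) ^ N" using v d by (intro power_mono add_left_mono mult_left_mono) auto
      then have "\<bar>B\<bar> * (1 + real M * d) ^ N \<le> \<bar>B\<bar> * (1 + real M * v) ^ N" by (rule mult_left_mono) simp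
      also have "\<dots> \<le> C" unfolding v(3) using tail [OF v(1)] by blast
      finally show ?thesis .
    qed
    have "\<bar>(if \<theta> < \<theta>0 then 1 else 0) - poly T (cos \<theta>)\<bar> \<le> A + \<bar>B\<bar>"
    proof (cases "\<theta> < \<theta>0")
      case True
      then have "d = - (\<theta> - \<theta>0)" by (simp add: d_def)
      then have "J d = - J (\<theta> - \<theta>0)" by (simp only: odd)
      then show ?thesis using True A(1) unfolding Tv A_def B_def by simp
    next
      case False
      then have "d = \<theta> - \<theta>0" by (simp add: d_def)
      then show ?thesis using False A(1) unfolding Tv A_def B_def by simp
    qed
    then have "\<bar>(if \<theta> < \<theta>0 then 1 else 0) - poly T (cos \<theta>)\<bar> * (1 + real M * d) ^ N \<le> (A + \<bar>B\<bar>) * (1 + real M * d) ^ N"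
      using d by (intro mult_right_mono) auto
    also have "\<dots> \<le> 2 * C" using A(2) B by (simp add: distrib_right)
    finally show ?thesis by (simp add: d_def)
  qed
  then show ?thesis using dT unfolding L_def N_def C_def by blast
qed

section \<open>Polynomials and weights on the cells\<close>

text \<open>Among \<open>k\<close> separated subintervals of \<open>[c, c + l]\<close>, take the one on which the minimum of \<open>\<bar>p\<bar>\<close> is
  largest: Lagrange interpolation at the \<open>k\<close> minimisers bounds \<open>p\<close> everywhere by that minimum.\<close>

lemma poly_dominated_on_piece:
  fixes p :: "real poly" and c l :: real
  assumes p: "degree p < k" and l: "0 < l"
  shows "\<exists>A\<ge>0. \<exists>i<k. (\<forall>y\<in>{c + 2 * real i * (l / (2 * real k))..c + (2 * real i + 1) * (l / (2 * real k))}. A \<le> \<bar>poly p y\<bar>) \<and>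
    (\<forall>x. \<bar>poly p x\<bar> \<le> real k * (2 * real k) ^ k * (1 + \<bar>x - c\<bar> / l) ^ k * A)"
proof -
  \<comment> \<open>The \<open>k\<close> subintervals have length \<open>h\<close> and are separated
    by gaps of length \<open>h\<close>. Points from different ones are at least \<open>h\<close>
    apart, which bounds the denominators in the Lagrange formula.\<close>
  define h where "h = l / (2 * real k)"
  have kr: "1 \<le> real k" using p by simp
  have h: "0 < h" and hl: "2 * real k * h = l" using l kr by (simp_all add: h_def)
  let ?I = "\<lambda>i::nat. {c + 2 * real i * h..c + (2 * real i + 1) * h}"
  have "\<exists>y\<in>?I i. \<forall>z\<in>?I i. \<bar>poly p y\<bar> \<le> \<bar>poly p z\<bar>" for i
    using h by (intro continuous_attains_inf continuous_intros) (auto simp: algebra_simps)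
  then obtain y where y: "\<And>i. y i \<in> ?I i" "\<And>i z. z \<in> ?I i \<Longrightarrow> \<bar>poly p (y i)\<bar> \<le> \<bar>poly p z\<bar>" by metis
  have sep: "h \<le> \<bar>y j - y i\<bar>" if "i \<noteq> j" for i j :: nat
  proof -
    have "h \<le> y j' - y i'" if "i' < j'" for i' j' :: nat
    proof -
      have "(2 * real i' + 1) * h + h \<le> 2 * real j' * h"
        using that h mult_right_mono [of "2 * real i' + 2" "2 * real j'" h] by (simp add: algebra_simps)
      then show ?thesis using y(1) [of i'] y(1) [of j'] by auto
    qed
    then show ?thesis using \<open>i \<noteq> j\<close> by (metis abs_minus_commute abs_of_nonneg h less_imp_le linorder_neqE_nat order_trans)
  qed
  have inj: "inj_on y {..<k}" using sep h by (force simp: inj_on_def)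
  have yr: "\<bar>y i - c\<bar> \<le> l" if "i < k" for i
  proof -
    have "(2 * real i + 1) * h \<le> (2 * real k) * h" using that h by (intro mult_right_mono) auto
    moreover have "0 \<le> 2 * real i * h" using h by simp
    moreover have "c + 2 * real i * h \<le> y i" "y i \<le> c + (2 * real i + 1) * h" using y(1) [of i] by auto
    ultimately show ?thesis unfolding abs_le_iff using hl l by linarith
  qed
  define A where "A = Max ((\<lambda>i. \<bar>poly p (y i)\<bar>) ` {..<k})"
  have ne: "{..<k} \<noteq> {}" using p by auto
  have "A \<in> (\<lambda>i. \<bar>poly p (y i)\<bar>) ` {..<k}" unfolding A_def using ne by (intro Max_in) auto
  then obtain i0 where i0: "i0 < k" "A = \<bar>poly p (y i0)\<bar>" by auto
  have Amax: "\<bar>poly p (y j)\<bar> \<le> A" if "j < k" for j unfolding A_def using that by (intro Max_ge) auto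
  have "\<bar>poly p x\<bar> \<le> real k * (2 * real k) ^ k * (1 + \<bar>x - c\<bar> / l) ^ k * A" for x
  proof -
    define R where "R = 2 * real k * (1 + \<bar>x - c\<bar> / l)"
    have R1: "1 \<le> R"
    proof -
      have "1 * 1 \<le> (2 * real k) * (1 + \<bar>x - c\<bar> / l)" using kr l by (intro mult_mono) auto
      then show ?thesis by (simp add: R_def)
    qed
    have lag: "\<bar>lagrange k y j x\<bar> \<le> R ^ k" if j: "j < k" for j
    proof -
      have "\<bar>lagrange k y j x\<bar> \<le> (\<Prod>i\<in>{..<k} - {j}. R)"
        unfolding lagrange_def abs_prod
      proof (rule prod_mono)
        fix i assume i: "i \<in> {..<k} - {j}"
        have "\<bar>x - y i\<bar> \<le> \<bar>x - c\<bar> + l" using yr [of i] i by auto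
        then have "\<bar>x - y i\<bar> / \<bar>y j - y i\<bar> \<le> (\<bar>x - c\<bar> + l) / h"
          using sep [of i j] i h l by (intro frac_le) auto
        also have "\<dots> = R" unfolding R_def h_def using l kr by (simp add: field_simps)
        finally show "0 \<le> \<bar>(x - y i) / (y j - y i)\<bar> \<and> \<bar>(x - y i) / (y j - y i)\<bar> \<le> R" by (simp add: abs_divide)
      qed
      also have "\<dots> = R ^ card ({..<k} - {j})" by simp
      also have "\<dots> \<le> R ^ k" using R1 by (intro power_increasing) (auto simp: card_Diff_subset_Int)
      finally show ?thesis .
    qed
    have "\<bar>poly p x\<bar> = \<bar>\<Sum>j<k. poly p (y j) * lagrange k y j x\<bar>" by (rule arg_cong [OF lagrange_formula [OF p inj]])
    also have "\<dots> \<le> (\<Sum>j<k. A * R ^ k)"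
      by (rule order_trans [OF sum_abs], rule sum_mono) (use Amax lag in \<open>auto simp: abs_mult intro!: mult_mono order_trans [OF abs_ge_zero]\<close>)
    also have "\<dots> = real k * (2 * real k) ^ k * (1 + \<bar>x - c\<bar> / l) ^ k * A" 
    proof -
      have "R ^ k = (2 * real k) ^ k * (1 + \<bar>x - c\<bar> / l) ^ k" unfolding R_def by (rule power_mult_distrib)
      then show ?thesis by simp
    qed
    finally show ?thesis .
  qed
  moreover have "0 \<le> A" using i0 by simp
  ultimately show ?thesis using i0 y(2) unfolding h_def [symmetric] by blast
qed

section \<open>Comparison of two cells in terms of the distance of their indices\<close>

lemma node_reflect: "i \<le> m \<Longrightarrow> 0 < m \<Longrightarrow> node m (m - i) = - node m i"
proof -
  assume i: "i \<le> m" "0 < m"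
  have "real (m - i) * (pi / real m) = pi - real i * (pi / real m)" using i by (simp add: of_nat_diff field_simps)
  then show ?thesis by (simp add: node_def cos_diff)
qed

lemma sin_lipschitz: "\<bar>sin x - sin y\<bar> \<le> \<bar>x - y\<bar>" for x y :: real
proof -
  have "\<bar>sin x - sin y\<bar> = 2 * \<bar>sin ((x - y) / 2)\<bar> * \<bar>cos ((x + y) / 2)\<bar>" unfolding sin_diff_sin by (simp add: abs_mult)
  also have "\<dots> \<le> 2 * \<bar>(x - y) / 2\<bar> * 1" by (intro mult_mono abs_sin_x_le_abs_x) auto
  finally show ?thesis by simp
qed

text \<open>\<open>1 - node\<close> is twice the square of a sine. The sine is Lipschitz and is at
  least a quarter of the mesh width at every node except the first, so moving by \<open>D\<close>
  indices multiplies it by at most a constant times \<open>1 + D\<close>. Here as in the comparisons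
  below, the loss is polynomial in \<open>D\<close>, which a kernel of high enough order
  absorbs.\<close>

lemma one_minus_node_ratio:
  assumes i: "i < m" and j: "j < m" and D: "D = \<bar>real i - real j\<bar>"
  shows "1 - node m (Suc i) \<le> 4 * (1 + D)\<^sup>2 * (1 - node m (Suc j))"
proof -
  define d where "d = pi / real m"
  have m: "0 < real m" using i by simp
  have d: "0 < d" using m by (simp add: d_def)
  have md: "real m * d = pi" using m by (simp add: d_def)
  let ?s = "\<lambda>i. sin (real (Suc i) * d / 2)"
  have "real (Suc j) * d \<le> real m * d" using j d by (intro mult_right_mono) auto
  then have sj: "real (Suc j) * d / 2 / 2 \<le> ?s j" using d md by (intro sin_ge_half) auto
  have "1 * d \<le> real (Suc j) * d" using d by (intro mult_right_mono) auto
  then have sj': "d / 4 \<le> ?s j" using sj by linarith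
  have "real (Suc i) * d \<le> real m * d" using i d by (intro mult_right_mono) auto
  moreover have "0 \<le> real (Suc i) * d" using d by simp
  ultimately have si: "0 \<le> ?s i" using md pi_gt_zero by (intro sin_ge_zero) linarith+
  have "\<bar>?s i - ?s j\<bar> \<le> \<bar>real (Suc i) * d / 2 - real (Suc j) * d / 2\<bar>" by (rule sin_lipschitz)
  also have "\<dots> = \<bar>(real i - real j) * (d / 2)\<bar>" by (simp add: algebra_simps diff_divide_distrib add_divide_distrib)
  also have "\<dots> = D * d / 2" using d by (simp add: abs_mult D)
  finally have "?s i \<le> ?s j + D * d / 2" by linarith
  also have "\<dots> \<le> ?s j + 2 * D * ?s j"
  proof -
    have "2 * D * (d / 4) \<le> 2 * D * ?s j" using D by (intro mult_left_mono [OF sj']) simp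
    then show ?thesis by simp
  qed
  also have "\<dots> \<le> 2 * (1 + D) * ?s j" using sj' d by (simp add: algebra_simps)
  finally have "(?s i)\<^sup>2 \<le> (2 * (1 + D) * ?s j)\<^sup>2" using si by (intro power_mono)
  also have "(2 * (1 + D) * ?s j)\<^sup>2 = 4 * (1 + D)\<^sup>2 * (?s j)\<^sup>2" by (simp only: power_mult_distrib) simp
  finally show ?thesis unfolding one_minus_node d_def by simp
qed

lemma one_plus_node_ratio:
  assumes i: "i < m" and j: "j < m" and D: "D = \<bar>real i - real j\<bar>"
  shows "1 + node m i \<le> 4 * (1 + D)\<^sup>2 * (1 + node m j)"
proof -
  have "1 - node m (Suc (m - Suc i)) \<le> 4 * (1 + D)\<^sup>2 * (1 - node m (Suc (m - Suc j)))"
    using i j by (intro one_minus_node_ratio) (auto simp: D of_nat_diff)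
  moreover have "Suc (m - Suc i) = m - i" "Suc (m - Suc j) = m - j" using i j by auto
  ultimately show ?thesis using i j by (simp add: node_reflect)
qed

text \<open>The maximum over the cell \<open>[node m (j + 1), node m j]\<close> of each of the two factors of the weight.\<close>

definition cell_weight :: "real \<Rightarrow> real \<Rightarrow> nat \<Rightarrow> nat \<Rightarrow> real" where
  "cell_weight \<alpha> \<beta> m j = (1 - node m (Suc j)) powr \<alpha> * (1 + node m j) powr \<beta>"

lemma cell_weight_ratio:
  assumes i: "i < m" and j: "j < m" and D: "D = \<bar>real i - real j\<bar>" and ab: "0 \<le> \<alpha>" "0 \<le> \<beta>"
    and e: "2 * (\<alpha> + \<beta>) \<le> real e"
  shows "cell_weight \<alpha> \<beta> m i \<le> 4 powr (\<alpha> + \<beta>) * (1 + D) ^ e * cell_weight \<alpha> \<beta> m j"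
proof -
  have D0: "0 \<le> D" by (simp add: D)
  have n: "0 \<le> 1 - node m i" "0 \<le> 1 + node m i" for i using node_range [of m i] by auto
  have "cell_weight \<alpha> \<beta> m i \<le> (4 * (1 + D)\<^sup>2 * (1 - node m (Suc j))) powr \<alpha> * (4 * (1 + D)\<^sup>2 * (1 + node m j)) powr \<beta>"
    unfolding cell_weight_def
    using one_minus_node_ratio [OF i j D] one_plus_node_ratio [OF i j D] ab n
    by (intro mult_mono powr_mono2) auto
  also have "\<dots> = (4 * (1 + D)\<^sup>2) powr (\<alpha> + \<beta>) * cell_weight \<alpha> \<beta> m j"
    using n D0 by (simp add: cell_weight_def powr_mult powr_add mult_ac)
  also have "(4 * (1 + D)\<^sup>2) powr (\<alpha> + \<beta>) = 4 powr (\<alpha> + \<beta>) * (1 + D) powr (2 * (\<alpha> + \<beta>))"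
  proof -
    have "((1 + D)\<^sup>2) powr (\<alpha> + \<beta>) = ((1 + D) powr 2) powr (\<alpha> + \<beta>)" using D0 by simp
    also have "\<dots> = (1 + D) powr (2 * (\<alpha> + \<beta>))" by (rule powr_powr)
    finally show ?thesis using D0 by (simp add: powr_mult)
  qed
  also have "\<dots> * cell_weight \<alpha> \<beta> m j \<le> 4 powr (\<alpha> + \<beta>) * (1 + D) ^ e * cell_weight \<alpha> \<beta> m j"
  proof (intro mult_right_mono mult_left_mono)
    have "(1 + D) powr (2 * (\<alpha> + \<beta>)) \<le> (1 + D) powr real e" using D0 e by (intro powr_mono) auto
    also have "\<dots> = (1 + D) ^ e" using D0 by (intro powr_realpow) auto
    finally show "(1 + D) powr (2 * (\<alpha> + \<beta>)) \<le> (1 + D) ^ e" .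
  qed (auto simp: cell_weight_def)
  finally show ?thesis .
qed

lemma jacobi_weight_le_cell_weight:
  assumes "x \<in> {node m (Suc j)..node m j}" "0 \<le> \<alpha>" "0 \<le> \<beta>"
  shows "jacobi_weight \<alpha> \<beta> x \<le> cell_weight \<alpha> \<beta> m j"
  unfolding jacobi_weight_def cell_weight_def
  using assms node_range [of m "Suc j"] node_range [of m j] by (intro mult_mono powr_mono2) auto

text \<open>On the middle third each of the two linear factors is at least a third of its maximum
  over the cell. Near the ends this fails in the two end cells, where the weight may vanish.\<close>

lemma cell_weight_le_jacobi_weight:
  assumes l: "l = node m j - node m (Suc j)" and x: "x \<in> {node m (Suc j) + l / 3..node m (Suc j) + 2 * l / 3}"
    and ab: "0 \<le> \<alpha>" "0 \<le> \<beta>" and l0: "0 \<le> l"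
  shows "cell_weight \<alpha> \<beta> m j \<le> 3 powr (\<alpha> + \<beta>) * jacobi_weight \<alpha> \<beta> x"
proof -
  have n: "- 1 \<le> node m (Suc j)" "node m j \<le> 1" by (simp_all add: node_range)
  have x': "node m (Suc j) + l / 3 \<le> x" "x \<le> node m (Suc j) + 2 * l / 3" using x by auto
  have "3 * x \<le> 3 * node m (Suc j) + 2 * l" "3 * node m (Suc j) + l \<le> 3 * x" using x' by simp_all
  then have "3 * x \<le> node m (Suc j) + 2 * node m j" "2 * node m (Suc j) + node m j \<le> 3 * x" using l by simp_all
  then have 1: "1 - node m (Suc j) \<le> 3 * (1 - x)" and 2: "1 + node m j \<le> 3 * (1 + x)" using n by simp_all
  have p: "0 \<le> 1 - node m (Suc j)" "0 \<le> 1 + node m j" using node_range [of m "Suc j"] node_range [of m j] by auto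
  have "cell_weight \<alpha> \<beta> m j \<le> (3 * (1 - x)) powr \<alpha> * (3 * (1 + x)) powr \<beta>"
    unfolding cell_weight_def using 1 2 p ab by (intro mult_mono powr_mono2) auto
  also have "\<dots> = 3 powr (\<alpha> + \<beta>) * jacobi_weight \<alpha> \<beta> x"
  proof -
    have "0 \<le> 1 - x" "0 \<le> 1 + x" using 1 2 p by simp_all
    then have "(3 * (1 - x)) powr \<alpha> = 3 powr \<alpha> * (1 - x) powr \<alpha>" "(3 * (1 + x)) powr \<beta> = 3 powr \<beta> * (1 + x) powr \<beta>"
      by (intro powr_mult; simp)+
    then show ?thesis by (simp only: jacobi_weight_def powr_add mult_ac)
  qed
  finally show ?thesis .
qed

lemma half_node_sin:
  assumes j: "j < m"
  shows "pi / real m / 4 \<le> sin ((real j + 1 / 2) * (pi / real m))"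
    "node m j - node m (Suc j) = 2 * sin ((real j + 1 / 2) * (pi / real m)) * sin (pi / real m / 2)"
proof -
  define d where "d = pi / real m"
  have m: "1 \<le> real m" using j by simp
  have d: "0 < d" using m by (simp add: d_def)
  have md: "real m * d = pi" using m by (simp add: d_def)
  have "1 * d \<le> real m * d" using m d by (intro mult_right_mono) auto
  then have d2: "d \<le> pi" using md by simp
  have dd: "d / 4 \<le> sin (d / 2)" using sin_ge_half [of "d / 2"] d d2 by simp
  let ?u = "(real j + 1 / 2) * d"
  have u1: "d / 2 \<le> ?u" using d by (simp add: algebra_simps)
  have "(real j + 1) * d \<le> real m * d" using j d by (intro mult_right_mono) auto
  then have u2: "?u + d / 2 \<le> pi" using md by (simp add: algebra_simps)
  have "sin (d / 2) \<le> sin ?u"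
  proof (cases "?u \<le> pi / 2")
    case True
    then show ?thesis using u1 d pi_gt_zero by (intro sin_monotone_2pi_le) linarith+
  next
    case False
    have "sin (d / 2) \<le> sin (pi - ?u)" using False u2 d pi_gt_zero by (intro sin_monotone_2pi_le) linarith+
    then show ?thesis by simp
  qed
  then show "pi / real m / 4 \<le> sin ((real j + 1 / 2) * (pi / real m))" using dd by (simp add: d_def)
  have "(real j * d + real (Suc j) * d) / 2 = ?u" "(real (Suc j) * d - real j * d) / 2 = d / 2"
    by (simp_all add: algebra_simps)
  then show "node m j - node m (Suc j) = 2 * sin ((real j + 1 / 2) * (pi / real m)) * sin (pi / real m / 2)"
    unfolding node_def cos_diff_cos d_def by simp
qed

lemma cell_length_ratio:
  assumes i: "i < m" and j: "j < m" and D: "D = \<bar>real i - real j\<bar>"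
  shows "node m i - node m (Suc i) \<le> 4 * (1 + D) * (node m j - node m (Suc j))"
proof -
  define d where "d = pi / real m"
  let ?s = "\<lambda>i. sin ((real i + 1 / 2) * d)"
  have m: "1 \<le> real m" using j by simp
  have d: "0 < d" using m by (simp add: d_def)
  have D0: "0 \<le> D" by (simp add: D)
  have sj: "d / 4 \<le> ?s j" using half_node_sin(1) [OF j] by (simp add: d_def)
  have "\<bar>?s i - ?s j\<bar> \<le> \<bar>(real i + 1 / 2) * d - (real j + 1 / 2) * d\<bar>" by (rule sin_lipschitz)
  also have "\<dots> = \<bar>(real i - real j) * d\<bar>" by (simp add: algebra_simps)
  also have "\<dots> = D * d" using d by (simp add: abs_mult D)
  finally have "?s i \<le> ?s j + D * d" by linarith
  also have "\<dots> \<le> ?s j + 4 * D * ?s j" using mult_left_mono [OF sj, of "4 * D"] D0 by simp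
  also have "\<dots> \<le> 4 * (1 + D) * ?s j" using sj d by (simp add: algebra_simps)
  finally have s: "?s i \<le> 4 * (1 + D) * ?s j" .
  have "d \<le> pi" using m pi_gt_zero by (simp add: d_def field_simps mult_le_cancel_left1)
  then have s2: "0 \<le> sin (d / 2)" using d by (intro sin_ge_zero) auto
  have "2 * ?s i * sin (d / 2) \<le> 2 * (4 * (1 + D) * ?s j) * sin (d / 2)" using s s2 by (intro mult_right_mono mult_left_mono) auto
  then show ?thesis unfolding half_node_sin(2) [OF i] half_node_sin(2) [OF j] d_def by simp
qed

text \<open>In terms of angles a difference of cosines is a product of the sine of the mean angle
  and the sine of half the gap. Each is at most of order \<open>1 + D\<close> times the
  corresponding quantity of cell \<open>j\<close>, and the product of those quantities is the length
  of cell \<open>j\<close>.\<close>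

lemma cell_distance:
  assumes i: "i < m" and j: "j < m" and D: "D = \<bar>real i - real j\<bar>"
    and x: "x \<in> {node m (Suc i)..node m i}" and y: "y \<in> {node m (Suc j)..node m j}"
  shows "\<bar>x - y\<bar> \<le> 12 * (1 + D)\<^sup>2 * (node m j - node m (Suc j))"
proof -
  define d where "d = pi / real m"
  have m: "1 \<le> real m" using j by simp
  have d: "0 < d" using m by (simp add: d_def)
  have md: "real m * d = pi" using m by (simp add: d_def)
  have D0: "0 \<le> D" by (simp add: D)
  have arc: "\<exists>\<theta>. z = cos \<theta> \<and> real l * d \<le> \<theta> \<and> \<theta> \<le> real (Suc l) * d"
    if "l < m" "z \<in> {node m (Suc l)..node m l}" for l z
  proof -
    have z: "- 1 \<le> z" "z \<le> 1" using that node_range [of m l] node_range [of m "Suc l"] by auto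
    have r: "0 \<le> real l * d" "real (Suc l) * d \<le> pi" "real l * d \<le> pi"
    proof -
      have "real (Suc l) * d \<le> real m * d" using that d by (intro mult_right_mono) auto
      then show "real (Suc l) * d \<le> pi" using md by simp
      then show "real l * d \<le> pi" using d by (simp add: algebra_simps)
    qed (use d in simp)
    have "arccos (cos (real l * d)) \<le> arccos z" "arccos z \<le> arccos (cos (real (Suc l) * d))"
      using that z by (auto simp: node_def d_def intro!: arccos_le_arccos)
    moreover have "arccos (cos (real l * d)) = real l * d" "arccos (cos (real (Suc l) * d)) = real (Suc l) * d"
      using r d by (auto intro!: arccos_cos)
    ultimately show ?thesis using z by (intro exI [of _ "arccos z"]) (simp add: cos_arccos)
  qed
  obtain \<theta> where th: "x = cos \<theta>" "real i * d \<le> \<theta>" "\<theta> \<le> real (Suc i) * d" using arc [OF i x] by blast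
  obtain \<eta> where et: "y = cos \<eta>" "real j * d \<le> \<eta>" "\<eta> \<le> real (Suc j) * d" using arc [OF j y] by blast
  have Dij: "real i - real j \<le> D" "real j - real i \<le> D" by (auto simp: D)
  have Dd: "(real i - real j) * d \<le> D * d" "(real j - real i) * d \<le> D * d" using Dij d by (auto intro!: mult_right_mono)
  have Dd0: "0 \<le> D * d" using D0 d by simp
  have te: "\<bar>\<theta> - \<eta>\<bar> \<le> (1 + D) * d" using th et Dd by (auto simp: algebra_simps abs_le_iff)
  let ?s = "sin ((real j + 1 / 2) * d)"
  have sj: "d / 4 \<le> ?s" using half_node_sin(1) [OF j] by (simp add: d_def)
  have "\<bar>sin ((\<theta> + \<eta>) / 2)\<bar> \<le> 5 * (1 + D) * ?s"
  proof -
    have "\<bar>sin ((\<theta> + \<eta>) / 2) - ?s\<bar> \<le> \<bar>(\<theta> + \<eta>) / 2 - (real j + 1 / 2) * d\<bar>" by (rule sin_lipschitz)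
    also have "\<dots> \<le> (1 + D) * d"
    proof -
      have "\<theta> \<le> real i * d + d" "\<eta> \<le> real j * d + d" "real i * d - real j * d \<le> D * d" "real j * d - real i * d \<le> D * d"
        using th et Dd by (simp_all add: algebra_simps)
      moreover have "(1 + D) * d = d + D * d" "(\<theta> + \<eta>) / 2 - (real j + 1 / 2) * d = \<theta> / 2 + \<eta> / 2 - real j * d - d / 2"
        by (simp_all add: algebra_simps add_divide_distrib)
      ultimately show ?thesis using th(2) et(2) d Dd0 unfolding abs_le_iff by linarith
    qed
    also have "\<dots> \<le> (1 + D) * (4 * ?s)" using sj D0 by (intro mult_left_mono) auto
    finally have "\<bar>sin ((\<theta> + \<eta>) / 2)\<bar> \<le> ?s + (1 + D) * (4 * ?s)" using sj d by linarith
    also have "\<dots> \<le> 5 * (1 + D) * ?s" using sj d D0 by (simp add: algebra_simps)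
    finally show ?thesis .
  qed
  moreover have "\<bar>sin ((\<eta> - \<theta>) / 2)\<bar> \<le> (1 + D) * d / 2"
  proof -
    have "\<bar>sin ((\<eta> - \<theta>) / 2)\<bar> \<le> \<bar>(\<eta> - \<theta>) / 2\<bar>" by (rule abs_sin_x_le_abs_x)
    also have "\<dots> = \<bar>\<theta> - \<eta>\<bar> / 2" by (simp add: abs_minus_commute)
    also have "\<dots> \<le> (1 + D) * d / 2" by (rule divide_right_mono [OF te]) simp
    finally show ?thesis .
  qed
  ultimately have "\<bar>x - y\<bar> \<le> 2 * (5 * (1 + D) * ?s) * ((1 + D) * d / 2)"
    unfolding th(1) et(1) cos_diff_cos abs_mult using D0 sj d by (intro mult_mono) auto
  also have "\<dots> = 5 * (1 + D)\<^sup>2 * (?s * d)" by (simp add: power2_eq_square)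
  also have "\<dots> \<le> 5 * (1 + D)\<^sup>2 * (2 * (node m j - node m (Suc j)))"
  proof (rule mult_left_mono)
    have "1 * d \<le> real m * d" using m d by (intro mult_right_mono) auto
    then have "d / 4 \<le> sin (d / 2)" using sin_ge_half [of "d / 2"] d md by simp
    then have "?s * (d / 4) \<le> ?s * sin (d / 2)" using sj d by (intro mult_left_mono) auto
    then show "?s * d \<le> 2 * (node m j - node m (Suc j))" unfolding half_node_sin(2) [OF j] d_def [symmetric] by simp
  qed simp
  also have "\<dots> \<le> 12 * (1 + D)\<^sup>2 * (node m j - node m (Suc j))"
  proof -
    have "0 \<le> node m j - node m (Suc j)" using node_less [of j "Suc j" m] j by simp
    then have "(5 * 2) * ((1 + D)\<^sup>2 * (node m j - node m (Suc j))) \<le> 12 * ((1 + D)\<^sup>2 * (node m j - node m (Suc j)))"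
      by (intro mult_right_mono) auto
    then show ?thesis by (simp only: mult_ac)
  qed
  finally show ?thesis .
qed

section \<open>Gluing the local approximants\<close>

text \<open>\<open>q j\<close> belongs to the double cell from node \<open>j\<close> to node
  \<open>j + 2\<close>, so the indices end at \<open>64 n - 2\<close>, and the last cell
  \<open>64 n - 1\<close> is served by the same polynomial as the one before; hence the minimum. The
  length \<open>l / (6 k)\<close> is that of one of the \<open>2 k\<close> equal pieces of a middle
  third.\<close>

abbreviation glued :: "nat \<Rightarrow> nat \<Rightarrow> real \<Rightarrow> real \<Rightarrow> real \<Rightarrow> nat \<Rightarrow> (nat \<Rightarrow> real poly) \<Rightarrow> real poly \<Rightarrow>
    (nat \<Rightarrow> real) \<Rightarrow> (nat \<Rightarrow> real) \<Rightarrow> bool" where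
  "glued k n \<alpha> \<beta> C \<kappa> q p A c \<equiv> (\<forall>j. 0 \<le> A j) \<and>
    (\<forall>j\<in>{1..64 * n - 2}.
      {c j..c j + (node (64 * n) j - node (64 * n) (Suc j)) / (6 * real k)} \<subseteq> {node (64 * n) (Suc j)..node (64 * n) j} \<and>
      (\<forall>y\<in>{c j..c j + (node (64 * n) j - node (64 * n) (Suc j)) / (6 * real k)}.
         A j \<le> C * (jacobi_weight \<alpha> \<beta> y * \<bar>poly (q (j - 1)) y - poly (q j) y\<bar>))) \<and>
    (\<forall>i<64 * n. \<forall>x\<in>{node (64 * n) (Suc i)<..node (64 * n) i}.
       jacobi_weight \<alpha> \<beta> x * \<bar>poly (q (min i (64 * n - 2))) x - poly p x\<bar>
        \<le> C * (\<Sum>j\<in>{1..64 * n - 2}. A j * (1 / (1 + \<bar>real i - real j\<bar>)) ^ \<kappa>))"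

text \<open>\<open>A j\<close> measures how far the neighbours \<open>q (j - 1)\<close> and \<open>q j\<close> are apart on cell \<open>j\<close>. It is bounded
  pointwise on a whole subinterval, so that the same lemma serves every exponent of the norm.\<close>

lemma gluing:
  fixes k \<kappa> :: nat and \<alpha> \<beta> :: real
  assumes k: "1 \<le> k" and ab: "0 \<le> \<alpha>" "0 \<le> \<beta>"
  shows "\<exists>C>0. \<forall>n\<ge>k. \<forall>q :: nat \<Rightarrow> real poly. (\<forall>j. degree (q j) < k) \<longrightarrow>
    (\<exists>p\<in>poly_space n. \<exists>A c. glued k n \<alpha> \<beta> C \<kappa> q p A c)"
proof -
  define e where "e = nat \<lceil>2 * (\<alpha> + \<beta>)\<rceil>"
  have e: "2 * (\<alpha> + \<beta>) \<le> real e" unfolding e_def by (rule real_nat_ceiling_ge)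
  \<comment> \<open>The decay has to absorb \<open>e\<close> powers of \<open>1 + D\<close> from the
    weight and \<open>2 k\<close> powers from the growth of polynomials of degree below
    \<open>k\<close>, whose argument moves by order \<open>(1 + D)^2\<close>;
    \<open>\<kappa>\<close> powers must survive.\<close>
  define \<rho> where "\<rho> = \<kappa> + e + 2 * k + 1"
  have rho: "1 \<le> \<rho>" by (simp add: \<rho>_def)
  define N where "N = 4 * \<rho> - 1"
  have N: "\<kappa> + e + 2 * k \<le> N" by (simp add: N_def \<rho>_def)
  define CT where "CT = (2 * (2 ^ (4 * \<rho>) * 64 ^ (2 * \<rho>)) :: real)"
  define b where "b = 64 * (real k + 2 * real \<rho>)"
  define Cp where "Cp = real k * (2 * real k) ^ k * 49 ^ k"
  define C where "C = 3 powr (\<alpha> + \<beta>) + 4 powr (\<alpha> + \<beta>) * Cp * (CT * (2 * b) ^ N)"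
  have kr: "1 \<le> real k" using k by simp
  have b1: "1 \<le> b" using kr by (simp add: b_def)
  have Cp0: "0 < Cp" using kr by (simp add: Cp_def)
  have CT0: "0 < CT" by (simp add: CT_def)
  have C3: "3 powr (\<alpha> + \<beta>) \<le> C" and C4: "4 powr (\<alpha> + \<beta>) * Cp * (CT * (2 * b) ^ N) \<le> C"
    unfolding C_def using Cp0 CT0 b1 by auto
  have C0: "0 < C" using C3 by (smt (verit) powr_gt_zero)
  show ?thesis
  proof (rule exI [of _ C], rule conjI [OF C0], intro allI impI)
    fix n :: nat and q :: "nat \<Rightarrow> real poly"
    assume n: "k \<le> n" and q: "\<forall>j. degree (q j) < k"
    define m where "m = 64 * n"
    have m2: "2 < m" using n k by (simp add: m_def)
    \<comment> \<open>The largest kernel order for which the step polynomials have degree at most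
      \<open>n - k\<close>. Multiplied by polynomials of degree at most \<open>k - 1\<close> they
      give degree at most \<open>n - 1\<close>; this uses \<open>k <= n\<close>.\<close>
    define M where "M = (n - k) div (2 * \<rho>) + 1"
    have M1: "1 \<le> M" by (simp add: M_def)
    have degM: "2 * \<rho> * (M - 1) \<le> n - k" by (simp add: M_def)
    have nM: "real n \<le> (real k + 2 * real \<rho>) * real M"
    proof -
      have "(n - k) mod (2 * \<rho>) < 2 * \<rho>" using rho by (intro mod_less_divisor) simp
      then have "n - k \<le> 2 * \<rho> * ((n - k) div (2 * \<rho>)) + 2 * \<rho>"
        using mult_div_mod_eq [of "2 * \<rho>" "n - k"] by linarith
      then have "n - k \<le> 2 * \<rho> * M" by (simp add: M_def)
      moreover have "k * 1 \<le> k * M" using M1 by (rule mult_le_mono2)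
      ultimately have "n \<le> k * M + 2 * \<rho> * M" using n by linarith
      then have "real n \<le> real (k * M + 2 * \<rho> * M)" by (rule of_nat_mono)
      then show ?thesis by (simp add: algebra_simps)
    qed
    define d where "d = pi / real m"
    have mr: "0 < real m" using m2 by simp
    have d0: "0 < d" using mr by (simp add: d_def)
    have md: "real m * d = pi" using mr by (simp add: d_def)
    \<comment> \<open>A mesh width is at least a fixed fraction of the kernel width
      \<open>1 / M\<close>: \<open>b\<close> combines the 64 of the mesh with
      \<open>n <= (k + 2 \<rho>) M\<close>.\<close>
    have Md: "1 / b \<le> real M * d"
    proof -
      have "1 \<le> real m / (b * real M) * (b * (real M * d))" using md M1 b1 mr pi_ge_two by (simp add: field_simps)
      moreover have "real m / (b * real M) \<le> 1"
        using nM M1 b1 unfolding m_def b_def by (simp add: divide_le_eq algebra_simps)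
      then have "real m / (b * real M) * (b * (real M * d)) \<le> 1 * (b * (real M * d))"
        using b1 d0 by (intro mult_right_mono) auto
      ultimately show ?thesis using b1 by (simp add: field_simps)
    qed
    define \<theta> where "\<theta> j = real j * d" for j
    have th: "\<theta> j \<in> {0..pi}" if "j \<le> m" for j
    proof -
      have "real j * d \<le> real m * d" using that d0 by (intro mult_right_mono) auto
      then show ?thesis using d0 md by (simp add: \<theta>_def)
    qed
    have nodeth: "node m j = cos (\<theta> j)" for j by (simp add: node_def \<theta>_def d_def)
    have "\<exists>T::real poly. degree T \<le> n - k \<and> (\<forall>t\<in>{0..pi}.
      \<bar>(if t < \<theta> j then 1 else 0) - poly T (cos t)\<bar> * (1 + real M * \<bar>t - \<theta> j\<bar>) ^ N \<le> CT)" if "j \<le> m" for j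
      using step_polynomial [OF rho M1 th [OF that]] degM unfolding N_def CT_def by (meson order_trans)
    then obtain T :: "nat \<Rightarrow> real poly" where dT: "\<And>j. j \<le> m \<Longrightarrow> degree (T j) \<le> n - k"
      and T: "\<And>j t. j \<le> m \<Longrightarrow> t \<in> {0..pi} \<Longrightarrow> \<bar>(if t < \<theta> j then 1 else 0) - poly (T j) (cos t)\<bar> * (1 + real M * \<bar>t - \<theta> j\<bar>) ^ N \<le> CT"
      by metis
    define l where "l j = node m j - node m (Suc j)" for j
    have l0: "0 < l j" if "j < m" for j using node_less [of j "Suc j" m] that by (simp add: l_def)
    define df where "df j = q (j - 1) - q j" for j
    have dd: "degree (df j) < k" for j unfolding df_def using q by (intro degree_diff_less) auto
    let ?c0 = "\<lambda>j. node m (Suc j) + l j / 3"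
    have "\<exists>B i. 0 \<le> B \<and> i < k \<and> (\<forall>y\<in>{?c0 j + 2 * real i * (l j / 3 / (2 * real k))..?c0 j + (2 * real i + 1) * (l j / 3 / (2 * real k))}. B \<le> \<bar>poly (df j) y\<bar>) \<and>
      (\<forall>x. \<bar>poly (df j) x\<bar> \<le> real k * (2 * real k) ^ k * (1 + \<bar>x - ?c0 j\<bar> / (l j / 3)) ^ k * B)" if "j < m" for j
      using poly_dominated_on_piece [OF dd [of j], of "l j / 3" "?c0 j"] l0 [OF that] by auto
    then obtain B i0 where B: "\<And>j. j < m \<Longrightarrow> 0 \<le> B j" "\<And>j. j < m \<Longrightarrow> i0 j < k"
      and Blow: "\<And>j y. j < m \<Longrightarrow> y \<in> {?c0 j + 2 * real (i0 j) * (l j / 3 / (2 * real k))..?c0 j + (2 * real (i0 j) + 1) * (l j / 3 / (2 * real k))} \<Longrightarrow> B j \<le> \<bar>poly (df j) y\<bar>"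
      and Bup: "\<And>j x. j < m \<Longrightarrow> \<bar>poly (df j) x\<bar> \<le> real k * (2 * real k) ^ k * (1 + \<bar>x - ?c0 j\<bar> / (l j / 3)) ^ k * B j"
      by metis
    define c where "c j = ?c0 j + 2 * real (i0 j) * (l j / 3 / (2 * real k))" for j
    define A where "A j = (if j < m then cell_weight \<alpha> \<beta> m j * B j else 0)" for j
    have cwn: "0 \<le> cell_weight \<alpha> \<beta> m j" for j by (simp add: cell_weight_def)
    have A0: "0 \<le> A j" for j using B(1) cwn by (simp add: A_def)
    \<comment> \<open>Summation by parts: with exact step functions in place of \<open>T j\<close>
      this would be the piecewise polynomial equal to \<open>q (min i (m - 2))\<close> on cell
      \<open>i\<close>. The error is therefore the sum of \<open>df j\<close> times the error of
      \<open>T j\<close>.\<close>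
    define p where "p = q (m - 2) + (\<Sum>j\<in>{1..m - 2}. df j * T j)"
    have "degree p \<le> n - 1" unfolding p_def
    proof (intro degree_add_le degree_sum_le)
      have "degree (q (m - 2)) < k" using q by blast
      then show "degree (q (m - 2)) \<le> n - 1" using n by linarith
      fix j assume j: "j \<in> {1..m - 2}"
      have "degree (df j * T j) \<le> degree (df j) + degree (T j)" by (rule degree_mult_le)
      also have "\<dots> \<le> n - 1" using dd [of j] dT [of j] j n by force
      finally show "degree (df j * T j) \<le> n - 1" .
    qed simp
    then have pn: "p \<in> poly_space n" unfolding poly_space_def using n k by auto
    have ce: "c j + l j / (6 * real k) = ?c0 j + (2 * real (i0 j) + 1) * (l j / 3 / (2 * real k))" for j
    proof -
      have "a + 2 * i * h + h = a + (2 * i + 1) * h" for a i h :: real by (simp add: algebra_simps)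
      moreover have "l j / (6 * real k) = l j / 3 / (2 * real k)" by simp
      ultimately show ?thesis unfolding c_def by metis
    qed
    have piece: "{c j..c j + l j / (6 * real k)} \<subseteq> {?c0 j..node m (Suc j) + 2 * l j / 3}" if j: "j < m" for j
    proof -
      have h: "l j / 3 / (2 * real k) = l j / (6 * real k)" by simp
      have hp: "0 \<le> l j / (6 * real k)" using l0 [OF j] by simp
      have "c j + l j / (6 * real k) = ?c0 j + (2 * real (i0 j) + 1) * (l j / (6 * real k))"
        unfolding ce h ..
      also have "(2 * real (i0 j) + 1) * (l j / (6 * real k)) \<le> (2 * real k) * (l j / (6 * real k))"
        using B(2) [OF j] hp by (intro mult_right_mono) auto
      also have "(2 * real k) * (l j / (6 * real k)) = l j / 3" using kr by simp
      finally have 1: "c j + l j / (6 * real k) \<le> node m (Suc j) + 2 * l j / 3" by simp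
      have "?c0 j \<le> c j" unfolding c_def using l0 [OF j] by simp
      then show ?thesis using 1 by auto
    qed
    have part1: "{c j..c j + l j / (6 * real k)} \<subseteq> {node m (Suc j)..node m j} \<and>
        (\<forall>y\<in>{c j..c j + l j / (6 * real k)}. A j \<le> C * (jacobi_weight \<alpha> \<beta> y * \<bar>poly (q (j - 1)) y - poly (q j) y\<bar>))"
      if "j \<in> {1..m - 2}" for j
    proof
      have j: "j < m" using that m2 by auto
      have lj: "0 < l j" by (rule l0 [OF j])
      have e: "node m j = node m (Suc j) + l j" by (simp add: l_def)
      have "{?c0 j..node m (Suc j) + 2 * l j / 3} \<subseteq> {node m (Suc j)..node m j}" unfolding e using lj by auto
      then show "{c j..c j + l j / (6 * real k)} \<subseteq> {node m (Suc j)..node m j}" using piece [OF j] by blast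
      show "\<forall>y\<in>{c j..c j + l j / (6 * real k)}. A j \<le> C * (jacobi_weight \<alpha> \<beta> y * \<bar>poly (q (j - 1)) y - poly (q j) y\<bar>)"
      proof
        fix y assume y: "y \<in> {c j..c j + l j / (6 * real k)}"
        have "y \<in> {?c0 j + 2 * real (i0 j) * (l j / 3 / (2 * real k))..?c0 j + (2 * real (i0 j) + 1) * (l j / 3 / (2 * real k))}"
          using y unfolding ce by (simp only: c_def)
        then have By: "B j \<le> \<bar>poly (df j) y\<bar>" by (rule Blow [OF j])
        have "cell_weight \<alpha> \<beta> m j \<le> 3 powr (\<alpha> + \<beta>) * jacobi_weight \<alpha> \<beta> y"
          by (rule cell_weight_le_jacobi_weight [of "l j"]) (use piece [OF j] y lj ab in \<open>auto simp: l_def\<close>)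
        then have "A j \<le> 3 powr (\<alpha> + \<beta>) * jacobi_weight \<alpha> \<beta> y * \<bar>poly (df j) y\<bar>"
          using By B(1) [OF j] j cwn unfolding A_def by (auto intro!: mult_mono)
        also have "\<dots> \<le> C * jacobi_weight \<alpha> \<beta> y * \<bar>poly (df j) y\<bar>" using C3 by (intro mult_right_mono) auto
        finally show "A j \<le> C * (jacobi_weight \<alpha> \<beta> y * \<bar>poly (q (j - 1)) y - poly (q j) y\<bar>)" by (simp add: df_def mult.assoc)
      qed
    qed
    have part2: "jacobi_weight \<alpha> \<beta> x * \<bar>poly (q (min i (m - 2))) x - poly p x\<bar>
          \<le> C * (\<Sum>j\<in>{1..m - 2}. A j * (1 / (1 + \<bar>real i - real j\<bar>)) ^ \<kappa>)"
      if i: "i < m" and x: "x \<in> {node m (Suc i)<..node m i}" for i x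
    proof -
      have x1: "- 1 \<le> x" "x \<le> 1" using x node_range [of m i] node_range [of m "Suc i"] by auto
      define t where "t = arccos x"
      have xt: "x = cos t" and tI: "t \<in> {0..pi}" using x1 by (auto simp: t_def arccos_lbound arccos_ubound)
      have ti: "\<theta> i \<le> t"
      proof (rule ccontr)
        assume "\<not> ?thesis"
        then have "cos (\<theta> i) < cos t" using tI th [of i] i by (intro cos_monotone_0_pi) auto
        then show False using x xt nodeth by auto
      qed
      have ti': "t < \<theta> (Suc i)"
      proof (rule ccontr)
        assume "\<not> ?thesis"
        then have "cos t \<le> cos (\<theta> (Suc i))" using tI th [of "Suc i"] i by (intro cos_monotone_0_pi_le) auto
        then show False using x xt nodeth by auto
      qed
      have chi: "t < \<theta> j \<longleftrightarrow> i < j" for j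
      proof
        assume "t < \<theta> j"
        then have "real i * d < real j * d" using ti by (simp add: \<theta>_def)
        then show "i < j" using d0 by simp
      next
        assume "i < j"
        then have "real (Suc i) * d \<le> real j * d" using d0 by (intro mult_right_mono) auto
        then show "t < \<theta> j" using ti' by (simp add: \<theta>_def)
      qed
      have tele: "poly (q (min i (m - 2))) x = poly (q (m - 2)) x + (\<Sum>j\<in>{1..m - 2}. poly (df j) x * (if t < \<theta> j then 1 else 0))"
      proof -
        have "(\<Sum>j\<in>{1..r}. poly (df j) x * (if i < j then 1 else 0)) = poly (q (min i r)) x - poly (q r) x" for r
        proof (induction r)
          case (Suc r)
          then show ?case by (cases "i < Suc r") (auto simp: df_def min_def)
        qed simp
        then show ?thesis unfolding chi by simp
      qed
      have "poly (q (min i (m - 2))) x - poly p x = (\<Sum>j\<in>{1..m - 2}. poly (df j) x * ((if t < \<theta> j then 1 else 0) - poly (T j) x))"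
        unfolding tele by (simp add: p_def poly_sum right_diff_distrib sum_subtractf)
      then have "jacobi_weight \<alpha> \<beta> x * \<bar>poly (q (min i (m - 2))) x - poly p x\<bar>
         \<le> jacobi_weight \<alpha> \<beta> x * (\<Sum>j\<in>{1..m - 2}. \<bar>poly (df j) x\<bar> * \<bar>(if t < \<theta> j then 1 else 0) - poly (T j) x\<bar>)"
        using sum_abs [of "\<lambda>j. poly (df j) x * ((if t < \<theta> j then 1 else 0) - poly (T j) x)" "{1..m - 2}"]
        by (intro mult_left_mono) (simp_all add: abs_mult)
      also have "\<dots> = (\<Sum>j\<in>{1..m - 2}. jacobi_weight \<alpha> \<beta> x * (\<bar>poly (df j) x\<bar> * \<bar>(if t < \<theta> j then 1 else 0) - poly (T j) x\<bar>))"
        by (rule sum_distrib_left)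
      also have "\<dots> \<le> (\<Sum>j\<in>{1..m - 2}. C * (A j * (1 / (1 + \<bar>real i - real j\<bar>)) ^ \<kappa>))"
      proof (rule sum_mono)
        fix j assume "j \<in> {1..m - 2}"
        then have j: "j < m" using m2 by auto
        define D where "D = \<bar>real i - real j\<bar>"
        have D0: "0 \<le> D" by (simp add: D_def)
        have w: "jacobi_weight \<alpha> \<beta> x \<le> 4 powr (\<alpha> + \<beta>) * (1 + D) ^ e * cell_weight \<alpha> \<beta> m j"
        proof -
          have "jacobi_weight \<alpha> \<beta> x \<le> cell_weight \<alpha> \<beta> m i" using x ab by (intro jacobi_weight_le_cell_weight) auto
          then show ?thesis using cell_weight_ratio [OF i j D_def ab e] by linarith
        qed
        have pd: "\<bar>poly (df j) x\<bar> \<le> Cp * (1 + D) ^ (2 * k) * B j"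
        proof -
          have lj: "0 < l j" by (rule l0 [OF j])
          have "\<bar>x - ?c0 j\<bar> \<le> 12 * (1 + D)\<^sup>2 * (node m j - node m (Suc j))"
          proof (rule cell_distance [OF i j D_def])
            have e: "node m j = node m (Suc j) + l j" by (simp add: l_def)
            show "?c0 j \<in> {node m (Suc j)..node m j}" unfolding e using lj by simp
          qed (use x in simp)
          then have "\<bar>x - ?c0 j\<bar> / (l j / 3) \<le> 36 * (1 + D)\<^sup>2" using lj by (simp add: l_def [symmetric] field_simps)
          moreover have "1 \<le> (1 + D)\<^sup>2" using D0 by (intro one_le_power) auto
          ultimately have "1 + \<bar>x - ?c0 j\<bar> / (l j / 3) \<le> 49 * (1 + D)\<^sup>2" by linarith
          then have "(1 + \<bar>x - ?c0 j\<bar> / (l j / 3)) ^ k \<le> (49 * (1 + D)\<^sup>2) ^ k"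
            using lj by (intro power_mono) auto
          also have "\<dots> = 49 ^ k * (1 + D) ^ (2 * k)" by (simp only: power_mult_distrib power_mult)
          finally have "real k * (2 * real k) ^ k * (1 + \<bar>x - ?c0 j\<bar> / (l j / 3)) ^ k * B j \<le> real k * (2 * real k) ^ k * (49 ^ k * (1 + D) ^ (2 * k)) * B j"
            using B(1) [OF j] by (intro mult_right_mono mult_left_mono) auto
          also have "\<dots> = Cp * (1 + D) ^ (2 * k) * B j" by (simp add: Cp_def)
          finally show ?thesis using Bup [OF j, of x] by linarith
        qed
        \<comment> \<open>A point anywhere in cell \<open>i\<close> is only guaranteed the angular
          distance \<open>(D - 1) d\<close> from node \<open>j\<close>. The lost unit is recovered
          by the summand 1 in the decay factor, at the price of \<open>2 b\<close> in place of
          \<open>b\<close>.\<close>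
        have tp: "\<bar>(if t < \<theta> j then 1 else 0) - poly (T j) x\<bar> \<le> CT * (2 * b) ^ N * (1 / (1 + D)) ^ N"
        proof -
          let ?Y = "1 + real M * \<bar>t - \<theta> j\<bar>"
          have "(D - 1) * d \<le> \<bar>t - \<theta> j\<bar>"
          proof (cases "i < j")
            case True
            then have "(D - 1) * d = \<theta> j - \<theta> (Suc i)" by (simp add: D_def \<theta>_def algebra_simps)
            then show ?thesis using ti' by linarith
          next
            case False
            then have "D * d = \<theta> i - \<theta> j" by (simp add: D_def \<theta>_def algebra_simps)
            then have "(D - 1) * d \<le> \<theta> i - \<theta> j" using d0 by (simp add: left_diff_distrib)
            then show ?thesis using ti by linarith
          qed
          then have "real M * ((D - 1) * d) \<le> real M * \<bar>t - \<theta> j\<bar>" by (rule mult_left_mono) simp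
          have Y1: "1 \<le> ?Y" by simp
          have Y: "(1 + D) / (2 * b) \<le> ?Y"
          proof (cases "D \<le> 1")
            case True
            then have "(1 + D) / (2 * b) \<le> 1" using b1 D0 by (simp add: divide_le_eq)
            then show ?thesis using Y1 by linarith
          next
            case False
            have "(D - 1) * (1 / b) \<le> (D - 1) * (real M * d)" using False Md by (intro mult_left_mono) auto
            also have "\<dots> \<le> real M * \<bar>t - \<theta> j\<bar>" using \<open>real M * ((D - 1) * d) \<le> real M * \<bar>t - \<theta> j\<bar>\<close> by (simp add: mult_ac)
            finally have "1 + (D - 1) / b \<le> ?Y" by simp
            moreover have "(1 + D) / (2 * b) \<le> 1 + (D - 1) / b"
            proof -
              have "(1 + D) / (2 * b) = (1 + D) / 2 / b" by simp
              also have "\<dots> \<le> (b + (D - 1)) / b" using b1 False by (intro divide_right_mono) auto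
              also have "\<dots> = 1 + (D - 1) / b" using b1 by (simp add: add_divide_distrib)
              finally show ?thesis .
            qed
            ultimately show ?thesis by linarith
          qed
          have YN: "((1 + D) / (2 * b)) ^ N \<le> ?Y ^ N" using Y D0 b1 by (intro power_mono) auto
          have "\<bar>(if t < \<theta> j then 1 else 0) - poly (T j) x\<bar> * ((1 + D) / (2 * b)) ^ N \<le> \<bar>(if t < \<theta> j then 1 else 0) - poly (T j) x\<bar> * ?Y ^ N"
            using YN by (rule mult_left_mono) simp
          also have "\<dots> \<le> CT" using T [of j t] j tI xt by simp
          finally have "\<bar>(if t < \<theta> j then 1 else 0) - poly (T j) x\<bar> * ((1 + D) / (2 * b)) ^ N \<le> CT" .
          moreover have pos: "0 < ((1 + D) / (2 * b)) ^ N" using D0 b1 by simp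
          ultimately have "\<bar>(if t < \<theta> j then 1 else 0) - poly (T j) x\<bar> \<le> CT / ((1 + D) / (2 * b)) ^ N"
            by (simp add: pos_le_divide_eq)
          also have "\<dots> = CT * (2 * b) ^ N * (1 / (1 + D)) ^ N" by (simp add: power_divide)
          finally show ?thesis .
        qed
        have "jacobi_weight \<alpha> \<beta> x * (\<bar>poly (df j) x\<bar> * \<bar>(if t < \<theta> j then 1 else 0) - poly (T j) x\<bar>)
          \<le> 4 powr (\<alpha> + \<beta>) * (1 + D) ^ e * cell_weight \<alpha> \<beta> m j * (Cp * (1 + D) ^ (2 * k) * B j * (CT * (2 * b) ^ N * (1 / (1 + D)) ^ N))"
          using w pd tp D0 cwn Cp0 B(1) [OF j] by (intro mult_mono mult_nonneg_nonneg) auto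
        also have "\<dots> = (4 powr (\<alpha> + \<beta>) * Cp * (CT * (2 * b) ^ N)) * (A j * ((1 + D) ^ (e + 2 * k) * (1 / (1 + D)) ^ N))"
          using j by (simp add: A_def power_add)
        also have "\<dots> \<le> C * (A j * (1 / (1 + D)) ^ \<kappa>)"
        proof (intro mult_mono C4)
          obtain r where r: "N = (e + 2 * k) + (\<kappa> + r)" using N by (metis add.assoc add.commute le_iff_add)
          have "(1 + D) ^ (e + 2 * k) * (1 / (1 + D)) ^ N = (1 / (1 + D)) ^ (\<kappa> + r)"
            using D0 unfolding r by (simp add: power_add power_divide)
          also have "\<dots> \<le> (1 / (1 + D)) ^ \<kappa>" using D0 by (intro power_decreasing) auto
          finally show "(1 + D) ^ (e + 2 * k) * (1 / (1 + D)) ^ N \<le> (1 / (1 + D)) ^ \<kappa>" .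
        qed (use A0 D0 C0 in auto)
        finally show "jacobi_weight \<alpha> \<beta> x * (\<bar>poly (df j) x\<bar> * \<bar>(if t < \<theta> j then 1 else 0) - poly (T j) x\<bar>)
          \<le> C * (A j * (1 / (1 + \<bar>real i - real j\<bar>)) ^ \<kappa>)" by (simp only: D_def)
      qed
      finally show ?thesis by (simp only: sum_distrib_left)
    qed
    show "\<exists>p\<in>poly_space n. \<exists>A c. glued k n \<alpha> \<beta> C \<kappa> q p A c"
      unfolding m_def [symmetric] l_def [symmetric]
    proof (rule bexI [OF _ pn], rule exI [of _ A], rule exI [of _ c], intro conjI allI ballI impI A0)
    qed (use part1 part2 in blast)+
  qed
qed

section \<open>Reflection at the origin, which exchanges the two exponents of the weight\<close>

lemma fdiff_mirror: "\<bar>fdiff k s (\<lambda>x. f (- x)) y\<bar> = \<bar>fdiff k s f (- y - real k * s)\<bar>"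
proof -
  have "fdiff k s (\<lambda>x. f (- x)) y = fdiff k (- s) f (- y)" unfolding fdiff_def by (simp add: algebra_simps)
  then show ?thesis using fdiff_reflect [of k s f "- y - real k * s"] by simp
qed

text \<open>Reflection turns the difference with leftmost point \<open>y\<close> and step
  \<open>s\<close> into the one with leftmost point \<open>- y - k s\<close> and the same
  step.\<close>

lemma step_weight_mirror: "step_weight \<beta> \<alpha> k y s = step_weight \<alpha> \<beta> k (- y - real k * s) s"
  unfolding step_weight_def by (simp add: algebra_simps)

lemma phi_minus [simp]: "phi (- x) = phi x"
  by (simp add: phi_def)

lemma steps_mirror: "(- y - real k * s, s) \<in> steps k r \<longleftrightarrow> (y, s) \<in> steps k r"
proof -
  define c where "c = y + real k * s / 2"
  have e: "- y - real k * s + real k * s / 2 = - c" by (simp add: c_def)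
  show ?thesis unfolding steps_def mem_Collect_eq fst_conv snd_conv e phi_minus c_def [symmetric] by auto
qed

lemma nn_integral_mirror:
  fixes h :: "real \<times> real \<Rightarrow> ennreal"
  assumes [measurable]: "h \<in> borel_measurable plane"
  shows "(\<integral>\<^sup>+z. h (- fst z - c * snd z, snd z) \<partial>plane) = (\<integral>\<^sup>+z. h z \<partial>plane)"
proof -
  have "(\<integral>\<^sup>+z. h (- fst z - c * snd z, snd z) \<partial>plane) = (\<integral>\<^sup>+s. \<integral>\<^sup>+y. h (- y - c * s, s) \<partial>lborel \<partial>lborel)"
    by (subst lborel_pair.nn_integral_snd [symmetric]) auto
  also have "\<dots> = (\<integral>\<^sup>+s. \<integral>\<^sup>+y. h (y, s) \<partial>lborel \<partial>lborel)"
  proof (rule nn_integral_cong)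
    fix s
    have "(\<integral>\<^sup>+y. h (y, s) \<partial>lborel) = ennreal \<bar>-1\<bar> * (\<integral>\<^sup>+y. h (- (c * s) + -1 * y, s) \<partial>lborel)"
      by (rule nn_integral_real_affine [where f = "\<lambda>y. h (y, s)"]) auto
    moreover have "(\<integral>\<^sup>+y. h (- (c * s) + -1 * y, s) \<partial>lborel) = (\<integral>\<^sup>+y. h (- y - c * s, s) \<partial>lborel)"
      by (intro nn_integral_cong) (simp add: algebra_simps)
    ultimately show "(\<integral>\<^sup>+y. h (- y - c * s, s) \<partial>lborel) = (\<integral>\<^sup>+y. h (y, s) \<partial>lborel)" by simp
  qed
  also have "\<dots> = (\<integral>\<^sup>+z. h z \<partial>plane)"
    by (subst lborel_pair.nn_integral_snd [symmetric]) auto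
  finally show ?thesis .
qed

lemma energy_density_mirror:
  "energy_density k r P \<beta> \<alpha> (\<lambda>x. f (- x)) z = energy_density k r P \<alpha> \<beta> f (- fst z - real k * snd z, snd z)"
proof -
  obtain y s where z: "z = (y, s)" by (cases z)
  have "- y - real k * s + real k * s / 2 = - (y + real k * s / 2)" by simp
  then have "phi (- y - real k * s + real k * s / 2) = phi (y + real k * s / 2)" by (simp only: phi_minus)
  then show ?thesis unfolding energy_density_def z
    using steps_mirror [of y k s r] by (simp add: fdiff_mirror step_weight_mirror [of \<beta>] indicator_def)
qed

lemma step_energy_mirror:
  assumes [measurable]: "f \<in> borel_measurable borel"
  shows "step_energy k r P \<beta> \<alpha> (\<lambda>x. f (- x)) = step_energy k r P \<alpha> \<beta> f"
  unfolding step_energy_eq energy_density_mirror by (rule nn_integral_mirror) measurable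

lemma jacobi_weight_mirror: "jacobi_weight \<alpha> \<beta> (- x) = jacobi_weight \<beta> \<alpha> x"
  by (simp add: jacobi_weight_def mult.commute)

section \<open>Summation over the cells\<close>

lemma node_overlap:
  assumes "J + 2 \<le> m"
  shows "(\<Sum>j<J. indicator {node m (j + 3)..node m j} y) \<le> (4 :: ennreal)"
proof -
  let ?S = "{j\<in>{..<J}. node m (j + 3) \<le> y \<and> y \<le> node m j}"
  have c: "card ?S \<le> 4"
  proof (cases "?S = {}")
    case False
    define i where "i = Min ?S"
    have "i \<in> ?S" unfolding i_def using False by (intro Min_in) auto
    then have i: "i < J" "node m (i + 3) \<le> y" by auto
    have "?S \<subseteq> {i..i + 3}"
    proof
      fix j assume j: "j \<in> ?S"
      have "i \<le> j" unfolding i_def using j by (intro Min_le) auto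
      moreover have "j \<le> i + 3"
      proof (rule ccontr)
        assume "\<not> j \<le> i + 3"
        then have "node m j < node m (i + 3)" using j assms by (intro node_less) auto
        then show False using i j by auto
      qed
      ultimately show "j \<in> {i..i + 3}" by simp
    qed
    then have "card ?S \<le> card {i..i + 3}" by (intro card_mono) auto
    then show ?thesis by simp
  next
    case True
    show ?thesis unfolding True by simp
  qed
  have "(\<Sum>j<J. indicator {node m (j + 3)..node m j} y) = (\<Sum>j\<in>?S. (1 :: ennreal))"
    by (rule sum.mono_neutral_cong_right) (auto simp: indicator_def)
  also have "\<dots> = of_nat (card ?S)" by simp
  also have "\<dots> \<le> of_nat 4" using c by (rule of_nat_mono)
  finally show ?thesis by simp
qed

text \<open>Every cell is given exactly its own share \<open>I j\<close> of the energy. A point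
  belongs to at most four of the triple cells in which the first points range, so the shares add up
  to at most four times the total.\<close>

lemma right_cells_Lp:
  fixes k :: nat and \<alpha> \<beta> P :: real
  assumes k: "1 \<le> k" and ab: "0 \<le> \<alpha>" "0 \<le> \<beta>" and P: "0 < P"
  shows "\<exists>C>0. \<forall>n\<ge>1. \<forall>f\<in>borel_measurable borel. \<forall>E\<ge>0. step_energy k (1 / real n) P \<alpha> \<beta> f \<le> ennreal E \<longrightarrow>
    (\<exists>q. (\<forall>j. degree (q j) < k) \<and> (\<Sum>j<32 * n. weighted_error \<alpha> \<beta> P f (q j) {node (64 * n) (j + 2)..node (64 * n) j}) \<le> ennreal (C * real n * E))"
proof -
  obtain C where C: "0 < C" and cell: "\<And>n j f e. 1 \<le> n \<Longrightarrow> j < 32 * n \<Longrightarrow> f \<in> borel_measurable borel \<Longrightarrow> 0 \<le> e \<Longrightarrow>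
    (\<integral>\<^sup>+z. energy_density k (1 / real n) P \<alpha> \<beta> f z * indicator {node (64 * n) (j + 3)..node (64 * n) j} (fst z) \<partial>plane) \<le> ennreal e \<Longrightarrow>
    (\<exists>q. degree q < k \<and> weighted_error \<alpha> \<beta> P f q {node (64 * n) (j + 2)..node (64 * n) j} \<le> ennreal (C * real n * e))"
    using right_cell_whitney_Lp [OF k ab P] by blast
  show ?thesis
  proof (rule exI [of _ "4 * C"], rule conjI, use C in simp, intro allI impI ballI)
    fix n :: nat and f :: "real \<Rightarrow> real" and E :: real
    assume n: "1 \<le> n" and f [measurable]: "f \<in> borel_measurable borel" and E: "0 \<le> E" and le: "step_energy k (1 / real n) P \<alpha> \<beta> f \<le> ennreal E"
    let ?x = "node (64 * n)"
    define I where "I j = (\<integral>\<^sup>+z. energy_density k (1 / real n) P \<alpha> \<beta> f z * indicator {?x (j + 3)..?x j} (fst z) \<partial>plane)" for j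
    have "I j \<le> step_energy k (1 / real n) P \<alpha> \<beta> f" for j
      unfolding I_def step_energy_eq by (rule nn_integral_mono) (simp add: indicator_def)
    then have "I j < \<infinity>" for j using le by (metis ennreal_less_top infinity_ennreal_def order_le_less_trans)
    then have Ie: "I j = ennreal (enn2real (I j))" for j by (simp add: less_top)
    have ex: "\<exists>q. degree q < k \<and> (j < 32 * n \<longrightarrow> weighted_error \<alpha> \<beta> P f q {?x (j + 2)..?x j} \<le> ennreal (C * real n * enn2real (I j)))" for j
    proof (cases "j < 32 * n")
      case True
      have "(\<integral>\<^sup>+z. energy_density k (1 / real n) P \<alpha> \<beta> f z * indicator {?x (j + 3)..?x j} (fst z) \<partial>plane) \<le> ennreal (enn2real (I j))"
        unfolding I_def [symmetric] using Ie [of j] by simp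
      from cell [OF n True f enn2real_nonneg this] show ?thesis by blast
    next
      case False
      then show ?thesis using k by (intro exI [of _ 0]) simp
    qed
    define Q where "Q j q \<longleftrightarrow> degree q < k \<and> (j < 32 * n \<longrightarrow> weighted_error \<alpha> \<beta> P f q {?x (j + 2)..?x j} \<le> ennreal (C * real n * enn2real (I j)))" for j q
    have "\<forall>j. \<exists>q. Q j q" using ex unfolding Q_def by blast
    then obtain q where q: "\<And>j. Q j (q j)" using choice by metis
    have "(\<Sum>j<32 * n. weighted_error \<alpha> \<beta> P f (q j) {?x (j + 2)..?x j}) \<le> (\<Sum>j<32 * n. ennreal (C * real n) * I j)"
    proof (rule sum_mono)
      fix j assume "j \<in> {..<32 * n}"
      then have "weighted_error \<alpha> \<beta> P f (q j) {?x (j + 2)..?x j} \<le> ennreal (C * real n * enn2real (I j))" using q [of j] unfolding Q_def by simp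
      also have "\<dots> = ennreal (C * real n) * ennreal (enn2real (I j))" using C by (simp add: ennreal_mult)
      finally show "weighted_error \<alpha> \<beta> P f (q j) {?x (j + 2)..?x j} \<le> ennreal (C * real n) * I j" using Ie [of j] by simp
    qed
    also have "\<dots> = ennreal (C * real n) * (\<Sum>j<32 * n. I j)" by (rule sum_distrib_left [symmetric])
    also have "(\<Sum>j<32 * n. I j) = (\<integral>\<^sup>+z. (\<Sum>j<32 * n. energy_density k (1 / real n) P \<alpha> \<beta> f z * indicator {?x (j + 3)..?x j} (fst z)) \<partial>plane)"
      unfolding I_def by (rule nn_integral_sum [symmetric]) measurable
    also have "\<dots> = (\<integral>\<^sup>+z. energy_density k (1 / real n) P \<alpha> \<beta> f z * (\<Sum>j<32 * n. indicator {?x (j + 3)..?x j} (fst z)) \<partial>plane)"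
      by (simp only: sum_distrib_left)
    also have "\<dots> \<le> (\<integral>\<^sup>+z. energy_density k (1 / real n) P \<alpha> \<beta> f z * 4 \<partial>plane)"
      using n by (intro nn_integral_mono mult_left_mono node_overlap) auto
    also have "\<dots> = step_energy k (1 / real n) P \<alpha> \<beta> f * 4" unfolding step_energy_eq by (rule nn_integral_multc) measurable
    also have "\<dots> \<le> ennreal E * 4" by (rule mult_right_mono [OF le]) simp
    also have "ennreal (C * real n) * (ennreal E * 4) = ennreal (4 * C * real n * E)"
    proof -
      have "ennreal E * 4 = ennreal (E * 4)" using E by (simp add: ennreal_mult)
      then show ?thesis using C E by (simp add: ennreal_mult [symmetric] mult_ac)
    qed
    finally have "(\<Sum>j<32 * n. weighted_error \<alpha> \<beta> P f (q j) {?x (j + 2)..?x j}) \<le> ennreal (4 * C * real n * E)" by (simp add: mult_left_mono)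
    then show "\<exists>q. (\<forall>j. degree (q j) < k) \<and> (\<Sum>j<32 * n. weighted_error \<alpha> \<beta> P f (q j) {?x (j + 2)..?x j}) \<le> ennreal (4 * C * real n * E)"
      using q unfolding Q_def by blast
  qed
qed

lemma mirror_cell:
  assumes "j + 2 \<le> m" "0 < m"
  shows "- x \<in> {node m (m - 2 - j + 2)..node m (m - 2 - j)} \<longleftrightarrow> x \<in> {node m (j + 2)..node m j}"
proof -
  have e: "m - 2 - j = m - (j + 2)" "m - (j + 2) + 2 = m - j" using assms by auto
  show ?thesis unfolding e using assms by (subst (1 2) node_reflect) auto
qed

lemma degree_mirror: "degree (pcompose q [:0, - 1:]) = degree (q :: real poly)"
  by (simp add: degree_pcompose)

lemma poly_mirror: "poly (pcompose q [:0, - 1:]) x = poly q (- x :: real)"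
  by (simp add: poly_pcompose)

text \<open>Double cells that start at or left of 0, \<open>j >= 32 n\<close>, are handled by
  reflection. Reflection maps double cell \<open>j\<close> to \<open>m - 2 - j\<close>, an index
  below \<open>32 n\<close>, and exchanges \<open>\<alpha>\<close> and \<open>\<beta>\<close>, so
  the two halves come with different constants.\<close>

lemma all_cells_Lp:
  fixes k :: nat and \<alpha> \<beta> P :: real
  assumes k: "1 \<le> k" and ab: "0 \<le> \<alpha>" "0 \<le> \<beta>" and P: "0 < P"
  shows "\<exists>C>0. \<forall>n\<ge>1. \<forall>f\<in>borel_measurable borel. \<forall>E\<ge>0. step_energy k (1 / real n) P \<alpha> \<beta> f \<le> ennreal E \<longrightarrow>
    (\<exists>q. (\<forall>j. degree (q j) < k) \<and> (\<Sum>j\<le>64 * n - 2. weighted_error \<alpha> \<beta> P f (q j) {node (64 * n) (j + 2)..node (64 * n) j}) \<le> ennreal (C * real n * E))"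
proof -
  obtain C1 where C1: "0 < C1" and r1: "\<And>n f E. 1 \<le> n \<Longrightarrow> f \<in> borel_measurable borel \<Longrightarrow> 0 \<le> E \<Longrightarrow> step_energy k (1 / real n) P \<alpha> \<beta> f \<le> ennreal E \<Longrightarrow>
    (\<exists>q. (\<forall>j. degree (q j) < k) \<and> (\<Sum>j<32 * n. weighted_error \<alpha> \<beta> P f (q j) {node (64 * n) (j + 2)..node (64 * n) j}) \<le> ennreal (C1 * real n * E))"
    using right_cells_Lp [OF k ab P] by blast
  obtain C2 where C2: "0 < C2" and r2: "\<And>n f E. 1 \<le> n \<Longrightarrow> f \<in> borel_measurable borel \<Longrightarrow> 0 \<le> E \<Longrightarrow> step_energy k (1 / real n) P \<beta> \<alpha> f \<le> ennreal E \<Longrightarrow>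
    (\<exists>q. (\<forall>j. degree (q j) < k) \<and> (\<Sum>j<32 * n. weighted_error \<beta> \<alpha> P f (q j) {node (64 * n) (j + 2)..node (64 * n) j}) \<le> ennreal (C2 * real n * E))"
    using right_cells_Lp [OF k ab(2) ab(1) P] by blast
  show ?thesis
  proof (rule exI [of _ "C1 + C2"], rule conjI, use C1 C2 in simp, intro allI impI ballI)
    fix n :: nat and f :: "real \<Rightarrow> real" and E :: real
    assume n: "1 \<le> n" and f [measurable]: "f \<in> borel_measurable borel" and E: "0 \<le> E" and le: "step_energy k (1 / real n) P \<alpha> \<beta> f \<le> ennreal E"
    define m where "m = 64 * n"
    have m: "2 < m" "0 < m" using n by (auto simp: m_def)
    define F where "F q j = weighted_error \<alpha> \<beta> P f q {node m (j + 2)..node m j}" for q j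
    define F' where "F' q j = (\<integral>\<^sup>+x. ennreal ((jacobi_weight \<beta> \<alpha> x * \<bar>f (- x) - poly q x\<bar>) powr P) * indicator {node m (j + 2)..node m j} x \<partial>lborel)" for q j
    obtain q1 where q1: "\<And>j. degree (q1 j) < k" "(\<Sum>j<32 * n. F (q1 j) j) \<le> ennreal (C1 * real n * E)"
      using r1 [OF n f E le] unfolding F_def m_def by blast
    have fm: "(\<lambda>x. f (- x)) \<in> borel_measurable borel" by measurable
    have le': "step_energy k (1 / real n) P \<beta> \<alpha> (\<lambda>x. f (- x)) \<le> ennreal E" using le step_energy_mirror [OF f] by simp
    obtain q2 where q2: "\<And>j. degree (q2 j) < k" "(\<Sum>j<32 * n. F' (q2 j) j) \<le> ennreal (C2 * real n * E)"
      using r2 [OF n fm E le'] unfolding F'_def m_def by blast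
    have FF': "F (pcompose q [:0, - 1:]) j = F' q (m - 2 - j)" if "j + 2 \<le> m" for q j
    proof -
      have "F (pcompose q [:0, - 1:]) j = ennreal \<bar>-1\<bar> * (\<integral>\<^sup>+x. ennreal ((jacobi_weight \<alpha> \<beta> (0 + -1 * x) * \<bar>f (0 + -1 * x) - poly (pcompose q [:0, - 1:]) (0 + -1 * x)\<bar>) powr P) * indicator {node m (j + 2)..node m j} (0 + -1 * x) \<partial>lborel)"
        unfolding F_def by (rule nn_integral_real_affine [where f = "\<lambda>x. ennreal ((jacobi_weight \<alpha> \<beta> x * \<bar>f x - poly (pcompose q [:0, - 1:]) x\<bar>) powr P) * indicator {node m (j + 2)..node m j} x"]) auto
      also have "\<dots> = (\<integral>\<^sup>+x. ennreal ((jacobi_weight \<alpha> \<beta> (0 + -1 * x) * \<bar>f (0 + -1 * x) - poly (pcompose q [:0, - 1:]) (0 + -1 * x)\<bar>) powr P) * indicator {node m (j + 2)..node m j} (0 + -1 * x) \<partial>lborel)"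
        by simp
      also have "\<dots> = F' q (m - 2 - j)"
        unfolding F'_def
      proof (intro nn_integral_cong)
        fix x
        have "indicator {node m (j + 2)..node m j} (- x) = (indicator {node m (m - 2 - j + 2)..node m (m - 2 - j)} x :: ennreal)"
          using mirror_cell [OF that m(2), of "- x"] by (simp add: indicator_def)
        then show "ennreal ((jacobi_weight \<alpha> \<beta> (0 + -1 * x) * \<bar>f (0 + -1 * x) - poly (pcompose q [:0, - 1:]) (0 + -1 * x)\<bar>) powr P) * indicator {node m (j + 2)..node m j} (0 + -1 * x) =
          ennreal ((jacobi_weight \<beta> \<alpha> x * \<bar>f (- x) - poly q x\<bar>) powr P) * indicator {node m (m - 2 - j + 2)..node m (m - 2 - j)} x"
          by (simp add: jacobi_weight_mirror poly_mirror)
      qed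
      finally show ?thesis .
    qed
    define q where "q j = (if j < 32 * n then q1 j else pcompose (q2 (m - 2 - j)) [:0, - 1:])" for j
    have dq: "degree (q j) < k" for j using q1 q2 by (simp add: q_def degree_mirror)
    have "{..m - 2} = {..<32 * n} \<union> {32 * n..m - 2}" using n by (auto simp: m_def)
    then have "(\<Sum>j\<le>m - 2. F (q j) j) = (\<Sum>j<32 * n. F (q j) j) + (\<Sum>j\<in>{32 * n..m - 2}. F (q j) j)"
      by (simp only:) (rule sum.union_disjoint, auto)
    also have "(\<Sum>j<32 * n. F (q j) j) = (\<Sum>j<32 * n. F (q1 j) j)" by (rule sum.cong) (auto simp: q_def)
    also have "(\<Sum>j\<in>{32 * n..m - 2}. F (q j) j) = (\<Sum>j\<in>{32 * n..m - 2}. F' (q2 (m - 2 - j)) (m - 2 - j))"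
      using m by (intro sum.cong) (auto simp: q_def FF')
    also have "\<dots> = (\<Sum>j\<in>(\<lambda>j. m - 2 - j) ` {32 * n..m - 2}. F' (q2 j) j)"
      by (subst sum.reindex) (auto simp: inj_on_def)
    also have "\<dots> \<le> (\<Sum>j<32 * n. F' (q2 j) j)"
      using n by (intro sum_mono2) (auto simp: m_def)
    also note q2(2)
    also have "(\<Sum>j<32 * n. F (q1 j) j) + ennreal (C2 * real n * E) \<le> ennreal (C1 * real n * E) + ennreal (C2 * real n * E)"
      using q1(2) by (rule add_right_mono)
    also have "\<dots> = ennreal ((C1 + C2) * real n * E)"
      using C1 C2 E by (simp add: ennreal_plus [symmetric] distrib_right del: ennreal_plus)
    finally have "(\<Sum>j\<le>m - 2. F (q j) j) \<le> ennreal ((C1 + C2) * real n * E)" by (simp add: add_left_mono)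
    then show "\<exists>q. (\<forall>j. degree (q j) < k) \<and> (\<Sum>j\<le>64 * n - 2. weighted_error \<alpha> \<beta> P f (q j) {node (64 * n) (j + 2)..node (64 * n) j}) \<le> ennreal ((C1 + C2) * real n * E)"
      using dq unfolding F_def m_def by blast
  qed
qed

lemma all_cells_sup:
  fixes k :: nat and \<alpha> \<beta> :: real
  assumes k: "1 \<le> k" and ab: "0 \<le> \<alpha>" "0 \<le> \<beta>"
  shows "\<exists>C>0. \<forall>n\<ge>1. \<forall>f\<in>borel_measurable borel. \<forall>\<omega>\<ge>0.
    steps_bounded k (1 / real n) \<alpha> \<beta> f \<omega> \<longrightarrow>
    (\<exists>q. (\<forall>j. degree (q j) < k) \<and> (\<forall>j\<le>64 * n - 2. AE x in lborel. x \<in> {node (64 * n) (j + 2)..node (64 * n) j} \<longrightarrow>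
        jacobi_weight \<alpha> \<beta> x * \<bar>f x - poly (q j) x\<bar> \<le> C * \<omega>))"
proof -
  define Hyp where "Hyp \<alpha> \<beta> n f \<omega> \<longleftrightarrow> steps_bounded k (1 / real n) \<alpha> \<beta> f \<omega>"
    for \<alpha> \<beta> :: real and n :: nat and f :: "real \<Rightarrow> real" and \<omega> :: real
  define Con where "Con \<alpha> \<beta> n f j B q \<longleftrightarrow> (AE x in lborel. x \<in> {node (64 * n) (j + 2)..node (64 * n) j} \<longrightarrow>
        jacobi_weight \<alpha> \<beta> x * \<bar>f x - poly q x\<bar> \<le> B)" for \<alpha> \<beta> :: real and n j :: nat and f :: "real \<Rightarrow> real" and B :: real and q :: "real poly"
  obtain C1 where C1: "0 < C1" and r1: "\<And>n j f \<omega>. 1 \<le> n \<Longrightarrow> j < 32 * n \<Longrightarrow> f \<in> borel_measurable borel \<Longrightarrow> 0 \<le> \<omega> \<Longrightarrow> Hyp \<alpha> \<beta> n f \<omega> \<Longrightarrow>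
      \<exists>q. degree q < k \<and> Con \<alpha> \<beta> n f j (C1 * \<omega>) q"
    using right_cell_whitney_sup [OF k ab] unfolding Hyp_def [symmetric] Con_def [symmetric] by blast
  obtain C2 where C2: "0 < C2" and r2: "\<And>n j f \<omega>. 1 \<le> n \<Longrightarrow> j < 32 * n \<Longrightarrow> f \<in> borel_measurable borel \<Longrightarrow> 0 \<le> \<omega> \<Longrightarrow> Hyp \<beta> \<alpha> n f \<omega> \<Longrightarrow>
      \<exists>q. degree q < k \<and> Con \<beta> \<alpha> n f j (C2 * \<omega>) q"
    using right_cell_whitney_sup [OF k ab(2) ab(1)] unfolding Hyp_def [symmetric] Con_def [symmetric] by blast
  have "\<exists>q. (\<forall>j. degree (q j) < k) \<and> (\<forall>j\<le>64 * n - 2. Con \<alpha> \<beta> n f j ((C1 + C2) * \<omega>) (q j))"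
    if n: "1 \<le> n" and f: "f \<in> borel_measurable borel" and w: "0 \<le> \<omega>" and H: "Hyp \<alpha> \<beta> n f \<omega>" for n f \<omega>
  proof -
    note f [measurable]
    define m where "m = 64 * n"
    have m: "2 < m" "0 < m" using n by (auto simp: m_def)
    have fm: "(\<lambda>x. f (- x)) \<in> borel_measurable borel" by measurable
    have H': "Hyp \<beta> \<alpha> n (\<lambda>x. f (- x)) \<omega>"
    proof -
      define h where "h z = (if z \<in> steps k (1 / real n) \<longrightarrow> step_weight \<alpha> \<beta> k (fst z) (snd z) * \<bar>fdiff k (snd z) f (fst z)\<bar> \<le> \<omega> then 0 else 1 :: ennreal)" for z
      have hm [measurable]: "h \<in> borel_measurable plane" unfolding h_def by measurable
      have "AE z in plane. h z = 0" using H unfolding Hyp_def by (rule eventually_mono) (simp add: h_def)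
      then have "(\<integral>\<^sup>+z. h z \<partial>plane) = 0" by (subst nn_integral_0_iff_AE) auto
      then have "(\<integral>\<^sup>+z. h (- fst z - real k * snd z, snd z) \<partial>plane) = 0" by (simp add: nn_integral_mirror)
      then have "AE z in plane. h (- fst z - real k * snd z, snd z) = 0"
        by (subst (asm) nn_integral_0_iff_AE) auto
      then show ?thesis unfolding Hyp_def
      proof (rule eventually_mono)
        fix z :: "real \<times> real"
        obtain y s where z: "z = (y, s)" by (cases z)
        assume "h (- fst z - real k * snd z, snd z) = 0"
        then show "z \<in> steps k (1 / real n) \<longrightarrow> step_weight \<beta> \<alpha> k (fst z) (snd z) * \<bar>fdiff k (snd z) (\<lambda>x. f (- x)) (fst z)\<bar> \<le> \<omega>"
          unfolding z h_def using steps_mirror [of y k s "1 / real n"]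
          by (auto simp: fdiff_mirror step_weight_mirror [of \<beta>] split: if_splits)
      qed
    qed
    have "\<exists>q. degree q < k \<and> (j \<le> m - 2 \<longrightarrow> Con \<alpha> \<beta> n f j ((C1 + C2) * \<omega>) q)" for j
    proof (cases "j < 32 * n")
      case True
      obtain q where q: "degree q < k" "Con \<alpha> \<beta> n f j (C1 * \<omega>) q" using r1 [OF n True f w H] by blast
      have "C1 * \<omega> \<le> (C1 + C2) * \<omega>" using C2 w by (intro mult_right_mono) auto
      then have "Con \<alpha> \<beta> n f j ((C1 + C2) * \<omega>) q"
        using q(2) unfolding Con_def by (elim eventually_mono) auto
      then show ?thesis using q by blast
    next
      case False
      show ?thesis
      proof (cases "j \<le> m - 2")
        case True
        then have j2: "j + 2 \<le> m" using m by simp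
        have "m - 2 - j < 32 * n" using False n by (simp add: m_def)
        then obtain q where q: "degree q < k" "Con \<beta> \<alpha> n (\<lambda>x. f (- x)) (m - 2 - j) (C2 * \<omega>) q"
          using r2 [OF n _ fm w H'] by blast
        have c: "C2 * \<omega> \<le> (C1 + C2) * \<omega>" using C1 w by (intro mult_right_mono) auto
        have "AE x in lborel. x \<in> {node m (m - 2 - j + 2)..node m (m - 2 - j)} \<longrightarrow> jacobi_weight \<beta> \<alpha> x * \<bar>f (- x) - poly q x\<bar> \<le> C2 * \<omega>"
          using q(2) unfolding Con_def m_def .
        then have "AE x in lborel. 0 + - 1 * x \<in> {node m (m - 2 - j + 2)..node m (m - 2 - j)} \<longrightarrow> jacobi_weight \<beta> \<alpha> (0 + - 1 * x) * \<bar>f (- (0 + - 1 * x)) - poly q (0 + - 1 * x)\<bar> \<le> C2 * \<omega>"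
          by (intro AE_borel_affine [where P = "\<lambda>x. x \<in> {node m (m - 2 - j + 2)..node m (m - 2 - j)} \<longrightarrow> jacobi_weight \<beta> \<alpha> x * \<bar>f (- x) - poly q x\<bar> \<le> C2 * \<omega>"]) auto
        then have "Con \<alpha> \<beta> n f j ((C1 + C2) * \<omega>) (pcompose q [:0, - 1:])"
          unfolding Con_def m_def [symmetric]
        proof (rule eventually_mono, intro impI)
          fix x
          assume a: "0 + - 1 * x \<in> {node m (m - 2 - j + 2)..node m (m - 2 - j)} \<longrightarrow> jacobi_weight \<beta> \<alpha> (0 + - 1 * x) * \<bar>f (- (0 + - 1 * x)) - poly q (0 + - 1 * x)\<bar> \<le> C2 * \<omega>"
            and x: "x \<in> {node m (j + 2)..node m j}"
          have "- x \<in> {node m (m - 2 - j + 2)..node m (m - 2 - j)}" using mirror_cell [OF j2 m(2), of x] x by blast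
          then have "jacobi_weight \<beta> \<alpha> (- x) * \<bar>f x - poly q (- x)\<bar> \<le> C2 * \<omega>" using a by simp
          then show "jacobi_weight \<alpha> \<beta> x * \<bar>f x - poly (pcompose q [:0, - 1:]) x\<bar> \<le> (C1 + C2) * \<omega>"
            using c unfolding poly_mirror jacobi_weight_mirror by linarith
        qed
        then show ?thesis using q(1) by (intro exI [of _ "pcompose q [:0, - 1:]"]) (simp add: degree_mirror)
      next
        case False
        then show ?thesis using k by (intro exI [of _ 0]) simp
      qed
    qed
    then have "\<exists>q. \<forall>j. degree (q j) < k \<and> (j \<le> m - 2 \<longrightarrow> Con \<alpha> \<beta> n f j ((C1 + C2) * \<omega>) (q j))" by (rule choice [OF allI])
    then show ?thesis unfolding m_def by blast
  qed
  then show ?thesis unfolding Hyp_def [symmetric] Con_def [symmetric] using C1 C2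
    by (intro exI [of _ "C1 + C2"]) (auto intro: add_pos_pos)
qed

section \<open>Jackson's inequality\<close>

text \<open>The bound is uniform in the centre \<open>i\<close> and in the index set, hence in the
  number of cells.\<close>

lemma decay_sum_bounded:
  "\<exists>\<Lambda>\<ge>1. \<forall>S (i::nat). finite S \<longrightarrow> (\<Sum>j\<in>S. (1 / (1 + \<bar>real i - real j\<bar>)) ^ 2) \<le> \<Lambda>"
proof -
  define g where "g r = (1 / (1 + real r)) ^ 2" for r
  have g: "summable g" unfolding g_def using inverse_squares_sums by (simp add: sums_iff power_one_over add.commute)
  have g0: "0 \<le> g r" for r by (simp add: g_def)
  show ?thesis
  proof (intro exI [of _ "1 + 2 * suminf g"] conjI allI impI)
    show "1 \<le> 1 + 2 * suminf g" using suminf_nonneg [OF g g0] by simp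
    fix S :: "nat set" and i :: nat assume S: "finite S"
    let ?f = "\<lambda>j. (1 / (1 + \<bar>real i - real j\<bar>)) ^ 2"
    have 1: "(\<Sum>j\<in>S \<inter> {..i}. ?f j) \<le> suminf g"
    proof -
      have "(\<Sum>j\<in>S \<inter> {..i}. ?f j) = (\<Sum>j\<in>S \<inter> {..i}. g (i - j))" by (rule sum.cong) (auto simp: g_def of_nat_diff)
      also have "\<dots> = (\<Sum>r\<in>(\<lambda>j. i - j) ` (S \<inter> {..i}). g r)" by (subst sum.reindex) (auto simp: inj_on_def)
      also have "\<dots> \<le> suminf g" using S g g0 by (intro sum_le_suminf) auto
      finally show ?thesis .
    qed
    have 2: "(\<Sum>j\<in>S - {..i}. ?f j) \<le> suminf g"
    proof -
      have "(\<Sum>j\<in>S - {..i}. ?f j) = (\<Sum>j\<in>S - {..i}. g (j - i))" by (rule sum.cong) (auto simp: g_def of_nat_diff)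
      also have "\<dots> = (\<Sum>r\<in>(\<lambda>j. j - i) ` (S - {..i}). g r)" by (subst sum.reindex) (auto simp: inj_on_def)
      also have "\<dots> \<le> suminf g" using S g g0 by (intro sum_le_suminf) auto
      finally show ?thesis .
    qed
    have "(\<Sum>j\<in>S. ?f j) = (\<Sum>j\<in>S \<inter> {..i}. ?f j) + (\<Sum>j\<in>S - {..i}. ?f j)" by (rule sum.Int_Diff [OF S])
    then show "(\<Sum>j\<in>S. ?f j) \<le> 1 + 2 * suminf g" using 1 2 by linarith
  qed
qed

text \<open>Splitting off a summable factor \<open>(1 + \<bar>i - j\<bar>)^(-2)\<close> and estimating the rest by its maximum
  works for every exponent \<open>P > 0\<close>, without distinguishing \<open>P < 1\<close> from \<open>P \<ge> 1\<close>.\<close>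

lemma powr_decay_sum:
  fixes x :: "nat \<Rightarrow> real"
  assumes S: "finite S" and x: "\<And>j. 0 \<le> x j" and P: "0 < P" and \<kappa>: "3 \<le> real \<kappa> * P" and L1: "1 \<le> \<Lambda>"
    and L: "(\<Sum>j\<in>S. (1 / (1 + \<bar>real i - real j\<bar>)) ^ 2) \<le> \<Lambda>"
  shows "(\<Sum>j\<in>S. x j * (1 / (1 + \<bar>real i - real j\<bar>)) ^ (\<kappa> + 2)) powr P
    \<le> \<Lambda> powr P * (\<Sum>j\<in>S. x j powr P * (1 / (1 + \<bar>real i - real j\<bar>)) ^ 3)"
proof (cases "S = {}")
  case False
  define l where "l j = 1 / (1 + \<bar>real i - real j\<bar>)" for j :: nat
  have l: "0 < l j" "l j \<le> 1" for j by (auto simp: l_def add_pos_nonneg)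
  define M where "M = Max ((\<lambda>j. x j * l j ^ \<kappa>) ` S)"
  have M: "x j * l j ^ \<kappa> \<le> M" if "j \<in> S" for j unfolding M_def using S that by (intro Max_ge) auto
  have "M \<in> (\<lambda>j. x j * l j ^ \<kappa>) ` S" unfolding M_def using S False by (intro Max_in) auto
  then obtain j0 where j0: "j0 \<in> S" "M = x j0 * l j0 ^ \<kappa>" by auto
  have M0: "0 \<le> M" using j0 x l by (simp add: less_imp_le)
  have "(\<Sum>j\<in>S. x j * l j ^ (\<kappa> + 2)) \<le> (\<Sum>j\<in>S. M * l j ^ 2)"
  proof (rule sum_mono)
    fix j assume "j \<in> S"
    then have "x j * l j ^ \<kappa> * l j ^ 2 \<le> M * l j ^ 2" using l by (intro mult_right_mono M) auto
    then show "x j * l j ^ (\<kappa> + 2) \<le> M * l j ^ 2" by (simp only: power_add mult.assoc)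
  qed
  also have "\<dots> = M * (\<Sum>j\<in>S. l j ^ 2)" by (rule sum_distrib_left [symmetric])
  also have "\<dots> \<le> M * \<Lambda>" using L M0 unfolding l_def by (intro mult_left_mono) auto
  finally have "(\<Sum>j\<in>S. x j * l j ^ (\<kappa> + 2)) powr P \<le> (M * \<Lambda>) powr P"
    using x l P by (intro powr_mono2 sum_nonneg mult_nonneg_nonneg) (auto simp: less_imp_le)
  also have "\<dots> = \<Lambda> powr P * (x j0 powr P * (l j0 ^ \<kappa>) powr P)"
    using M0 L1 x l by (simp add: j0(2) powr_mult less_imp_le)
  also have "\<dots> \<le> \<Lambda> powr P * (x j0 powr P * l j0 ^ 3)"
  proof (intro mult_left_mono)
    have "(l j0 ^ \<kappa>) powr P = l j0 powr (real \<kappa> * P)" using l by (simp add: powr_realpow [symmetric] powr_powr)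
    also have "\<dots> \<le> l j0 powr 3" using l \<kappa> by (intro powr_mono') (auto simp: less_imp_le)
    also have "\<dots> = l j0 ^ 3" using l [of j0] by simp
    finally show "(l j0 ^ \<kappa>) powr P \<le> l j0 ^ 3" .
  qed auto
  also have "\<dots> \<le> \<Lambda> powr P * (\<Sum>j\<in>S. x j powr P * l j ^ 3)"
    using j0 S l by (intro mult_left_mono member_le_sum) (auto simp: less_imp_le)
  finally show ?thesis unfolding l_def .
qed simp

text \<open>Half-open cells match the strict inequalities of the step functions. They miss only the
  point -1, which is later discarded as a null set.\<close>

lemma cells_cover:
  assumes "0 < m" "x \<in> {-1..1}" "x \<noteq> - 1"
  shows "\<exists>i<m. x \<in> {node m (Suc i)<..node m i}"
proof -
  have nm: "node m m = - 1" using assms by (simp add: node_def)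
  define i where "i = (LEAST i. node m (Suc i) < x)"
  have ex: "node m (Suc (m - 1)) < x" using assms nm by simp
  then have 1: "node m (Suc i) < x" unfolding i_def by (rule LeastI)
  have "i \<le> m - 1" unfolding i_def using ex by (rule Least_le)
  then have im: "i < m" using assms by simp
  have "x \<le> node m i"
  proof (cases i)
    case 0
    then show ?thesis using assms by simp
  next
    case (Suc i')
    then have "\<not> node m (Suc i') < x" using not_less_Least [of i' "\<lambda>i. node m (Suc i) < x"] unfolding i_def by simp
    then show ?thesis using Suc by simp
  qed
  then show ?thesis using 1 im by auto
qed

text \<open>On each cell the error splits into that of the local polynomial and that of gluing. The
  latter is a sum over all \<open>j\<close> with decay in the index distance; interchanging the sums
  over \<open>i\<close> and \<open>j\<close> leaves the total of the quantities \<open>a j\<close>,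
  and these are controlled by the local errors of neighbouring polynomials.\<close>

lemma jackson_Lp:
  fixes k :: nat and \<alpha> \<beta> P :: real
  assumes k: "1 \<le> k" and ab: "0 \<le> \<alpha>" "0 \<le> \<beta>" and P: "0 < P"
  shows "\<exists>C>0. \<forall>n\<ge>k. \<forall>f\<in>borel_measurable borel. \<forall>E\<ge>0. step_energy k (1 / real n) P \<alpha> \<beta> f \<le> ennreal E \<longrightarrow>
    (\<exists>p\<in>poly_space n. weighted_error \<alpha> \<beta> P f p {-1..1} \<le> ennreal (C * real n * E))"
proof -
  obtain \<Lambda> where L1: "1 \<le> \<Lambda>" and L: "\<And>S i. finite S \<Longrightarrow> (\<Sum>j\<in>S. (1 / (1 + \<bar>real i - real j\<bar>)) ^ 2) \<le> \<Lambda>"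
    using decay_sum_bounded by blast
  \<comment> \<open>After taking \<open>P\<close>-th powers three powers of the decay survive: one
    compensates the ratio of cell lengths, two make the sum over the cells converge. The gluing is
    asked for two more, which are spent on pulling the power \<open>P\<close> into the sum.\<close>
  define \<kappa> where "\<kappa> = nat \<lceil>3 / P\<rceil>"
  have kap: "3 \<le> real \<kappa> * P"
  proof -
    have "3 / P \<le> real \<kappa>" unfolding \<kappa>_def by (rule real_nat_ceiling_ge)
    then show ?thesis using P by (simp add: field_simps)
  qed
  obtain C1 where C1: "0 < C1" and cells: "\<And>n f E. 1 \<le> n \<Longrightarrow> f \<in> borel_measurable borel \<Longrightarrow> 0 \<le> E \<Longrightarrow> step_energy k (1 / real n) P \<alpha> \<beta> f \<le> ennreal E \<Longrightarrow>
    (\<exists>q. (\<forall>j. degree (q j) < k) \<and> (\<Sum>j\<le>64 * n - 2. weighted_error \<alpha> \<beta> P f (q j) {node (64 * n) (j + 2)..node (64 * n) j}) \<le> ennreal (C1 * real n * E))"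
    using all_cells_Lp [OF k ab P] by blast
  obtain C2 where C2: "0 < C2" and glue: "\<And>n q. k \<le> n \<Longrightarrow> (\<forall>j. degree (q j) < k) \<Longrightarrow>
    (\<exists>p\<in>poly_space n. \<exists>A c. glued k n \<alpha> \<beta> C2 (\<kappa> + 2) q p A c)"
    using gluing [OF k ab, of "\<kappa> + 2"] by blast
  define K1 where "K1 = 6 * real k * (C2 powr P * 2 powr P)"
  define K2 where "K2 = 2 powr P * (C2 powr P * \<Lambda> powr P * 4)"
  define C where "C = 2 * (2 powr P) * C1 + K2 * \<Lambda> * (2 * K1 * C1)"
  have K1: "0 < K1" using k C2 by (simp add: K1_def)
  have K2: "0 < K2" using C2 L1 by (simp add: K2_def)
  have C0: "0 < C" unfolding C_def using C1 K1 K2 L1 by (intro add_pos_pos mult_pos_pos) auto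
  show ?thesis
  proof (rule exI [of _ C], rule conjI [OF C0], intro allI impI ballI)
    fix n :: nat and f :: "real \<Rightarrow> real" and E :: real
    assume n: "k \<le> n" and f [measurable]: "f \<in> borel_measurable borel" and E: "0 \<le> E" and le: "step_energy k (1 / real n) P \<alpha> \<beta> f \<le> ennreal E"
    define m where "m = 64 * n"
    have n1: "1 \<le> n" using n k by simp
    have m: "2 < m" "0 < m" using n1 by (auto simp: m_def)
    let ?x = "node m"
    let ?w = "jacobi_weight \<alpha> \<beta>"
    define e where "e q j = (\<integral>\<^sup>+x. ennreal ((?w x * \<bar>f x - poly q x\<bar>) powr P) * indicator {?x (j + 2)..?x j} x \<partial>lborel)" for q j
    obtain q where q: "\<forall>j. degree (q j) < k" and qe: "(\<Sum>j\<le>m - 2. e (q j) j) \<le> ennreal (C1 * real n * E)"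
      using cells [OF n1 f E le] unfolding e_def m_def by blast
    define l where "l j = ?x j - ?x (Suc j)" for j
    have l0: "0 < l j" if "j < m" for j using node_less [of j "Suc j" m] that by (simp add: l_def)
    obtain p A c where p: "p \<in> poly_space n" and A0: "\<And>j. 0 \<le> A j"
      and piece: "\<And>j. j \<in> {1..m - 2} \<Longrightarrow> {c j..c j + l j / (6 * real k)} \<subseteq> {?x (Suc j)..?x j}"
      and Alow: "\<And>j y. j \<in> {1..m - 2} \<Longrightarrow> y \<in> {c j..c j + l j / (6 * real k)} \<Longrightarrow> A j \<le> C2 * (?w y * \<bar>poly (q (j - 1)) y - poly (q j) y\<bar>)"
      and Aup: "\<And>i x. i < m \<Longrightarrow> x \<in> {?x (Suc i)<..?x i} \<Longrightarrow> ?w x * \<bar>poly (q (min i (m - 2))) x - poly p x\<bar>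
          \<le> C2 * (\<Sum>j\<in>{1..m - 2}. A j * (1 / (1 + \<bar>real i - real j\<bar>)) ^ (\<kappa> + 2))"
      using glue [OF n q] unfolding m_def [symmetric] l_def [symmetric] by blast
    \<comment> \<open>Of the size of the integral over cell \<open>j\<close> of the weighted
      distance between \<open>q (j - 1)\<close> and \<open>q j\<close>, raised to the power
      \<open>P\<close>. It is estimated on a piece of relative length \<open>1 / (6 k)\<close>,
      whence the factor \<open>6 k\<close> in \<open>K1\<close>.\<close>
    define a where "a j = l j * A j powr P" for j
    have a_le: "ennreal (a j) \<le> ennreal K1 * (e (q (j - 1)) (j - 1) + e (q j) j)" if j: "j \<in> {1..m - 2}" for j
    proof -
      have jm: "j < m" using j m by auto
      have lj: "0 < l j" by (rule l0 [OF jm])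
      let ?L = "{c j..c j + l j / (6 * real k)}"
      have kr: "1 \<le> real k" using k by simp
      have jj: "{?x (Suc j)..?x j} \<subseteq> {?x (j + 2)..?x j}" "{?x (Suc j)..?x j} \<subseteq> {?x (j - 1 + 2)..?x (j - 1)}"
        using j m by (auto intro: order_trans [OF node_le] order_trans [OF _ node_le])
      have "ennreal (A j powr P) * ennreal (l j / (6 * real k)) = (\<integral>\<^sup>+y. ennreal (A j powr P) * indicator ?L y \<partial>lborel)"
        using lj kr by (subst nn_integral_cmult_indicator) auto
      also have "\<dots> \<le> (\<integral>\<^sup>+y. ennreal (C2 powr P * 2 powr P) * (ennreal ((?w y * \<bar>f y - poly (q (j - 1)) y\<bar>) powr P) * indicator {?x (j - 1 + 2)..?x (j - 1)} y
           + ennreal ((?w y * \<bar>f y - poly (q j) y\<bar>) powr P) * indicator {?x (j + 2)..?x j} y) \<partial>lborel)"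
      proof (rule nn_integral_mono)
        fix y
        show "ennreal (A j powr P) * indicator ?L y \<le> ennreal (C2 powr P * 2 powr P) * (ennreal ((?w y * \<bar>f y - poly (q (j - 1)) y\<bar>) powr P) * indicator {?x (j - 1 + 2)..?x (j - 1)} y
           + ennreal ((?w y * \<bar>f y - poly (q j) y\<bar>) powr P) * indicator {?x (j + 2)..?x j} y)"
        proof (cases "y \<in> ?L")
          case True
          then have y: "y \<in> {?x (j - 1 + 2)..?x (j - 1)}" "y \<in> {?x (j + 2)..?x j}" using piece [OF j] jj by blast+
          let ?u = "?w y * \<bar>f y - poly (q (j - 1)) y\<bar>" and ?v = "?w y * \<bar>f y - poly (q j) y\<bar>"
          have uv: "0 \<le> ?u" "0 \<le> ?v" by simp_all
          have "\<bar>poly (q (j - 1)) y - poly (q j) y\<bar> \<le> \<bar>f y - poly (q (j - 1)) y\<bar> + \<bar>f y - poly (q j) y\<bar>" by simp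
          then have "?w y * \<bar>poly (q (j - 1)) y - poly (q j) y\<bar> \<le> ?w y * (\<bar>f y - poly (q (j - 1)) y\<bar> + \<bar>f y - poly (q j) y\<bar>)"
            by (rule mult_left_mono) simp
          also have "\<dots> = ?u + ?v" by (rule distrib_left)
          finally have "C2 * (?w y * \<bar>poly (q (j - 1)) y - poly (q j) y\<bar>) \<le> C2 * (?u + ?v)"
            using C2 by (intro mult_left_mono) auto
          then have "A j \<le> C2 * (?u + ?v)" using Alow [OF j True] by linarith
          then have "A j powr P \<le> (C2 * (?u + ?v)) powr P" using A0 P by (intro powr_mono2) auto
          also have "\<dots> = C2 powr P * (?u + ?v) powr P" by (rule powr_mult)
          also have "\<dots> \<le> C2 powr P * (2 powr P * (?u powr P + ?v powr P))"
            using powr_add_le [OF uv P] by (rule mult_left_mono) simp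
          also have "\<dots> = (C2 powr P * 2 powr P) * (?u powr P + ?v powr P)" by (simp only: mult.assoc)
          finally have "ennreal (A j powr P) \<le> ennreal ((C2 powr P * 2 powr P) * (?u powr P + ?v powr P))" by (rule ennreal_leI)
          also have "\<dots> = ennreal (C2 powr P * 2 powr P) * (ennreal (?u powr P) + ennreal (?v powr P))"
            by (subst ennreal_mult) auto
          finally show ?thesis using True y by simp
        qed simp
      qed
      also have "\<dots> = ennreal (C2 powr P * 2 powr P) * (e (q (j - 1)) (j - 1) + e (q j) j)"
        unfolding e_def by (subst nn_integral_cmult, measurable) (subst nn_integral_add, auto)
      finally have *: "ennreal (A j powr P) * ennreal (l j / (6 * real k)) \<le> ennreal (C2 powr P * 2 powr P) * (e (q (j - 1)) (j - 1) + e (q j) j)" .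
      have "ennreal (a j) = ennreal (6 * real k) * (ennreal (A j powr P) * ennreal (l j / (6 * real k)))"
        using kr lj by (simp add: a_def ennreal_mult [symmetric])
      also have "\<dots> \<le> ennreal (6 * real k) * (ennreal (C2 powr P * 2 powr P) * (e (q (j - 1)) (j - 1) + e (q j) j))"
        by (rule mult_left_mono [OF *]) simp
      also have "\<dots> = ennreal K1 * (e (q (j - 1)) (j - 1) + e (q j) j)"
        unfolding K1_def by (simp add: ennreal_mult mult.assoc)
      finally show ?thesis .
    qed
    have a_sum: "(\<Sum>j\<in>{1..m - 2}. ennreal (a j)) \<le> ennreal (2 * K1 * C1 * real n * E)"
    proof -
      have "(\<Sum>j\<in>{1..m - 2}. ennreal (a j)) \<le> (\<Sum>j\<in>{1..m - 2}. ennreal K1 * (e (q (j - 1)) (j - 1) + e (q j) j))"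
        by (rule sum_mono) (rule a_le)
      also have "\<dots> = ennreal K1 * ((\<Sum>j\<in>{1..m - 2}. e (q (j - 1)) (j - 1)) + (\<Sum>j\<in>{1..m - 2}. e (q j) j))"
        by (simp add: sum_distrib_left [symmetric] sum.distrib)
      also have "\<dots> \<le> ennreal K1 * (ennreal (C1 * real n * E) + ennreal (C1 * real n * E))"
      proof (intro mult_left_mono add_mono)
        have "(\<Sum>j\<in>{1..m - 2}. e (q (j - 1)) (j - 1)) = (\<Sum>j\<in>(\<lambda>j. j - 1) ` {1..m - 2}. e (q j) j)"
          by (subst sum.reindex) (auto simp: inj_on_def)
        also have "\<dots> \<le> (\<Sum>j\<le>m - 2. e (q j) j)" by (rule sum_mono2) auto
        finally show "(\<Sum>j\<in>{1..m - 2}. e (q (j - 1)) (j - 1)) \<le> ennreal (C1 * real n * E)" using qe by simp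
        have "(\<Sum>j\<in>{1..m - 2}. e (q j) j) \<le> (\<Sum>j\<le>m - 2. e (q j) j)" by (rule sum_mono2) auto
        then show "(\<Sum>j\<in>{1..m - 2}. e (q j) j) \<le> ennreal (C1 * real n * E)" using qe by simp
      qed simp
      also have "\<dots> = ennreal (2 * K1 * C1 * real n * E)"
        using K1 C1 E by (simp add: ennreal_plus [symmetric] ennreal_mult [symmetric] del: ennreal_plus)
      finally show ?thesis .
    qed
    define lam where "lam i j = 1 / (1 + \<bar>real i - real j\<bar>)" for i j :: nat
    have lam: "0 < lam i j" for i j by (simp add: lam_def add_pos_nonneg)
    have a0: "0 \<le> a j" if "j < m" for j using l0 [OF that] by (simp add: a_def)
    \<comment> \<open>The length of cell \<open>i\<close> is already accounted for:
      \<open>l i <= 4 (1 + D) l j\<close> trades it for the factor \<open>l j\<close> in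
      \<open>a j\<close> and uses up one of the three powers of decay.\<close>
    define r where "r i = (\<Sum>j\<in>{1..m - 2}. a j * lam i j ^ 2)" for i
    have r0: "0 \<le> r i" for i unfolding r_def using a0 m by (intro sum_nonneg mult_nonneg_nonneg) auto
    have on_cell: "(\<integral>\<^sup>+x. ennreal ((?w x * \<bar>f x - poly p x\<bar>) powr P) * indicator {?x (Suc i)<..?x i} x \<partial>lborel)
       \<le> ennreal (2 powr P) * e (q (min i (m - 2))) (min i (m - 2)) + ennreal (K2 * r i)" if i: "i < m" for i
    proof -
      let ?j = "min i (m - 2)"
      let ?s = "\<Sum>j\<in>{1..m - 2}. A j * lam i j ^ (\<kappa> + 2)"
      have li: "0 < l i" by (rule l0 [OF i])
      have s0: "0 \<le> ?s" using A0 lam by (intro sum_nonneg mult_nonneg_nonneg) (auto simp: less_imp_le)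
      have sub: "{?x (Suc i)<..?x i} \<subseteq> {?x (?j + 2)..?x ?j}"
      proof -
        have "?x (?j + 2) \<le> ?x (Suc i)" using i m by (intro node_le) auto
        moreover have "?x i \<le> ?x ?j" using i m by (intro node_le) auto
        ultimately show ?thesis by auto
      qed
      have "(\<integral>\<^sup>+x. ennreal ((?w x * \<bar>f x - poly p x\<bar>) powr P) * indicator {?x (Suc i)<..?x i} x \<partial>lborel)
        \<le> (\<integral>\<^sup>+x. ennreal (2 powr P) * (ennreal ((?w x * \<bar>f x - poly (q ?j) x\<bar>) powr P) * indicator {?x (?j + 2)..?x ?j} x)
            + ennreal (2 powr P * (C2 * ?s) powr P) * indicator {?x (Suc i)<..?x i} x \<partial>lborel)"
      proof (rule nn_integral_mono)
        fix x
        show "ennreal ((?w x * \<bar>f x - poly p x\<bar>) powr P) * indicator {?x (Suc i)<..?x i} x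
          \<le> ennreal (2 powr P) * (ennreal ((?w x * \<bar>f x - poly (q ?j) x\<bar>) powr P) * indicator {?x (?j + 2)..?x ?j} x)
            + ennreal (2 powr P * (C2 * ?s) powr P) * indicator {?x (Suc i)<..?x i} x"
        proof (cases "x \<in> {?x (Suc i)<..?x i}")
          case True
          let ?u = "?w x * \<bar>f x - poly (q ?j) x\<bar>"
          have "\<bar>f x - poly p x\<bar> \<le> \<bar>f x - poly (q ?j) x\<bar> + \<bar>poly (q ?j) x - poly p x\<bar>" by simp
          then have "?w x * \<bar>f x - poly p x\<bar> \<le> ?w x * (\<bar>f x - poly (q ?j) x\<bar> + \<bar>poly (q ?j) x - poly p x\<bar>)"
            by (rule mult_left_mono) simp
          also have "\<dots> = ?u + ?w x * \<bar>poly (q ?j) x - poly p x\<bar>" by (rule distrib_left)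
          also have "\<dots> \<le> ?u + C2 * ?s" using Aup [OF i True] by (simp add: lam_def)
          finally have "(?w x * \<bar>f x - poly p x\<bar>) powr P \<le> (?u + C2 * ?s) powr P" using P by (intro powr_mono2) auto
          also have "\<dots> \<le> 2 powr P * (?u powr P + (C2 * ?s) powr P)" using C2 s0 P by (intro powr_add_le) auto
          finally have "ennreal ((?w x * \<bar>f x - poly p x\<bar>) powr P) \<le> ennreal (2 powr P * ?u powr P + 2 powr P * (C2 * ?s) powr P)"
            by (intro ennreal_leI) (simp add: distrib_left)
          also have "\<dots> = ennreal (2 powr P) * ennreal (?u powr P) + ennreal (2 powr P * (C2 * ?s) powr P)"
            by (simp add: ennreal_mult)
          finally show ?thesis using True sub by (simp add: subset_iff)
        qed simp
      qed
      also have "\<dots> = ennreal (2 powr P) * e (q ?j) ?j + ennreal (2 powr P * (C2 * ?s) powr P) * ennreal (l i)"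
        unfolding e_def using li
        by (subst nn_integral_add, measurable) (simp add: nn_integral_cmult nn_integral_cmult_indicator l_def)
      also have "\<dots> \<le> ennreal (2 powr P) * e (q ?j) ?j + ennreal (K2 * r i)"
      proof (rule add_left_mono)
        have "(C2 * ?s) powr P = C2 powr P * ?s powr P" by (rule powr_mult)
        also have "\<dots> \<le> C2 powr P * (\<Lambda> powr P * (\<Sum>j\<in>{1..m - 2}. A j powr P * lam i j ^ 3))"
          using powr_decay_sum [where S = "{1..m - 2}" and i = i and x = A, OF _ A0 P kap L1 L] unfolding lam_def by (intro mult_left_mono) auto
        finally have "l i * (2 powr P * (C2 * ?s) powr P) \<le> l i * (2 powr P * (C2 powr P * (\<Lambda> powr P * (\<Sum>j\<in>{1..m - 2}. A j powr P * lam i j ^ 3))))"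
          using li by (intro mult_left_mono) auto
        also have "\<dots> = 2 powr P * (C2 powr P * \<Lambda> powr P) * (\<Sum>j\<in>{1..m - 2}. l i * (A j powr P * lam i j ^ 3))"
          by (simp add: sum_distrib_left mult_ac)
        also have "\<dots> \<le> 2 powr P * (C2 powr P * \<Lambda> powr P) * (\<Sum>j\<in>{1..m - 2}. 4 * (a j * lam i j ^ 2))"
        proof (intro mult_left_mono sum_mono)
          fix j assume "j \<in> {1..m - 2}"
          then have j: "j < m" using m by auto
          have "l i \<le> 4 * (1 + \<bar>real i - real j\<bar>) * l j" unfolding l_def by (rule cell_length_ratio [OF i j refl])
          then have "l i * (A j powr P * lam i j ^ 3) \<le> 4 * (1 + \<bar>real i - real j\<bar>) * l j * (A j powr P * lam i j ^ 3)"
            using lam [of i j] by (intro mult_right_mono) auto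
          also have "\<dots> = 4 * (l j * A j powr P) * ((1 + \<bar>real i - real j\<bar>) * lam i j) * lam i j ^ 2"
            by (simp add: power3_eq_cube power2_eq_square)
          also have "(1 + \<bar>real i - real j\<bar>) * lam i j = 1" unfolding lam_def by (simp add: add_pos_nonneg)
          finally show "l i * (A j powr P * lam i j ^ 3) \<le> 4 * (a j * lam i j ^ 2)" by (simp add: a_def)
        qed simp
        also have "\<dots> = K2 * r i" by (simp add: K2_def r_def sum_distrib_left mult_ac)
        finally have "2 powr P * (C2 * ?s) powr P * l i \<le> K2 * r i" by (simp only: mult_ac)
        then show "ennreal (2 powr P * (C2 * ?s) powr P) * ennreal (l i) \<le> ennreal (K2 * r i)"
          using li by (subst ennreal_mult [symmetric]) (auto intro: ennreal_leI)
      qed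
      finally show ?thesis .
    qed
    have r_sum: "ennreal (\<Sum>i<m. K2 * r i) \<le> ennreal (K2 * \<Lambda>) * ennreal (2 * K1 * C1 * real n * E)"
    proof -
      have "(\<Sum>i<m. r i) = (\<Sum>j\<in>{1..m - 2}. a j * (\<Sum>i<m. lam i j ^ 2))"
        unfolding r_def sum_distrib_left by (rule sum.swap)
      also have "\<dots> \<le> (\<Sum>j\<in>{1..m - 2}. a j * \<Lambda>)"
      proof (intro sum_mono mult_left_mono)
        fix j assume j: "j \<in> {1..m - 2}"
        show "(\<Sum>i<m. lam i j ^ 2) \<le> \<Lambda>" using L [of "{..<m}" j] by (simp add: lam_def abs_minus_commute)
        show "0 \<le> a j" using j m by (intro a0) auto
      qed
      also have "\<dots> = \<Lambda> * (\<Sum>j\<in>{1..m - 2}. a j)" by (simp add: sum_distrib_left mult.commute)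
      finally have "(\<Sum>i<m. K2 * r i) \<le> K2 * \<Lambda> * (\<Sum>j\<in>{1..m - 2}. a j)"
        using K2 by (simp add: sum_distrib_left [symmetric] mult.assoc)
      then have "ennreal (\<Sum>i<m. K2 * r i) \<le> ennreal (K2 * \<Lambda> * (\<Sum>j\<in>{1..m - 2}. a j))" by (rule ennreal_leI)
      also have "\<dots> = ennreal (K2 * \<Lambda>) * (\<Sum>j\<in>{1..m - 2}. ennreal (a j))"
      proof -
        have nn: "0 \<le> a j" if "j \<in> {1..m - 2}" for j using that m by (intro a0) auto
        then have "(\<Sum>j\<in>{1..m - 2}. ennreal (a j)) = ennreal (\<Sum>j\<in>{1..m - 2}. a j)" by (rule sum_ennreal)
        moreover have "0 \<le> (\<Sum>j\<in>{1..m - 2}. a j)" using nn by (rule sum_nonneg)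
        ultimately show ?thesis using K2 L1 by (simp add: ennreal_mult)
      qed
      also have "\<dots> \<le> ennreal (K2 * \<Lambda>) * ennreal (2 * K1 * C1 * real n * E)" by (rule mult_left_mono [OF a_sum]) simp
      finally show ?thesis .
    qed
    have "(\<integral>\<^sup>+x. ennreal ((?w x * \<bar>f x - poly p x\<bar>) powr P) * indicator {-1..1} x \<partial>lborel)
      \<le> (\<integral>\<^sup>+x. (\<Sum>i<m. ennreal ((?w x * \<bar>f x - poly p x\<bar>) powr P) * indicator {?x (Suc i)<..?x i} x) \<partial>lborel)"
    proof (rule nn_integral_mono_AE)
      have "AE x in lborel. x \<noteq> (- 1 :: real)" by (rule AE_lborel_singleton)
      then show "AE x in lborel. ennreal ((?w x * \<bar>f x - poly p x\<bar>) powr P) * indicator {-1..1} x \<le> (\<Sum>i<m. ennreal ((?w x * \<bar>f x - poly p x\<bar>) powr P) * indicator {?x (Suc i)<..?x i} x)"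
      proof (rule eventually_mono)
        fix x :: real assume x: "x \<noteq> - 1"
        let ?h = "\<lambda>i. ennreal ((?w x * \<bar>f x - poly p x\<bar>) powr P) * indicator {?x (Suc i)<..?x i} x"
        show "ennreal ((?w x * \<bar>f x - poly p x\<bar>) powr P) * indicator {-1..1} x \<le> (\<Sum>i<m. ?h i)"
        proof (cases "x \<in> {-1..1}")
          case True
          obtain i where i: "i < m" "x \<in> {?x (Suc i)<..?x i}" using cells_cover [OF m(2) True x] by blast
          have "?h i \<le> (\<Sum>i<m. ?h i)" using i by (intro member_le_sum) auto
          then show ?thesis using i True by simp
        qed simp
      qed
    qed
    also have "\<dots> = (\<Sum>i<m. \<integral>\<^sup>+x. ennreal ((?w x * \<bar>f x - poly p x\<bar>) powr P) * indicator {?x (Suc i)<..?x i} x \<partial>lborel)"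
      by (rule nn_integral_sum) measurable
    also have "\<dots> \<le> (\<Sum>i<m. ennreal (2 powr P) * e (q (min i (m - 2))) (min i (m - 2)) + ennreal (K2 * r i))"
      by (rule sum_mono) (use on_cell in simp)
    also have "\<dots> = ennreal (2 powr P) * (\<Sum>i<m. e (q (min i (m - 2))) (min i (m - 2))) + ennreal (\<Sum>i<m. K2 * r i)"
      using K2 r0 by (subst sum_ennreal [symmetric]) (auto simp: sum.distrib sum_distrib_left)
    also have "\<dots> \<le> ennreal (2 powr P) * (ennreal (C1 * real n * E) + ennreal (C1 * real n * E)) + ennreal (K2 * \<Lambda>) * ennreal (2 * K1 * C1 * real n * E)"
    proof (intro add_mono mult_left_mono r_sum)
      \<comment> \<open>The polynomial \<open>q (m - 2)\<close> serves the last two cells, so its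
        error is counted twice.\<close>
      have "{..<m} = insert (m - 1) {..m - 2}" using m by auto
      then have "(\<Sum>i<m. e (q (min i (m - 2))) (min i (m - 2))) = e (q (m - 2)) (m - 2) + (\<Sum>i\<le>m - 2. e (q (min i (m - 2))) (min i (m - 2)))"
        using m by (simp add: min_def)
      also have "(\<Sum>i\<le>m - 2. e (q (min i (m - 2))) (min i (m - 2))) = (\<Sum>i\<le>m - 2. e (q i) i)" by (rule sum.cong) (auto simp: min_def)
      also have "e (q (m - 2)) (m - 2) \<le> (\<Sum>i\<le>m - 2. e (q i) i)" by (rule member_le_sum) auto
      finally have "(\<Sum>i<m. e (q (min i (m - 2))) (min i (m - 2))) \<le> (\<Sum>i\<le>m - 2. e (q i) i) + (\<Sum>i\<le>m - 2. e (q i) i)" by (simp add: add_right_mono)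
      also have "\<dots> \<le> ennreal (C1 * real n * E) + ennreal (C1 * real n * E)" by (intro add_mono qe)
      finally show "(\<Sum>i<m. e (q (min i (m - 2))) (min i (m - 2))) \<le> ennreal (C1 * real n * E) + ennreal (C1 * real n * E)" .
    qed simp
    also have "\<dots> = ennreal (C * real n * E)"
    proof -
      have "2 powr P * (C1 * real n * E + C1 * real n * E) + K2 * \<Lambda> * (2 * K1 * C1 * real n * E) = C * real n * E"
        by (simp add: C_def algebra_simps)
      moreover have "0 \<le> C1 * real n * E" "0 \<le> 2 * K1 * C1 * real n * E" "0 \<le> K2 * \<Lambda>" using C1 K1 K2 L1 E by auto
      moreover have "ennreal a * (ennreal b + ennreal b) + ennreal c * ennreal d = ennreal (a * (b + b) + c * d)"
        if "0 \<le> a" "0 \<le> b" "0 \<le> c" "0 \<le> d" for a b c d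
        using that by (simp only: ennreal_plus ennreal_mult add_nonneg_nonneg mult_nonneg_nonneg)
      ultimately show ?thesis by (metis powr_ge_zero)
    qed
    finally show "\<exists>p\<in>poly_space n. (\<integral>\<^sup>+x. ennreal ((?w x * \<bar>f x - poly p x\<bar>) powr P) * indicator {-1..1} x \<partial>lborel) \<le> ennreal (C * real n * E)"
      using p by blast
  qed
qed

text \<open>Decay of order 2 suffices, since the quantities \<open>A j\<close> are bounded
  individually and only the sum of the decay factors is needed.\<close>

lemma jackson_sup:
  fixes k :: nat and \<alpha> \<beta> :: real
  assumes k: "1 \<le> k" and ab: "0 \<le> \<alpha>" "0 \<le> \<beta>"
  shows "\<exists>C>0. \<forall>n\<ge>k. \<forall>f\<in>borel_measurable borel. \<forall>\<omega>\<ge>0.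
    steps_bounded k (1 / real n) \<alpha> \<beta> f \<omega> \<longrightarrow>
    (\<exists>p\<in>poly_space n. AE x in lborel. x \<in> {-1..1} \<longrightarrow> jacobi_weight \<alpha> \<beta> x * \<bar>f x - poly p x\<bar> \<le> C * \<omega>)"
proof -
  obtain \<Lambda> where L1: "1 \<le> \<Lambda>" and L: "\<And>S i. finite S \<Longrightarrow> (\<Sum>j\<in>S. (1 / (1 + \<bar>real i - real j\<bar>)) ^ 2) \<le> \<Lambda>"
    using decay_sum_bounded by blast
  define Hyp where "Hyp n f \<omega> \<longleftrightarrow> steps_bounded k (1 / real n) \<alpha> \<beta> f \<omega>"
    for n :: nat and f :: "real \<Rightarrow> real" and \<omega> :: real
  obtain C1 where C1: "0 < C1" and cells: "\<And>n f \<omega>. 1 \<le> n \<Longrightarrow> f \<in> borel_measurable borel \<Longrightarrow> 0 \<le> \<omega> \<Longrightarrow> Hyp n f \<omega> \<Longrightarrow>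
    (\<exists>q. (\<forall>j. degree (q j) < k) \<and> (\<forall>j\<le>64 * n - 2. AE x in lborel. x \<in> {node (64 * n) (j + 2)..node (64 * n) j} \<longrightarrow>
        jacobi_weight \<alpha> \<beta> x * \<bar>f x - poly (q j) x\<bar> \<le> C1 * \<omega>))"
    using all_cells_sup [OF k ab] unfolding Hyp_def [symmetric] by blast
  obtain C2 where C2: "0 < C2" and glue: "\<And>n q. k \<le> n \<Longrightarrow> (\<forall>j. degree (q j) < k) \<Longrightarrow>
    (\<exists>p\<in>poly_space n. \<exists>A c. glued k n \<alpha> \<beta> C2 2 q p A c)"
    using gluing [OF k ab, of 2] by blast
  define C where "C = C1 + C2 * (2 * C2 * C1 * \<Lambda>)"
  have C0: "0 < C" unfolding C_def using C1 C2 L1 by (intro add_pos_pos mult_pos_pos) auto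
  have "\<exists>p\<in>poly_space n. AE x in lborel. x \<in> {-1..1} \<longrightarrow> jacobi_weight \<alpha> \<beta> x * \<bar>f x - poly p x\<bar> \<le> C * \<omega>"
    if n: "k \<le> n" and f: "f \<in> borel_measurable borel" and w: "0 \<le> \<omega>" and H: "Hyp n f \<omega>" for n f \<omega>
  proof -
    define m where "m = 64 * n"
    have n1: "1 \<le> n" using n k by simp
    have m: "2 < m" "0 < m" using n1 by (auto simp: m_def)
    let ?x = "node m"
    let ?w = "jacobi_weight \<alpha> \<beta>"
    obtain q where q: "\<forall>j. degree (q j) < k" and qe: "\<And>j. j \<le> m - 2 \<Longrightarrow> AE x in lborel. x \<in> {?x (j + 2)..?x j} \<longrightarrow> ?w x * \<bar>f x - poly (q j) x\<bar> \<le> C1 * \<omega>"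
      using cells [OF n1 f w H] unfolding m_def by blast
    define l where "l j = ?x j - ?x (Suc j)" for j
    have l0: "0 < l j" if "j < m" for j using node_less [of j "Suc j" m] that by (simp add: l_def)
    obtain p A c where p: "p \<in> poly_space n" and A0: "\<And>j. 0 \<le> A j"
      and piece: "\<And>j. j \<in> {1..m - 2} \<Longrightarrow> {c j..c j + l j / (6 * real k)} \<subseteq> {?x (Suc j)..?x j}"
      and Alow: "\<And>j y. j \<in> {1..m - 2} \<Longrightarrow> y \<in> {c j..c j + l j / (6 * real k)} \<Longrightarrow> A j \<le> C2 * (?w y * \<bar>poly (q (j - 1)) y - poly (q j) y\<bar>)"
      and Aup: "\<And>i x. i < m \<Longrightarrow> x \<in> {?x (Suc i)<..?x i} \<Longrightarrow> ?w x * \<bar>poly (q (min i (m - 2))) x - poly p x\<bar>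
          \<le> C2 * (\<Sum>j\<in>{1..m - 2}. A j * (1 / (1 + \<bar>real i - real j\<bar>)) ^ 2)"
      using glue [OF n q] unfolding m_def [symmetric] l_def [symmetric] by blast
    \<comment> \<open>The lower estimate of the gluing lemma holds on a whole interval of positive
      length, which contains points where both neighbouring almost sure bounds are valid.\<close>
    have A_le: "A j \<le> 2 * C2 * C1 * \<omega>" if j: "j \<in> {1..m - 2}" for j
    proof -
      have jm: "j < m" using j m by auto
      let ?L = "{c j..c j + l j / (6 * real k)}"
      have lk: "0 < l j / (6 * real k)" using l0 [OF jm] k by simp
      have jj: "{?x (Suc j)..?x j} \<subseteq> {?x (j + 2)..?x j}" "{?x (Suc j)..?x j} \<subseteq> {?x (j - 1 + 2)..?x (j - 1)}"
        using j m by (auto intro: order_trans [OF node_le] order_trans [OF _ node_le])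
      have a1: "AE x in lborel. x \<in> {?x (j - 1 + 2)..?x (j - 1)} \<longrightarrow> ?w x * \<bar>f x - poly (q (j - 1)) x\<bar> \<le> C1 * \<omega>"
        using j by (intro qe) auto
      have a2: "AE x in lborel. x \<in> {?x (j + 2)..?x j} \<longrightarrow> ?w x * \<bar>f x - poly (q j) x\<bar> \<le> C1 * \<omega>"
        using j by (intro qe) auto
      show ?thesis
      proof (rule ccontr)
        assume neg: "\<not> ?thesis"
        have "AE x in lborel. x \<notin> ?L"
          using a1 a2
        proof eventually_elim
          case (elim x)
          show ?case
          proof
            assume x: "x \<in> ?L"
            then have xx: "x \<in> {?x (j - 1 + 2)..?x (j - 1)}" "x \<in> {?x (j + 2)..?x j}" using piece [OF j] jj by blast+
            have "\<bar>poly (q (j - 1)) x - poly (q j) x\<bar> \<le> \<bar>f x - poly (q (j - 1)) x\<bar> + \<bar>f x - poly (q j) x\<bar>" by simp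
            then have "?w x * \<bar>poly (q (j - 1)) x - poly (q j) x\<bar> \<le> ?w x * (\<bar>f x - poly (q (j - 1)) x\<bar> + \<bar>f x - poly (q j) x\<bar>)"
              by (rule mult_left_mono) simp
            also have "\<dots> \<le> 2 * (C1 * \<omega>)" using elim xx by (simp add: distrib_left)
            finally have "C2 * (?w x * \<bar>poly (q (j - 1)) x - poly (q j) x\<bar>) \<le> C2 * (2 * (C1 * \<omega>))"
              using C2 by (intro mult_left_mono) auto
            then have "A j \<le> C2 * (2 * (C1 * \<omega>))" using Alow [OF j x] by linarith
            then show False using neg by (simp add: mult_ac)
          qed
        qed
        then have "emeasure lborel ?L = 0" by (subst (asm) AE_iff_null_sets [symmetric]) (auto simp: null_sets_def)
        moreover have "emeasure lborel ?L = ennreal (l j / (6 * real k))" using lk by (simp add: less_imp_le)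
        moreover have "ennreal (l j / (6 * real k)) \<noteq> 0" using lk by (simp only: ennreal_eq_0_iff not_le)
        ultimately show False by metis
      qed
    qed
    have "AE x in lborel. \<forall>j\<in>{..m - 2}. x \<in> {?x (j + 2)..?x j} \<longrightarrow> ?w x * \<bar>f x - poly (q j) x\<bar> \<le> C1 * \<omega>"
      by (intro AE_finite_allI qe) auto
    moreover have "AE x in lborel. x \<noteq> (- 1 :: real)" by (rule AE_lborel_singleton)
    ultimately have "AE x in lborel. x \<in> {-1..1} \<longrightarrow> ?w x * \<bar>f x - poly p x\<bar> \<le> C * \<omega>"
    proof eventually_elim
      case (elim x)
      show ?case
      proof
        assume x: "x \<in> {-1..1}"
        obtain i where i: "i < m" "x \<in> {?x (Suc i)<..?x i}" using cells_cover [OF m(2) x elim(2)] by blast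
        let ?j = "min i (m - 2)"
        have sub: "{?x (Suc i)<..?x i} \<subseteq> {?x (?j + 2)..?x ?j}"
        proof -
          have "?x (?j + 2) \<le> ?x (Suc i)" using i m by (intro node_le) auto
          moreover have "?x i \<le> ?x ?j" using i m by (intro node_le) auto
          ultimately show ?thesis by auto
        qed
        have 1: "?w x * \<bar>f x - poly (q ?j) x\<bar> \<le> C1 * \<omega>" using elim(1) i sub by auto
        have "(\<Sum>j\<in>{1..m - 2}. A j * (1 / (1 + \<bar>real i - real j\<bar>)) ^ 2) \<le> (\<Sum>j\<in>{1..m - 2}. 2 * C2 * C1 * \<omega> * (1 / (1 + \<bar>real i - real j\<bar>)) ^ 2)"
          by (intro sum_mono mult_right_mono A_le) auto
        also have "\<dots> = 2 * C2 * C1 * \<omega> * (\<Sum>j\<in>{1..m - 2}. (1 / (1 + \<bar>real i - real j\<bar>)) ^ 2)" by (rule sum_distrib_left [symmetric])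
        also have "\<dots> \<le> 2 * C2 * C1 * \<omega> * \<Lambda>" using C1 C2 w by (intro mult_left_mono L) auto
        finally have "C2 * (\<Sum>j\<in>{1..m - 2}. A j * (1 / (1 + \<bar>real i - real j\<bar>)) ^ 2) \<le> C2 * (2 * C2 * C1 * \<omega> * \<Lambda>)"
          using C2 by (intro mult_left_mono) auto
        then have 2: "?w x * \<bar>poly (q ?j) x - poly p x\<bar> \<le> C2 * (2 * C2 * C1 * \<omega> * \<Lambda>)" using Aup [OF i] by linarith
        have "\<bar>f x - poly p x\<bar> \<le> \<bar>f x - poly (q ?j) x\<bar> + \<bar>poly (q ?j) x - poly p x\<bar>" by simp
        then have "?w x * \<bar>f x - poly p x\<bar> \<le> ?w x * (\<bar>f x - poly (q ?j) x\<bar> + \<bar>poly (q ?j) x - poly p x\<bar>)"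
          by (rule mult_left_mono) simp
        also have "\<dots> \<le> C1 * \<omega> + C2 * (2 * C2 * C1 * \<omega> * \<Lambda>)" unfolding distrib_left using 1 2 by (rule add_mono)
        also have "\<dots> = C * \<omega>" by (simp add: C_def algebra_simps)
        finally show "?w x * \<bar>f x - poly p x\<bar> \<le> C * \<omega>" .
      qed
    qed
    then show ?thesis using p by blast
  qed
  then show ?thesis unfolding Hyp_def [symmetric] using C0 by blast
qed

theorem theorem1p4:
  fixes k :: nat and p :: ennreal and \<alpha> \<beta> :: real
  assumes "1 \<le> k" and "0 < p" and "0 \<le> \<alpha>" and "0 \<le> \<beta>"
  shows "\<exists>c::real. 0 < c \<and>
    (\<forall>f \<in> Lp_weighted \<alpha> \<beta> p. \<forall>n\<ge>k.
       best_approx n f \<alpha> \<beta> p \<le> ennreal c * modulus k f (1 / real n) \<alpha> \<beta> p)"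
proof -
  note k = assms(1) and ab = assms(3,4)
  \<comment> \<open>A finite modulus is represented by a real \<open>\<omega>\<close>, which may be
    0. An infinite modulus makes the right-hand side infinite, as \<open>c\<close> is
    positive.\<close>
  have main: "\<exists>c::real. 0 < c \<and> (\<forall>f \<in> Lp_weighted \<alpha> \<beta> p. \<forall>n\<ge>k. \<forall>\<omega>\<ge>0. modulus k f (1 / real n) \<alpha> \<beta> p \<le> ennreal \<omega> \<longrightarrow>
      (\<exists>q\<in>poly_space n. Lp_norm p (\<lambda>x. jacobi_weight \<alpha> \<beta> x * (f x - poly q x)) \<le> ennreal (c * \<omega>)))"
  proof (cases "p = \<infinity>")
    case True
    obtain C where C: "0 < C" and J: "\<And>n f \<omega>. k \<le> n \<Longrightarrow> f \<in> borel_measurable borel \<Longrightarrow> 0 \<le> \<omega> \<Longrightarrow>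
      steps_bounded k (1 / real n) \<alpha> \<beta> f \<omega> \<Longrightarrow>
      (\<exists>p\<in>poly_space n. AE x in lborel. x \<in> {-1..1} \<longrightarrow> jacobi_weight \<alpha> \<beta> x * \<bar>f x - poly p x\<bar> \<le> C * \<omega>)"
      using jackson_sup [OF k ab] by blast
    show ?thesis
    proof (rule exI [of _ C], rule conjI [OF C], intro ballI allI impI)
      fix f :: "real \<Rightarrow> real" and n :: nat and \<omega> :: real
      assume f: "f \<in> Lp_weighted \<alpha> \<beta> p" and n: "k \<le> n" and w: "0 \<le> \<omega>" and m: "modulus k f (1 / real n) \<alpha> \<beta> p \<le> ennreal \<omega>"
      have fm [measurable]: "f \<in> borel_measurable I_measure" using f by (simp add: Lp_weighted_def)
      obtain g where g: "g \<in> borel_measurable borel" and eq: "AE x in lborel. x \<in> {-1..1} \<longrightarrow> f x = g x"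
        using borel_representative [OF fm] by blast
      have "steps_bounded k (1 / real n) \<alpha> \<beta> g \<omega>"
        using m True by (intro steps_AE_le_modulus [OF g eq _ _ w]) auto
      from J [OF n g w this] obtain q where q: "q \<in> poly_space n"
        and ae: "AE x in lborel. x \<in> {-1..1} \<longrightarrow> jacobi_weight \<alpha> \<beta> x * \<bar>g x - poly q x\<bar> \<le> C * \<omega>" by blast
      from ae eq have "AE x in lborel. x \<in> {-1..1} \<longrightarrow> ennreal \<bar>jacobi_weight \<alpha> \<beta> x * (f x - poly q x)\<bar> \<le> ennreal (C * \<omega>)"
        by eventually_elim (auto simp: abs_mult intro!: ennreal_leI)
      then have "AE x in lebesgue. x \<in> {-1..1} \<longrightarrow> ennreal \<bar>jacobi_weight \<alpha> \<beta> x * (f x - poly q x)\<bar> \<le> ennreal (C * \<omega>)"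
        by (rule AE_completion)
      then have "AE x in I_measure. ennreal \<bar>jacobi_weight \<alpha> \<beta> x * (f x - poly q x)\<bar> \<le> ennreal (C * \<omega>)"
        by (subst AE_restrict_space_iff) auto
      moreover have "(\<lambda>x. ennreal \<bar>jacobi_weight \<alpha> \<beta> x * (f x - poly q x)\<bar>) \<in> borel_measurable I_measure"
      proof -
        have [measurable]: "h \<in> borel_measurable I_measure" if "h \<in> borel_measurable borel" for h :: "real \<Rightarrow> real"
          using that by (intro measurable_restrict_space1 measurable_completion) simp
        have [measurable]: "jacobi_weight \<alpha> \<beta> \<in> borel_measurable I_measure" "poly q \<in> borel_measurable I_measure" by measurable
        show ?thesis by measurable
      qed
      ultimately have "Lp_norm p (\<lambda>x. jacobi_weight \<alpha> \<beta> x * (f x - poly q x)) \<le> ennreal (C * \<omega>)"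
        using True by (simp add: Lp_norm_def esssup_I)
      then show "\<exists>q\<in>poly_space n. Lp_norm p (\<lambda>x. jacobi_weight \<alpha> \<beta> x * (f x - poly q x)) \<le> ennreal (C * \<omega>)"
        using q by blast
    qed
  next
    case False
    define P where "P = enn2real p"
    have P: "0 < P" unfolding P_def using assms(2) False by (simp add: enn2real_positive_iff less_top)
    obtain C where C: "0 < C" and J: "\<And>n f E. k \<le> n \<Longrightarrow> f \<in> borel_measurable borel \<Longrightarrow> 0 \<le> E \<Longrightarrow> step_energy k (1 / real n) P \<alpha> \<beta> f \<le> ennreal E \<Longrightarrow>
      (\<exists>p\<in>poly_space n. weighted_error \<alpha> \<beta> P f p {-1..1} \<le> ennreal (C * real n * E))"
      using jackson_Lp [OF k ab P] by blast
    show ?thesis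
    proof (rule exI [of _ "C powr (1 / P)"], rule conjI, use C in simp, intro ballI allI impI)
      fix f :: "real \<Rightarrow> real" and n :: nat and \<omega> :: real
      assume f: "f \<in> Lp_weighted \<alpha> \<beta> p" and n: "k \<le> n" and w: "0 \<le> \<omega>" and m: "modulus k f (1 / real n) \<alpha> \<beta> p \<le> ennreal \<omega>"
      have nr: "0 < real n" using n k by simp
      have fm: "f \<in> borel_measurable I_measure" using f by (simp add: Lp_weighted_def)
      obtain g where g: "g \<in> borel_measurable borel" and eq: "AE x in lborel. x \<in> {-1..1} \<longrightarrow> f x = g x"
        using borel_representative [OF fm] by blast
      \<comment> \<open>The factor \<open>1 / n\<close>, the length of the range of
        \<open>h\<close>, cancels the factor \<open>n\<close> lost on the cells, so the final
        constant is independent of \<open>n\<close>.\<close>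
      have "step_energy k (1 / real n) P \<alpha> \<beta> g \<le> ennreal (\<omega> powr P * (1 / real n))"
        unfolding P_def using P by (intro step_energy_le_modulus [OF g eq False _ _ m w]) (auto simp: P_def)
      from J [OF n g _ this] obtain q where q: "q \<in> poly_space n"
        and qe: "(\<integral>\<^sup>+x. ennreal ((jacobi_weight \<alpha> \<beta> x * \<bar>g x - poly q x\<bar>) powr P) * indicator {-1..1} x \<partial>lborel) \<le> ennreal (C * real n * (\<omega> powr P * (1 / real n)))"
        by auto
      let ?J = "\<integral>\<^sup>+x. ennreal (\<bar>jacobi_weight \<alpha> \<beta> x * (f x - poly q x)\<bar> powr P) \<partial>I_measure"
      have "?J = (\<integral>\<^sup>+x. ennreal (\<bar>jacobi_weight \<alpha> \<beta> x * (f x - poly q x)\<bar> powr P) * indicator {-1..1} x \<partial>lebesgue)"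
        by (rule nn_integral_restrict_space) simp
      also have "\<dots> = (\<integral>\<^sup>+x. ennreal (\<bar>jacobi_weight \<alpha> \<beta> x * (f x - poly q x)\<bar> powr P) * indicator {-1..1} x \<partial>lborel)"
        by (rule nn_integral_completion)
      also have "\<dots> = (\<integral>\<^sup>+x. ennreal ((jacobi_weight \<alpha> \<beta> x * \<bar>g x - poly q x\<bar>) powr P) * indicator {-1..1} x \<partial>lborel)"
      proof (rule nn_integral_cong_AE)
        show "AE x in lborel. ennreal (\<bar>jacobi_weight \<alpha> \<beta> x * (f x - poly q x)\<bar> powr P) * indicator {-1..1} x =
          ennreal ((jacobi_weight \<alpha> \<beta> x * \<bar>g x - poly q x\<bar>) powr P) * indicator {-1..1} x"
          using eq by (rule eventually_mono) (auto simp: abs_mult indicator_def)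
      qed
      also have "\<dots> \<le> ennreal (C * \<omega> powr P)" using qe nr by simp
      finally have J: "?J \<le> ennreal (C * \<omega> powr P)" .
      then have fin: "?J \<noteq> \<infinity>" using le_less_trans [OF J ennreal_less_top] by simp
      have "enn2real ?J \<le> C * \<omega> powr P" using J C by (intro enn2real_leI) auto
      then have "enn2real ?J powr (1 / P) \<le> (C * \<omega> powr P) powr (1 / P)" using P by (intro powr_mono2) auto
      also have "\<dots> = C powr (1 / P) * \<omega>" using C w P by (simp add: powr_mult powr_powr)
      finally have "ennreal (enn2real ?J powr (1 / P)) \<le> ennreal (C powr (1 / P) * \<omega>)" by (rule ennreal_leI)
      moreover have "Lp_norm p (\<lambda>x. jacobi_weight \<alpha> \<beta> x * (f x - poly q x)) = ennreal (enn2real ?J powr (1 / P))"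
        using False fin by (simp add: Lp_norm_def Let_def P_def)
      ultimately have "Lp_norm p (\<lambda>x. jacobi_weight \<alpha> \<beta> x * (f x - poly q x)) \<le> ennreal (C powr (1 / P) * \<omega>)"
        by simp
      then show "\<exists>q\<in>poly_space n. Lp_norm p (\<lambda>x. jacobi_weight \<alpha> \<beta> x * (f x - poly q x)) \<le> ennreal (C powr (1 / P) * \<omega>)"
        using q by blast
    qed
  qed
  then obtain c where c: "0 < c" and main: "\<And>f n \<omega>. f \<in> Lp_weighted \<alpha> \<beta> p \<Longrightarrow> k \<le> n \<Longrightarrow> 0 \<le> \<omega> \<Longrightarrow> modulus k f (1 / real n) \<alpha> \<beta> p \<le> ennreal \<omega> \<Longrightarrow>
      (\<exists>q\<in>poly_space n. Lp_norm p (\<lambda>x. jacobi_weight \<alpha> \<beta> x * (f x - poly q x)) \<le> ennreal (c * \<omega>))" by blast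
  show ?thesis
  proof (rule exI [of _ c], rule conjI [OF c], intro ballI allI impI)
    fix f n assume f: "f \<in> Lp_weighted \<alpha> \<beta> p" and n: "k \<le> n"
    show "best_approx n f \<alpha> \<beta> p \<le> ennreal c * modulus k f (1 / real n) \<alpha> \<beta> p"
    proof (cases "modulus k f (1 / real n) \<alpha> \<beta> p")
      case (real \<omega>)
      obtain q where q: "q \<in> poly_space n" "Lp_norm p (\<lambda>x. jacobi_weight \<alpha> \<beta> x * (f x - poly q x)) \<le> ennreal (c * \<omega>)"
        using main [OF f n real(1)] real(2) by auto
      have "best_approx n f \<alpha> \<beta> p \<le> Lp_norm p (\<lambda>x. jacobi_weight \<alpha> \<beta> x * (f x - poly q x))"
        unfolding best_approx_def using q(1) by (rule INF_lower)
      also note q(2)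
      also have "ennreal (c * \<omega>) = ennreal c * modulus k f (1 / real n) \<alpha> \<beta> p"
        using c real by (simp add: ennreal_mult)
      finally show ?thesis .
    next
      case top
      then show ?thesis using c by (simp add: ennreal_mult_top)
    qed
  qed
qed

end
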